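(* Let $\alpha\in(0,1)$, $p>\frac1\alpha$ (with $p<\infty$), $0<\varepsilon<\alpha-\frac1p$, and let $T>0$ be fixed. Assume that $\mathcal A:\mathcal X_{\alpha-\varepsilon,p}\to\mathcal B(D(A),H)$ is Lipschitz continuous on bounded subsets of $\mathcal X_{\alpha-\varepsilon,p}$ and that $\mathcal A(0)=A$. Then there exists $\varepsilon'>0$ such that for all $u_0\in\mathcal X_{\alpha,p}$ with $\|u_0\|_{\mathcal X_{\alpha,p}}\le\varepsilon'$, the quasilinear equation \[ \partial_t^\alpha(u(t)-u_0)-\mathrm i\,\mathcal A(u(t))u(t)=0,\qquad t\in(0,T), \] has a unique solution $u\in\mathcal{MR}_{\alpha,p}(T)$.
   Context: $(H,\langle\cdot,\cdot\rangle)$ is a complex Hilbert space with norm $\|\cdot\|$. $A:D(A)\subset H\to H$ is self-adjoint, negative-definite ($\langle Au,u\rangle<0$ for all $u\in D(A)\setminus\{0\}$) and has compact resolvent (with eigenvalues $-\lambda_n$, $0<\lambda_1\le\lambda_2\le\cdots\to\infty$). $D(A)$ carries the norm $\|u\|_{D(A)}=\|Au\|$. $\mathcal B(D(A),H)$ is the space of bounded linear operators from $D(A)$ to $H$. For $v\in L^p(0,T;H)$, $J^\alpha v(t)=\frac1{\Gamma(\alpha)}\int_0^t(t-s)^{\alpha-1}v(s)\,\mathrm ds$; $J^\alpha$ is injective on $L^p(0,T;H)$. $W_{\alpha,p}(0,T;H)=J^\alpha L^p(0,T;H)$ with norm $\|v\|_{W_{\alpha,p}(0,T;H)}=\|J^{-\alpha}v\|_{L^p(0,T;H)}$,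 and $\partial_t^\alpha:=J^{-\alpha}$ with domain $W_{\alpha,p}(0,T;H)$. For $\beta>\frac1p$, $\mathcal X_{\beta,p}:=(H,D(A))_{1-\frac1{\beta p},\,p}$ (real interpolation space). The maximal regularity space is \[ \mathcal{MR}_{\alpha,p}(T)=\{u\in C([0,T];H)\cap L^p(0,T;D(A)):\ u-u(0)\in W_{\alpha,p}(0,T;H)\}, \] with norm $\|u-u(0)\|_{W_{\alpha,p}(0,T;H)}+\|u\|_{L^p(0,T;D(A))}+\|u(0)\|$. A solution in $\mathcal{MR}_{\alpha,p}(T)$ is a $u\in\mathcal{MR}_{\alpha,p}(T)$ with $u(0)=u_0$ such that the equation holds for a.e. $t\in(0,T)$, with $u_0$ regarded as a constant function of $t$. *)

theory Defs
  imports "HOL-Analysis.Analysis"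
begin

section \<open>Complex Hilbert spaces\<close>

text \<open>The inner product is linear in its first argument and induces the norm.\<close>

class complex_hilbert = banach +
  fixes scaleC :: "complex \<Rightarrow> 'a \<Rightarrow> 'a" (infixr "*\<^sub>C" 75)
    and cinner :: "'a \<Rightarrow> 'a \<Rightarrow> complex"
  assumes scaleC_add_right: "c *\<^sub>C (x + y) = c *\<^sub>C x + c *\<^sub>C y"
    and scaleC_add_left: "(c + d) *\<^sub>C x = c *\<^sub>C x + d *\<^sub>C x"
    and scaleC_scaleC: "c *\<^sub>C (d *\<^sub>C x) = (c * d) *\<^sub>C x"
    and scaleC_of_real: "complex_of_real r *\<^sub>C x = r *\<^sub>R x"
    and cinner_commute: "cinner x y = cnj (cinner y x)"
    and cinner_add_left: "cinner (x + y) z = cinner x z + cinner y z"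
    and cinner_scaleC_left: "cinner (c *\<^sub>C x) y = c * cinner x y"
    and cinner_self: "cinner x x = complex_of_real ((norm x)\<^sup>2)"

instantiation complex :: complex_hilbert
begin
definition scaleC_complex :: "complex \<Rightarrow> complex \<Rightarrow> complex"
  where "scaleC_complex c x = c * x"
definition cinner_complex :: "complex \<Rightarrow> complex \<Rightarrow> complex"
  where "cinner_complex x y = x * cnj y"
instance
  by standard
    (simp_all add: scaleC_complex_def cinner_complex_def algebra_simps scaleR_conv_of_real
      complex_norm_square flip: of_real_power)
end


section \<open>Unbounded operators\<close>

text \<open>An unbounded operator is a function together with its domain \<open>D\<close>; the values of the function
  outside \<open>D\<close> are irrelevant.\<close>

definition csubspace :: "'a::complex_hilbert set \<Rightarrow> bool"
  where "csubspace D \<longleftrightarrow>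
    0 \<in> D \<and> (\<forall>x\<in>D. \<forall>y\<in>D. x + y \<in> D) \<and> (\<forall>c. \<forall>x\<in>D. c *\<^sub>C x \<in> D)"

definition clinear_on :: "'a::complex_hilbert set \<Rightarrow> ('a \<Rightarrow> 'a) \<Rightarrow> bool"
  where "clinear_on D B \<longleftrightarrow>
    (\<forall>x\<in>D. \<forall>y\<in>D. B (x + y) = B x + B y) \<and> (\<forall>c. \<forall>x\<in>D. B (c *\<^sub>C x) = c *\<^sub>C B x)"

definition adjoint_graph :: "('a::complex_hilbert \<Rightarrow> 'a) \<Rightarrow> 'a set \<Rightarrow> ('a \<times> 'a) set"
  where "adjoint_graph A D = {(v, w). \<forall>u\<in>D. cinner (A u) v = cinner u w}"

definition self_adjoint :: "('a::complex_hilbert \<Rightarrow> 'a) \<Rightarrow> 'a set \<Rightarrow> bool"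
  where "self_adjoint A D \<longleftrightarrow>
    csubspace D \<and> clinear_on D A \<and> closure D = UNIV \<and> adjoint_graph A D = {(u, A u) |u. u \<in> D}"

definition negative_definite :: "('a::complex_hilbert \<Rightarrow> 'a) \<Rightarrow> 'a set \<Rightarrow> bool"
  where "negative_definite A D \<longleftrightarrow>
    (\<forall>u\<in>D - {0}. cinner (A u) u \<in> \<real> \<and> Re (cinner (A u) u) < 0)"

definition resolvent :: "('a::complex_hilbert \<Rightarrow> 'a) \<Rightarrow> 'a set \<Rightarrow> complex \<Rightarrow> 'a \<Rightarrow> 'a"
  where "resolvent A D z = inv_into D (\<lambda>u. z *\<^sub>C u - A u)"

definition resolvent_set :: "('a::complex_hilbert \<Rightarrow> 'a) \<Rightarrow> 'a set \<Rightarrow> complex set"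
  where "resolvent_set A D =
    {z. bij_betw (\<lambda>u. z *\<^sub>C u - A u) D UNIV \<and> bounded_linear (resolvent A D z)}"

definition compact_operator :: "('a::complex_hilbert \<Rightarrow> 'a) \<Rightarrow> bool"
  where "compact_operator R \<longleftrightarrow>
    bounded_linear R \<and> (\<forall>S. bounded S \<longrightarrow> compact (closure (R ` S)))"

definition compact_resolvent :: "('a::complex_hilbert \<Rightarrow> 'a) \<Rightarrow> 'a set \<Rightarrow> bool"
  where "compact_resolvent A D \<longleftrightarrow>
    (\<exists>z\<in>resolvent_set A D. compact_operator (resolvent A D z))"

text \<open>The Bochner integral of the library is available for second countable spaces only. The
  following lemma shows that this sort constraint on the Hilbert space costs no generality: a
  densely defined operator with compact resolvent exists only on a separable space.\<close>

lemma compact_resolvent_separable: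
  fixes A :: "'a::complex_hilbert \<Rightarrow> 'a"
  assumes dense: "closure D = UNIV" and "compact_resolvent A D"
  shows "\<exists>C::'a set. countable C \<and> closure C = UNIV"
proof -
  obtain z where z: "z \<in> resolvent_set A D" and cpt: "compact_operator (resolvent A D z)"
    using assms unfolding compact_resolvent_def by blast
  define R where "R = resolvent A D z"
  have bij: "bij_betw (\<lambda>u. z *\<^sub>C u - A u) D UNIV"
    using z by (simp add: resolvent_set_def)
  have D: "D = R ` UNIV"
    using bij_betw_imp_surj_on[OF bij_betw_inv_into[OF bij]] by (simp add: R_def resolvent_def)
  define K where "K n = closure (R ` cball 0 (real n))" for n
  have cptK: "compact (K n)" for n
    using cpt by (simp add: K_def R_def compact_operator_def bounded_cball)
  have "\<exists>C. countable C \<and> K n \<subseteq> closure C" for n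
  proof -
    have "\<exists>k. finite k \<and> K n \<subseteq> (\<Union>x\<in>k. ball x (1 / real (Suc m)))" for m
      using compact_imp_seq_compact[OF cptK[of n], THEN seq_compact_imp_totally_bounded]
      by (meson divide_pos_pos of_nat_0_less_iff zero_less_Suc zero_less_one)
    then obtain k where k: "\<And>m. finite (k m)"
        "\<And>m. K n \<subseteq> (\<Union>x\<in>k m. ball x (1 / real (Suc m)))"
      by metis
    have "x \<in> closure (\<Union>m. k m)" if xK: "x \<in> K n" for x
    proof (subst closure_approachable, intro allI impI)
      fix e :: real assume "e > 0"
      then obtain m where m: "1 / real (Suc m) < e" using nat_approx_posE by blast
      obtain y where y: "y \<in> k m" "x \<in> ball y (1 / real (Suc m))"
        using subsetD[OF k(2)[of m] xK] by blast
      then have "dist y x < e" using m unfolding mem_ball by linarith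
      then show "\<exists>y\<in>\<Union>m. k m. dist y x < e" using y(1) by blast
    qed
    moreover have "countable (\<Union>m. k m)" using k(1) by (simp add: countable_finite)
    ultimately show ?thesis by blast
  qed
  then obtain C where C: "\<And>n. countable (C n)" "\<And>n. K n \<subseteq> closure (C n)"
    by metis
  have "D \<subseteq> closure (\<Union>n. C n)"
  proof
    fix x assume "x \<in> D"
    then obtain y where y: "x = R y" using D by blast
    obtain n where "norm y \<le> real n" using real_arch_simple by blast
    then have "x \<in> K n"
      unfolding K_def y by (intro subsetD[OF closure_subset] imageI) simp
    then show "x \<in> closure (\<Union>n. C n)"
      using C(2)[of n] closure_mono[OF UN_upper[of n UNIV C]] by blast
  qed
  then have "UNIV \<subseteq> closure (\<Union>n. C n)"
    using closure_minimal[OF _ closed_closure] dense by metis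
  then have "closure (\<Union>n. C n) = UNIV" by (rule top_le)
  moreover have "countable (\<Union>n. C n)" using C(1) by simp
  ultimately show ?thesis by blast
qed


section \<open>Bounded operators from the domain space to the whole space\<close>

text \<open>The domain \<open>D\<close> carries the norm \<open>\<lambda>u. norm (A u)\<close>.\<close>

definition bounded_operators :: "('a::complex_hilbert \<Rightarrow> 'a) \<Rightarrow> 'a set \<Rightarrow> ('a \<Rightarrow> 'a) set"
  where "bounded_operators A D =
    {B. clinear_on D B \<and> (\<exists>C. \<forall>u\<in>D. norm (B u) \<le> C * norm (A u))}"

definition operator_norm :: "('a::complex_hilbert \<Rightarrow> 'a) \<Rightarrow> 'a set \<Rightarrow> ('a \<Rightarrow> 'a) \<Rightarrow> real"
  where "operator_norm A D B = (SUP u\<in>{u\<in>D. norm (A u) \<le> 1}. norm (B u))"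


section \<open>Real interpolation between the space and the domain\<close>

definition K_functional :: "('a::complex_hilbert \<Rightarrow> 'a) \<Rightarrow> 'a set \<Rightarrow> real \<Rightarrow> 'a \<Rightarrow> real"
  where "K_functional A D t x = Inf {norm a + t * norm (A b) |a b. b \<in> D \<and> x = a + b}"

definition interp_integral ::
    "('a::complex_hilbert \<Rightarrow> 'a) \<Rightarrow> 'a set \<Rightarrow> real \<Rightarrow> real \<Rightarrow> 'a \<Rightarrow> ennreal"
  where "interp_integral A D \<theta> p x =
    (\<integral>\<^sup>+t\<in>{0<..}. ennreal ((t powr (-\<theta>) * K_functional A D t x) powr p / t) \<partial>lborel)"

definition interp_space :: "('a::complex_hilbert \<Rightarrow> 'a) \<Rightarrow> 'a set \<Rightarrow> real \<Rightarrow> real \<Rightarrow> 'a set"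
  where "interp_space A D \<theta> p = {x. interp_integral A D \<theta> p x < \<infinity>}"

definition interp_norm :: "('a::complex_hilbert \<Rightarrow> 'a) \<Rightarrow> 'a set \<Rightarrow> real \<Rightarrow> real \<Rightarrow> 'a \<Rightarrow> real"
  where "interp_norm A D \<theta> p x = enn2real (interp_integral A D \<theta> p x) powr (1 / p)"

definition X_space :: "('a::complex_hilbert \<Rightarrow> 'a) \<Rightarrow> 'a set \<Rightarrow> real \<Rightarrow> real \<Rightarrow> 'a set"
  where "X_space A D \<beta> p = interp_space A D (1 - 1 / (\<beta> * p)) p"

definition X_norm :: "('a::complex_hilbert \<Rightarrow> 'a) \<Rightarrow> 'a set \<Rightarrow> real \<Rightarrow> real \<Rightarrow> 'a \<Rightarrow> real"
  where "X_norm A D \<beta> p = interp_norm A D (1 - 1 / (\<beta> * p)) p"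

definition lipschitz_on_bounded_subsets ::
    "('a::complex_hilbert \<Rightarrow> 'a) \<Rightarrow> 'a set \<Rightarrow> real \<Rightarrow> real \<Rightarrow> ('a \<Rightarrow> 'a \<Rightarrow> 'a) \<Rightarrow> bool"
  where "lipschitz_on_bounded_subsets A D \<beta> p F \<longleftrightarrow>
    (\<forall>S \<subseteq> X_space A D \<beta> p. (\<exists>R. \<forall>v\<in>S. X_norm A D \<beta> p v \<le> R) \<longrightarrow>
      (\<exists>L. \<forall>v\<in>S. \<forall>w\<in>S.
        operator_norm A D (\<lambda>x. F v x - F w x) \<le> L * X_norm A D \<beta> p (v - w)))"


section \<open>Function spaces on the time interval\<close>

text \<open>Elements of Lebesgue spaces are represented by functions, not by classes modulo
  equality almost everywhere.\<close>

definition Lp_space :: "real \<Rightarrow> real \<Rightarrow> (real \<Rightarrow> 'a::complex_hilbert) set"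
  where "Lp_space p T =
    {v. v \<in> borel_measurable (lebesgue_on {0<..<T}) \<and>
        integrable (lebesgue_on {0<..<T}) (\<lambda>t. norm (v t) powr p)}"

text \<open>Since \<open>A\<close> is an isometry from \<open>D\<close> with the norm \<open>\<lambda>u. norm (A u)\<close> into the Hilbert space,
  a \<open>D\<close>-valued function \<open>u\<close> is strongly measurable iff \<open>\<lambda>t. A (u t)\<close> is.\<close>

definition Lp_domain ::
    "('a::complex_hilbert \<Rightarrow> 'a) \<Rightarrow> 'a set \<Rightarrow> real \<Rightarrow> real \<Rightarrow> (real \<Rightarrow> 'a) set"
  where "Lp_domain A D p T =
    {u. (AE t in lebesgue_on {0<..<T}. u t \<in> D) \<and> (\<lambda>t. A (u t)) \<in> Lp_space p T}"

definition frac_integral ::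
    "real \<Rightarrow> (real \<Rightarrow> 'a) \<Rightarrow> real \<Rightarrow> 'a::{complex_hilbert, second_countable_topology}"
  where "frac_integral \<alpha> v t =
    (1 / Gamma \<alpha>) *\<^sub>R (LINT s:{0<..<t}|lebesgue. (t - s) powr (\<alpha> - 1) *\<^sub>R v s)"

definition W_space ::
    "real \<Rightarrow> real \<Rightarrow> real \<Rightarrow> (real \<Rightarrow> 'a::{complex_hilbert, second_countable_topology}) set"
  where "W_space \<alpha> p T =
    {w. \<exists>v\<in>Lp_space p T. AE t in lebesgue_on {0<..<T}. w t = frac_integral \<alpha> v t}"

text \<open>The inverse of the fractional integral, determined up to equality almost everywhere because
  the fractional integral is injective. The value is meaningful for \<open>w\<close> in \<open>W_space \<alpha> p T\<close> only.\<close>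

definition frac_deriv ::
    "real \<Rightarrow> real \<Rightarrow> real \<Rightarrow> (real \<Rightarrow> 'a) \<Rightarrow> real \<Rightarrow> 'a::{complex_hilbert, second_countable_topology}"
  where "frac_deriv \<alpha> p T w =
    (SOME v. v \<in> Lp_space p T \<and> (AE t in lebesgue_on {0<..<T}. w t = frac_integral \<alpha> v t))"

definition MR_space ::
    "('a::{complex_hilbert, second_countable_topology} \<Rightarrow> 'a) \<Rightarrow> 'a set \<Rightarrow>
      real \<Rightarrow> real \<Rightarrow> real \<Rightarrow> (real \<Rightarrow> 'a) set"
  where "MR_space A D \<alpha> p T =
    {u. continuous_on {0..T} u \<and> u \<in> Lp_domain A D p T \<and> (\<lambda>t. u t - u 0) \<in> W_space \<alpha> p T}"

definition quasilinear_solution ::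
    "('a::{complex_hilbert, second_countable_topology} \<Rightarrow> 'a) \<Rightarrow> 'a set \<Rightarrow>
      real \<Rightarrow> real \<Rightarrow> real \<Rightarrow> ('a \<Rightarrow> 'a \<Rightarrow> 'a) \<Rightarrow> 'a \<Rightarrow> (real \<Rightarrow> 'a) \<Rightarrow> bool"
  where "quasilinear_solution A D \<alpha> p T F u0 u \<longleftrightarrow>
    u \<in> MR_space A D \<alpha> p T \<and> u 0 = u0 \<and>
    (AE t in lebesgue_on {0<..<T}.
      frac_deriv \<alpha> p T (\<lambda>s. u s - u0) t - \<i> *\<^sub>C F (u t) (u t) = 0)"

end

theory Submission
  imports Defs "HOL-Complex_Analysis.Complex_Analysis" "HOL-Real_Asymp.Real_Asymp"
begin

text \<open>The operator \<open>A\<close> is diagonal in an orthonormal basis with eigenvalues \<open>- lam n\<close>. In each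
  coordinate the linear problem is a scalar Volterra equation, solved by convolution with a
  Mittag-Leffler kernel that is a superposition of exponentials, found by residues. Its modulus is
  dominated by the Hardy--Littlewood maximal function uniformly in \<open>lam n\<close>, and square function
  estimates turn this into maximal \<open>L\<^sup>p\<close>-regularity. The solution of the homogeneous problem is
  controlled by the K-functional of the initial value, and Hoelder continuity of fractional integrals
  bounds the solution in the interpolation spaces. The quasilinear equation is then a
  fixed point equation for the right-hand side \<open>f\<close> of the linear problem, contractive for small data;
  uniqueness follows by extending the coincidence set of two solutions in small time steps.\<close>

text \<open>The kernel for \<open>- A u\<close> in one coordinate has an L^1 norm independent of
  \<open>lam n\<close>, since rescaling time changes neither its mass nor its maximal-function
  bound; hence no singular integrals occur. Uniform bounds in each coordinate do not by themselves
  bound the l^2-valued convolution when p differs from 2. Therefore the kernels are replaced by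
  positive majorants, and the square function is tested against a weight for p > 2 and split by a
  weight for p < 2.

  The unknown is f = \<i> (F u - A) u rather than u: f ranges over a ball of L^p, while u has to lie
  in the interpolation space at every time and in \<open>D\<close> almost everywhere. Since F 0 = A,
  this f is small of second order. Hoelder exponent \<alpha> - 1/p in time becomes interpolation
  exponent \<theta> through \<tau> = t powr \<alpha>, as \<alpha> * \<theta> = \<alpha> - 1/p. This
  yields only a supremum bound on the K-functional; the loss \<epsilon> pays for the passage to
  p-integrability with a smaller exponent.

  A competing solution is not assumed to be small, so the contraction alone does not give
  uniqueness. The difference estimate for the nonlinearity is therefore asymmetric: smallness is
  used for one of the two solutions only.\<close>

abbreviation nn_integral_lborel :: "(real => ennreal) => ennreal" (binder "\<integral>" 10)
  where "nn_integral_lborel f \<equiv> integral\<^sup>N lborel f"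

section \<open>The density of the Mittag-Leffler kernel\<close>

lemma has_contour_integral_linepath_same_Im_iff:
  assumes "Im z = c" "Im z' = c" "Re z = a" "Re z' = b" "a < b"
  shows "(f has_contour_integral I) (linepath z z') \<longleftrightarrow> ((\<lambda>x. f (Complex x c)) has_integral I) {a..b}"
proof -
  have linepath_conv: "linepath z z' x = Complex (a + (b - a) * x) c" for x using assms by (simp add: linepath_def complex_eq_iff algebra_simps)
  have z': "z' - z = of_real (b - a)" using assms by (simp add: complex_eq_iff)
  have "(f has_contour_integral I) (linepath z z') \<longleftrightarrow>
          ((\<lambda>x. f (linepath z z' x) * (z' - z)) has_integral I) {0..1}" by (subst has_contour_integral_linepath) simp_all
  also have "... \<longleftrightarrow> ((\<lambda>x. (b - a) *\<^sub>R f (Complex (a + (b - a) * x) c)) has_integral I) {0..1}" using assms by (intro has_integral_cong)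
       (auto simp: linepath_conv z' mult.commute scaleR_conv_of_real)
  also have "{0..1} = (\<lambda>x. x / (b - a)) ` {0..b-a}" using assms by simp
  also have "((\<lambda>x. (b - a) *\<^sub>R f (Complex (a + (b - a) * x) c)) has_integral I) ... \<longleftrightarrow>
             ((\<lambda>x. (b - a) *\<^sub>R f (Complex (a + x) c)) has_integral ((b-a) *\<^sub>R I)) {0..b-a}" by (subst has_integral_stretch_real_iff) (use assms in simp_all)
  also have "... \<longleftrightarrow> ((\<lambda>x. (b - a) *\<^sub>R f (Complex x c)) has_integral (b-a) *\<^sub>R I) {a..b}"
    by (subst has_integral_shift_real_ivl_iff[where c = "-a"]) (simp_all)
  also have "... \<longleftrightarrow> ((\<lambda>x. f (Complex x c)) has_integral I) {a..b}" using assms by (subst has_integral_cmul_iff) auto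
  finally show ?thesis .
qed

text \<open>Links the gauge integrals over bounded segments, which contour integrals produce, to the
  Bochner integral over the line; dominated convergence.\<close>

lemma lborel_integral_symmetric_limit:
  fixes f :: "real => complex"
  assumes "integrable lborel f"
  shows "(\<lambda>n. integral {- real n..real n} f) \<longlonglongrightarrow> (LINT x|lborel. f x)"
proof -
  have "(\<lambda>n. LINT x|lborel. indicator {- real n..real n} x *\<^sub>R f x) \<longlonglongrightarrow> (LINT x|lborel. f x)"
  proof (rule integral_dominated_convergence[where w="\<lambda>x. norm (f x)"])
    show "AE x in lborel. (\<lambda>n. indicator {- real n..real n} x *\<^sub>R f x) \<longlonglongrightarrow> f x"
    proof (intro AE_I2 tendsto_eventually)
      fix x :: real
      obtain N where "\<bar>x\<bar> \<le> real N" using real_arch_simple by blast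
      then show "\<forall>\<^sub>F n in sequentially. indicator {- real n..real n} x *\<^sub>R f x = f x" by (intro eventually_sequentiallyI[of N]) (auto simp: indicator_def)
    qed
  qed (use assms in \<open>auto intro: borel_measurable_integrable split: split_indicator\<close>)
  moreover have "(LINT x|lborel. indicator {- real n..real n} x *\<^sub>R f x) = integral {- real n..real n} f" for n
  proof -
    have "set_integrable lborel {- real n..real n} f" unfolding set_integrable_def using assms by (intro integrable_mult_indicator) auto
    then show ?thesis using set_borel_integral_eq_integral(2) by (auto simp: set_lebesgue_integral_def)
  qed
  ultimately show ?thesis by simp
qed

text \<open>The residue theorem on rectangles with real part between - n and n: the vertical sides
  have fixed length \<open>b - a\<close>, and they vanish in the limit because \<open>f\<close>
  decays uniformly in the imaginary part. The margin \<open>\<delta>\<close> puts the closed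
  rectangles into an open convex set.\<close>

lemma strip_residue:
  fixes f :: "complex => complex" and a b \<delta> :: real
  assumes ab: "a < 0" "0 < b" and \<delta>: "\<delta> > 0"
    and holo: "f holomorphic_on ({w. a - \<delta> < Im w \<and> Im w < b + \<delta>} - {0})"
    and res: "(\<lambda>w. f w * w) \<midarrow>0\<rightarrow> r"
    and int_a: "integrable lborel (\<lambda>x. f (Complex x a))"
    and int_b: "integrable lborel (\<lambda>x. f (Complex x b))"
    and decay: "\<And>x y. [|a \<le> y; y \<le> b; \<bar>x\<bar> \<ge> 1|] ==> norm (f (Complex x y)) \<le> \<epsilon> \<bar>x\<bar>"
    and \<epsilon>: "(\<epsilon> \<longlongrightarrow> 0) at_top"
  shows "(LINT x|lborel. f (Complex x a)) - (LINT x|lborel. f (Complex x b)) = 2 * pi * \<i> * r"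
proof -
  define S where "S = {w. a - \<delta> < Im w \<and> Im w < b + \<delta>}"
  have opS: "open S" unfolding S_def by (intro open_Collect_conj open_Collect_less continuous_intros)
  have S_eq: "S = {w. Im w < b + \<delta>} \<inter> {w. Im w > a - \<delta>}" by (auto simp: S_def)
  have cvS: "convex S" unfolding S_eq by (intro convex_Int convex_halfspace_Im_lt convex_halfspace_Im_gt)
  have 0: "0 \<in> S" using ab \<delta> by (auto simp: S_def)
  have residue: "residue f 0 = r" by (rule residue_simple'[OF opS 0]) (use holo res in \<open>auto simp: S_def\<close>)
  define Bot where "Bot n = integral {- real n..real n} (\<lambda>x. f (Complex x a))" for n
  define Top where "Top n = integral {- real n..real n} (\<lambda>x. f (Complex x b))" for n
  have cont: "continuous_on (S - {0}) f" using holo holomorphic_on_imp_continuous_on by (auto simp: S_def)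
  \<comment> \<open>What separates the horizontal sides from the residue are the two vertical sides,
    each of length \<open>b - a\<close>.\<close>
  have main: "norm (Bot n - Top n - 2 * pi * \<i> * r) \<le> 2 * \<epsilon> (real n) * (b - a)" if n: "n \<ge> 1" for n
  proof -
    define R where "R = real n"
    have R: "R \<ge> 1" using n by (simp add: R_def)
    define p1 where "p1 = Complex (-R) a"
    define p2 where "p2 = Complex R a"
    define p3 where "p3 = Complex R b"
    define p4 where "p4 = Complex (-R) b"
    define g where "g = rectpath p1 p3"
    have g: "g = linepath p1 p2 +++ linepath p2 p3 +++ linepath p3 p4 +++ linepath p4 p1" by (simp add: g_def rectpath_def p1_def p2_def p3_def p4_def Let_def)
    have seg: "closed_segment p1 p2 \<subseteq> S - {0}" "closed_segment p2 p3 \<subseteq> S - {0}"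
      "closed_segment p3 p4 \<subseteq> S - {0}" "closed_segment p4 p1 \<subseteq> S - {0}" using ab \<delta> R
      by (auto simp: p1_def p2_def p3_def p4_def closed_segment_same_Re closed_segment_same_Im
          closed_segment_eq_real_ivl S_def split: if_splits)
    have ci: "f contour_integrable_on linepath p1 p2" "f contour_integrable_on linepath p2 p3"
      "f contour_integrable_on linepath p3 p4" "f contour_integrable_on linepath p4 p1"
      using seg cont by (auto intro!: contour_integrable_continuous_linepath continuous_on_subset[OF cont])
    have "contour_integral g f = 2 * pi * \<i> * (\<Sum>p\<in>{0}. winding_number g p * residue f p)"
    proof (rule Residue_theorem[OF opS])
      show "connected S" using cvS by (rule convex_connected)
      show "f holomorphic_on S - {0}" using holo by (simp add: S_def)
      show "path_image g \<subseteq> S - {0}" using seg by (auto simp: g path_image_join)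
      show "\<forall>z. z \<notin> S --> winding_number g z = 0"
      proof (intro allI impI)
        fix z assume "z \<notin> S"
        then have "z \<notin> cbox p1 p3" using ab \<delta> R by (auto simp: S_def in_cbox_complex_iff p1_def p3_def)
        then show "winding_number g z = 0" unfolding g_def using ab R by (intro winding_number_rectpath_outside) (auto simp: p1_def p3_def)
      qed
    qed (auto simp: g_def)
    moreover have "winding_number g 0 = 1" unfolding g_def using ab R by (intro winding_number_rectpath) (auto simp: in_box_complex_iff p1_def p3_def)
    ultimately have tot: "contour_integral g f = 2 * pi * \<i> * r" by (simp add: residue)
    have split: "contour_integral g f = contour_integral (linepath p1 p2) f + contour_integral (linepath p2 p3) f
      + contour_integral (linepath p3 p4) f + contour_integral (linepath p4 p1) f" unfolding g using ci by simp
    have b1: "contour_integral (linepath p1 p2) f = Bot n"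
    proof -
      have "(f has_contour_integral contour_integral (linepath p1 p2) f) (linepath p1 p2)" using ci(1) by (rule has_contour_integral_integral)
      then show ?thesis using R by (subst (asm) has_contour_integral_linepath_same_Im_iff[where c=a and a="-R" and b=R])
          (auto simp: p1_def p2_def Bot_def R_def integral_unique)
    qed
    have b3: "contour_integral (linepath p4 p3) f = Top n"
    proof -
      have "(f has_contour_integral contour_integral (linepath p4 p3) f) (linepath p4 p3)"
        using seg(3) by (intro has_contour_integral_integral contour_integrable_continuous_linepath
          continuous_on_subset[OF cont]) (simp add: closed_segment_commute)
      then show ?thesis using R by (subst (asm) has_contour_integral_linepath_same_Im_iff[where c=b and a="-R" and b=R])
          (auto simp: p4_def p3_def Top_def R_def integral_unique)
    qed
    have b3': "contour_integral (linepath p3 p4) f = - Top n" using b3 contour_integral_reverse_linepath[OF continuous_on_subset[OF cont seg(3)]] by simp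
    have eps0: "0 \<le> \<epsilon> R" using decay[of a R] ab R order_trans[OF norm_ge_zero] by auto
    have seg2: "norm (f x) \<le> \<epsilon> R" if "x \<in> closed_segment p2 p3 \<union> closed_segment p4 p1" for x
    proof -
      have "x = Complex (Re x) (Im x)" "\<bar>Re x\<bar> = R" "a \<le> Im x" "Im x \<le> b" using that ab R by (auto simp: p1_def p2_def p3_def p4_def closed_segment_same_Re
            closed_segment_eq_real_ivl)
      then show ?thesis using decay[of "Im x" "Re x"] R by metis
    qed
    have v2: "norm (contour_integral (linepath p2 p3) f) \<le> \<epsilon> R * norm (p3 - p2)" by (rule contour_integral_bound_linepath[OF ci(2) eps0])
        (use seg2 in auto)
    have v4: "norm (contour_integral (linepath p4 p1) f) \<le> \<epsilon> R * norm (p1 - p4)" by (rule contour_integral_bound_linepath[OF ci(4) eps0])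
        (use seg2 in auto)
    have n2: "norm (p3 - p2) = b - a" "norm (p1 - p4) = b - a" using ab by (auto simp: p3_def p2_def p1_def p4_def cmod_def)
    have "Bot n - Top n - 2 * pi * \<i> * r =
       - contour_integral (linepath p2 p3) f - contour_integral (linepath p4 p1) f" using tot split b1 b3' by (simp add: algebra_simps)
    also have "norm ... \<le> \<epsilon> R * (b - a) + \<epsilon> R * (b - a)"
      using norm_triangle_ineq4[of "- contour_integral (linepath p2 p3) f" "contour_integral (linepath p4 p1) f"]
        v2 v4 n2 by simp
    finally show ?thesis by (simp add: R_def algebra_simps)
  qed
  have "(\<lambda>n. Bot n - Top n - 2 * pi * \<i> * r) \<longlonglongrightarrow> 0"
  proof (rule Lim_null_comparison)
    show "\<forall>\<^sub>F n in sequentially. norm (Bot n - Top n - 2 * pi * \<i> * r) \<le> 2 * \<epsilon> (real n) * (b - a)"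
      using main by (intro eventually_sequentiallyI[of 1]) auto
    have "(\<lambda>n. \<epsilon> (real n)) \<longlonglongrightarrow> 0" using \<epsilon> filterlim_real_sequentially by (rule filterlim_compose)
    then have "(\<lambda>n. 2 * \<epsilon> (real n) * (b - a)) \<longlonglongrightarrow> 2 * 0 * (b - a)" by (intro tendsto_intros)
    then show "(\<lambda>n. 2 * \<epsilon> (real n) * (b - a)) \<longlonglongrightarrow> 0" by simp
  qed
  moreover have "(\<lambda>n. Bot n - Top n - 2 * pi * \<i> * r) \<longlonglongrightarrow>
     (LINT x|lborel. f (Complex x a)) - (LINT x|lborel. f (Complex x b)) - 2 * pi * \<i> * r" unfolding Bot_def Top_def
    by (intro tendsto_diff tendsto_const lborel_integral_symmetric_limit int_a int_b)
  ultimately show ?thesis using LIMSEQ_unique by fastforce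
qed

lemma integrable_exp_neg_abs:
  fixes a :: real
  assumes "a > 0"
  shows "integrable lborel (\<lambda>x. exp (- a * \<bar>x\<bar>))"
proof -
  have pos: "set_integrable lborel {0..} (\<lambda>x::real. exp (- a * x))"
  proof -
    have "(\<lambda>x. exp (- a * x)) absolutely_integrable_on {0..}" using integrable_on_exp_minus_to_infinity[OF assms, of 0] by (intro nonnegative_absolutely_integrable_1) auto
    then show ?thesis unfolding set_integrable_def by (subst (asm) integrable_completion) auto
  qed
  have p1: "integrable lborel (\<lambda>x. indicator {0..} x * exp (- a * x))" using pos by (simp add: set_integrable_def)
  have p2: "integrable lborel (\<lambda>x. indicator {0..} (-x) * exp (- a * (-x)))" using lborel_integrable_real_affine[OF p1, of "-1" 0] by simp
  have "integrable lborel (\<lambda>x. indicator {0..} x * exp (- a * x) + indicator {0..} (-x) * exp (- a * (-x)))" by (rule Bochner_Integration.integrable_add[OF p1 p2])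
  then show ?thesis by (rule Bochner_Integration.integrable_bound) (auto simp: indicator_def)
qed

lemma sin_gt_neg_one:
  assumes "- pi / 2 < t" "t < 3 * pi / 2"
  shows "sin t > - 1"
proof -
  have "sin t \<noteq> - 1"
  proof
    assume "sin t = - 1"
    then have c: "cos (t - pi / 2) = - 1" by (simp add: cos_diff)
    have "\<bar>t - pi / 2\<bar> < pi" using assms by (simp add: abs_if field_simps)
    then have "cos \<bar>t - pi / 2\<bar> > cos pi" by (intro cos_monotone_0_pi) auto
    then show False using c by simp
  qed
  then show ?thesis using sin_ge_minus_one[of t] by linarith
qed

text \<open>The squared modulus is E^2 + 1 + 2 E sin t, and 2 E is at most E^2 + 1, so it is at
  least (1 - s)(E^2 + 1). The first bound serves large \<open>E\<close>, the second small
  \<open>E\<close>.\<close>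

lemma norm_rotated_plus_i:
  fixes E s t :: real
  assumes E: "E > 0" and s: "0 \<le> s" "s < 1" "- s \<le> sin t"
  shows "norm (of_real E * cis t + \<i>) \<ge> sqrt (1 - s) * E"
    and "norm (of_real E * cis t + \<i>) \<ge> sqrt (1 - s)"
proof -
  have "(norm (of_real E * cis t + \<i>))\<^sup>2 = (E * cos t)\<^sup>2 + (E * sin t + 1)\<^sup>2" by (simp add: cmod_power2)
  also have "... = E\<^sup>2 * ((cos t)\<^sup>2 + (sin t)\<^sup>2) + 1 + 2 * E * sin t"
    by (simp add: power_mult_distrib power2_sum algebra_simps del: sin_cos_squared_add sin_cos_squared_add2)
  also have "... = E\<^sup>2 + 1 + 2 * E * sin t" by simp
  also have "... \<ge> E\<^sup>2 + 1 + 2 * E * (- s)" using mult_left_mono[OF s(3), of E] E by simp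
  finally have 1: "(norm (of_real E * cis t + \<i>))\<^sup>2 \<ge> E\<^sup>2 + 1 - 2 * E * s" by simp
  have 2: "2 * E * s \<le> s * (E\<^sup>2 + 1)" using mult_left_mono[OF sum_squares_ge_zero[of "E - 1" 0] s(1)] by (simp add: power2_eq_square algebra_simps)
  have 3: "(norm (of_real E * cis t + \<i>))\<^sup>2 \<ge> (1 - s) * (E\<^sup>2 + 1)" using 1 2 by (simp add: algebra_simps)
  have "(1 - s) * E\<^sup>2 \<le> (1 - s) * (E\<^sup>2 + 1)" "(1 - s) * 1 \<le> (1 - s) * (E\<^sup>2 + 1)" using s by (intro mult_left_mono; simp)+
  then have "(1 - s) * E\<^sup>2 \<le> (norm (of_real E * cis t + \<i>))\<^sup>2"
    "(1 - s) * 1 \<le> (norm (of_real E * cis t + \<i>))\<^sup>2" using 3 by linarith+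
  then have "(1 - s) * E\<^sup>2 \<le> (norm (of_real E * cis t + \<i>))\<^sup>2"
    "1 - s \<le> (norm (of_real E * cis t + \<i>))\<^sup>2" by (simp_all only: mult_1_right)
  then have "(sqrt (1 - s) * E)\<^sup>2 \<le> (norm (of_real E * cis t + \<i>))\<^sup>2"
    "(sqrt (1 - s))\<^sup>2 \<le> (norm (of_real E * cis t + \<i>))\<^sup>2" using s by (simp_all add: power_mult_distrib)
  then show "norm (of_real E * cis t + \<i>) \<ge> sqrt (1 - s) * E"
    "norm (of_real E * cis t + \<i>) \<ge> sqrt (1 - s)" by (auto intro: power2_le_imp_le)
qed

text \<open>The density of the Mittag-Leffler kernel with respect to the exponentials \<open>exp (- z t)\<close> on the
  ray through \<open>cis (\<alpha> * pi / 2)\<close>: the jump of \<open>z \<mapsto> 1 / (z powr \<alpha> + \<i>)\<close> across the opposite ray,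
  which for this angle is a cut that leaves no pole on the sheet.\<close>

definition ml_density :: "real => real => complex"
  where "ml_density \<alpha> x = cis (\<alpha> * pi / 2) / (2 * pi * \<i>) *
    (1 / (of_real (exp (\<alpha> * x)) * cis (\<alpha> * (\<alpha> * pi / 2 - pi)) + \<i>) -
     1 / (of_real (exp (\<alpha> * x)) * cis (\<alpha> * (\<alpha> * pi / 2 + pi)) + \<i>))"

section \<open>The cut, the decay of the density and its Stieltjes representation\<close>

locale fractional_order =
  fixes \<alpha> :: real
  assumes \<alpha>: "0 < \<alpha>" "\<alpha> < 1"
begin

abbreviation mld :: "real => complex" where "mld \<equiv> ml_density \<alpha>"


abbreviation \<eta> :: real where "\<eta> \<equiv> \<alpha> * pi / 2"

lemma \<eta>_bounds: "0 < \<eta>" "\<eta> < pi / 2" using \<alpha> by auto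

lemma cos_\<eta>_pos: "cos \<eta> > 0" using \<eta>_bounds by (intro cos_gt_zero) auto

text \<open>The choice of \<open>\<eta>\<close> enters here: \<alpha> (\<eta> - pi) equals pi/2 ((1
  - \<alpha>)^2 - 1), which exceeds - pi/2 by pi/2 (1 - \<alpha>)^2. Widening the strip by that
  amount costs only \<alpha> times as much. The bounds are the angles at which
  \<open>z powr \<alpha>\<close> could reach \<open>- \<i>\<close>.\<close>

lemma strip_angle:
  assumes "\<eta> - pi - pi / 2 * (1 - \<alpha>)\<^sup>2 < y" "y < \<eta> + pi + pi / 2 * (1 - \<alpha>)\<^sup>2"
  shows "- pi / 2 < \<alpha> * y" "\<alpha> * y < 3 * pi / 2"
proof -
  have q: "0 < (1 - \<alpha>)\<^sup>2" using \<alpha> by simp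
  have "\<alpha> * (1 - \<alpha>)\<^sup>2 < 1 * (1 - \<alpha>)\<^sup>2" using \<alpha> q by (intro mult_strict_right_mono) auto
  then have q2: "\<alpha> * (1 - \<alpha>)\<^sup>2 < (1 - \<alpha>)\<^sup>2" by simp
  have "\<alpha> * y > \<alpha> * (\<eta> - pi - pi / 2 * (1 - \<alpha>)\<^sup>2)" using assms \<alpha> by (intro mult_strict_left_mono) auto
  moreover have "\<alpha> * (\<eta> - pi - pi / 2 * (1 - \<alpha>)\<^sup>2) = pi / 2 * (\<alpha>\<^sup>2 - 2 * \<alpha> - \<alpha> * (1 - \<alpha>)\<^sup>2)"
    by (simp add: power2_eq_square algebra_simps)
  moreover have "pi / 2 * (\<alpha>\<^sup>2 - 2 * \<alpha> - \<alpha> * (1 - \<alpha>)\<^sup>2) \<ge> pi / 2 * (- 1)"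
    using q2 by (intro mult_left_mono) (auto simp: power2_eq_square algebra_simps)
  ultimately show "- pi / 2 < \<alpha> * y" by simp
  have "\<alpha> * y < \<alpha> * (\<eta> + pi + pi / 2 * (1 - \<alpha>)\<^sup>2)" using assms \<alpha> by (intro mult_strict_left_mono) auto
  moreover have "\<alpha> * (\<eta> + pi + pi / 2 * (1 - \<alpha>)\<^sup>2) = pi / 2 * (\<alpha>\<^sup>2 + 2 * \<alpha> + \<alpha> * (1 - \<alpha>)\<^sup>2)"
    by (simp add: power2_eq_square field_simps)
  moreover have "pi / 2 * (\<alpha>\<^sup>2 + 2 * \<alpha> + \<alpha> * (1 - \<alpha>)\<^sup>2) \<le> pi / 2 * 3"
  proof (intro mult_left_mono)
    have "\<alpha> * \<alpha> \<le> 1 * 1" using \<alpha> by (intro mult_mono) auto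
    then show "\<alpha>\<^sup>2 + 2 * \<alpha> + \<alpha> * (1 - \<alpha>)\<^sup>2 \<le> 3" using q2 by (simp add: power2_eq_square algebra_simps)
  qed auto
  ultimately show "\<alpha> * y < 3 * pi / 2" by linarith
qed

text \<open>By compactness sin (\<alpha> y) has a minimum over the closed strip, and by
  \<open>strip_angle\<close> that minimum is larger than - 1.\<close>

lemma strip_denominator_bound:
  "\<exists>d>0. \<forall>E y. 0 < E --> \<eta> - pi \<le> y --> y \<le> \<eta> + pi -->
    d * E \<le> norm (of_real E * cis (\<alpha> * y) + \<i>) \<and> d \<le> norm (of_real E * cis (\<alpha> * y) + \<i>)"
proof -
  have "continuous_on {\<eta> - pi..\<eta> + pi} (\<lambda>y. sin (\<alpha> * y))" by (intro continuous_intros)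
  then obtain y0 where y0: "y0 \<in> {\<eta> - pi..\<eta> + pi}"
    and min: "\<And>y. y \<in> {\<eta> - pi..\<eta> + pi} ==> sin (\<alpha> * y0) \<le> sin (\<alpha> * y)"
    using continuous_attains_inf[of "{\<eta> - pi..\<eta> + pi}"] pi_gt_zero by (force simp: compact_Icc)
  have pos: "pi / 2 * (1 - \<alpha>)\<^sup>2 > 0" using \<alpha> by simp
  have "sin (\<alpha> * y0) > - 1" using y0 pos by (intro sin_gt_neg_one strip_angle) auto
  define s where "s = max 0 (- sin (\<alpha> * y0))"
  have s: "0 \<le> s" "s < 1" using \<open>sin (\<alpha> * y0) > - 1\<close> by (auto simp: s_def)
  have ms: "- s \<le> sin (\<alpha> * y)" if "\<eta> - pi \<le> y" "y \<le> \<eta> + pi" for y using min[of y] that by (auto simp: s_def)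
  show ?thesis by (rule exI[of _ "sqrt (1 - s)"]) (use s ms norm_rotated_plus_i in auto)
qed

text \<open>The two tails decay for different reasons: for large positive \<open>x\<close> each
  denominator grows like exp (\<alpha> x), while for large negative \<open>x\<close> both fractions
  approach the same limit and only their difference is of size exp (\<alpha> x).\<close>

lemma ml_density_bound:
  "\<exists>C>0. \<forall>x. norm (mld x) \<le> C * exp (- \<alpha> * \<bar>x\<bar>)"
proof -
  obtain d where d: "d > 0"
    "\<And>E y. [|E > 0; \<eta> - pi \<le> y; y \<le> \<eta> + pi|] ==> d * E \<le> norm (of_real E * cis (\<alpha> * y) + \<i>)"
    "\<And>E y. [|E > 0; \<eta> - pi \<le> y; y \<le> \<eta> + pi|] ==> d \<le> norm (of_real E * cis (\<alpha> * y) + \<i>)" using strip_denominator_bound by blast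
  define u where "u x = of_real (exp (\<alpha> * x)) * cis (\<alpha> * (\<eta> - pi)) + \<i>" for x :: real
  define v where "v x = of_real (exp (\<alpha> * x)) * cis (\<alpha> * (\<eta> + pi)) + \<i>" for x :: real
  have u: "d * exp (\<alpha> * x) \<le> norm (u x)" "d \<le> norm (u x)" for x unfolding u_def using d(2,3)[of "exp (\<alpha> * x)" "\<eta> - pi"] by auto
  have v: "d * exp (\<alpha> * x) \<le> norm (v x)" "d \<le> norm (v x)" for x unfolding v_def using d(2,3)[of "exp (\<alpha> * x)" "\<eta> + pi"] by auto
  have nz: "u x \<noteq> 0" "v x \<noteq> 0" for x using u(2)[of x] v(2)[of x] d(1) by auto
  have M: "norm (mld x) = norm (1 / u x - 1 / v x) / (2 * pi)" for x by (simp add: ml_density_def u_def v_def norm_mult norm_divide)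
  show ?thesis
  proof (intro exI[of _ "2 / d + 2 / d\<^sup>2"] conjI allI)
    show "2 / d + 2 / d\<^sup>2 > 0" using d by (auto intro!: add_pos_pos)
    fix x :: real
    have pi1: "y / (2 * pi) \<le> y" if "y \<ge> 0" for y :: real
    proof -
      have "y / (2 * pi) \<le> y / 1" using that pi_gt3 by (intro divide_left_mono) auto
      then show ?thesis by simp
    qed
    have "norm (1 / u x - 1 / v x) \<le> (2 / d + 2 / d\<^sup>2) * exp (- \<alpha> * \<bar>x\<bar>)"
    proof (cases "x \<ge> 0")
      case True
      have "norm (1 / u x - 1 / v x) \<le> 1 / norm (u x) + 1 / norm (v x)" using norm_triangle_ineq4[of "1 / u x" "1 / v x"] by (simp add: norm_divide)
      also have "... \<le> 1 / (d * exp (\<alpha> * x)) + 1 / (d * exp (\<alpha> * x))" using u[of x] v[of x] d(1) nz by (intro add_mono divide_left_mono) auto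
      also have "... = 2 / d * exp (- \<alpha> * \<bar>x\<bar>)" using True by (simp add: exp_minus field_simps)
      also have "... \<le> (2 / d + 2 / d\<^sup>2) * exp (- \<alpha> * \<bar>x\<bar>)" by (intro mult_right_mono) auto
      finally show ?thesis .
    next
      case False
      have "1 / u x - 1 / v x = (v x - u x) / (u x * v x)" using nz by (simp add: field_simps)
      also have "norm ... = norm (v x - u x) / (norm (u x) * norm (v x))" by (simp add: norm_divide norm_mult)
      also have "... \<le> (2 * exp (\<alpha> * x)) / (d * d)"
      proof (intro frac_le mult_mono)
        have "v x - u x = of_real (exp (\<alpha> * x)) * (cis (\<alpha> * (\<eta> + pi)) - cis (\<alpha> * (\<eta> - pi)))" by (simp add: u_def v_def algebra_simps)
        then have "norm (v x - u x) = exp (\<alpha> * x) * norm (cis (\<alpha> * (\<eta> + pi)) - cis (\<alpha> * (\<eta> - pi)))"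
          by (simp only: norm_mult norm_of_real abs_exp_cancel)
        also have "... \<le> exp (\<alpha> * x) * 2" using norm_triangle_ineq4[of "cis (\<alpha> * (\<eta> + pi))" "cis (\<alpha> * (\<eta> - pi))"] by (intro mult_left_mono) auto
        finally show "norm (v x - u x) \<le> 2 * exp (\<alpha> * x)" by simp
      qed (use d u v in auto)
      also have "... = 2 / d\<^sup>2 * exp (- \<alpha> * \<bar>x\<bar>)" using False by (simp add: power2_eq_square)
      also have "... \<le> (2 / d + 2 / d\<^sup>2) * exp (- \<alpha> * \<bar>x\<bar>)" using d by (intro mult_right_mono) auto
      finally show ?thesis .
    qed
    then show "norm (mld x) \<le> (2 / d + 2 / d\<^sup>2) * exp (- \<alpha> * \<bar>x\<bar>)" unfolding M using pi1[OF norm_ge_zero[of "1 / u x - 1 / v x"]] by linarith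
  qed
qed

lemma ml_density_measurable [measurable]: "mld \<in> borel_measurable borel" unfolding ml_density_def by measurable

lemma integrable_norm_ml_density: "integrable lborel (\<lambda>x. norm (mld x))"
proof -
  obtain C where C: "C > 0" "\<And>x. norm (mld x) \<le> C * exp (- \<alpha> * \<bar>x\<bar>)" using ml_density_bound by blast
  have "integrable lborel (\<lambda>x. C * exp (- \<alpha> * \<bar>x\<bar>))" using integrable_exp_neg_abs[OF \<alpha>(1)] by simp
  then show ?thesis by (rule Bochner_Integration.integrable_bound) (use C in \<open>auto intro!: AE_I2 order_trans[OF C(2)]\<close>)
qed

text \<open>With \<open>\<sigma> = exp L\<close> this is the Stieltjes representation of \<open>1 / (\<sigma> powr \<alpha> + \<i>)\<close>: the substitution
  \<open>z = \<sigma> exp w\<close> turns the Hankel contour into the boundary of a horizontal strip.\<close>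

lemma ml_density_stieltjes:
  "(LINT x|lborel. mld (x + L) / (cis \<eta> + of_real (exp (- x)))) = 1 / (of_real (exp (\<alpha> * L)) + \<i>)"
proof -
  define \<delta> where "\<delta> = pi / 2 * (1 - \<alpha>)\<^sup>2"
  define a where "a = \<eta> - pi"
  define b where "b = \<eta> + pi"
  \<comment> \<open>\<open>\<phi>\<close> is 1 / (z powr \<alpha> + \<i>) at z = exp (w + L),
    continued along the strip. Dividing by 1 - exp (- w) adds a simple pole at 0 with residue
    \<open>\<phi> 0\<close>, which is the right-hand side of the claim.\<close>
  define \<phi> :: "complex => complex" where "\<phi> w = 1 / (exp (\<alpha> * (w + of_real L)) + \<i>)" for w :: complex
  define f :: "complex => complex" where "f w = \<phi> w / (1 - exp (- w))" for w :: complex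
  have \<delta>: "\<delta> > 0" "\<delta> < pi / 2"
  proof -
    show "\<delta> > 0" using \<alpha> by (simp add: \<delta>_def)
    have "(1 - \<alpha>)\<^sup>2 < 1" using \<alpha> by (auto simp: power_less_one_iff abs_if)
    then have "pi / 2 * (1 - \<alpha>)\<^sup>2 < pi / 2 * 1" by (intro mult_strict_left_mono) auto
    then show "\<delta> < pi / 2" by (simp add: \<delta>_def)
  qed
  have ab: "a < 0" "0 < b" using \<eta>_bounds pi_gt_zero unfolding a_def b_def by linarith+
  have expC: "exp (\<alpha> * (Complex x y + L)) = of_real (exp (\<alpha> * (x + L))) * cis (\<alpha> * y)" for x y by (subst exp_eq_polar) simp
  have nz1: "exp (\<alpha> * (w + of_real L)) + \<i> \<noteq> 0" if "a - \<delta> < Im w" "Im w < b + \<delta>" for w :: complex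
  proof
    assume "exp (\<alpha> * (w + of_real L)) + \<i> = 0"
    then have eq: "of_real (exp (\<alpha> * (Re w + L))) * cis (\<alpha> * Im w) + \<i> = 0" using expC[of "Re w" "Im w"] by simp
    have "sin (\<alpha> * Im w) > - 1" using that by (intro sin_gt_neg_one strip_angle) (auto simp: a_def b_def \<delta>_def)
    then have "norm (of_real (exp (\<alpha> * (Re w + L))) * cis (\<alpha> * Im w) + \<i>) \<ge> sqrt (1 - max 0 (- sin (\<alpha> * Im w)))" by (intro norm_rotated_plus_i) auto
    moreover have "sqrt (1 - max 0 (- sin (\<alpha> * Im w))) > 0" using \<open>sin (\<alpha> * Im w) > - 1\<close> by auto
    ultimately show False using eq by simp
  qed
  \<comment> \<open>The other zeros of 1 - exp (- w) have imaginary part at least 2 pi in modulus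
    and stay outside the strip, since \<eta> and \<delta> are both below pi/2.\<close>
  have nz2: "1 - exp (- w) \<noteq> 0" if "a - \<delta> < Im w" "Im w < b + \<delta>" "w \<noteq> 0" for w :: complex
  proof
    assume "1 - exp (- w) = 0"
    then have "exp (- w) = 1" by simp
    then obtain n :: int where n: "Re (- w) = 0" "Im (- w) = of_int (2 * n) * pi" unfolding exp_eq_1 by blast
    have "\<bar>Im w\<bar> < 2 * pi" using that(1,2) \<eta>_bounds \<delta> unfolding a_def b_def abs_less_iff by linarith
    then have "\<bar>of_int (2 * n) * pi\<bar> < 2 * pi" using n(2) by simp
    then have "\<bar>of_int (2 * n)\<bar> * pi < 2 * pi" by (simp only: abs_mult abs_of_pos[OF pi_gt_zero])
    then have "\<bar>real_of_int (2 * n)\<bar> < 2" using pi_gt_zero by (simp only: mult_less_cancel_right_pos)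
    then have "n = 0" by linarith
    then have "w = 0" using n by (simp add: complex_eq_iff)
    then show False using that by simp
  qed
  obtain d where d: "d > 0"
    "\<And>E y. [|E > 0; \<eta> - pi \<le> y; y \<le> \<eta> + pi|] ==> d * E \<le> norm (of_real E * cis (\<alpha> * y) + \<i>)"
    "\<And>E y. [|E > 0; \<eta> - pi \<le> y; y \<le> \<eta> + pi|] ==> d \<le> norm (of_real E * cis (\<alpha> * y) + \<i>)" using strip_denominator_bound by blast
  have \<phi>_bound: "norm (\<phi> (Complex x y)) \<le> 1 / d" "norm (\<phi> (Complex x y)) \<le> exp (- \<alpha> * L) / d * exp (- \<alpha> * x)"
    if "a \<le> y" "y \<le> b" for x y
  proof -
    have 1: "norm (\<phi> (Complex x y)) = 1 / norm (of_real (exp (\<alpha> * (x + L))) * cis (\<alpha> * y) + \<i>)" unfolding \<phi>_def expC by (simp add: norm_divide)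
    have 2: "d \<le> norm (of_real (exp (\<alpha> * (x + L))) * cis (\<alpha> * y) + \<i>)"
      "d * exp (\<alpha> * (x + L)) \<le> norm (of_real (exp (\<alpha> * (x + L))) * cis (\<alpha> * y) + \<i>)"
      using d(2,3)[of "exp (\<alpha> * (x + L))" y] that by (auto simp: a_def b_def)
    show "norm (\<phi> (Complex x y)) \<le> 1 / d" unfolding 1 using 2 d(1) by (intro divide_left_mono mult_pos_pos) auto
    have "norm (\<phi> (Complex x y)) \<le> 1 / (d * exp (\<alpha> * (x + L)))" unfolding 1 using 2 d(1) by (intro divide_left_mono mult_pos_pos) (auto intro: less_le_trans)
    then show "norm (\<phi> (Complex x y)) \<le> exp (- \<alpha> * L) / d * exp (- \<alpha> * x)" by (simp add: exp_minus exp_add field_simps)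
  qed
  have den: "norm (1 - exp (- Complex x y)) \<ge> \<bar>1 - exp (- x)\<bar>" for x y using norm_triangle_ineq3[of 1 "exp (- Complex x y)"] by simp
  have fin: "(LINT x|lborel. f (Complex x a)) - (LINT x|lborel. f (Complex x b)) =
    2 * pi * \<i> * (1 / (of_real (exp (\<alpha> * L)) + \<i>))"
    if ia: "integrable lborel (\<lambda>x. f (Complex x a))" and ib: "integrable lborel (\<lambda>x. f (Complex x b))"
  proof (rule strip_residue[OF ab \<delta>(1) _ _ ia ib])
    show "f holomorphic_on {w. a - \<delta> < Im w \<and> Im w < b + \<delta>} - {0}" unfolding f_def \<phi>_def by (intro holomorphic_intros) (use nz1 nz2 in auto)
    show "(\<lambda>w. f w * w) \<midarrow>0\<rightarrow> 1 / (of_real (exp (\<alpha> * L)) + \<i>)"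
    proof -
      have "((\<lambda>z::complex. (exp z - 1) / z) \<longlongrightarrow> 1) (at 0)" by (rule lim_exp_minus_1)
      then have "((\<lambda>w::complex. (exp (- w) - 1) / (- w)) \<longlongrightarrow> 1) (at 0)"
        by (rule filterlim_compose) (auto intro!: filterlim_atI tendsto_eq_intros simp: eventually_at_filter)
      then have l1: "((\<lambda>w::complex. inverse ((exp (- w) - 1) / (- w))) \<longlongrightarrow> inverse 1) (at 0)" by (intro tendsto_inverse) auto
      have e0: "exp (of_real \<alpha> * (0 + of_real L)) = complex_of_real (exp (\<alpha> * L))" by (simp add: exp_of_real flip: of_real_mult)
      have \<phi>0: "\<phi> 0 = 1 / (of_real (exp (\<alpha> * L)) + \<i>)" unfolding \<phi>_def e0 ..
      have "isCont \<phi> 0" unfolding \<phi>_def using nz1[of 0] ab \<delta> by (intro continuous_intros) auto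
      then have l2: "\<phi> \<midarrow>0\<rightarrow> \<phi> 0" by (rule isContD)
      have "(\<lambda>w. \<phi> w * inverse ((exp (- w) - 1) / (- w))) \<midarrow>0\<rightarrow> \<phi> 0 * inverse 1" by (intro tendsto_mult l1 l2)
      moreover have "(\<lambda>w. \<phi> w * inverse ((exp (- w) - 1) / (- w))) = (\<lambda>w. f w * w)" by (rule ext) (simp add: f_def divide_simps minus_divide_left)
      ultimately show ?thesis unfolding \<phi>0 by simp
    qed
    define C where "C = 2 / d * (1 + exp (- \<alpha> * L))"
    have C: "2 / d \<le> C" "2 / d * exp (- \<alpha> * L) \<le> C" "C > 0" using d by (auto simp: C_def field_simps intro!: divide_pos_pos add_pos_pos)
    show "norm (f (Complex x y)) \<le> C * (exp (- \<alpha> * \<bar>x\<bar>) + exp (- \<bar>x\<bar>))"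
      if "a \<le> y" "y \<le> b" "\<bar>x\<bar> \<ge> 1" for x y
    proof (cases "x \<ge> 1")
      case True
      have "exp (- x) \<le> exp (-1)" using True by simp
      also have "exp (- 1 :: real) \<le> 1 / 2" using exp_ge_add_one_self[of 1] by (simp add: exp_minus field_simps)
      finally have "1 / 2 \<le> norm (1 - exp (- Complex x y))" using den[of x y] by linarith
      then have "norm (f (Complex x y)) \<le> (exp (- \<alpha> * L) / d * exp (- \<alpha> * x)) / (1 / 2)" unfolding f_def norm_divide using \<phi>_bound(2)[OF that(1,2), of x]
        by (intro frac_le) (auto intro: order_trans[OF norm_ge_zero])
      also have "... = 2 / d * exp (- \<alpha> * L) * exp (- \<alpha> * \<bar>x\<bar>)" using True by simp
      also have "... \<le> C * exp (- \<alpha> * \<bar>x\<bar>)" using C by (intro mult_right_mono) auto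
      also have "... \<le> C * (exp (- \<alpha> * \<bar>x\<bar>) + exp (- \<bar>x\<bar>))" using C by (intro mult_left_mono) auto
      finally show ?thesis .
    next
      case False
      then have x: "x \<le> - 1" using that by auto
      have "exp 1 \<le> exp (- x)" using x by simp
      moreover have "exp (1 :: real) \<ge> 2" using exp_ge_add_one_self[of 1] by simp
      ultimately have "exp (- x) / 2 \<le> norm (1 - exp (- Complex x y))" using den[of x y] by linarith
      then have "norm (f (Complex x y)) \<le> (1 / d) / (exp (- x) / 2)" unfolding f_def norm_divide using \<phi>_bound(1)[OF that(1,2), of x] d by (intro frac_le) auto
      also have "... = 2 / d * exp (- \<bar>x\<bar>)" using x by (simp add: exp_minus field_simps)
      also have "... \<le> C * exp (- \<bar>x\<bar>)" using C by (intro mult_right_mono) auto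
      also have "... \<le> C * (exp (- \<alpha> * \<bar>x\<bar>) + exp (- \<bar>x\<bar>))" using C by (intro mult_left_mono) auto
      finally show ?thesis .
    qed
    have t: "((\<lambda>x. exp (- c * x)) \<longlongrightarrow> 0) at_top" if "c > 0" for c :: real
      using that by (intro filterlim_compose[OF exp_at_bot] filterlim_tendsto_neg_mult_at_bot[OF tendsto_const])
        (auto intro: filterlim_ident)
    have "((\<lambda>x. C * (exp (- \<alpha> * x) + exp (- 1 * x))) \<longlongrightarrow> C * (0 + 0)) at_top" by (intro tendsto_intros t) (use \<alpha> in auto)
    then show "((\<lambda>x. C * (exp (- \<alpha> * x) + exp (- x))) \<longlongrightarrow> 0) at_top" by simp
  qed
  \<comment> \<open>The two lines differ by 2 pi \<i>, so exp (- w) agrees on them; the difference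
    of \<open>f\<close> across the strip is thus the jump of \<open>\<phi>\<close> over a common
    denominator.\<close>
  have expa: "exp (- Complex x a) = - (of_real (exp (- x)) * cis (- \<eta>))"
    and expb: "exp (- Complex x b) = - (of_real (exp (- x)) * cis (- \<eta>))" for x
    by (subst exp_eq_polar, simp add: a_def b_def complex_eq_iff cos_diff sin_diff cos_add sin_add)+
  have line: "1 + of_real e * cis (- \<eta>) = cis (- \<eta>) * (cis \<eta> + of_real e)" for e :: real by (simp add: algebra_simps cis_mult)
  have den_nz: "cis \<eta> + of_real (exp (- x)) \<noteq> 0" for x :: real
  proof
    assume "cis \<eta> + of_real (exp (- x)) = 0"
    then have "Re (cis \<eta> + of_real (exp (- x))) = 0" by simp
    then have "cos \<eta> + exp (- x) = 0" by simp
    then show False using cos_\<eta>_pos exp_gt_zero[of "- x"] by linarith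
  qed
  have f_line: "f (Complex x y) = cis \<eta> * \<phi> (Complex x y) / (cis \<eta> + of_real (exp (- x)))" if "y = a \<or> y = b" for x y
  proof -
    have "1 - exp (- Complex x y) = cis (- \<eta>) * (cis \<eta> + of_real (exp (- x)))" using that line[of "exp (- x)"] by (auto simp only: expa expb diff_minus_eq_add)
    then have "f (Complex x y) = \<phi> (Complex x y) / (cis (- \<eta>) * (cis \<eta> + of_real (exp (- x))))" by (simp only: f_def)
    also have "... = inverse (cis (- \<eta>)) * \<phi> (Complex x y) / (cis \<eta> + of_real (exp (- x)))" by (simp only: divide_inverse inverse_mult_distrib mult_ac)
    also have "inverse (cis (- \<eta>)) = cis \<eta>" by (subst cis_inverse) simp
    finally show ?thesis .
  qed
  have int_line: "integrable lborel (\<lambda>x. f (Complex x y))" if y: "y = a \<or> y = b" for y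
  proof -
    have yab: "a \<le> y" "y \<le> b" using y ab by auto
    define C where "C = 1 / d + exp (- \<alpha> * L) / (d * cos \<eta>)"
    have den2: "norm (cis \<eta> + of_real (exp (- x))) \<ge> cos \<eta>" "norm (cis \<eta> + of_real (exp (- x))) \<ge> exp (- x)" for x :: real
    proof -
      have "Re (cis \<eta> + of_real (exp (- x))) = cos \<eta> + exp (- x)" by simp
      then have "cos \<eta> + exp (- x) \<le> norm (cis \<eta> + of_real (exp (- x)))" using complex_Re_le_cmod by metis
      then show "norm (cis \<eta> + of_real (exp (- x))) \<ge> cos \<eta>" "norm (cis \<eta> + of_real (exp (- x))) \<ge> exp (- x)"
        using cos_\<eta>_pos exp_gt_zero[of "- x"] by linarith+
    qed
    have bound: "norm (f (Complex x y)) \<le> C * exp (- \<alpha> * \<bar>x\<bar>)" for x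
    proof (cases "x \<ge> 0")
      case True
      have "norm (f (Complex x y)) = norm (\<phi> (Complex x y)) / norm (cis \<eta> + of_real (exp (- x)))" unfolding f_line[OF y] by (simp add: norm_mult norm_divide)
      also have "... \<le> (exp (- \<alpha> * L) / d * exp (- \<alpha> * x)) / cos \<eta>"
        using \<phi>_bound(2)[OF yab, of x] den2(1)[of x] cos_\<eta>_pos by (intro frac_le) (auto intro: order_trans[OF norm_ge_zero])
      also have "... = exp (- \<alpha> * L) / (d * cos \<eta>) * exp (- \<alpha> * \<bar>x\<bar>)" using True by simp
      also have "... \<le> C * exp (- \<alpha> * \<bar>x\<bar>)" using d by (intro mult_right_mono) (auto simp: C_def)
      finally show ?thesis .
    next
      case False
      have "norm (f (Complex x y)) = norm (\<phi> (Complex x y)) / norm (cis \<eta> + of_real (exp (- x)))" unfolding f_line[OF y] by (simp add: norm_mult norm_divide)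
      also have "... \<le> (1 / d) / exp (- x)" using \<phi>_bound(1)[OF yab, of x] den2(2)[of x] d by (intro frac_le) auto
      also have "... = 1 / d * exp (- \<bar>x\<bar>)" using False by (simp add: exp_minus field_simps)
      also have "... \<le> 1 / d * exp (- \<alpha> * \<bar>x\<bar>)" using d \<alpha> False by (intro mult_left_mono) (auto simp: mult_le_cancel_right1)
      also have "... \<le> C * exp (- \<alpha> * \<bar>x\<bar>)" using d cos_\<eta>_pos by (intro mult_right_mono) (auto simp: C_def)
      finally show ?thesis .
    qed
    have "integrable lborel (\<lambda>x. C * exp (- \<alpha> * \<bar>x\<bar>))" using integrable_exp_neg_abs[OF \<alpha>(1)] by simp
    then show ?thesis
    proof (rule Bochner_Integration.integrable_bound)
      have "(\<lambda>x. Complex x y) \<in> borel_measurable borel" unfolding Complex_eq by measurable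
      then show "(\<lambda>x. f (Complex x y)) \<in> borel_measurable lborel" unfolding f_def \<phi>_def by measurable
    qed (use bound in \<open>auto intro!: AE_I2 intro: order_trans[OF _ abs_ge_self]\<close>)
  qed
  have "mld (x + L) / (cis \<eta> + of_real (exp (- x))) = (f (Complex x a) - f (Complex x b)) / (2 * pi * \<i>)" for x
  proof -
    have "\<phi> (Complex x a) = 1 / (of_real (exp (\<alpha> * (x + L))) * cis (\<alpha> * (\<eta> - pi)) + \<i>)"
      "\<phi> (Complex x b) = 1 / (of_real (exp (\<alpha> * (x + L))) * cis (\<alpha> * (\<eta> + pi)) + \<i>)" by (simp_all only: \<phi>_def expC a_def b_def)
    then have "mld (x + L) = cis \<eta> / (2 * pi * \<i>) * (\<phi> (Complex x a) - \<phi> (Complex x b))" by (simp add: ml_density_def)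
    moreover have "f (Complex x a) - f (Complex x b) =
      cis \<eta> * (\<phi> (Complex x a) - \<phi> (Complex x b)) / (cis \<eta> + of_real (exp (- x)))"
      by (simp only: f_line[of a x, OF disjI1, OF refl] f_line[of b x, OF disjI2, OF refl]
          right_diff_distrib diff_divide_distrib)
    ultimately show ?thesis by simp
  qed
  then have "(LINT x|lborel. mld (x + L) / (cis \<eta> + of_real (exp (- x)))) =
     (LINT x|lborel. (f (Complex x a) - f (Complex x b)) / (2 * pi * \<i>))" by simp
  also have "... = ((LINT x|lborel. f (Complex x a)) - (LINT x|lborel. f (Complex x b))) / (2 * pi * \<i>)" using int_line by simp
  also have "... = 1 / (of_real (exp (\<alpha> * L)) + \<i>)" using fin int_line by simp
  finally show ?thesis .
qed

end

section \<open>The maximal function\<close>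

text \<open>Moments of maximal functions and of kernel convolutions can be written down with this
  power before their finiteness is known.\<close>

definition epow :: "ennreal => real => ennreal"
  where "epow x q = (if x = top then top else ennreal (enn2real x powr q))"

lemma epow_ennreal [simp]: "0 \<le> a ==> epow (ennreal a) q = ennreal (a powr q)" by (simp add: epow_def)

lemma epow_top [simp]: "epow top q = top" by (simp add: epow_def)

lemma epow_measurable [measurable (raw)]:
  assumes [measurable]: "f \<in> borel_measurable M"
  shows "(\<lambda>x. epow (f x) q) \<in> borel_measurable M" unfolding epow_def by measurable

lemma epow_mono: "x \<le> y ==> 0 \<le> q ==> epow x q \<le> epow y q" by (cases x; cases y) (auto intro: powr_mono2 simp: top_unique)

lemma nn_integral_powr_from_0:
  fixes a e :: real
  assumes "a \<ge> 0" "e > - 1"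
  shows "(\<integral>x. ennreal (x powr e) * indicator {0<..<a} x) = ennreal (a powr (e + 1) / (e + 1))"
proof -
  have "((\<lambda>x. if x \<in> {0..a} then x powr e else 0) has_integral (a powr (e+1) / (e+1))) UNIV"
    using has_integral_powr_from_0[OF assms(2,1)] by (subst has_integral_restrict_UNIV)
  then have "(\<integral>x. ennreal (if x \<in> {0..a} then x powr e else 0)) = ennreal (a powr (e + 1) / (e + 1))" by (intro nn_integral_has_integral_lborel) auto
  moreover have "(\<integral>x. ennreal (if x \<in> {0..a} then x powr e else 0)) =
    (\<integral>x. ennreal (x powr e) * indicator {0<..<a} x)"
  proof (rule nn_integral_cong_AE)
    have "AE x in lborel. x \<notin> {0, a}" by (intro AE_not_in finite_imp_null_set_lborel) auto
    then show "AE x in lborel. ennreal (if x \<in> {0..a} then x powr e else 0) = ennreal (x powr e) * indicator {0<..<a} x" by eventually_elim (auto simp: indicator_def)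
  qed
  ultimately show ?thesis by simp
qed

text \<open>Brings the level sets into the integral, so that a weak-type bound can be integrated
  over the levels. An infinite value is approached from below through the levels n powr (1 /
  q).\<close>

lemma epow_layer_cake:
  assumes "q > 0"
  shows "epow x q = (\<integral>m. ennreal (q * m powr (q - 1)) * indicator {m. 0 < m \<and> ennreal m < x} m)"
proof (cases x)
  case (real a)
  have "(\<integral>m. ennreal (q * m powr (q - 1)) * indicator {m. 0 < m \<and> ennreal m < x} m) =
     (\<integral>m. ennreal q * (ennreal (m powr (q - 1)) * indicator {0<..<a} m))"
    using real assms by (intro nn_integral_cong) (auto simp: indicator_def ennreal_mult ennreal_less_iff)
  also have "... = ennreal q * ennreal (a powr q / q)" using nn_integral_powr_from_0[of a "q - 1"] real assms by (subst nn_integral_cmult) auto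
  also have "... = ennreal (a powr q)" using assms by (simp flip: ennreal_mult)
  finally show ?thesis using real by simp
next
  case top
  have "ennreal (b powr q) \<le> (\<integral>m. ennreal (q * m powr (q - 1)) * indicator {m. 0 < m \<and> ennreal m < x} m)"
    if "b \<ge> 0" for b
  proof -
    have "ennreal (b powr q) = ennreal q * ennreal (b powr q / q)" using assms by (simp flip: ennreal_mult)
    also have "... = (\<integral>m. ennreal q * (ennreal (m powr (q - 1)) * indicator {0<..<b} m))"
      using nn_integral_powr_from_0[of b "q - 1"] that assms by (subst nn_integral_cmult) auto
    also have "... \<le> (\<integral>m. ennreal (q * m powr (q - 1)) * indicator {m. 0 < m \<and> ennreal m < x} m)"
      using top assms by (intro nn_integral_mono) (auto simp: indicator_def ennreal_mult)
    finally show ?thesis .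
  qed
  from this[of "real n powr (1 / q)" for n]
  have "of_nat n \<le> (\<integral>m. ennreal (q * m powr (q - 1)) * indicator {m. 0 < m \<and> ennreal m < x} m)" for n
    using assms by (cases "n = 0") (auto simp: powr_powr ennreal_of_nat_eq_real_of_nat)
  then have "(\<integral>m. ennreal (q * m powr (q - 1)) * indicator {m. 0 < m \<and> ennreal m < x} m) = top"
    using ennreal_SUP_of_nat_eq_top SUP_least[of UNIV of_nat] top_unique by metis
  then show ?thesis using top by simp
qed

text \<open>The centred Hardy--Littlewood function with dyadic radii only: a countable supremum is
  measurable, and other radii cost a factor 2.\<close>

definition maximal :: "(real => ennreal) => real => ennreal"
  where "maximal \<phi> t = (SUP j::int. (\<integral>s. \<phi> s * indicator {..<2 powi j} \<bar>t - s\<bar>) / ennreal (2 * 2 powi j))"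

lemma maximal_measurable [measurable]:
  assumes [measurable]: "\<phi> \<in> borel_measurable borel"
  shows "maximal \<phi> \<in> borel_measurable borel" unfolding maximal_def[abs_def] by measurable

text \<open>The radius \<open>h\<close> is rounded up to a power of 2 that is at most 2 h; the
  corresponding interval has length at most 4 h.\<close>

lemma ball_integral_le_maximal:
  assumes "h > 0"
  shows "(\<integral>s. \<phi> s * indicator {..<h} \<bar>t - s\<bar>) \<le> ennreal (4 * h) * maximal \<phi> t"
proof -
  define j where "j = \<lceil>log 2 h\<rceil>"
  have "h = 2 powr (log 2 h)" using assms by simp
  also have "... \<le> 2 powr (of_int j)" by (simp add: j_def)
  finally have 1: "h \<le> (2::real) powi j" by (simp add: powr_real_of_int')
  have "(2::real) powi j = 2 powr (of_int j)" by (simp add: powr_real_of_int')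
  also have "... \<le> 2 powr (log 2 h + 1)" by (intro powr_mono) (auto simp: j_def)
  also have "... = 2 * h" using assms by (simp add: powr_add)
  finally have 2: "(2::real) powi j \<le> 2 * h" .
  define I where "I = (\<integral>s. \<phi> s * indicator {..<2 powi j} \<bar>t - s\<bar>)"
  have pos: "(0::real) < 2 * 2 powi j" by simp
  have "I / ennreal (2 * 2 powi j) \<le> maximal \<phi> t" unfolding maximal_def I_def by (rule SUP_upper) simp
  then have "I / ennreal (2 * 2 powi j) * ennreal (2 * 2 powi j) \<le> maximal \<phi> t * ennreal (2 * 2 powi j)" by (intro mult_right_mono) auto
  then have "I \<le> maximal \<phi> t * ennreal (2 * 2 powi j)" using pos by (simp add: ennreal_divide_times ennreal_mult_divide_eq)
  also have "... \<le> maximal \<phi> t * ennreal (4 * h)" using 2 by (intro mult_left_mono ennreal_leI) auto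
  finally have "I \<le> ennreal (4 * h) * maximal \<phi> t" by (simp add: mult.commute)
  moreover have "(\<integral>s. \<phi> s * indicator {..<h} \<bar>t - s\<bar>) \<le> I" unfolding I_def using 1 by (intro nn_integral_mono) (auto simp: indicator_def)
  ultimately show ?thesis by (rule order_trans[rotated])
qed

text \<open>Vitali covering: every point of the level set is the centre of an interval whose average
  exceeds \<open>m\<close>. A disjoint subfamily, enlarged five times, still covers, and on disjoint
  intervals the integrals of \<open>\<phi>\<close> add up to at most the total.\<close>

lemma maximal_weak_type:
  assumes [measurable]: "\<phi> \<in> borel_measurable borel" and m: "m > 0"
  shows "emeasure lborel {t. ennreal m < maximal \<phi> t} \<le> ennreal (5 / m) * (\<integral>s. \<phi> s)"
proof (cases "(\<integral>s. \<phi> s) = top")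
  case True
  then show ?thesis using m by (simp add: ennreal_mult_top)
next
  case False
  define I where "I = enn2real (\<integral>s. \<phi> s)"
  have I: "(\<integral>s. \<phi> s) = ennreal I" "I \<ge> 0" using False by (auto simp: I_def less_top)
  define S where "S = {t. ennreal m < maximal \<phi> t}"
  define B where "B x = cball (fst x) (snd x)" for x :: "real \<times> real"
  \<comment> \<open>Pairs of centre and radius whose closed interval has an average larger than
    \<open>m\<close>.\<close>
  define K where "K = {x :: real \<times> real. 0 < snd x \<and> ennreal (2 * snd x * m) < (\<integral>\<^sup>+s\<in>B x. \<phi> s \<partial>lborel)}"
  have cov: "S \<subseteq> (\<Union>x\<in>K. cball (fst x) (snd x))"
  proof
    fix t assume "t \<in> S"
    then obtain j :: int where j: "ennreal m < (\<integral>s. \<phi> s * indicator {..<2 powi j} \<bar>t - s\<bar>) / ennreal (2 * 2 powi j)"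
      by (auto simp: S_def maximal_def less_SUP_iff)
    define h :: real where "h = 2 powi j"
    have h: "h > 0" by (simp add: h_def)
    have "ennreal (2 * h * m) = ennreal m * ennreal (2 * h)" using h m by (simp flip: ennreal_mult add: mult_ac)
    also have "... < (\<integral>s. \<phi> s * indicator {..<h} \<bar>t - s\<bar>) / ennreal (2 * h) * ennreal (2 * h)"
      using j h unfolding h_def[symmetric] by (intro ennreal_mult_strict_right_mono) auto
    also have "... = (\<integral>s. \<phi> s * indicator {..<h} \<bar>t - s\<bar>)" using h by (simp add: ennreal_divide_times ennreal_mult_divide_eq)
    also have "... \<le> (\<integral>\<^sup>+s\<in>B (t, h). \<phi> s \<partial>lborel)" by (intro nn_integral_mono) (auto simp: indicator_def B_def dist_real_def)
    finally have "(t, h) \<in> K" using h by (simp add: K_def)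
    then show "t \<in> (\<Union>x\<in>K. cball (fst x) (snd x))" using h by force
  qed
  \<comment> \<open>The radii of a family in Vitali's lemma have to be bounded; here the finite
    total integral bounds them.\<close>
  have bnd: "0 < snd x \<and> snd x \<le> I / (2 * m)" if "x \<in> K" for x
  proof -
    have "ennreal (2 * snd x * m) < (\<integral>\<^sup>+s\<in>B x. \<phi> s \<partial>lborel)" using that by (simp add: K_def)
    also have "... \<le> (\<integral>s. \<phi> s)" by (intro nn_integral_mono) (auto simp: indicator_def)
    finally have "2 * snd x * m < I" using that m I by (simp add: K_def ennreal_less_iff)
    then show ?thesis using that m by (simp add: K_def field_simps)
  qed
  obtain C where C: "countable C" "C \<subseteq> K"
     "pairwise (\<lambda>i j. disjnt (cball (fst i) (snd i)) (cball (fst j) (snd j))) C"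
     "S \<subseteq> (\<Union>i\<in>C. cball (fst i) (5 * snd i))" using Vitali_covering_lemma_cballs[OF cov, of "I / (2 * m)"] bnd by blast
  \<comment> \<open>The countable subfamily is indexed by naturals and padded with empty sets, so
    that countable additivity applies.\<close>
  define N where "N = to_nat_on C ` C"
  define D where "D n = (if n \<in> N then B (from_nat_into C n) else {})" for n
  define D5 where "D5 n = (if n \<in> N then cball (fst (from_nat_into C n)) (5 * snd (from_nat_into C n)) else {})" for n
  have fn: "from_nat_into C n \<in> C" if "n \<in> N" for n using that C(1) by (auto simp: N_def)
  have inj: "n = n'" if "n \<in> N" "n' \<in> N" "from_nat_into C n = from_nat_into C n'" for n n' using that C(1) by (auto simp: N_def)
  have disj: "disjoint_family D" unfolding disjoint_family_on_def
  proof (intro ballI impI)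
    fix n n' :: nat assume "n \<noteq> n'"
    show "D n \<inter> D n' = {}"
    proof (cases "n \<in> N \<and> n' \<in> N")
      case True
      then have "from_nat_into C n \<noteq> from_nat_into C n'" using inj \<open>n \<noteq> n'\<close> by blast
      then show ?thesis using C(3) fn True unfolding D_def B_def pairwise_def disjnt_def by simp
    qed (auto simp: D_def)
  qed
  have Dm: "D n \<in> sets lborel" for n by (auto simp: D_def B_def)
  have D_bound: "emeasure lborel (D5 n) \<le> ennreal (5 / m) * (\<integral>\<^sup>+s\<in>D n. \<phi> s \<partial>lborel)" for n
  proof (cases "n \<in> N")
    case True
    define x where "x = from_nat_into C n"
    have x: "x \<in> K" using fn[OF True] C(2) by (auto simp: x_def)
    have "emeasure lborel (D5 n) = ennreal (10 * snd x)" using True x by (simp add: D5_def x_def[symmetric] cball_eq_atLeastAtMost K_def)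
    also have "... = ennreal (5 / m) * ennreal (2 * snd x * m)" using m x by (simp flip: ennreal_mult add: K_def)
    also have "... \<le> ennreal (5 / m) * (\<integral>\<^sup>+s\<in>B x. \<phi> s \<partial>lborel)" using x by (intro mult_left_mono) (auto simp: K_def)
    finally show ?thesis using True by (simp add: D_def x_def)
  qed (simp add: D5_def)
  have "S \<subseteq> (\<Union>n. D5 n)"
  proof
    fix t assume "t \<in> S"
    then obtain x where x: "x \<in> C" "t \<in> cball (fst x) (5 * snd x)" using C(4) by blast
    then have "to_nat_on C x \<in> N" "from_nat_into C (to_nat_on C x) = x" using C(1) by (auto simp: N_def)
    then show "t \<in> (\<Union>n. D5 n)" using x by (intro UN_I[of "to_nat_on C x"]) (auto simp: D5_def)
  qed
  then have "emeasure lborel S \<le> emeasure lborel (\<Union>n. D5 n)" by (intro emeasure_mono) (auto simp: D5_def)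
  also have "... \<le> (\<Sum>n. emeasure lborel (D5 n))" by (intro emeasure_subadditive_countably) (auto simp: D5_def)
  also have "... \<le> (\<Sum>n. ennreal (5 / m) * (\<integral>\<^sup>+s\<in>D n. \<phi> s \<partial>lborel))" by (intro suminf_le D_bound) auto
  also have "... = ennreal (5 / m) * (\<Sum>n. (\<integral>\<^sup>+s\<in>D n. \<phi> s \<partial>lborel))" by simp
  also have "(\<Sum>n. (\<integral>\<^sup>+s\<in>D n. \<phi> s \<partial>lborel)) = (\<integral>\<^sup>+s\<in>(\<Union>n. D n). \<phi> s \<partial>lborel)"
    using disj Dm by (intro nn_integral_disjoint_family[symmetric]) auto
  also have "ennreal (5 / m) * (\<integral>\<^sup>+s\<in>(\<Union>n. D n). \<phi> s \<partial>lborel) \<le> ennreal (5 / m) * (\<integral>s. \<phi> s)"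
    by (intro mult_left_mono nn_integral_mono) (auto simp: indicator_def)
  finally show ?thesis unfolding S_def .
qed

text \<open>Values of \<open>\<phi>\<close> up to \<open>c\<close> contribute at most
  \<open>c\<close> to any average.\<close>

lemma maximal_truncate:
  assumes [measurable]: "\<phi> \<in> borel_measurable borel" and c: "c \<ge> 0"
  shows "maximal \<phi> t \<le> maximal (\<lambda>s. \<phi> s * indicator {x. ennreal c < x} (\<phi> s)) t + ennreal c" unfolding maximal_def
proof (rule SUP_least)
  fix j :: int
  define h :: real where "h = 2 powi j"
  have h: "h > 0" by (simp add: h_def)
  have "(\<integral>s. \<phi> s * indicator {..<h} \<bar>t - s\<bar>) \<le>
    (\<integral>s. \<phi> s * indicator {x. ennreal c < x} (\<phi> s) * indicator {..<h} \<bar>t - s\<bar>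
       + ennreal c * indicator {t - h<..<t + h} s)" by (intro nn_integral_mono) (auto simp: indicator_def abs_if not_less)
  also have "... = (\<integral>s. \<phi> s * indicator {x. ennreal c < x} (\<phi> s) * indicator {..<h} \<bar>t - s\<bar>) +
     ennreal c * ennreal (2 * h)" using h by (subst nn_integral_add) (auto simp: nn_integral_cmult)
  finally have "(\<integral>s. \<phi> s * indicator {..<h} \<bar>t - s\<bar>) / ennreal (2 * h) \<le>
    ((\<integral>s. \<phi> s * indicator {x. ennreal c < x} (\<phi> s) * indicator {..<h} \<bar>t - s\<bar>) +
     ennreal c * ennreal (2 * h)) / ennreal (2 * h)" by (rule divide_right_mono_ennreal)
  also have "... = (\<integral>s. \<phi> s * indicator {x. ennreal c < x} (\<phi> s) * indicator {..<h} \<bar>t - s\<bar>) / ennreal (2 * h)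
     + ennreal c" using h by (simp add: add_divide_distrib_ennreal ennreal_mult_divide_eq)
  also have "... \<le> (SUP j::int. (\<integral>s. \<phi> s * indicator {x. ennreal c < x} (\<phi> s) * indicator {..<2 powi j} \<bar>t - s\<bar>) / ennreal (2 * 2 powi j))
     + ennreal c" unfolding h_def by (intro add_right_mono SUP_upper) auto
  finally show "(\<integral>s. \<phi> s * indicator {..<2 powi j} \<bar>t - s\<bar>) / ennreal (2 * 2 powi j) \<le> ..." unfolding h_def .
qed

text \<open>Marcinkiewicz interpolation: at level \<open>m\<close> only the part of
  \<open>\<phi>\<close> above m/2 matters, to which the weak-type bound applies with constant 5 /
  (m/2). Exchanging the integrals leaves that of m powr (q - 2) up to 2 \<phi>, which gives the
  constant.\<close>

lemma maximal_strong_type: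
  assumes [measurable]: "\<phi> \<in> borel_measurable borel" and q: "q > 1" and nn: "\<And>s. 0 \<le> \<phi> s"
  shows "(\<integral>t. epow (maximal (\<lambda>s. ennreal (\<phi> s)) t) q) \<le>
    ennreal (10 * q * 2 powr (q - 1) / (q - 1)) * (\<integral>t. ennreal (\<phi> t powr q))"
proof -
  define M where "M = maximal (\<lambda>s. ennreal (\<phi> s))"
  have [measurable]: "M \<in> borel_measurable borel" unfolding M_def by measurable
  have level: "emeasure lborel {t. ennreal m < M t} \<le>
      ennreal (10 / m) * (\<integral>s. ennreal (\<phi> s) * indicator {m / 2<..} (\<phi> s))" if m: "m > 0" for m
  proof -
    define \<psi> where "\<psi> s = ennreal (\<phi> s) * indicator {x. ennreal (m / 2) < x} (ennreal (\<phi> s))" for s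
    have [measurable]: "\<psi> \<in> borel_measurable borel" unfolding \<psi>_def by measurable
    have "{t. ennreal m < M t} \<subseteq> {t. ennreal (m / 2) < maximal \<psi> t}"
    proof (intro subsetI CollectI, rule ccontr)
      fix t assume t: "t \<in> {t. ennreal m < M t}" and "\<not> ennreal (m / 2) < maximal \<psi> t"
      then have "maximal \<psi> t + ennreal (m / 2) \<le> ennreal (m / 2) + ennreal (m / 2)" by (intro add_mono) auto
      also have "... = ennreal m" using m by (simp flip: ennreal_plus)
      finally have "maximal \<psi> t + ennreal (m / 2) \<le> ennreal m" .
      moreover have "M t \<le> maximal \<psi> t + ennreal (m / 2)" unfolding M_def \<psi>_def using m by (intro maximal_truncate) auto
      ultimately show False using t by auto
    qed
    then have "emeasure lborel {t. ennreal m < M t} \<le> emeasure lborel {t. ennreal (m / 2) < maximal \<psi> t}" by (intro emeasure_mono) auto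
    also have "... \<le> ennreal (5 / (m / 2)) * (\<integral>s. \<psi> s)" using m by (intro maximal_weak_type) auto
    also have "(\<integral>s. \<psi> s) = (\<integral>s. ennreal (\<phi> s) * indicator {m / 2<..} (\<phi> s))"
      unfolding \<psi>_def using m nn by (intro nn_integral_cong) (auto simp: indicator_def ennreal_less_iff)
    finally show ?thesis by simp
  qed
  have "(\<integral>t. epow (M t) q) =
    (\<integral>t. (\<integral>m. ennreal (q * m powr (q - 1)) * indicator {m. 0 < m \<and> ennreal m < M t} m))" using q by (intro nn_integral_cong epow_layer_cake) auto
  also have "... = (\<integral>m. (\<integral>t. ennreal (q * m powr (q - 1)) * indicator {m. 0 < m \<and> ennreal m < M t} m))" by (intro lborel_pair.Fubini') measurable
  also have "... \<le> (\<integral>m. (\<integral>s. ennreal (10 * q * m powr (q - 2)) * (ennreal (\<phi> s) * indicator {m. 0 < m \<and> m < 2 * \<phi> s} m)))"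
  proof (rule nn_integral_mono)
    fix m :: real
    show "(\<integral>t. ennreal (q * m powr (q - 1)) * indicator {m. 0 < m \<and> ennreal m < M t} m) \<le>
      (\<integral>s. ennreal (10 * q * m powr (q - 2)) * (ennreal (\<phi> s) * indicator {m. 0 < m \<and> m < 2 * \<phi> s} m))"
    proof (cases "m > 0")
      case True
      have "(\<integral>t. ennreal (q * m powr (q - 1)) * indicator {m. 0 < m \<and> ennreal m < M t} m) =
        (\<integral>t. ennreal (q * m powr (q - 1)) * indicator {t. ennreal m < M t} t)" using True by (intro nn_integral_cong) (auto simp: indicator_def)
      also have "... = ennreal (q * m powr (q - 1)) * emeasure lborel {t. ennreal m < M t}" by (rule nn_integral_cmult_indicator) measurable
      also have "... \<le> ennreal (q * m powr (q - 1)) *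
         (ennreal (10 / m) * (\<integral>s. ennreal (\<phi> s) * indicator {m / 2<..} (\<phi> s)))" by (intro mult_left_mono level True) auto
      also have "... = ennreal (10 * q * m powr (q - 2)) * (\<integral>s. ennreal (\<phi> s) * indicator {m / 2<..} (\<phi> s))"
      proof -
        have "q * m powr (q - 1) * (10 / m) = 10 * q * m powr (q - 2)" using True by (simp add: powr_diff field_simps power2_eq_square)
        then have "ennreal (q * m powr (q - 1)) * ennreal (10 / m) = ennreal (10 * q * m powr (q - 2))" using q True by (simp flip: ennreal_mult)
        then show ?thesis by (simp flip: mult.assoc)
      qed
      also have "... = (\<integral>s. ennreal (10 * q * m powr (q - 2)) * (ennreal (\<phi> s) * indicator {m / 2<..} (\<phi> s)))" by (subst nn_integral_cmult) auto
      also have "... = (\<integral>s. ennreal (10 * q * m powr (q - 2)) * (ennreal (\<phi> s) * indicator {m. 0 < m \<and> m < 2 * \<phi> s} m))"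
        using True by (intro nn_integral_cong) (auto simp: indicator_def)
      finally show ?thesis by simp
    qed (simp add: indicator_def)
  qed
  also have "... = (\<integral>s. (\<integral>m. ennreal (10 * q * m powr (q - 2)) * (ennreal (\<phi> s) * indicator {m. 0 < m \<and> m < 2 * \<phi> s} m)))"
    by (intro lborel_pair.Fubini') measurable
  also have "... = (\<integral>s. ennreal (10 * q * 2 powr (q - 1) / (q - 1)) * ennreal (\<phi> s powr q))"
  proof (intro nn_integral_cong)
    fix s
    have "(\<integral>m. ennreal (10 * q * m powr (q - 2)) * (ennreal (\<phi> s) * indicator {m. 0 < m \<and> m < 2 * \<phi> s} m)) =
       (\<integral>m. (ennreal (10 * q) * ennreal (\<phi> s)) * (ennreal (m powr (q - 2)) * indicator {m. 0 < m \<and> m < 2 * \<phi> s} m))"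
      using q by (intro nn_integral_cong) (simp add: ennreal_mult mult_ac)
    also have "... = (ennreal (10 * q) * ennreal (\<phi> s)) * ennreal ((2 * \<phi> s) powr (q - 1) / (q - 1))" using nn_integral_powr_from_0[of "2 * \<phi> s" "q - 2"] q nn[of s]
      by (subst nn_integral_cmult) (auto simp: greaterThanLessThan_def greaterThan_def lessThan_def Int_def)
    also have "... = ennreal (10 * q * \<phi> s * ((2 * \<phi> s) powr (q - 1) / (q - 1)))" using q nn[of s] by (simp flip: ennreal_mult)
    also have "10 * q * \<phi> s * ((2 * \<phi> s) powr (q - 1) / (q - 1)) = (10 * q * 2 powr (q - 1) / (q - 1)) * \<phi> s powr q"
      using q nn[of s] by (cases "\<phi> s = 0") (auto simp: powr_mult powr_diff field_simps)
    finally show "(\<integral>m. ennreal (10 * q * m powr (q - 2)) * (ennreal (\<phi> s) * indicator {m. 0 < m \<and> m < 2 * \<phi> s} m)) =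
       ennreal (10 * q * 2 powr (q - 1) / (q - 1)) * ennreal (\<phi> s powr q)" using q by (subst ennreal_mult[symmetric]) auto
  qed
  also have "... = ennreal (10 * q * 2 powr (q - 1) / (q - 1)) * (\<integral>s. ennreal (\<phi> s powr q))" by (subst nn_integral_cmult) auto
  finally show ?thesis by (simp add: M_def)
qed

text \<open>The exponential is a superposition of indicators of balls.\<close>

lemma exp_average_le_maximal:
  assumes [measurable]: "\<phi> \<in> borel_measurable borel" and a: "a > 0"
  shows "(\<integral>s. ennreal (a * exp (- a * \<bar>t - s\<bar>)) * \<phi> s) \<le> 8 * maximal \<phi> t"
proof -
  \<comment> \<open>The tail integral of the derivative: this exhibits the exponential as a positive
    mixture of indicators of balls of radius \<open>h\<close>.\<close>
  have tail: "ennreal (a * exp (- a * x)) = (\<integral>h. ennreal (a\<^sup>2 * exp (- a * h)) * indicator {h. x \<le> h} h)"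
    for x
  proof -
    have "((\<lambda>h. - a * exp (- a * h)) \<longlongrightarrow> - a * 0) at_top" using a by (intro tendsto_mult tendsto_const filterlim_compose[OF exp_at_bot]
          filterlim_tendsto_neg_mult_at_bot[OF tendsto_const]) (auto intro: filterlim_ident)
    then have "(\<integral>h. ennreal (a\<^sup>2 * exp (- a * h)) * indicator {x..} h) = ennreal (0 - (- a * exp (- a * x)))" by (intro nn_integral_FTC_atLeast)
        (auto intro!: derivative_eq_intros simp: power2_eq_square)
    then show ?thesis by (simp add: atLeast_def)
  qed
  have "(\<integral>s. ennreal (a * exp (- a * \<bar>t - s\<bar>)) * \<phi> s) =
    (\<integral>s. (\<integral>h. ennreal (a\<^sup>2 * exp (- a * h)) * indicator {h. \<bar>t - s\<bar> \<le> h} h * \<phi> s))"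
    by (intro nn_integral_cong, subst tail, subst nn_integral_multc) auto
  also have "... = (\<integral>h. (\<integral>s. ennreal (a\<^sup>2 * exp (- a * h)) * indicator {h. \<bar>t - s\<bar> \<le> h} h * \<phi> s))"
    by (intro lborel_pair.Fubini') measurable
  also have "... \<le> (\<integral>h. ennreal (a\<^sup>2 * exp (- a * h)) * (ennreal (8 * h) * indicator {0..} h * maximal \<phi> t))"
  proof (rule nn_integral_mono_AE)
    have "AE h in lborel. h \<noteq> (0::real)" by (rule AE_lborel_singleton)
    then show "AE h in lborel. (\<integral>s. ennreal (a\<^sup>2 * exp (- a * h)) * indicator {h. \<bar>t - s\<bar> \<le> h} h * \<phi> s) \<le>
      ennreal (a\<^sup>2 * exp (- a * h)) * (ennreal (8 * h) * indicator {0..} h * maximal \<phi> t)"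
    proof eventually_elim
      case (elim h)
      show ?case
      proof (cases "h > 0")
        case True
        \<comment> \<open>The closed ball of radius h is enlarged to the open ball of radius 2 h,
          because \<open>ball_integral_le_maximal\<close> is about open balls; this turns 4 h into 8
          h.\<close>
        have "(\<integral>s. ennreal (a\<^sup>2 * exp (- a * h)) * indicator {h. \<bar>t - s\<bar> \<le> h} h * \<phi> s) \<le>
          (\<integral>s. ennreal (a\<^sup>2 * exp (- a * h)) * (\<phi> s * indicator {..<2 * h} \<bar>t - s\<bar>))"
          using True by (intro nn_integral_mono) (auto simp: indicator_def)
        also have "... = ennreal (a\<^sup>2 * exp (- a * h)) * (\<integral>s. \<phi> s * indicator {..<2 * h} \<bar>t - s\<bar>)" by (subst nn_integral_cmult) auto
        also have "... \<le> ennreal (a\<^sup>2 * exp (- a * h)) * (ennreal (4 * (2 * h)) * maximal \<phi> t)" using True by (intro mult_left_mono ball_integral_le_maximal) auto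
        finally show ?thesis using True by simp
      next
        case False
        then have "indicator {h. \<bar>t - s\<bar> \<le> h} h = (0 :: ennreal)" for s using elim by (auto simp: indicator_def)
        then show ?thesis by simp
      qed
    qed
  qed
  also have "... = (\<integral>h. ennreal (8 * (a\<^sup>2 * h * exp (- a * h))) * indicator {0..} h * maximal \<phi> t)"
  proof (rule nn_integral_cong)
    fix h :: real
    show "ennreal (a\<^sup>2 * exp (- a * h)) * (ennreal (8 * h) * indicator {0..} h * maximal \<phi> t) =
      ennreal (8 * (a\<^sup>2 * h * exp (- a * h))) * indicator {0..} h * maximal \<phi> t"
    proof (cases "h \<ge> 0")
      case True
      have "ennreal (a\<^sup>2 * exp (- a * h)) * ennreal (8 * h) = ennreal (a\<^sup>2 * exp (- a * h) * (8 * h))" using True by (intro ennreal_mult[symmetric]) auto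
      also have "a\<^sup>2 * exp (- a * h) * (8 * h) = 8 * (a\<^sup>2 * h * exp (- a * h))" by simp
      finally show ?thesis using True by (simp flip: mult.assoc)
    qed simp
  qed
  also have "... = (\<integral>h. ennreal (8 * (a\<^sup>2 * h * exp (- a * h))) * indicator {0..} h) * maximal \<phi> t" by (rule nn_integral_multc) measurable
  also have "(\<integral>h. ennreal (8 * (a\<^sup>2 * h * exp (- a * h))) * indicator {0..} h) = 8"
  proof -
    define F where "F h = - 8 * (a * h + 1) * exp (- a * h)" for h
    have "((\<lambda>h. F h) \<longlongrightarrow> 0) at_top" unfolding F_def using a by real_asymp
    then have "(\<integral>h. ennreal (8 * (a\<^sup>2 * h * exp (- a * h))) * indicator {0..} h) = ennreal (0 - F 0)"
    proof (rule nn_integral_FTC_atLeast[rotated 3])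
      show "(F has_real_derivative 8 * (a\<^sup>2 * h * exp (- a * h))) (at h)" for h unfolding F_def by (auto intro!: derivative_eq_intros simp: power2_eq_square algebra_simps)
      show "0 \<le> 8 * (a\<^sup>2 * h * exp (- a * h))" if "0 \<le> h" for h using that by (intro mult_nonneg_nonneg) auto
    qed measurable
    then show ?thesis by (simp add: F_def)
  qed
  finally show ?thesis .
qed

section \<open>Square functions of dominated convolutions\<close>

lemma power2_powr_half:
  assumes "(c :: real) \<ge> 0"
  shows "(c\<^sup>2) powr (p / 2) = c powr p"
proof (cases "c = 0")
  case False
  then have "c powr 2 = c\<^sup>2" using assms by (simp add: powr_numeral)
  moreover have "(c powr 2) powr (p / 2) = c powr p" by (simp only: powr_powr) simp
  ultimately show ?thesis by simp
qed simp

text \<open>Young's inequality for the rescaled product (s a) (b / s), where s powr r' = 1 /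
  \<epsilon>. The term with \<open>\<epsilon>\<close> will be absorbed into the left-hand
  side.\<close>

lemma Youngs_inequality_eps:
  fixes r r' \<epsilon> :: real
  assumes "r > 1" "r' > 1" "1 / r + 1 / r' = 1" "\<epsilon> > 0"
  shows "\<exists>K\<ge>0. \<forall>a\<ge>0. \<forall>b. ennreal a * b \<le> ennreal (K * a powr r) + ennreal \<epsilon> * epow b r'"
proof -
  define s where "s = (1 / \<epsilon>) powr (1 / r')"
  have s: "s > 0" using assms by (simp add: s_def)
  have sr: "s powr r' = 1 / \<epsilon>" using assms by (simp add: s_def powr_powr)
  show ?thesis
  proof (intro exI[of _ "s powr r"] conjI allI impI)
    fix a :: real and b :: ennreal
    assume a: "a \<ge> 0"
    show "ennreal a * b \<le> ennreal (s powr r * a powr r) + ennreal \<epsilon> * epow b r'"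
    proof (cases b)
      case (real c)
      have "a * c = (s * a) * (c / s)" using s by simp
      also have "... \<le> (s * a) powr r / r + (c / s) powr r' / r'" using assms s a real by (intro Youngs_inequality) auto
      also have "... \<le> (s * a) powr r / 1 + (c / s) powr r' / 1" using assms by (intro add_mono divide_left_mono) auto
      also have "... = s powr r * a powr r + \<epsilon> * c powr r'" using s a real sr assms by (simp add: powr_mult powr_divide)
      finally have "ennreal (a * c) \<le> ennreal (s powr r * a powr r + \<epsilon> * c powr r')" by (rule ennreal_leI)
      also have "... = ennreal (s powr r * a powr r) + ennreal \<epsilon> * epow b r'" using real assms by (simp add: ennreal_plus ennreal_mult)
      finally show ?thesis using a real by (simp add: ennreal_mult)
    next
      case top
      then show ?thesis using assms a by (auto simp: ennreal_mult_top)
    qed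
  qed auto
qed

text \<open>A crude bound that depends on the number of terms; it serves only to establish
  finiteness.\<close>

lemma epow_sum_squares_le:
  assumes "p > 0"
  shows "epow (\<Sum>n<N. (x n)\<^sup>2) (p / 2) \<le> ennreal (real N powr (p / 2)) * (\<Sum>n<N. epow (x n) p)"
proof (cases "N = 0")
  case True
  then show ?thesis using assms by (simp add: epow_def)
next
  case False
  obtain m where m: "m < N" "\<And>n. n < N ==> x n \<le> x m"
  proof -
    have "Max (x ` {..<N}) \<in> x ` {..<N}" using False by (intro Max_in) auto
    then obtain m where "m < N" "x m = Max (x ` {..<N})" by auto
    then show thesis using that[of m] by simp
  qed
  have "(\<Sum>n<N. (x n)\<^sup>2) \<le> (\<Sum>n<N. (x m)\<^sup>2)" using m by (intro sum_mono power_mono) auto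
  then have "epow (\<Sum>n<N. (x n)\<^sup>2) (p / 2) \<le> epow (of_nat N * (x m)\<^sup>2) (p / 2)" using assms by (intro epow_mono) auto
  also have "... \<le> ennreal (real N powr (p / 2)) * epow (x m) p"
  proof (cases "x m")
    case (real c)
    have "of_nat N * (x m)\<^sup>2 = ennreal (real N * c\<^sup>2)" using real by (simp add: ennreal_mult ennreal_power ennreal_of_nat_eq_real_of_nat)
    moreover have "(real N * c\<^sup>2) powr (p / 2) = real N powr (p / 2) * c powr p" using real by (simp add: powr_mult power2_powr_half)
    ultimately have "epow (of_nat N * (x m)\<^sup>2) (p / 2) = ennreal (real N powr (p / 2) * c powr p)" using epow_ennreal[of "real N * c\<^sup>2" "p / 2"] by simp
    then show ?thesis using real by (simp add: ennreal_mult)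
  next
    case top
    then show ?thesis using False by (simp add: ennreal_mult_top)
  qed
  also have "... \<le> ennreal (real N powr (p / 2)) * (\<Sum>n<N. epow (x n) p)" using m(1) by (intro mult_left_mono member_le_sum) auto
  finally show ?thesis .
qed

lemma ennreal_absorb_half:
  assumes "A \<le> X + ennreal (1 / 2) * A" "A < top"
  shows "A \<le> 2 * (X :: ennreal)"
proof (cases X)
  case (real x)
  obtain a where a: "A = ennreal a" "a \<ge> 0" using assms(2) by (cases A) auto
  have "ennreal a \<le> ennreal (x + 1 / 2 * a)"
  proof -
    have "ennreal (x + 1 / 2 * a) = ennreal x + ennreal (1 / 2 * a)" using real a by (intro ennreal_plus) auto
    moreover have "ennreal (1 / 2 * a) = ennreal (1 / 2) * ennreal a" using a by (intro ennreal_mult) auto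
    ultimately show ?thesis using assms(1) unfolding real a(1) by (simp only:)
  qed
  then have "a \<le> x + 1 / 2 * a" using real a by (subst (asm) ennreal_le_iff) auto
  then have "a \<le> 2 * x" by simp
  then have "ennreal a \<le> ennreal (2 * x)" by (rule ennreal_leI)
  then show ?thesis using a real by (simp add: ennreal_mult)
qed (simp add: ennreal_mult_top)

definition nnconv :: "(real => ennreal) => (real => ennreal) => real => ennreal"
  where "nnconv \<kappa> f t = (\<integral>s. \<kappa> (t - s) * f s)"

lemma nnconv_measurable [measurable (raw)]:
  assumes [measurable]: "\<kappa> \<in> borel_measurable borel" "f \<in> borel_measurable borel"
  shows "nnconv \<kappa> f \<in> borel_measurable borel" unfolding nnconv_def[abs_def] by measurable

text \<open>Cauchy--Schwarz for the measure with density \<open>\<kappa> (t - s)\<close>.\<close>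

lemma nnconv_mult_square_le:
  assumes [measurable]: "\<kappa> \<in> borel_measurable borel" "g \<in> borel_measurable borel" "h \<in> borel_measurable borel"
  shows "(nnconv \<kappa> (\<lambda>s. g s * h s) t)\<^sup>2 \<le> nnconv \<kappa> (\<lambda>s. (g s)\<^sup>2) t * nnconv \<kappa> (\<lambda>s. (h s)\<^sup>2) t"
proof -
  define M where "M = density lborel (\<lambda>s. \<kappa> (t - s))"
  have "(\<integral>\<^sup>+s. g s * h s \<partial>M)\<^sup>2 \<le> (\<integral>\<^sup>+s. (g s)\<^sup>2 \<partial>M) * (\<integral>\<^sup>+s. (h s)\<^sup>2 \<partial>M)"
    unfolding M_def by (intro Cauchy_Schwarz_nn_integral) auto
  then show ?thesis unfolding M_def nnconv_def by (simp add: nn_integral_density)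
qed

lemma nnconv_one: "\<kappa> \<in> borel_measurable borel ==> nnconv \<kappa> (\<lambda>_. 1) t = (\<integral>s. \<kappa> s)"
  using nn_integral_real_affine[of \<kappa> "-1" t] by (simp add: nnconv_def)

lemma nnconv_adjoint:
  assumes [measurable]: "\<kappa> \<in> borel_measurable borel" "f \<in> borel_measurable borel" "g \<in> borel_measurable borel"
  shows "(\<integral>t. nnconv \<kappa> f t * g t) = (\<integral>s. f s * nnconv (\<lambda>x. \<kappa> (- x)) g s)"
proof -
  have "(\<integral>t. nnconv \<kappa> f t * g t) = (\<integral>t. (\<integral>s. \<kappa> (t - s) * f s * g t))"
    unfolding nnconv_def by (intro nn_integral_cong, subst nn_integral_multc) auto
  also have "... = (\<integral>s. (\<integral>t. \<kappa> (t - s) * f s * g t))" by (intro lborel_pair.Fubini') measurable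
  also have "... = (\<integral>s. f s * nnconv (\<lambda>x. \<kappa> (- x)) g s)"
    unfolding nnconv_def by (intro nn_integral_cong, subst nn_integral_cmult[symmetric]) (auto simp: mult_ac)
  finally show ?thesis .
qed

text \<open>Mass and domination are uniform in \<open>n\<close>. The bound for the reflected kernels
  is part of the locale because duality moves each convolution to its adjoint.\<close>

locale maximal_kernels =
  fixes \<kappa> :: "nat => real => ennreal" and C :: real
  assumes \<kappa>_measurable [measurable]: "\<And>n. \<kappa> n \<in> borel_measurable borel"
    and C: "C > 0"
    and mass: "\<And>n. (\<integral>s. \<kappa> n s) \<le> ennreal C"
    and dominated: "\<And>n \<phi> t. \<phi> \<in> borel_measurable borel ==> nnconv (\<kappa> n) \<phi> t \<le> ennreal C * maximal \<phi> t"
    and dominated_reflected: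
      "\<And>n \<phi> t. \<phi> \<in> borel_measurable borel ==> nnconv (\<lambda>x. \<kappa> n (- x)) \<phi> t \<le> ennreal C * maximal \<phi> t"
begin

lemma nnconv_square_le:
  assumes [measurable]: "f \<in> borel_measurable borel"
  shows "(nnconv (\<kappa> n) f t)\<^sup>2 \<le> ennreal C * nnconv (\<kappa> n) (\<lambda>s. (f s)\<^sup>2) t"
proof -
  have "(nnconv (\<kappa> n) f t)\<^sup>2 \<le> (\<integral>s. \<kappa> n s) * nnconv (\<kappa> n) (\<lambda>s. (f s)\<^sup>2) t"
    using nnconv_mult_square_le[of "\<kappa> n" "\<lambda>_. 1" f t] by (simp add: nnconv_one)
  also have "... \<le> ennreal C * nnconv (\<kappa> n) (\<lambda>s. (f s)\<^sup>2) t" by (intro mult_right_mono mass) auto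
  finally show ?thesis .
qed

lemma nn_integral_nnconv_le:
  assumes [measurable]: "f \<in> borel_measurable borel"
  shows "(\<integral>t. nnconv (\<kappa> n) f t) \<le> ennreal C * (\<integral>t. f t)"
proof -
  have "(\<integral>t. nnconv (\<kappa> n) f t) = (\<integral>s. f s * nnconv (\<lambda>x. \<kappa> n (- x)) (\<lambda>_. 1) s)"
    using nnconv_adjoint[of "\<kappa> n" f "\<lambda>_. 1"] by simp
  also have "... = (\<integral>s. f s * (\<integral>x. \<kappa> n x))" using nn_integral_real_affine[of "\<kappa> n" "-1" 0] by (simp add: nnconv_one)
  also have "... \<le> (\<integral>s. f s * ennreal C)" by (intro nn_integral_mono mult_left_mono mass) auto
  also have "... = ennreal C * (\<integral>t. f t)" by (subst nn_integral_multc) (auto simp: mult.commute)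
  finally show ?thesis .
qed

text \<open>Qualitative finiteness, by the scalar maximal theorem in each coordinate. It makes
  absorption in \<open>square_function_bound_gt2\<close> legitimate; the bound obtained on the way
  depends on \<open>N\<close> and is discarded.\<close>

lemma nnconv_sum_finite:
  assumes p: "p > 1" and f [measurable]: "\<And>n. f n \<in> borel_measurable borel" and nn: "\<And>n s. 0 \<le> f n s"
    and fin: "(\<integral>t. ennreal ((\<Sum>n<N. (f n t)\<^sup>2) powr (p / 2))) < top"
  shows "(\<integral>t. epow (\<Sum>n<N. (nnconv (\<kappa> n) (\<lambda>s. ennreal (f n s)) t)\<^sup>2) (p / 2)) < top"
proof -
  define S where "S = 10 * p * 2 powr (p - 1) / (p - 1)"
  have one: "(\<integral>t. epow (nnconv (\<kappa> n) (\<lambda>s. ennreal (f n s)) t) p) < top" if n: "n < N" for n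
  proof -
    have "epow (nnconv (\<kappa> n) (\<lambda>s. ennreal (f n s)) t) p \<le>
      ennreal (C powr p) * epow (maximal (\<lambda>s. ennreal (f n s)) t) p" for t
    proof -
      have "epow (nnconv (\<kappa> n) (\<lambda>s. ennreal (f n s)) t) p \<le> epow (ennreal C * maximal (\<lambda>s. ennreal (f n s)) t) p"
        using p by (intro epow_mono dominated) auto
      also have "... = ennreal (C powr p) * epow (maximal (\<lambda>s. ennreal (f n s)) t) p"
      proof (cases "maximal (\<lambda>s. ennreal (f n s)) t")
        case (real r)
        then show ?thesis using C by (simp add: powr_mult flip: ennreal_mult)
      next
        case top
        then show ?thesis using C by (simp add: ennreal_mult_top)
      qed
      finally show ?thesis .
    qed
    then have "(\<integral>t. epow (nnconv (\<kappa> n) (\<lambda>s. ennreal (f n s)) t) p) \<le>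
      (\<integral>t. ennreal (C powr p) * epow (maximal (\<lambda>s. ennreal (f n s)) t) p)" by (intro nn_integral_mono)
    also have "... = ennreal (C powr p) * (\<integral>t. epow (maximal (\<lambda>s. ennreal (f n s)) t) p)" by (intro nn_integral_cmult) measurable
    also have "... \<le> ennreal (C powr p) * (ennreal S * (\<integral>t. ennreal (f n t powr p)))" unfolding S_def by (intro mult_left_mono maximal_strong_type p nn) auto
    also have "... \<le> ennreal (C powr p) * (ennreal S * (\<integral>t. ennreal ((\<Sum>n<N. (f n t)\<^sup>2) powr (p / 2))))"
    proof (intro mult_left_mono nn_integral_mono ennreal_leI)
      fix t
      have "f n t powr p = ((f n t)\<^sup>2) powr (p / 2)" using nn by (simp add: power2_powr_half)
      also have "... \<le> (\<Sum>n<N. (f n t)\<^sup>2) powr (p / 2)" using n p by (intro powr_mono2 member_le_sum) auto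
      finally show "f n t powr p \<le> (\<Sum>n<N. (f n t)\<^sup>2) powr (p / 2)" .
    qed auto
    also have "... < top" using fin by (simp add: ennreal_mult_less_top)
    finally show ?thesis .
  qed
  have "(\<integral>t. epow (\<Sum>n<N. (nnconv (\<kappa> n) (\<lambda>s. ennreal (f n s)) t)\<^sup>2) (p / 2)) \<le>
    (\<integral>t. ennreal (real N powr (p / 2)) * (\<Sum>n<N. epow (nnconv (\<kappa> n) (\<lambda>s. ennreal (f n s)) t) p))"
    using p by (intro nn_integral_mono epow_sum_squares_le) auto
  also have "... = ennreal (real N powr (p / 2)) * (\<Sum>n<N. (\<integral>t. epow (nnconv (\<kappa> n) (\<lambda>s. ennreal (f n s)) t) p))"
    by (subst nn_integral_cmult, measurable, subst nn_integral_sum) auto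
  also have "... < top" using one by (auto simp: ennreal_mult_less_top)
  finally show ?thesis .
qed

text \<open>Duality: Jensen's inequality moves the square inside the convolution, and the adjoint
  then moves the kernel onto the weight, where a maximal function dominates it uniformly in
  \<open>n\<close>.\<close>

lemma weighted_square_bound:
  assumes f [measurable]: "\<And>n. f n \<in> borel_measurable borel"
    and [measurable]: "\<phi> \<in> borel_measurable borel"
  shows "(\<integral>t. (\<Sum>n<N. (nnconv (\<kappa> n) (f n) t)\<^sup>2) * \<phi> t) \<le>
    ennreal C * (\<Sum>n<N. (\<integral>s. (f n s)\<^sup>2 * nnconv (\<lambda>x. \<kappa> n (- x)) \<phi> s))"
proof -
  have "(\<integral>t. (\<Sum>n<N. (nnconv (\<kappa> n) (f n) t)\<^sup>2) * \<phi> t) =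
    (\<Sum>n<N. (\<integral>t. (nnconv (\<kappa> n) (f n) t)\<^sup>2 * \<phi> t))" by (subst nn_integral_sum[symmetric]) (auto simp: sum_distrib_right)
  also have "... \<le> (\<Sum>n<N. (\<integral>t. ennreal C * (nnconv (\<kappa> n) (\<lambda>s. (f n s)\<^sup>2) t * \<phi> t)))"
  proof (intro sum_mono nn_integral_mono)
    fix n t
    have "(nnconv (\<kappa> n) (f n) t)\<^sup>2 \<le> ennreal C * nnconv (\<kappa> n) (\<lambda>s. (f n s)\<^sup>2) t" by (rule nnconv_square_le) auto
    then show "(nnconv (\<kappa> n) (f n) t)\<^sup>2 * \<phi> t \<le> ennreal C * (nnconv (\<kappa> n) (\<lambda>s. (f n s)\<^sup>2) t * \<phi> t)"
      by (simp flip: mult.assoc add: mult_right_mono)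
  qed
  also have "... = (\<Sum>n<N. ennreal C * (\<integral>s. (f n s)\<^sup>2 * nnconv (\<lambda>x. \<kappa> n (- x)) \<phi> s))"
    by (intro sum.cong refl, subst nn_integral_cmult, measurable, subst nnconv_adjoint) auto
  also have "... = ennreal C * (\<Sum>n<N. (\<integral>s. (f n s)\<^sup>2 * nnconv (\<lambda>x. \<kappa> n (- x)) \<phi> s))" by (simp add: sum_distrib_left)
  finally show ?thesis .
qed

text \<open>The square function \<open>W\<close> is tested against its own power, the extremal
  weight for the duality between p/2 and \<open>q\<close>. The maximal theorem for the weight
  returns the integral of W powr (p/2) with a small factor, and this term is absorbed.\<close>

lemma square_function_bound_gt2:
  assumes p: "p > 2"
  shows "\<exists>K\<ge>0. \<forall>N f. (\<forall>n. f n \<in> borel_measurable borel) --> (\<forall>n s. 0 \<le> f n s) -->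
    (\<integral>t. epow (\<Sum>n<N. (nnconv (\<kappa> n) (\<lambda>s. ennreal (f n s)) t)\<^sup>2) (p / 2)) \<le>
    ennreal K * (\<integral>t. ennreal ((\<Sum>n<N. (f n t)\<^sup>2) powr (p / 2)))"
proof -
  define q where "q = p / (p - 2)"
  define S where "S = 10 * q * 2 powr (q - 1) / (q - 1)"
  \<comment> \<open>Chosen so that the term returned after the factors \<open>C\<^sup>2\<close> and
    \<open>S\<close> is exactly one half of the left-hand side.\<close>
  define \<epsilon> where "\<epsilon> = 1 / (2 * C\<^sup>2 * S)"
  have q: "q > 1" using p by (simp add: q_def field_simps)
  have conj: "1 / (p / 2) + 1 / q = 1" using p by (simp add: q_def field_simps)
  have S: "S > 0" using q by (simp add: S_def)
  have \<epsilon>: "\<epsilon> > 0" using S C by (simp add: \<epsilon>_def)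
  obtain K0 where K0: "K0 \<ge> 0" "\<And>a b. a \<ge> 0 ==> ennreal a * b \<le> ennreal (K0 * a powr (p / 2)) + ennreal \<epsilon> * epow b q"
    using Youngs_inequality_eps[OF _ q conj \<epsilon>] p by auto
  define K where "K = K0 + 1"
  have K: "K > 0" "\<And>a b. a \<ge> 0 ==> ennreal a * b \<le> ennreal (K * a powr (p / 2)) + ennreal \<epsilon> * epow b q"
    using K0 by (auto simp: K_def intro!: order_trans[OF K0(2)] add_right_mono ennreal_leI mult_right_mono)
  show ?thesis
  proof (intro exI[of _ "2 * (C\<^sup>2 * K)"] conjI allI impI)
    show "0 \<le> 2 * (C\<^sup>2 * K)" using K by simp
    fix N :: nat and f :: "nat => real => real"
    assume "\<forall>n. f n \<in> borel_measurable borel" and "\<forall>n s. 0 \<le> f n s"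
    then have f [measurable]: "\<And>n. f n \<in> borel_measurable borel" and nn: "\<And>n s. 0 \<le> f n s" by auto
    define W where "W t = (\<Sum>n<N. (nnconv (\<kappa> n) (\<lambda>s. ennreal (f n s)) t)\<^sup>2)" for t
    define F where "F t = (\<Sum>n<N. (f n t)\<^sup>2)" for t
    define A where "A = (\<integral>t. epow (W t) (p / 2))"
    define X where "X = (\<integral>t. ennreal (F t powr (p / 2)))"
    have F0: "F t \<ge> 0" for t by (simp add: F_def sum_nonneg)
    have [measurable]: "W \<in> borel_measurable borel" "F \<in> borel_measurable borel" unfolding W_def F_def by measurable
    have "A \<le> ennreal (2 * (C\<^sup>2 * K)) * X"
    proof (cases "X = top")
      case True
      then show ?thesis using C K by (simp add: ennreal_mult_top)
    next
      case False
      then have "X < top" by (simp add: less_top)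
      then have Afin: "A < top" unfolding A_def X_def W_def F_def using p nn by (intro nnconv_sum_finite) auto
      have W_fin: "AE t in lborel. W t \<noteq> top"
      proof -
        have "AE t in lborel. epow (W t) (p / 2) \<noteq> \<infinity>" using Afin unfolding A_def by (intro nn_integral_noteq_infinite) auto
        then show ?thesis by eventually_elim auto
      qed
      \<comment> \<open>With this weight both W \<phi> and \<phi> powr q equal W powr (p/2).\<close>
      define \<phi> where "\<phi> t = enn2real (W t) powr (p / 2 - 1)" for t
      have [measurable]: "\<phi> \<in> borel_measurable borel" unfolding \<phi>_def by measurable
      have "A = (\<integral>t. W t * ennreal (\<phi> t))" unfolding A_def
      proof (rule nn_integral_cong_AE)
        show "AE t in lborel. epow (W t) (p / 2) = W t * ennreal (\<phi> t)" using W_fin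
        proof eventually_elim
          case (elim t)
          then obtain w where w: "W t = ennreal w" "w \<ge> 0" by (cases "W t") auto
          have "w powr (p / 2) = w * w powr (p / 2 - 1)" using w p by (cases "w = 0") (auto simp: powr_diff)
          then show ?case using w by (simp add: \<phi>_def ennreal_mult)
        qed
      qed
      also have "... \<le> ennreal C * (\<Sum>n<N. (\<integral>s. (ennreal (f n s))\<^sup>2 * nnconv (\<lambda>x. \<kappa> n (- x)) (\<lambda>s. ennreal (\<phi> s)) s))"
        unfolding W_def by (rule weighted_square_bound) measurable
      also have "... \<le> ennreal C * (\<Sum>n<N. (\<integral>s. (ennreal (f n s))\<^sup>2 * (ennreal C * maximal (\<lambda>s. ennreal (\<phi> s)) s)))"
        by (intro mult_left_mono sum_mono nn_integral_mono dominated_reflected) auto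
      also have "... = ennreal C * (\<integral>s. ennreal C * (ennreal (F s) * maximal (\<lambda>s. ennreal (\<phi> s)) s))"
      proof -
        have "ennreal (F s) = (\<Sum>n<N. (ennreal (f n s))\<^sup>2)" for s unfolding F_def using nn by (subst sum_ennreal[symmetric]) (auto simp: ennreal_power)
        then show ?thesis by (subst nn_integral_sum[symmetric]) (auto simp: sum_distrib_right sum_distrib_left mult_ac)
      qed
      also have "... = ennreal (C\<^sup>2) * (\<integral>s. ennreal (F s) * maximal (\<lambda>s. ennreal (\<phi> s)) s)"
        using C by (subst nn_integral_cmult) (auto simp: power2_eq_square ennreal_mult mult.assoc)
      also have "... \<le> ennreal (C\<^sup>2) * (\<integral>s. ennreal (K * F s powr (p / 2)) + ennreal \<epsilon> * epow (maximal (\<lambda>s. ennreal (\<phi> s)) s) q)"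
        by (intro mult_left_mono nn_integral_mono K F0) auto
      also have "(\<integral>s. ennreal (K * F s powr (p / 2)) + ennreal \<epsilon> * epow (maximal (\<lambda>s. ennreal (\<phi> s)) s) q) =
        ennreal K * X + ennreal \<epsilon> * (\<integral>s. epow (maximal (\<lambda>s. ennreal (\<phi> s)) s) q)"
        using K unfolding X_def by (subst nn_integral_add) (auto simp: ennreal_mult nn_integral_cmult)
      also have "ennreal (C\<^sup>2) * (ennreal K * X + ennreal \<epsilon> * (\<integral>s. epow (maximal (\<lambda>s. ennreal (\<phi> s)) s) q)) \<le>
        ennreal (C\<^sup>2) * (ennreal K * X + ennreal \<epsilon> * (ennreal S * (\<integral>s. ennreal (\<phi> s powr q))))"
        unfolding S_def by (intro mult_left_mono add_mono maximal_strong_type q) (auto simp: \<phi>_def)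
      also have "(\<integral>s. ennreal (\<phi> s powr q)) = A" unfolding A_def
      proof (rule nn_integral_cong_AE)
        have "(p / 2 - 1) * q = p / 2" using p by (simp add: q_def field_simps)
        then have "\<phi> t powr q = enn2real (W t) powr (p / 2)" for t unfolding \<phi>_def powr_powr by (simp only:)
        then show "AE t in lborel. ennreal (\<phi> t powr q) = epow (W t) (p / 2)" using W_fin by (auto simp: epow_def)
      qed
      also have "ennreal (C\<^sup>2) * (ennreal K * X + ennreal \<epsilon> * (ennreal S * A)) = ennreal (C\<^sup>2 * K) * X + ennreal (1 / 2) * A"
      proof -
        have "C\<^sup>2 * (\<epsilon> * S) = 1 / 2" using C S by (simp add: \<epsilon>_def)
        then have "ennreal (C\<^sup>2) * (ennreal \<epsilon> * ennreal S) = ennreal (1 / 2)"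
          using ennreal_mult[of "C\<^sup>2" "\<epsilon> * S"] ennreal_mult[of \<epsilon> S] \<epsilon> S by (simp only:) auto
        then show ?thesis using K by (simp add: distrib_left ennreal_mult mult.assoc[symmetric])
      qed
      finally have "A \<le> 2 * (ennreal (C\<^sup>2 * K) * X)" using Afin by (rule ennreal_absorb_half)
      then show ?thesis using K by (simp add: ennreal_mult mult.assoc)
    qed
    then show "(\<integral>t. epow (\<Sum>n<N. (nnconv (\<kappa> n) (\<lambda>s. ennreal (f n s)) t)\<^sup>2) (p / 2)) \<le>
      ennreal (2 * (C\<^sup>2 * K)) * (\<integral>t. ennreal ((\<Sum>n<N. (f n t)\<^sup>2) powr (p / 2)))" unfolding A_def X_def W_def F_def .
  qed
qed

lemma square_function_bound_2:
  assumes f [measurable]: "\<And>n. f n \<in> borel_measurable borel" and nn: "\<And>n s. 0 \<le> f n s"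
  shows "(\<integral>t. epow (\<Sum>n<N. (nnconv (\<kappa> n) (\<lambda>s. ennreal (f n s)) t)\<^sup>2) (2 / 2)) \<le>
    ennreal (C\<^sup>2) * (\<integral>t. ennreal ((\<Sum>n<N. (f n t)\<^sup>2) powr (2 / 2)))"
proof -
  have epow1: "epow x 1 = x" for x by (cases x) auto
  have "(\<integral>t. (\<Sum>n<N. (nnconv (\<kappa> n) (\<lambda>s. ennreal (f n s)) t)\<^sup>2)) \<le>
    (\<integral>t. (\<Sum>n<N. ennreal C * nnconv (\<kappa> n) (\<lambda>s. (ennreal (f n s))\<^sup>2) t))" by (intro nn_integral_mono sum_mono nnconv_square_le) measurable
  also have "... = ennreal C * (\<Sum>n<N. (\<integral>t. nnconv (\<kappa> n) (\<lambda>s. (ennreal (f n s))\<^sup>2) t))"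
    by (subst nn_integral_sum) (auto simp: nn_integral_cmult sum_distrib_left)
  also have "... \<le> ennreal C * (\<Sum>n<N. ennreal C * (\<integral>t. (ennreal (f n t))\<^sup>2))" by (intro mult_left_mono sum_mono nn_integral_nnconv_le) auto
  also have "... = ennreal (C\<^sup>2) * (\<integral>t. (\<Sum>n<N. (ennreal (f n t))\<^sup>2))"
    using C by (subst nn_integral_sum) (auto simp: sum_distrib_left power2_eq_square ennreal_mult mult.assoc)
  also have "(\<lambda>t. \<Sum>n<N. (ennreal (f n t))\<^sup>2) = (\<lambda>t. ennreal (\<Sum>n<N. (f n t)\<^sup>2))"
    using nn by (subst sum_ennreal[symmetric]) (auto simp: ennreal_power)
  finally show ?thesis by (simp add: epow1 sum_nonneg)
qed

text \<open>For \<open>p < 2\<close> the weight \<open>w = F powr (1 - p / 2)\<close>, where \<open>F\<close> is the square function of \<open>f\<close>, is inserted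
  into the Cauchy--Schwarz inequality; then \<open>w powr (p / (2 - p))\<close> and \<open>F / w\<close> both equal \<open>F powr (p / 2)\<close>.\<close>

lemma square_function_bound_lt2:
  assumes p: "1 < p" "p < 2"
  shows "\<exists>K\<ge>0. \<forall>N f. (\<forall>n. f n \<in> borel_measurable borel) --> (\<forall>n s. 0 \<le> f n s) -->
    (\<integral>t. epow (\<Sum>n<N. (nnconv (\<kappa> n) (\<lambda>s. ennreal (f n s)) t)\<^sup>2) (p / 2)) \<le>
    ennreal K * (\<integral>t. ennreal ((\<Sum>n<N. (f n t)\<^sup>2) powr (p / 2)))"
proof -
  define r where "r = p / (2 - p)"
  define S where "S = 10 * r * 2 powr (r - 1) / (r - 1)"
  have r: "r > 1" using p by (simp add: r_def field_simps)
  have S: "S \<ge> 0" using r by (simp add: S_def)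
  \<comment> \<open>Young's inequality without optimal constants: the larger one of a powr r and
    \<open>b\<close> dominates, since (1 / r + 1) (p / 2) = 1.\<close>
  have young: "epow (ennreal C * a * b) (p / 2) \<le> ennreal (C powr (p / 2)) * (epow a r + b)" for a b
  proof (cases "a = top \<or> b = top")
    case True
    then show ?thesis using C by (auto simp: ennreal_mult_top)
  next
    case False
    then obtain x y where xy: "a = ennreal x" "b = ennreal y" "x \<ge> 0" "y \<ge> 0" by (metis ennreal_cases)
    have "(x * y) powr (p / 2) \<le> x powr r + y"
    proof (cases "x powr r \<le> y")
      case True
      have "(1 / r + 1) * (p / 2) = 1" using p by (simp add: r_def field_simps)
      moreover have "x \<le> y powr (1 / r)" using powr_mono2[OF _ _ True, of "1 / r"] xy r by (simp add: powr_powr)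
      then have "(x * y) powr (p / 2) \<le> (y powr (1 / r) * y) powr (p / 2)" using xy p by (intro powr_mono2 mult_right_mono) auto
      moreover have "y powr (1 / r) * y = y powr (1 / r + 1)" using xy by (cases "y = 0") (auto simp: powr_add)
      ultimately have "(x * y) powr (p / 2) \<le> y" using xy by (simp add: powr_powr)
      then show ?thesis using powr_ge_zero[of x r] by linarith
    next
      case False
      have "(r + 1) * (p / 2) = r" using p by (simp add: r_def field_simps)
      moreover have "(x * y) powr (p / 2) \<le> (x powr r * x) powr (p / 2)" using xy p False by (subst mult.commute, intro powr_mono2 mult_right_mono) auto
      moreover have "x powr r * x = x powr (r + 1)" using xy by (cases "x = 0") (auto simp: powr_add)
      ultimately show ?thesis using xy by (simp add: powr_powr)
    qed
    then have "C powr (p / 2) * (x * y) powr (p / 2) \<le> C powr (p / 2) * (x powr r + y)" by (rule mult_left_mono) simp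
    then show ?thesis using xy C by (simp add: powr_mult mult.assoc ennreal_leI flip: ennreal_mult ennreal_plus)
  qed
  show ?thesis
  proof (intro exI[of _ "C powr (p / 2) * (S + C)"] conjI allI impI)
    show "0 \<le> C powr (p / 2) * (S + C)" using S C by simp
    fix N :: nat and f :: "nat => real => real"
    assume "\<forall>n. f n \<in> borel_measurable borel" and "\<forall>n s. 0 \<le> f n s"
    then have f [measurable]: "\<And>n. f n \<in> borel_measurable borel" and nn: "\<And>n s. 0 \<le> f n s" by auto
    define F where "F t = (\<Sum>n<N. (f n t)\<^sup>2)" for t
    define w where "w t = F t powr (1 - p / 2)" for t
    define X where "X = (\<integral>t. ennreal (F t powr (p / 2)))"
    define M where "M = maximal (\<lambda>s. ennreal (w s))"
    define B where "B n = nnconv (\<kappa> n) (\<lambda>s. ennreal ((f n s)\<^sup>2 / w s))" for n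
    have [measurable]: "F \<in> borel_measurable borel" unfolding F_def by measurable
    have [measurable]: "w \<in> borel_measurable borel" unfolding w_def by measurable
    have [measurable]: "M \<in> borel_measurable borel" "B n \<in> borel_measurable borel" for n unfolding M_def B_def by measurable
    have F0: "F t \<ge> 0" and fF: "n < N ==> (f n t)\<^sup>2 \<le> F t" for n t unfolding F_def by (auto simp: sum_nonneg intro!: member_le_sum)
    have sq: "(nnconv (\<kappa> n) (\<lambda>s. ennreal (f n s)) t)\<^sup>2 \<le> ennreal C * M t * B n t" if n: "n < N" for n t
    proof -
      \<comment> \<open>Where \<open>F\<close> vanishes so does every \<open>f n\<close> with n < N;
        there the division by zero in the second factor yields 0 and the factorization
        persists.\<close>
      have "ennreal (f n s) = ennreal (sqrt (w s)) * ennreal (f n s / sqrt (w s))" for s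
      proof (cases "F s = 0")
        case True
        then show ?thesis using fF[OF n, of s] by (simp add: w_def)
      qed (use nn in \<open>simp add: w_def flip: ennreal_mult'\<close>)
      then have "(nnconv (\<kappa> n) (\<lambda>s. ennreal (f n s)) t)\<^sup>2 \<le>
        nnconv (\<kappa> n) (\<lambda>s. (ennreal (sqrt (w s)))\<^sup>2) t * nnconv (\<kappa> n) (\<lambda>s. (ennreal (f n s / sqrt (w s)))\<^sup>2) t"
        using nnconv_mult_square_le[of "\<kappa> n" "\<lambda>s. ennreal (sqrt (w s))" "\<lambda>s. ennreal (f n s / sqrt (w s))" t] by simp
      also have "... = nnconv (\<kappa> n) (\<lambda>s. ennreal (w s)) t * B n t" using nn by (simp add: ennreal_power power_divide w_def B_def)
      also have "... \<le> ennreal C * M t * B n t" unfolding M_def by (intro mult_right_mono dominated) auto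
      finally show ?thesis .
    qed
    have "(\<integral>t. epow (\<Sum>n<N. (nnconv (\<kappa> n) (\<lambda>s. ennreal (f n s)) t)\<^sup>2) (p / 2)) \<le>
      (\<integral>t. ennreal (C powr (p / 2)) * (epow (M t) r + (\<Sum>n<N. B n t)))"
    proof (rule nn_integral_mono, rule order_trans[OF epow_mono young])
      fix t
      show "(\<Sum>n<N. (nnconv (\<kappa> n) (\<lambda>s. ennreal (f n s)) t)\<^sup>2) \<le> ennreal C * M t * (\<Sum>n<N. B n t)"
        unfolding sum_distrib_left by (intro sum_mono sq) auto
    qed (use p in simp)
    also have "... = ennreal (C powr (p / 2)) * ((\<integral>t. epow (M t) r) + (\<Sum>n<N. (\<integral>t. B n t)))"
      by (simp add: nn_integral_cmult nn_integral_add nn_integral_sum)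
    also have "... \<le> ennreal (C powr (p / 2)) * (ennreal S * X + ennreal C * X)"
    proof (intro mult_left_mono add_mono)
      have "(1 - p / 2) * r = p / 2" using p by (simp add: r_def field_simps)
      then have "w t powr r = F t powr (p / 2)" for t unfolding w_def powr_powr by (simp only:)
      then show "(\<integral>t. epow (M t) r) \<le> ennreal S * X" using maximal_strong_type[of w r] r unfolding M_def S_def X_def by (simp add: w_def)
      have "(\<Sum>n<N. (\<integral>t. B n t)) \<le> (\<Sum>n<N. ennreal C * (\<integral>t. ennreal ((f n t)\<^sup>2 / w t)))"
        unfolding B_def by (intro sum_mono nn_integral_nnconv_le) measurable
      also have "... = ennreal C * (\<integral>t. (\<Sum>n<N. ennreal ((f n t)\<^sup>2 / w t)))" by (simp add: sum_distrib_left nn_integral_sum)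
      also have "(\<lambda>t. \<Sum>n<N. ennreal ((f n t)\<^sup>2 / w t)) = (\<lambda>t. ennreal (F t powr (p / 2)))"
      proof
        fix t
        have "(\<Sum>n<N. ennreal ((f n t)\<^sup>2 / w t)) = ennreal (F t / w t)" unfolding F_def sum_divide_distrib by (rule sum_ennreal) (simp add: w_def)
        also have "F t / w t = F t powr (p / 2)" using F0[of t] by (cases "F t = 0") (auto simp: w_def powr_diff)
        finally show "(\<Sum>n<N. ennreal ((f n t)\<^sup>2 / w t)) = ennreal (F t powr (p / 2))" .
      qed
      finally show "(\<Sum>n<N. (\<integral>t. B n t)) \<le> ennreal C * X" by (simp add: X_def)
    qed auto
    also have "... = ennreal (C powr (p / 2) * (S + C)) * X" using S C by (simp add: ennreal_mult distrib_right mult.assoc)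
    finally show "(\<integral>t. epow (\<Sum>n<N. (nnconv (\<kappa> n) (\<lambda>s. ennreal (f n s)) t)\<^sup>2) (p / 2)) \<le>
      ennreal (C powr (p / 2) * (S + C)) * (\<integral>t. ennreal ((\<Sum>n<N. (f n t)\<^sup>2) powr (p / 2)))" by (simp add: X_def F_def)
  qed
qed

lemma square_function_bound:
  assumes "p > 1"
  shows "\<exists>K\<ge>0. \<forall>N f. (\<forall>n. f n \<in> borel_measurable borel) --> (\<forall>n s. 0 \<le> f n s) -->
    (\<integral>t. epow (\<Sum>n<N. (nnconv (\<kappa> n) (\<lambda>s. ennreal (f n s)) t)\<^sup>2) (p / 2)) \<le>
    ennreal K * (\<integral>t. ennreal ((\<Sum>n<N. (f n t)\<^sup>2) powr (p / 2)))"
proof -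
  consider "p < 2" | "p = 2" | "p > 2" by linarith
  then show ?thesis
  proof cases
    case 2
    then show ?thesis using square_function_bound_2 by (intro exI[of _ "C\<^sup>2"]) auto
  qed (use assms square_function_bound_lt2 square_function_bound_gt2 in auto)
qed

end

section \<open>Convolutions and Laplace transforms\<close>

text \<open>Half-lines are closed under intersection and generate the Borel sets, so the integral of
  \<open>g\<close> vanishes over all of them by Dynkin's argument.\<close>

lemma AE_zero_if_initial_integrals_zero:
  fixes g :: "real => 'b::{banach, second_countable_topology}"
  assumes g: "integrable lborel g" and zero: "\<And>a. (LINT t|lborel. indicator {..a} t *\<^sub>R g t) = 0"
  shows "AE t in lborel. g t = 0"
proof (rule sigma_finite_measure.density_zero[OF lborel.sigma_finite_measure_axioms g])
  have [measurable]: "g \<in> borel_measurable borel" using g by auto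
  have int: "integrable lborel (\<lambda>t. indicator A t *\<^sub>R g t)" if "A \<in> sets borel" for A using that g by (intro integrable_mult_indicator) auto
  \<comment> \<open>Needed for complements: the integral over the whole line is the limit of those
    over half-lines.\<close>
  have total: "(LINT t|lborel. g t) = 0"
  proof -
    have "((\<lambda>y. LINT x|lborel. indicator {.. y} x *\<^sub>R g x) \<longlongrightarrow> (LINT t|lborel. g t)) at_top" by (rule tendsto_integral_at_top) (use g in auto)
    then show ?thesis using zero tendsto_unique[of at_top "\<lambda>_. 0" 0] by (simp add: tendsto_const_iff)
  qed
  fix A :: "real set" assume "A \<in> sets lborel"
  then have A: "A \<in> sigma_sets UNIV (range (\<lambda>a::real. {..a}))" by (simp add: borel_eq_atMost sets_measure_of)
  have range_Pow: "range (\<lambda>a::real. {..a}) \<subseteq> Pow UNIV" by simp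
  have stable: "Int_stable (range (\<lambda>a::real. {..a}))" by (auto simp: Int_stable_def)
  have "(LINT t|lborel. indicator A t *\<^sub>R g t) = 0" using stable range_Pow A
  proof (induction rule: sigma_sets_induct_disjoint)
    case (basic A)
    then show ?case using zero by auto
  next
    case empty
    show ?case by simp
  next
    case (compl A)
    then have A: "A \<in> sets borel" by (simp add: borel_eq_atMost sets_measure_of)
    have "(LINT t|lborel. indicator (UNIV - A) t *\<^sub>R g t) = (LINT t|lborel. g t - indicator A t *\<^sub>R g t)"
      by (intro Bochner_Integration.integral_cong) (auto simp: indicator_def)
    also have "... = 0" using int[OF A] g total compl by simp
    finally show ?case .
  next
    case (union A)
    then have A: "range A \<subseteq> sets borel" by (simp add: borel_eq_atMost sets_measure_of)
    then have "set_integrable lborel (\<Union>i. A i) g" unfolding set_integrable_def by (intro int) auto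
    then have "(LINT t:(\<Union>i. A i)|lborel. g t) = (\<Sum>i. LINT t:A i|lborel. g t)"
      using A union(1) by (intro lebesgue_integral_countable_add) (auto simp: disjoint_family_on_def)
    then show ?case using union(3) by (simp add: set_lebesgue_integral_def)
  qed
  then show "set_lebesgue_integral lborel A g = 0" by (simp add: set_lebesgue_integral_def)
qed

section \<open>Convolution and injectivity of the Laplace transform\<close>

definition conv :: "(real => complex) => (real => complex) => real => complex"
  where "conv f g t = (LINT s|lborel. f (t - s) * g s)"

lemma conv_measurable [measurable (raw)]:
  assumes [measurable]: "f \<in> borel_measurable borel" "g \<in> borel_measurable borel"
  shows "conv f g \<in> borel_measurable borel" unfolding conv_def[abs_def] by measurable

lemma conv_integrable_pair:
  fixes f g :: "real => complex"
  assumes f: "integrable lborel f" and g: "integrable lborel g"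
  shows "integrable (lborel \<Otimes>\<^sub>M lborel) (\<lambda>(t, s). f (t - s) * g s)"
proof (rule integrableI_bounded)
  have [measurable]: "f \<in> borel_measurable borel" "g \<in> borel_measurable borel" using f g by auto
  show "(\<lambda>(t, s). f (t - s) * g s) \<in> borel_measurable (lborel \<Otimes>\<^sub>M lborel)" by measurable
  have "(\<integral>\<^sup>+z. ennreal (norm (case z of (t, s) => f (t - s) * g s)) \<partial>(lborel \<Otimes>\<^sub>M lborel)) =
    (\<integral>s. (\<integral>t. ennreal (norm (f (t - s) * g s))))" by (subst lborel_pair.nn_integral_snd[symmetric]) auto
  also have "... = (\<integral>s. (\<integral>t. ennreal (norm (f t))) * ennreal (norm (g s)))"
  proof (intro nn_integral_cong)
    fix s
    have "(\<integral>t. ennreal (norm (f (t - s) * g s))) =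
      (\<integral>t. ennreal (norm (f (t - s))) * ennreal (norm (g s)))" by (simp add: norm_mult ennreal_mult)
    also have "... = (\<integral>t. ennreal (norm (f (t - s)))) * ennreal (norm (g s))" by (rule nn_integral_multc) measurable
    also have "(\<integral>t. ennreal (norm (f (t - s)))) = (\<integral>t. ennreal (norm (f t)))"
      using nn_integral_real_affine[of "\<lambda>t. ennreal (norm (f t))" 1 "- s"] by simp
    finally show "(\<integral>t. ennreal (norm (f (t - s) * g s))) =
      (\<integral>t. ennreal (norm (f t))) * ennreal (norm (g s))" .
  qed
  also have "... = (\<integral>t. ennreal (norm (f t))) * (\<integral>s. ennreal (norm (g s)))" by (rule nn_integral_cmult) measurable
  also have "... < \<infinity>" using f g by (simp add: integrable_iff_bounded ennreal_mult_less_top)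
  finally show "(\<integral>\<^sup>+z. ennreal (norm (case z of (t, s) => f (t - s) * g s)) \<partial>(lborel \<Otimes>\<^sub>M lborel)) < \<infinity>" .
qed

lemma
  assumes f: "integrable lborel f" and g: "integrable lborel g"
  shows integrable_conv: "integrable lborel (conv f g)"
    and integral_conv: "(LINT t|lborel. conv f g t) = (LINT t|lborel. f t) * (LINT t|lborel. g t)"
    and AE_integrable_conv: "AE t in lborel. integrable lborel (\<lambda>s. f (t - s) * g s)"
proof -
  note I = conv_integrable_pair[OF f g]
  show "integrable lborel (conv f g)" using lborel_pair.integrable_fst[OF I] by (simp add: conv_def[abs_def])
  show "AE t in lborel. integrable lborel (\<lambda>s. f (t - s) * g s)" using lborel_pair.AE_integrable_fst[OF I] by simp
  have "(LINT t|lborel. conv f g t) = (LINT s|lborel. (LINT t|lborel. f (t - s) * g s))"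
    unfolding conv_def using lborel_pair.Fubini_integral[of "\<lambda>t s. f (t - s) * g s"] I by simp
  also have "... = (LINT s|lborel. (LINT t|lborel. f t) * g s)"
  proof (intro Bochner_Integration.integral_cong refl)
    fix s
    have "(LINT t|lborel. f (t - s) * g s) = (LINT t|lborel. f (t - s)) * g s" by simp
    also have "(LINT t|lborel. f (t - s)) = (LINT t|lborel. f t)" using lborel_integral_real_affine[of 1 f "- s"] by simp
    finally show "(LINT t|lborel. f (t - s) * g s) = (LINT t|lborel. f t) * g s" .
  qed
  also have "... = (LINT t|lborel. f t) * (LINT t|lborel. g t)" by simp
  finally show "(LINT t|lborel. conv f g t) = (LINT t|lborel. f t) * (LINT t|lborel. g t)" .
qed

text \<open>Vanishing for t \<le> 0 makes one exponential weight sufficient for all s \<ge> 1. The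
  class contains the fractional kernels, which are not integrable, and it is closed under
  convolution.\<close>

definition laplace_class :: "(real => complex) set"
  where "laplace_class = {f. f \<in> borel_measurable borel \<and> (\<forall>t\<le>0. f t = 0) \<and>
    integrable lborel (\<lambda>t. of_real (exp (- t)) * f t)}"

definition laplace :: "(real => complex) => real => complex"
  where "laplace f s = (LINT t|lborel. of_real (exp (- s * t)) * f t)"

lemma laplace_class_measurable: "f \<in> laplace_class ==> f \<in> borel_measurable borel" by (simp add: laplace_class_def)

lemma laplace_class_zero: "f \<in> laplace_class ==> t \<le> 0 ==> f t = 0" by (simp add: laplace_class_def)

lemma laplace_integrable:
  assumes "f \<in> laplace_class" "s \<ge> 1"
  shows "integrable lborel (\<lambda>t. of_real (exp (- s * t)) * f t)"
proof (rule Bochner_Integration.integrable_bound)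
  show "integrable lborel (\<lambda>t. of_real (exp (- t)) * f t)" using assms by (simp add: laplace_class_def)
  show "(\<lambda>t. of_real (exp (- s * t)) * f t) \<in> borel_measurable lborel" using laplace_class_measurable[OF assms(1)] by measurable
  show "AE t in lborel. norm (of_real (exp (- s * t)) * f t) \<le> norm (of_real (exp (- t)) * f t)"
  proof (rule AE_I2)
    fix t
    show "norm (of_real (exp (- s * t)) * f t) \<le> norm (of_real (exp (- t)) * f t)" using laplace_class_zero[OF assms(1), of t] assms(2)
      by (cases "t \<le> 0") (auto simp: norm_mult intro!: mult_right_mono)
  qed
qed

lemma laplace_classI:
  assumes "f \<in> borel_measurable borel" "\<And>t. t \<le> 0 ==> f t = 0" "integrable lborel f"
  shows "f \<in> laplace_class"
proof -
  have "integrable lborel (\<lambda>t. of_real (exp (- t)) * f t)" using assms(3)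
  proof (rule Bochner_Integration.integrable_bound)
    show "AE t in lborel. norm (of_real (exp (- t)) * f t) \<le> norm (f t)"
    proof (rule AE_I2)
      fix t
      show "norm (of_real (exp (- t)) * f t) \<le> norm (f t)" using assms(2)[of t] by (cases "t \<le> 0") (auto simp: norm_mult intro!: mult_left_le_one_le)
    qed
  qed (use assms in measurable)
  then show ?thesis using assms by (simp add: laplace_class_def)
qed

lemma laplace_class_add: "f \<in> laplace_class ==> g \<in> laplace_class ==> (\<lambda>t. f t + g t) \<in> laplace_class" by (auto simp: laplace_class_def distrib_left)

lemma laplace_class_cmult: "f \<in> laplace_class ==> (\<lambda>t. c * f t) \<in> laplace_class" by (auto simp: laplace_class_def mult.left_commute)

lemma laplace_class_diff: "f \<in> laplace_class ==> g \<in> laplace_class ==> (\<lambda>t. f t - g t) \<in> laplace_class" by (auto simp: laplace_class_def right_diff_distrib)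

lemma laplace_add: "f \<in> laplace_class ==> g \<in> laplace_class ==> s \<ge> 1 ==>
    laplace (\<lambda>t. f t + g t) s = laplace f s + laplace g s" using laplace_integrable[of f s] laplace_integrable[of g s] by (simp add: laplace_def distrib_left)

lemma laplace_diff: "f \<in> laplace_class ==> g \<in> laplace_class ==> s \<ge> 1 ==>
    laplace (\<lambda>t. f t - g t) s = laplace f s - laplace g s" using laplace_integrable[of f s] laplace_integrable[of g s] by (simp add: laplace_def right_diff_distrib)

lemma laplace_cmult: "laplace (\<lambda>t. c * f t) s = c * laplace f s" by (simp add: laplace_def mult.left_commute)

text \<open>The exponential weight is multiplicative along t = (t - r) + r, so weighted convolutions
  reduce to convolutions of integrable functions.\<close>

lemma exp_conv:
  "of_real (exp (- s * t)) * conv f g t = conv (\<lambda>t. of_real (exp (- s * t)) * f t) (\<lambda>t. of_real (exp (- s * t)) * g t) t"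
proof -
  have e: "complex_of_real (exp (- s * t)) = of_real (exp (- s * (t - r))) * of_real (exp (- s * r))" for r by (simp flip: of_real_mult exp_add add: algebra_simps)
  have "of_real (exp (- s * t)) * conv f g t = (LINT r|lborel. of_real (exp (- s * t)) * (f (t - r) * g r))" by (simp add: conv_def)
  also have "... = (LINT r|lborel. of_real (exp (- s * (t - r))) * f (t - r) * (of_real (exp (- s * r)) * g r))"
  proof (intro Bochner_Integration.integral_cong refl)
    fix r
    show "of_real (exp (- s * t)) * (f (t - r) * g r) =
      of_real (exp (- s * (t - r))) * f (t - r) * (of_real (exp (- s * r)) * g r)" by (subst e[of r]) simp
  qed
  finally show ?thesis by (simp add: conv_def)
qed

lemma conv_zero:
  assumes "\<And>t. t \<le> 0 ==> f t = 0" "AE t in lborel. t < T --> g t = 0" "t \<le> T"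
  shows "conv f g t = 0"
proof -
  have "AE s in lborel. f (t - s) * g s = 0" using assms(2) by eventually_elim (use assms in \<open>force simp: not_less\<close>)
  then show ?thesis unfolding conv_def by (rule integral_eq_zero_AE)
qed

lemma laplace_class_conv:
  assumes f: "f \<in> laplace_class" and g: "g \<in> laplace_class"
  shows "conv f g \<in> laplace_class"
proof -
  have "conv f g t = 0" if "t \<le> 0" for t by (rule conv_zero[of f 0 g]) (use f g that in \<open>auto simp: laplace_class_zero\<close>)
  moreover have "integrable lborel (\<lambda>t. of_real (exp (- 1 * t)) * conv f g t)" unfolding exp_conv by (intro integrable_conv laplace_integrable f g) auto
  moreover have "conv f g \<in> borel_measurable borel" using f g by (intro conv_measurable laplace_class_measurable)
  ultimately show ?thesis by (simp add: laplace_class_def)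
qed

lemma laplace_conv:
  assumes f: "f \<in> laplace_class" and g: "g \<in> laplace_class" and s: "s \<ge> 1"
  shows "laplace (conv f g) s = laplace f s * laplace g s" unfolding laplace_def exp_conv by (intro integral_conv laplace_integrable f g s)

text \<open>Lerch's theorem: in the variable exp (- t), which lies between 0 and 1 where
  \<open>f\<close> is nonzero, the transform at integers gives all moments. Weierstrass
  approximation passes from polynomials to continuous functions, and these approximate the
  indicators of half-lines.\<close>

lemma laplace_injective_zero:
  assumes f: "f \<in> laplace_class" and zero: "\<And>s. s \<ge> 1 ==> laplace f s = 0"
  shows "AE t in lborel. f t = 0"
proof -
  define g where "g t = of_real (exp (- t)) * f t" for t
  have g: "integrable lborel g" using f by (simp add: laplace_class_def g_def[abs_def])
  have g0: "g t = 0" if "t \<le> 0" for t using laplace_class_zero[OF f that] by (simp add: g_def)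
  have [measurable]: "f \<in> borel_measurable borel" using f by (rule laplace_class_measurable)
  have [measurable]: "g \<in> borel_measurable borel" unfolding g_def by measurable
  have int: "integrable lborel (\<lambda>t. of_real (\<psi> (exp (- t))) * g t)"
    if [measurable]: "\<psi> \<in> borel_measurable borel" and B: "\<And>x. 0 \<le> x ==> x \<le> 1 ==> \<bar>\<psi> x\<bar> \<le> B" for \<psi> :: "real => real" and B
  proof (rule Bochner_Integration.integrable_bound)
    show "integrable lborel (\<lambda>t. of_real B * g t)" using g by simp
    show "AE t in lborel. norm (of_real (\<psi> (exp (- t))) * g t) \<le> norm (of_real B * g t)"
    proof (rule AE_I2)
      fix t
      show "norm (of_real (\<psi> (exp (- t))) * g t) \<le> norm (of_real B * g t)"
        using B[of "exp (- t)"] g0[of t] by (cases "t \<le> 0") (auto simp: norm_mult intro!: mult_right_mono)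
    qed
  qed measurable
  \<comment> \<open>Only the points s = 1 + j are used; one of the exponential factors is already
    contained in \<open>g\<close>.\<close>
  have mono: "(LINT t|lborel. of_real (exp (- t) ^ j) * g t) = 0" for j
  proof -
    have "of_real (exp (- t) ^ j) * g t = of_real (exp (- (1 + real j) * t)) * f t" for t
    proof -
      have "exp (- t) ^ j * exp (- t) = exp (- (1 + real j) * t)" by (simp flip: exp_of_nat_mult exp_add add: algebra_simps)
      moreover have "of_real (exp (- t) ^ j) * g t = of_real (exp (- t) ^ j * exp (- t)) * f t" by (simp add: g_def)
      ultimately show ?thesis by (simp only:)
    qed
    then show ?thesis using zero[of "1 + real j"] by (simp add: laplace_def)
  qed
  have cont0: "(LINT t|lborel. of_real (\<psi> (exp (- t))) * g t) = 0" if \<psi>: "continuous_on UNIV \<psi>" for \<psi> :: "real => real"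
  proof -
    have [measurable]: "\<psi> \<in> borel_measurable borel" using \<psi> by (rule borel_measurable_continuous_onI)
    define I where "I = (LINT t|lborel. norm (g t))"
    have I: "I \<ge> 0" by (simp add: I_def)
    have "compact (\<psi> ` {0..1})" by (intro compact_continuous_image continuous_on_subset[OF \<psi>]) auto
    then have "bounded (\<psi> ` {0..1})" by (rule compact_imp_bounded)
    then obtain B where "\<forall>y\<in>\<psi> ` {0..1}. norm y \<le> B" unfolding bounded_iff by blast
    then have B: "\<bar>\<psi> x\<bar> \<le> B" if "0 \<le> x" "x \<le> 1" for x using that by simp
    have "norm (LINT t|lborel. of_real (\<psi> (exp (- t))) * g t) \<le> e * I" if e: "e > 0" for e
    proof -
      obtain P where "real_polynomial_function P" and N: "\<And>x. x \<in> {0..1} ==> \<bar>\<psi> x - P x\<bar> < e"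
        using Stone_Weierstrass_real_polynomial_function[OF compact_Icc continuous_on_subset[OF \<psi>] e] by blast
      then obtain a n where P: "P = (\<lambda>x. \<Sum>i\<le>n. a i * x ^ i)" unfolding real_polynomial_function_iff_sum by blast
      have int_mono: "integrable lborel (\<lambda>t. of_real (exp (- t) ^ i) * g t)" for i by (rule int[of "\<lambda>x. x ^ i" 1]) (auto simp: power_le_one)
      have Peq: "(\<lambda>t. of_real (P (exp (- t))) * g t) = (\<lambda>t. \<Sum>i\<le>n. of_real (a i) * (of_real (exp (- t) ^ i) * g t))"
        by (auto simp: P sum_distrib_right mult.assoc)
      have Pint: "integrable lborel (\<lambda>t. of_real (P (exp (- t))) * g t)" unfolding Peq by (intro Bochner_Integration.integrable_sum integrable_mult_right int_mono)
      have P0: "(LINT t|lborel. of_real (P (exp (- t))) * g t) = 0" unfolding Peq by (subst Bochner_Integration.integral_sum) (use int_mono mono in auto)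
      have "(LINT t|lborel. of_real (\<psi> (exp (- t))) * g t) =
        (LINT t|lborel. of_real (\<psi> (exp (- t))) * g t - of_real (P (exp (- t))) * g t)" using int[of \<psi> B] B Pint P0 by simp
      also have "norm ... \<le> (LINT t|lborel. norm (of_real (\<psi> (exp (- t))) * g t - of_real (P (exp (- t))) * g t))" by (rule integral_norm_bound)
      also have "... \<le> (LINT t|lborel. e * norm (g t))"
      proof (rule integral_mono)
        show "integrable lborel (\<lambda>t. norm (of_real (\<psi> (exp (- t))) * g t - of_real (P (exp (- t))) * g t))" using int[of \<psi> B] B Pint by auto
        show "integrable lborel (\<lambda>t. e * norm (g t))" using g by simp
        fix t
        show "norm (of_real (\<psi> (exp (- t))) * g t - of_real (P (exp (- t))) * g t) \<le> e * norm (g t)"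
        proof (cases "t \<le> 0")
          case False
          then have "\<bar>\<psi> (exp (- t)) - P (exp (- t))\<bar> \<le> e" using N[of "exp (- t)"] by simp
          then have "\<bar>\<psi> (exp (- t)) - P (exp (- t))\<bar> * norm (g t) \<le> e * norm (g t)" by (rule mult_right_mono) simp
          moreover have "of_real (\<psi> (exp (- t))) * g t - of_real (P (exp (- t))) * g t =
            of_real (\<psi> (exp (- t)) - P (exp (- t))) * g t" by (simp add: algebra_simps)
          ultimately show ?thesis by (simp only: norm_mult norm_of_real)
        qed (use g0 in simp)
      qed
      also have "... = e * I" by (simp add: I_def)
      finally show ?thesis .
    qed
    note le = this
    have "norm (LINT t|lborel. of_real (\<psi> (exp (- t))) * g t) \<le> 0 + e" if "e > 0" for e
    proof -
      have "e / (I + 1) > 0" "e / (I + 1) * I \<le> e" using that I by (simp_all add: field_simps)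
      then show ?thesis using le[of "e / (I + 1)"] by linarith
    qed
    then have "norm (LINT t|lborel. of_real (\<psi> (exp (- t))) * g t) \<le> 0" by (rule field_le_epsilon)
    then show ?thesis by simp
  qed
  have "AE t in lborel. g t = 0"
  proof (rule AE_zero_if_initial_integrals_zero[OF g])
    fix a :: real
    \<comment> \<open>Linear ramps that are 1 from exp (- a) upwards; as functions of exp (- t) they
      converge to the indicator of t \<le> a.\<close>
    define \<psi> where "\<psi> n x = min 1 (max 0 (1 + real n * (x - exp (- a))))" for n :: nat and x :: real
    have cont: "continuous_on UNIV (\<psi> n)" for n unfolding \<psi>_def by (intro continuous_intros)
    have "(\<lambda>n. LINT t|lborel. of_real (\<psi> n (exp (- t))) * g t) \<longlonglongrightarrow> (LINT t|lborel. indicator {..a} t *\<^sub>R g t)"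
    proof (rule integral_dominated_convergence[where w="\<lambda>t. norm (g t)"])
      show "AE t in lborel. (\<lambda>n. of_real (\<psi> n (exp (- t))) * g t) \<longlonglongrightarrow> indicator {..a} t *\<^sub>R g t"
      proof (rule AE_I2)
        fix t
        have "(\<lambda>n. \<psi> n (exp (- t))) \<longlonglongrightarrow> indicator {..a} t"
        proof (cases "t \<le> a")
          case True
          then have "0 \<le> real n * (exp (- t) - exp (- a))" for n by (intro mult_nonneg_nonneg) auto
          then have "\<psi> n (exp (- t)) = 1" for n unfolding \<psi>_def by (simp add: min_def max_def)
          then show ?thesis using True by simp
        next
          case False
          define d where "d = exp (- a) - exp (- t)"
          have d: "d > 0" using False by (simp add: d_def)
          obtain N where N: "1 / d < real N" using reals_Archimedean2 by blast
          have "\<forall>\<^sub>F n in sequentially. \<psi> n (exp (- t)) = 0"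
          proof (rule eventually_sequentiallyI[of N])
            fix n assume "N \<le> n"
            then have "1 / d < real n" using N by linarith
            then have "1 < real n * d" using d by (simp add: field_simps)
            then have "1 + real n * (exp (- t) - exp (- a)) < 0" by (simp add: d_def algebra_simps)
            then show "\<psi> n (exp (- t)) = 0" by (simp add: \<psi>_def)
          qed
          then show ?thesis using False by (simp add: tendsto_eventually)
        qed
        then have "(\<lambda>n. of_real (\<psi> n (exp (- t))) * g t) \<longlonglongrightarrow> of_real (indicator {..a} t) * g t" by (intro tendsto_intros)
        then show "(\<lambda>n. of_real (\<psi> n (exp (- t))) * g t) \<longlonglongrightarrow> indicator {..a} t *\<^sub>R g t" by (simp add: scaleR_conv_of_real)
      qed
      show "integrable lborel (\<lambda>t. norm (g t))" using g by simp
      show "(\<lambda>t. of_real (\<psi> n (exp (- t))) * g t) \<in> borel_measurable lborel" for n using borel_measurable_continuous_onI[OF cont] by measurable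
      show "AE t in lborel. norm (of_real (\<psi> n (exp (- t))) * g t) \<le> norm (g t)" for n by (intro AE_I2) (auto simp: norm_mult \<psi>_def intro!: mult_left_le_one_le)
    qed measurable
    then show "(LINT t|lborel. indicator {..a} t *\<^sub>R g t) = 0" using cont0[OF cont] by (simp add: LIMSEQ_const_iff)
  qed
  then show ?thesis by eventually_elim (simp add: g_def)
qed

lemma laplace_injective:
  assumes f: "f \<in> laplace_class" and g: "g \<in> laplace_class" and eq: "\<And>s. s \<ge> 1 ==> laplace f s = laplace g s"
  shows "AE t in lborel. f t = g t"
proof -
  have "AE t in lborel. f t - g t = 0" by (rule laplace_injective_zero) (use assms in \<open>auto simp: laplace_diff intro: laplace_class_diff\<close>)
  then show ?thesis by simp
qed

text \<open>The Riemann--Liouville kernel, extended by zero so that fractional integration is a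
  convolution on the whole line.\<close>

definition frac_kernel :: "real => real => real"
  where "frac_kernel \<beta> t = (if t > 0 then t powr (\<beta> - 1) / Gamma \<beta> else 0)"

lemma frac_kernel_measurable [measurable]: "frac_kernel \<beta> \<in> borel_measurable borel" unfolding frac_kernel_def[abs_def] by measurable

lemma frac_kernel_nonneg: "\<beta> > 0 ==> frac_kernel \<beta> t \<ge> 0" by (simp add: frac_kernel_def Gamma_real_nonneg)

text \<open>Euler's integral for Gamma after rescaling t by \<open>s\<close>. Stated for nonnegative
  integrals, it gives integrability and the transform at once.\<close>

lemma nn_integral_frac_kernel:
  assumes \<beta>: "\<beta> > 0" and s: "s > 0"
  shows "(\<integral>t. ennreal (exp (- s * t) * frac_kernel \<beta> t)) = ennreal (s powr (- \<beta>))"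
proof -
  have G: "Gamma \<beta> > 0" using \<beta> by (rule Gamma_real_pos)
  have "ennreal (Gamma \<beta>) = (\<integral>t. ennreal (indicator {0..} t * t powr (\<beta> - 1) / exp t))" using Gamma_conv_nn_integral_real[OF \<beta>] by simp
  also have "... = ennreal s * (\<integral>t. ennreal (indicator {0..} (s * t) * (s * t) powr (\<beta> - 1) / exp (s * t)))"
    using nn_integral_real_affine[of "\<lambda>t. ennreal (indicator {0..} t * t powr (\<beta> - 1) / exp t)" s 0] s by simp
  also have "(\<integral>t. ennreal (indicator {0..} (s * t) * (s * t) powr (\<beta> - 1) / exp (s * t))) =
    (\<integral>t. ennreal (Gamma \<beta> * s powr (\<beta> - 1)) * ennreal (exp (- s * t) * frac_kernel \<beta> t))"
  proof (rule nn_integral_cong_AE)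
    have "AE t in lborel. t \<noteq> (0::real)" by (rule AE_lborel_singleton)
    then show "AE t in lborel. ennreal (indicator {0..} (s * t) * (s * t) powr (\<beta> - 1) / exp (s * t)) =
      ennreal (Gamma \<beta> * s powr (\<beta> - 1)) * ennreal (exp (- s * t) * frac_kernel \<beta> t)"
    proof eventually_elim
      case (elim t)
      show ?case using s G elim frac_kernel_nonneg[OF \<beta>, of t] by (cases "t > 0")
          (auto simp: frac_kernel_def indicator_def zero_le_mult_iff powr_mult exp_minus field_simps simp flip: ennreal_mult)
    qed
  qed
  also have "... = ennreal (Gamma \<beta> * s powr (\<beta> - 1)) * (\<integral>t. ennreal (exp (- s * t) * frac_kernel \<beta> t))" by (rule nn_integral_cmult) measurable
  finally have eq: "ennreal (Gamma \<beta>) = ennreal s * (ennreal (Gamma \<beta> * s powr (\<beta> - 1)) *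
     (\<integral>t. ennreal (exp (- s * t) * frac_kernel \<beta> t)))" .
  define I where "I = (\<integral>t. ennreal (exp (- s * t) * frac_kernel \<beta> t))"
  have "I \<noteq> top" using eq G s unfolding I_def[symmetric] by (auto simp: ennreal_mult_top)
  then obtain i where i: "I = ennreal i" "i \<ge> 0" by (cases I) auto
  have "Gamma \<beta> = s * (Gamma \<beta> * s powr (\<beta> - 1) * i)" using eq i G s unfolding I_def[symmetric] by (simp flip: ennreal_mult)
  then have "1 = s * s powr (\<beta> - 1) * i" using G by simp
  also have "s * s powr (\<beta> - 1) = s powr \<beta>" using s by (simp add: powr_diff)
  finally have "i = s powr (- \<beta>)" using s by (simp add: powr_minus field_simps)
  then show ?thesis using i by (simp add: I_def)
qed

lemma frac_kernel_laplace_class: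
  assumes "\<beta> > 0"
  shows "(\<lambda>t. of_real (frac_kernel \<beta> t)) \<in> laplace_class"
proof -
  have "integrable lborel (\<lambda>t. exp (- 1 * t) * frac_kernel \<beta> t)" using nn_integral_frac_kernel[OF assms, of 1] frac_kernel_nonneg[OF assms]
    by (intro integrableI_nonneg) auto
  then have "integrable lborel (\<lambda>t. complex_of_real (exp (- 1 * t) * frac_kernel \<beta> t))" by (rule integrable_of_real)
  then show ?thesis by (simp add: laplace_class_def frac_kernel_def)
qed

lemma laplace_frac_kernel:
  assumes "\<beta> > 0" "s > 0"
  shows "laplace (\<lambda>t. of_real (frac_kernel \<beta> t)) s = of_real (s powr (- \<beta>))"
proof -
  have "(LINT t|lborel. exp (- s * t) * frac_kernel \<beta> t) = s powr (- \<beta>)" using nn_integral_frac_kernel[OF assms] frac_kernel_nonneg[OF assms(1)]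
    by (subst integral_eq_nn_integral) auto
  then show ?thesis unfolding laplace_def by (simp flip: of_real_mult)
qed

section \<open>The Mittag-Leffler kernel\<close>

text \<open>The parameter \<open>\<mu>\<close> stands for \<open>\<lambda> powr (1 / \<alpha>)\<close>, where \<open>- \<lambda>\<close> is the eigenvalue: the kernel is
  \<open>\<lambda> * t powr (\<alpha> - 1) * E (- \<i> * \<lambda> * t powr \<alpha>)\<close> with the Mittag-Leffler function \<open>E\<close> of
  parameters \<open>\<alpha>, \<alpha>\<close>.\<close>

definition ml_kernel :: "real => real => real => complex"
  where "ml_kernel \<alpha> \<mu> t = (if t \<le> 0 then 0 else
    LINT x|lborel. ml_density \<alpha> x * of_real (exp x * \<mu>) * exp (- (of_real (exp x * \<mu> * t) * cis (\<alpha> * pi / 2))))"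

text \<open>The modulus is taken under the integral sign: what remains is a positive mixture of
  decaying exponentials, to each of which \<open>exp_average_le_maximal\<close> applies.\<close>

definition ml_majorant :: "real => real => real => ennreal"
  where "ml_majorant \<alpha> \<mu> t = indicator {0<..} t *
    (\<integral>x. ennreal (norm (ml_density \<alpha> x) * (exp x * \<mu>) * exp (- (exp x * \<mu> * cos (\<alpha> * pi / 2)) * t)))"

lemma nn_integral_exp_tail:
  fixes b T :: real
  assumes "b > 0"
  shows "(\<integral>t. indicator {T<..} t * ennreal (exp (- b * t))) = ennreal (exp (- b * T) / b)"
proof -
  have "((\<lambda>t. - (exp (- b * t) / b)) \<longlongrightarrow> - (0 / b)) at_top" using assms by (intro tendsto_intros filterlim_compose[OF exp_at_bot]
        filterlim_tendsto_neg_mult_at_bot[OF tendsto_const]) (auto intro: filterlim_ident)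
  then have "(\<integral>t. ennreal (exp (- b * t)) * indicator {T..} t) = ennreal (- (0 / b) - - (exp (- b * T) / b))"
    using assms by (intro nn_integral_FTC_atLeast) (auto intro!: derivative_eq_intros)
  moreover have "(\<integral>t. ennreal (exp (- b * t)) * indicator {T..} t) =
      (\<integral>t. indicator {T<..} t * ennreal (exp (- b * t)))"
  proof (rule nn_integral_cong_AE)
    have "AE t in lborel. t \<noteq> T" by (rule AE_lborel_singleton)
    then show "AE t in lborel. ennreal (exp (- b * t)) * indicator {T..} t = indicator {T<..} t * ennreal (exp (- b * t))" by eventually_elim (auto simp: indicator_def)
  qed
  ultimately show ?thesis by simp
qed

lemma
  fixes z :: complex
  assumes z: "Re z > 0"
  shows integrable_exp_complex: "integrable lborel (\<lambda>t. indicator {0<..} t *\<^sub>R exp (- (of_real t * z)))"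
    and integral_exp_complex: "(LINT t|lborel. indicator {0<..} t *\<^sub>R exp (- (of_real t * z))) = 1 / z"
proof -
  have n: "norm (exp (- (complex_of_real t * z))) = exp (- Re z * t)" for t by (simp add: mult.commute)
  show I: "integrable lborel (\<lambda>t. indicator {0<..} t *\<^sub>R exp (- (complex_of_real t * z)))"
  proof (rule integrableI_bounded)
    show "(\<lambda>t. indicator {0<..} t *\<^sub>R exp (- (complex_of_real t * z))) \<in> borel_measurable lborel" by measurable
    have "(\<integral>t. ennreal (norm (indicator {0<..} t *\<^sub>R exp (- (complex_of_real t * z))))) =
      (\<integral>t. indicator {0<..} t * ennreal (exp (- Re z * t)))" by (intro nn_integral_cong) (auto simp: n indicator_def)
    then show "(\<integral>t. ennreal (norm (indicator {0<..} t *\<^sub>R exp (- (complex_of_real t * z))))) < \<infinity>" using nn_integral_exp_tail[OF z, of 0] by simp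
  qed
  have z0: "z \<noteq> 0" using z by auto
  define F where "F t = - (exp (- (complex_of_real t * z)) / z)" for t
  have deriv: "(F has_vector_derivative exp (- (complex_of_real t * z))) (at t within S)" for t S unfolding F_def using z0
    by (auto intro!: derivative_eq_intros has_vector_derivative_real_field simp: o_def)
  have fin: "(LINT t|lborel. indicator {0..real n} t *\<^sub>R exp (- (complex_of_real t * z))) = F (real n) - F 0" for n
    by (rule integral_FTC_Icc) (auto intro!: deriv continuous_intros)
  have lim1: "(\<lambda>n. LINT t|lborel. indicator {0..real n} t *\<^sub>R exp (- (complex_of_real t * z)))
      \<longlonglongrightarrow> (LINT t|lborel. indicator {0<..} t *\<^sub>R exp (- (complex_of_real t * z)))"
  proof (rule integral_dominated_convergence[where w="\<lambda>t. norm (indicator {0<..} t *\<^sub>R exp (- (complex_of_real t * z)))"])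
    have ae: "AE t in lborel. t \<noteq> (0::real)" by (rule AE_lborel_singleton)
    show "AE t in lborel. (\<lambda>n. indicator {0..real n} t *\<^sub>R exp (- (complex_of_real t * z)))
        \<longlonglongrightarrow> indicator {0<..} t *\<^sub>R exp (- (complex_of_real t * z))" using ae
    proof eventually_elim
      case (elim t)
      obtain N where N: "t \<le> real N" using real_arch_simple by blast
      show ?case by (rule tendsto_eventually, rule eventually_sequentiallyI[of N]) (use N elim in \<open>auto simp: indicator_def\<close>)
    qed
    show "AE t in lborel. norm (indicator {0..real n} t *\<^sub>R exp (- (complex_of_real t * z)))
        \<le> norm (indicator {0<..} t *\<^sub>R exp (- (complex_of_real t * z)))" for n using ae by eventually_elim (auto simp: indicator_def)
    show "integrable lborel (\<lambda>t. norm (indicator {0<..} t *\<^sub>R exp (- (complex_of_real t * z))))" using I by (rule integrable_norm)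
  qed measurable
  have "(\<lambda>n. exp (- (complex_of_real (real n) * z))) \<longlonglongrightarrow> 0"
  proof (rule tendsto_norm_zero_cancel)
    have "((\<lambda>t. exp (- Re z * t)) \<longlongrightarrow> 0) at_top" using z by (intro filterlim_compose[OF exp_at_bot]
        filterlim_tendsto_neg_mult_at_bot[OF tendsto_const]) (auto intro: filterlim_ident)
    then show "(\<lambda>n. norm (exp (- (complex_of_real (real n) * z)))) \<longlonglongrightarrow> 0" unfolding n by (rule filterlim_compose[OF _ filterlim_real_sequentially])
  qed
  then have "(\<lambda>n. F (real n) - F 0) \<longlonglongrightarrow> - (0 / z) - F 0" unfolding F_def by (intro tendsto_intros z0)
  then have "(\<lambda>n. F (real n) - F 0) \<longlonglongrightarrow> 1 / z" by (simp add: F_def)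
  then show "(LINT t|lborel. indicator {0<..} t *\<^sub>R exp (- (of_real t * z))) = 1 / z" using lim1 unfolding fin by (rule LIMSEQ_unique[rotated])
qed

context fractional_order
begin

definition density_mass :: real where "density_mass = (LINT x|lborel. norm (mld x))"

lemma density_mass_nonneg: "density_mass \<ge> 0" by (simp add: density_mass_def)

lemma nn_density_mass: "(\<integral>x. ennreal (norm (mld x))) = ennreal density_mass" unfolding density_mass_def by (intro nn_integral_eq_integral integrable_norm_ml_density) auto

lemma ml_majorant_measurable [measurable]: "ml_majorant \<alpha> \<mu> \<in> borel_measurable borel" unfolding ml_majorant_def[abs_def] by measurable

lemma ml_kernel_measurable [measurable]: "ml_kernel \<alpha> \<mu> \<in> borel_measurable borel" unfolding ml_kernel_def[abs_def] by measurable

lemma norm_kernel_integrand: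
  assumes "\<mu> > 0"
  shows "norm (mld x * of_real (exp x * \<mu>) * exp (- (of_real (exp x * \<mu> * t) * cis \<eta>))) =
    norm (mld x) * (exp x * \<mu>) * exp (- (exp x * \<mu> * cos \<eta>) * t)"
proof -
  have "norm (exp (- (of_real (exp x * \<mu> * t) * cis \<eta>))) = exp (- (exp x * \<mu> * cos \<eta>) * t)" by (simp add: mult_ac del: of_real_mult)
  moreover have "norm (complex_of_real (exp x * \<mu>)) = exp x * \<mu>" using assms by (simp only: norm_of_real) simp
  ultimately show ?thesis by (simp only: norm_mult)
qed

lemma norm_ml_kernel_le:
  assumes "\<mu> > 0"
  shows "ennreal (norm (ml_kernel \<alpha> \<mu> t)) \<le> ml_majorant \<alpha> \<mu> t"
proof (cases "t \<le> 0")
  case False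
  define f where "f x = mld x * of_real (exp x * \<mu>) * exp (- (of_real (exp x * \<mu> * t) * cis \<eta>))" for x
  have "ennreal (norm (LINT x|lborel. f x)) \<le> (\<integral>x. ennreal (norm (f x)))"
  proof (cases "integrable lborel f")
    case True
    then show ?thesis by (rule integral_norm_bound_ennreal)
  qed (simp add: not_integrable_integral_eq)
  then show ?thesis using False unfolding f_def norm_kernel_integrand[OF assms] by (simp add: ml_kernel_def ml_majorant_def)
qed (simp add: ml_kernel_def)

text \<open>Tonelli: integrating an exponential over time divides by its rate, which cancels the
  factor exp x * \<mu>. For T = 0 this leaves a mass independent of \<open>\<mu>\<close>.\<close>

lemma nn_integral_ml_majorant_tail:
  assumes \<mu>: "\<mu> > 0" and T: "T \<ge> 0"
  shows "(\<integral>t. indicator {T<..} t * ml_majorant \<alpha> \<mu> t) =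
    (\<integral>x. ennreal (norm (mld x) * (exp (- (exp x * \<mu> * cos \<eta>) * T) / cos \<eta>)))"
proof -
  have "(\<integral>t. indicator {T<..} t * ml_majorant \<alpha> \<mu> t) =
    (\<integral>t. (\<integral>x. indicator {T<..} t *
      ennreal (norm (mld x) * (exp x * \<mu>) * exp (- (exp x * \<mu> * cos \<eta>) * t))))" unfolding ml_majorant_def using T
    by (intro nn_integral_cong, subst nn_integral_cmult) (auto simp: indicator_def)
  also have "... = (\<integral>x. (\<integral>t. indicator {T<..} t *
      ennreal (norm (mld x) * (exp x * \<mu>) * exp (- (exp x * \<mu> * cos \<eta>) * t))))" by (intro lborel_pair.Fubini') measurable
  also have "... = (\<integral>x. ennreal (norm (mld x) * (exp (- (exp x * \<mu> * cos \<eta>) * T) / cos \<eta>)))"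
  proof (rule nn_integral_cong)
    fix x
    define b where "b = exp x * \<mu> * cos \<eta>"
    have b: "b > 0" using \<mu> cos_\<eta>_pos by (simp add: b_def)
    have "(\<integral>t. indicator {T<..} t * ennreal (norm (mld x) * (exp x * \<mu>) * exp (- b * t))) =
      (\<integral>t. ennreal (norm (mld x) * (exp x * \<mu>)) * (indicator {T<..} t * ennreal (exp (- b * t))))"
      using \<mu> by (intro nn_integral_cong) (simp add: ennreal_mult mult_ac)
    also have "... = ennreal (norm (mld x) * (exp x * \<mu>)) * ennreal (exp (- b * T) / b)" using nn_integral_exp_tail[OF b, of T] by (subst nn_integral_cmult) auto
    also have "... = ennreal (norm (mld x) * (exp x * \<mu>) * (exp (- b * T) / b))" using \<mu> b by (intro ennreal_mult[symmetric]) auto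
    also have "norm (mld x) * (exp x * \<mu>) * (exp (- b * T) / b) =
      norm (mld x) * (exp (- b * T) / cos \<eta>)" using \<mu> cos_\<eta>_pos by (simp add: b_def)
    finally show "(\<integral>t. indicator {T<..} t * ennreal (norm (mld x) * (exp x * \<mu>) *
        exp (- (exp x * \<mu> * cos \<eta>) * t))) =
      ennreal (norm (mld x) * (exp (- (exp x * \<mu> * cos \<eta>) * T) / cos \<eta>))" by (simp only: b_def)
  qed
  finally show ?thesis .
qed

lemma nn_integral_ml_majorant:
  assumes \<mu>: "\<mu> > 0"
  shows "(\<integral>t. ml_majorant \<alpha> \<mu> t) = ennreal (density_mass / cos \<eta>)"
proof -
  have "(\<integral>t. ml_majorant \<alpha> \<mu> t) = (\<integral>t. indicator {0<..} t * ml_majorant \<alpha> \<mu> t)"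
    by (intro nn_integral_cong) (auto simp: ml_majorant_def indicator_def)
  also have "... = (\<integral>x. ennreal (norm (mld x)) * ennreal (1 / cos \<eta>))" using nn_integral_ml_majorant_tail[OF \<mu>, of 0] cos_\<eta>_pos by (simp flip: ennreal_mult)
  also have "... = ennreal density_mass * ennreal (1 / cos \<eta>)" by (subst nn_integral_multc) (auto simp: nn_density_mass)
  finally show ?thesis using cos_\<eta>_pos density_mass_nonneg by (simp flip: ennreal_mult)
qed

text \<open>The exponentials are bounded by two-sided ones, so the sign \<open>\<sigma>\<close>
  covers the kernel and its reflection together.\<close>

lemma nnconv_ml_majorant_le:
  assumes \<mu>: "\<mu> > 0" and [measurable]: "\<phi> \<in> borel_measurable borel" and \<sigma>: "\<bar>\<sigma>\<bar> = 1"
  shows "nnconv (\<lambda>x. ml_majorant \<alpha> \<mu> (\<sigma> * x)) \<phi> t \<le> ennreal (8 * density_mass / cos \<eta>) * maximal \<phi> t"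
proof -
  have "nnconv (\<lambda>x. ml_majorant \<alpha> \<mu> (\<sigma> * x)) \<phi> t \<le>
    (\<integral>s. (\<integral>x. ennreal (norm (mld x) * (exp x * \<mu>) * exp (- (exp x * \<mu> * cos \<eta>) * \<bar>t - s\<bar>)) * \<phi> s))" unfolding nnconv_def
  proof (rule nn_integral_mono)
    fix s
    have "ml_majorant \<alpha> \<mu> (\<sigma> * (t - s)) \<le>
      (\<integral>x. ennreal (norm (mld x) * (exp x * \<mu>) * exp (- (exp x * \<mu> * cos \<eta>) * \<bar>t - s\<bar>)))"
    proof (cases "\<sigma> * (t - s) > 0")
      case True
      then have "\<sigma> * (t - s) = \<bar>\<sigma> * (t - s)\<bar>" by simp
      also have "... = \<bar>t - s\<bar>" using \<sigma> by (simp add: abs_mult)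
      finally show ?thesis by (simp add: ml_majorant_def indicator_def)
    qed (simp add: ml_majorant_def)
    then show "ml_majorant \<alpha> \<mu> (\<sigma> * (t - s)) * \<phi> s \<le>
      (\<integral>x. ennreal (norm (mld x) * (exp x * \<mu>) * exp (- (exp x * \<mu> * cos \<eta>) * \<bar>t - s\<bar>)) * \<phi> s)"
      by (subst nn_integral_multc) (auto intro: mult_right_mono)
  qed
  also have "... = (\<integral>x. (\<integral>s. ennreal (norm (mld x) * (exp x * \<mu>) * exp (- (exp x * \<mu> * cos \<eta>) * \<bar>t - s\<bar>)) * \<phi> s))"
    by (intro lborel_pair.Fubini') measurable
  also have "... \<le> (\<integral>x. ennreal (norm (mld x)) * (ennreal (1 / cos \<eta>) * (8 * maximal \<phi> t)))"
  proof (rule nn_integral_mono)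
    fix x
    define b where "b = exp x * \<mu> * cos \<eta>"
    have b: "b > 0" using \<mu> cos_\<eta>_pos by (simp add: b_def)
    have "(\<integral>s. ennreal (norm (mld x) * (exp x * \<mu>) * exp (- b * \<bar>t - s\<bar>)) * \<phi> s) =
      (\<integral>s. (ennreal (norm (mld x)) * ennreal (1 / cos \<eta>)) * (ennreal (b * exp (- b * \<bar>t - s\<bar>)) * \<phi> s))"
    proof (rule nn_integral_cong)
      fix s
      have "ennreal (norm (mld x) * (exp x * \<mu>) * exp (- b * \<bar>t - s\<bar>)) =
        ennreal (norm (mld x) * (1 / cos \<eta>) * (b * exp (- b * \<bar>t - s\<bar>)))" using cos_\<eta>_pos by (simp add: b_def mult_ac)
      also have "... = ennreal (norm (mld x)) * ennreal (1 / cos \<eta>) * ennreal (b * exp (- b * \<bar>t - s\<bar>))"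
        using b cos_\<eta>_pos ennreal_mult[of "norm (mld x) * (1 / cos \<eta>)" "b * exp (- b * \<bar>t - s\<bar>)"]
          ennreal_mult[of "norm (mld x)" "1 / cos \<eta>"] by simp
      finally show "ennreal (norm (mld x) * (exp x * \<mu>) * exp (- b * \<bar>t - s\<bar>)) * \<phi> s =
        (ennreal (norm (mld x)) * ennreal (1 / cos \<eta>)) * (ennreal (b * exp (- b * \<bar>t - s\<bar>)) * \<phi> s)" by (simp only: mult.assoc)
    qed
    also have "... = (ennreal (norm (mld x)) * ennreal (1 / cos \<eta>)) *
       (\<integral>s. ennreal (b * exp (- b * \<bar>t - s\<bar>)) * \<phi> s)" by (rule nn_integral_cmult) measurable
    also have "... \<le> (ennreal (norm (mld x)) * ennreal (1 / cos \<eta>)) * (8 * maximal \<phi> t)" by (intro mult_left_mono exp_average_le_maximal b) auto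
    finally show "(\<integral>s. ennreal (norm (mld x) * (exp x * \<mu>) * exp (- (exp x * \<mu> * cos \<eta>) * \<bar>t - s\<bar>)) * \<phi> s) \<le>
      ennreal (norm (mld x)) * (ennreal (1 / cos \<eta>) * (8 * maximal \<phi> t))" by (simp only: b_def mult.assoc)
  qed
  also have "... = ennreal density_mass * (ennreal (1 / cos \<eta>) * (8 * maximal \<phi> t))" by (subst nn_integral_multc) (auto simp: nn_density_mass)
  also have "... = ennreal (8 * density_mass / cos \<eta>) * maximal \<phi> t"
  proof -
    have "ennreal (8 * density_mass / cos \<eta>) = ennreal (density_mass * (1 / cos \<eta> * 8))" by (simp add: mult_ac)
    also have "... = ennreal density_mass * (ennreal (1 / cos \<eta>) * 8)" using cos_\<eta>_pos density_mass_nonneg ennreal_mult[of density_mass "1 / cos \<eta> * 8"]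
        ennreal_mult[of "1 / cos \<eta>" 8] by simp
    finally show ?thesis by (simp only: mult.assoc)
  qed
  finally show ?thesis .
qed

text \<open>One constant for mass and domination; adding 1 makes it positive without a lower bound
  on \<open>density_mass\<close>.\<close>

definition kernel_const :: real where "kernel_const = 8 * density_mass / cos \<eta> + 1"

lemma kernel_const_pos: "kernel_const > 0" using density_mass_nonneg cos_\<eta>_pos by (simp add: kernel_const_def add_nonneg_pos)

lemma maximal_kernels_ml_majorant:
  assumes "\<And>n. \<mu> n > 0"
  shows "maximal_kernels (\<lambda>n. ml_majorant \<alpha> (\<mu> n)) kernel_const"
proof
  have le: "8 * density_mass / cos \<eta> \<le> kernel_const" by (simp add: kernel_const_def)
  have "density_mass / cos \<eta> \<le> 8 * density_mass / cos \<eta>" using density_mass_nonneg cos_\<eta>_pos by (intro divide_right_mono) auto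
  with le have le1: "density_mass / cos \<eta> \<le> kernel_const" by linarith
  show "(\<integral>s. ml_majorant \<alpha> (\<mu> n) s) \<le> ennreal kernel_const" for n unfolding nn_integral_ml_majorant[OF assms] by (intro ennreal_leI le1)
  fix \<phi> :: "real => ennreal" and n t assume \<phi>: "\<phi> \<in> borel_measurable borel"
  have step: "ennreal (8 * density_mass / cos \<eta>) * maximal \<phi> t \<le> ennreal kernel_const * maximal \<phi> t" by (intro mult_right_mono ennreal_leI le) auto
  show "nnconv (ml_majorant \<alpha> (\<mu> n)) \<phi> t \<le> ennreal kernel_const * maximal \<phi> t"
    using order_trans[OF nnconv_ml_majorant_le[OF assms \<phi>, of 1 n t] step] by simp
  show "nnconv (\<lambda>x. ml_majorant \<alpha> (\<mu> n) (- x)) \<phi> t \<le> ennreal kernel_const * maximal \<phi> t"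
    using order_trans[OF nnconv_ml_majorant_le[OF assms \<phi>, of "-1" n t] step] by simp
qed (auto simp: kernel_const_pos)

lemma integrable_ml_kernel:
  assumes \<mu>: "\<mu> > 0"
  shows "integrable lborel (ml_kernel \<alpha> \<mu>)"
proof (rule integrableI_bounded)
  have "(\<integral>t. ennreal (norm (ml_kernel \<alpha> \<mu> t))) \<le> (\<integral>t. ml_majorant \<alpha> \<mu> t)" by (intro nn_integral_mono norm_ml_kernel_le \<mu>)
  also have "... < \<infinity>" unfolding nn_integral_ml_majorant[OF \<mu>] by simp
  finally show "(\<integral>t. ennreal (norm (ml_kernel \<alpha> \<mu> t))) < \<infinity>" .
qed measurable

lemma ml_kernel_laplace_class: "\<mu> > 0 ==> ml_kernel \<alpha> \<mu> \<in> laplace_class" by (intro laplace_classI integrable_ml_kernel) (auto simp: ml_kernel_def)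

text \<open>After Fubini each exponential contributes 1 / (s + exp x * \<mu> * cis \<eta>); dividing
  by the scale and shifting x by ln (s / \<mu>) gives the Stieltjes integral of
  \<open>ml_density_stieltjes\<close>.\<close>

lemma laplace_ml_kernel:
  assumes \<mu>: "\<mu> > 0" and s: "s > 0"
  shows "laplace (ml_kernel \<alpha> \<mu>) s = 1 / (of_real ((s / \<mu>) powr \<alpha>) + \<i>)"
proof -
  define f where "f t x = indicator {0<..} t *\<^sub>R (of_real (exp (- s * t)) *
    (mld x * of_real (exp x * \<mu>) * exp (- (of_real (exp x * \<mu> * t) * cis \<eta>))))" for t x
  have fm: "(\<lambda>(t, x). f t x) \<in> borel_measurable (lborel \<Otimes>\<^sub>M lborel)" unfolding f_def by measurable
  have fi: "integrable (lborel \<Otimes>\<^sub>M lborel) (\<lambda>(t, x). f t x)"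
  proof (rule integrableI_bounded[OF fm])
    have "(\<integral>\<^sup>+z. ennreal (norm (case z of (t, x) => f t x)) \<partial>(lborel \<Otimes>\<^sub>M lborel)) =
      (\<integral>t. (\<integral>x. ennreal (norm (f t x))))" using fm by (subst lborel.nn_integral_fst[symmetric]) auto
    also have "... \<le> (\<integral>t. ml_majorant \<alpha> \<mu> t)"
    proof (rule nn_integral_mono)
      fix t :: real
      show "(\<integral>x. ennreal (norm (f t x))) \<le> ml_majorant \<alpha> \<mu> t"
      proof (cases "t > 0")
        case True
        have "norm (f t x) \<le> norm (mld x) * (exp x * \<mu>) * exp (- (exp x * \<mu> * cos \<eta>) * t)" for x
        proof -
          have "norm (f t x) = exp (- s * t) * norm (mld x * of_real (exp x * \<mu>) * exp (- (of_real (exp x * \<mu> * t) * cis \<eta>)))"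
            using True unfolding f_def by (simp only: norm_scaleR norm_mult norm_of_real) simp
          also have "... \<le> 1 * norm (mld x * of_real (exp x * \<mu>) * exp (- (of_real (exp x * \<mu> * t) * cis \<eta>)))" using s True by (intro mult_right_mono) auto
          finally show ?thesis by (simp only: norm_kernel_integrand[OF \<mu>] mult_1_left)
        qed
        then show ?thesis using True unfolding ml_majorant_def by (simp add: nn_integral_mono ennreal_leI)
      qed (simp add: f_def)
    qed
    also have "... < \<infinity>" unfolding nn_integral_ml_majorant[OF \<mu>] by simp
    finally show "(\<integral>\<^sup>+z. ennreal (norm (case z of (t, x) => f t x)) \<partial>(lborel \<Otimes>\<^sub>M lborel)) < \<infinity>" .
  qed
  have "laplace (ml_kernel \<alpha> \<mu>) s = (LINT t|lborel. (LINT x|lborel. f t x))" unfolding laplace_def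
  proof (intro Bochner_Integration.integral_cong refl)
    fix t
    show "of_real (exp (- s * t)) * ml_kernel \<alpha> \<mu> t = (LINT x|lborel. f t x)" by (cases "t > 0") (simp_all add: f_def ml_kernel_def)
  qed
  also have "... = (LINT x|lborel. (LINT t|lborel. f t x))" using lborel_pair.Fubini_integral[of f] fi by simp
  also have "... = (LINT x|lborel. mld x / (cis \<eta> + of_real (s / \<mu> * exp (- x))))"
  proof (intro Bochner_Integration.integral_cong refl)
    fix x
    define z where "z = of_real s + of_real (exp x * \<mu>) * cis \<eta>"
    have z: "Re z > 0" using s \<mu> cos_\<eta>_pos by (simp add: z_def add_pos_pos)
    have "f t x = mld x * of_real (exp x * \<mu>) * (indicator {0<..} t *\<^sub>R exp (- (of_real t * z)))" for t
    proof -
      have "- (of_real t * z) = of_real (- s * t) + (- (of_real (exp x * \<mu> * t) * cis \<eta>))" by (simp add: z_def algebra_simps)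
      then have "exp (- (of_real t * z)) = of_real (exp (- s * t)) * exp (- (of_real (exp x * \<mu> * t) * cis \<eta>))" by (simp only: exp_add exp_of_real)
      then show ?thesis unfolding f_def by (simp only: scaleR_conv_of_real mult_ac)
    qed
    then have "(LINT t|lborel. f t x) = mld x * of_real (exp x * \<mu>) * (1 / z)" by (simp only: integral_mult_right_zero integral_exp_complex[OF z])
    also have "... = mld x / (cis \<eta> + of_real (s / \<mu> * exp (- x)))"
    proof -
      have "z = of_real (exp x * \<mu>) * (cis \<eta> + of_real (s / \<mu> * exp (- x)))" using \<mu> by (simp add: z_def algebra_simps exp_minus)
      then show ?thesis using \<mu> by simp
    qed
    finally show "(LINT t|lborel. f t x) = mld x / (cis \<eta> + of_real (s / \<mu> * exp (- x)))" .
  qed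
  also have "... = (LINT x|lborel. mld (x + ln (s / \<mu>)) / (cis \<eta> + of_real (exp (- x))))"
  proof -
    have "s / \<mu> * exp (- (x + ln (s / \<mu>))) = exp (- x)" for x using s \<mu> by (simp add: exp_diff exp_minus)
    then show ?thesis using lborel_integral_real_affine[of 1 "\<lambda>x. mld x / (cis \<eta> + of_real (s / \<mu> * exp (- x)))" "ln (s / \<mu>)"] by (simp add: add.commute)
  qed
  also have "... = 1 / (of_real (exp (\<alpha> * ln (s / \<mu>))) + \<i>)" by (rule ml_density_stieltjes)
  also have "exp (\<alpha> * ln (s / \<mu>)) = (s / \<mu>) powr \<alpha>" using s \<mu> by (simp add: powr_def)
  finally show ?thesis .
qed

text \<open>The limit s \<rightarrow> 0 of the Laplace transform, in which the power of
  \<open>s\<close> disappears and 1 / \<i> remains.\<close>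

lemma integral_ml_kernel:
  assumes \<mu>: "\<mu> > 0"
  shows "(LINT t|lborel. ml_kernel \<alpha> \<mu> t) = - \<i>"
proof -
  define s where "s n = 1 / real (Suc n)" for n
  have s: "s n > 0" for n by (simp add: s_def)
  have s0: "s \<longlonglongrightarrow> 0" unfolding s_def by (rule LIMSEQ_Suc[OF lim_1_over_n])
  have "(\<lambda>n. laplace (ml_kernel \<alpha> \<mu>) (s n)) \<longlonglongrightarrow> (LINT t|lborel. ml_kernel \<alpha> \<mu> t)" unfolding laplace_def
  proof (rule integral_dominated_convergence[where w="\<lambda>t. norm (ml_kernel \<alpha> \<mu> t)"])
    show "AE t in lborel. (\<lambda>n. of_real (exp (- s n * t)) * ml_kernel \<alpha> \<mu> t) \<longlonglongrightarrow> ml_kernel \<alpha> \<mu> t"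
    proof (rule AE_I2)
      fix t
      have "(\<lambda>n. of_real (exp (- s n * t)) * ml_kernel \<alpha> \<mu> t) \<longlonglongrightarrow> of_real (exp (- 0 * t)) * ml_kernel \<alpha> \<mu> t"
        by (intro tendsto_intros s0)
      then show "(\<lambda>n. of_real (exp (- s n * t)) * ml_kernel \<alpha> \<mu> t) \<longlonglongrightarrow> ml_kernel \<alpha> \<mu> t" by simp
    qed
    show "AE t in lborel. norm (of_real (exp (- s n * t)) * ml_kernel \<alpha> \<mu> t) \<le> norm (ml_kernel \<alpha> \<mu> t)" for n
    proof (rule AE_I2)
      fix t
      show "norm (of_real (exp (- s n * t)) * ml_kernel \<alpha> \<mu> t) \<le> norm (ml_kernel \<alpha> \<mu> t)"
        using s[of n] by (cases "t \<le> 0") (auto simp: norm_mult ml_kernel_def intro!: mult_left_le_one_le)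
    qed
  qed (use integrable_ml_kernel[OF \<mu>] in auto)
  moreover have "(\<lambda>n. laplace (ml_kernel \<alpha> \<mu>) (s n)) \<longlonglongrightarrow> - \<i>"
  proof -
    have "(\<lambda>n. (s n / \<mu>) powr \<alpha>) \<longlonglongrightarrow> (0 / \<mu>) powr \<alpha>"
      using \<mu> \<alpha> s by (intro tendsto_powr2 tendsto_intros s0) (auto intro!: always_eventually less_imp_le)
    then have "(\<lambda>n. 1 / (of_real ((s n / \<mu>) powr \<alpha>) + \<i>)) \<longlonglongrightarrow> 1 / (of_real ((0 / \<mu>) powr \<alpha>) + \<i>)"
      by (intro tendsto_divide tendsto_add tendsto_of_real tendsto_const) (use \<mu> in auto)
    then show ?thesis using laplace_ml_kernel[OF \<mu> s] \<alpha> by (simp add: field_simps)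
  qed
  ultimately show ?thesis by (rule LIMSEQ_unique)
qed

text \<open>The density is at most a multiple of exp (\<alpha> x). Shifting \<open>x\<close> by ln
  (\<mu> T) extracts the factor (\<mu> T) powr (- \<alpha>) and leaves a convergent integral without
  parameters.\<close>

lemma ml_majorant_tail_bound:
  "\<exists>C>0. \<forall>\<mu>>0. \<forall>T>0. (\<integral>t. indicator {T<..} t * ml_majorant \<alpha> \<mu> t) \<le> ennreal (C / (\<mu> * T) powr \<alpha>)"
proof -
  obtain B where B: "B > 0" "\<And>x. norm (mld x) \<le> B * exp (- \<alpha> * \<bar>x\<bar>)" using ml_density_bound by blast
  define c where "c = cos \<eta>"
  have c: "c > 0" using cos_\<eta>_pos by (simp add: c_def)
  \<comment> \<open>The remaining integrand decays with rate \<alpha> on the left and, because exp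
    (- c exp x) is at most 1 / (c exp x), with rate 1 - \<alpha> on the right.\<close>
  define \<delta> where "\<delta> = min \<alpha> (1 - \<alpha>)"
  have \<delta>: "\<delta> > 0" using \<alpha> by (simp add: \<delta>_def)
  define D where "D = (LINT x|lborel. exp (- \<delta> * \<bar>x\<bar>))"
  have D: "(\<integral>x. ennreal (exp (- \<delta> * \<bar>x\<bar>))) = ennreal D" unfolding D_def by (intro nn_integral_eq_integral integrable_exp_neg_abs \<delta>) auto
  have D0: "D \<ge> 0" by (simp add: D_def)
  define E where "E = B / c * (1 + 1 / c)"
  have E: "E > 0" using B(1) c unfolding E_def by (intro mult_pos_pos divide_pos_pos add_pos_pos) auto
  have "(\<integral>t. indicator {T<..} t * ml_majorant \<alpha> \<mu> t) \<le> ennreal ((E * D + 1) / (\<mu> * T) powr \<alpha>)"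
    if \<mu>: "\<mu> > 0" and T: "T > 0" for \<mu> T
  proof -
    define y where "y = \<mu> * T"
    have y: "y > 0" using that by (simp add: y_def)
    have "(\<integral>t. indicator {T<..} t * ml_majorant \<alpha> \<mu> t) \<le>
      (\<integral>x. ennreal (B / c * exp (\<alpha> * x) * exp (- (exp x * y * c))))" unfolding nn_integral_ml_majorant_tail[OF \<mu> less_imp_le[OF T]]
    proof (intro nn_integral_mono ennreal_leI)
      fix x
      have "norm (mld x) \<le> B * exp (- \<alpha> * \<bar>x\<bar>)" by (rule B)
      also have "... \<le> B * exp (\<alpha> * x)"
      proof -
        have "\<alpha> * (- \<bar>x\<bar>) \<le> \<alpha> * x" using \<alpha> by (intro mult_left_mono) auto
        then show ?thesis using B by simp
      qed
      finally have "norm (mld x) * (exp (- (exp x * y * c)) / c) \<le> B * exp (\<alpha> * x) * (exp (- (exp x * y * c)) / c)" using c by (intro mult_right_mono) auto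
      then show "norm (mld x) * (exp (- (exp x * \<mu> * cos \<eta>) * T) / cos \<eta>) \<le>
        B / c * exp (\<alpha> * x) * exp (- (exp x * y * c))" by (simp add: y_def c_def mult_ac)
    qed
    also have "... = (\<integral>x. ennreal (B / c * exp (\<alpha> * (- ln y + x)) * exp (- (exp (- ln y + x) * y * c))))"
      using nn_integral_real_affine[of "\<lambda>x. ennreal (B / c * exp (\<alpha> * x) * exp (- (exp x * y * c)))" 1 "- ln y"] by simp
    also have "... \<le> (\<integral>x. ennreal (E / y powr \<alpha>) * ennreal (exp (- \<delta> * \<bar>x\<bar>)))"
    proof (rule nn_integral_mono)
      fix x
      have 1: "exp (- ln y + x) * y = exp x" using y by (simp add: exp_add exp_minus exp_diff)
      have 2: "exp (\<alpha> * (- ln y + x)) = exp (\<alpha> * x) / y powr \<alpha>" using y by (simp add: powr_def algebra_simps exp_add exp_diff exp_minus)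
      have 3: "exp (\<alpha> * x) * exp (- (exp x * c)) \<le> (1 + 1 / c) * exp (- \<delta> * \<bar>x\<bar>)"
      proof (cases "x \<ge> 0")
        case True
        have "exp x * c \<le> exp (exp x * c)" using exp_ge_add_one_self[of "exp x * c"] by linarith
        then have "exp (- (exp x * c)) \<le> 1 / (exp x * c)" unfolding exp_minus inverse_eq_divide using c by (intro divide_left_mono mult_pos_pos) auto
        then have "exp (\<alpha> * x) * exp (- (exp x * c)) \<le> exp (\<alpha> * x) * (1 / (exp x * c))" by (intro mult_left_mono) auto
        also have "... = 1 / c * exp (- ((1 - \<alpha>) * x))" by (simp add: algebra_simps exp_diff exp_minus divide_simps flip: exp_add)
        also have "... \<le> 1 / c * exp (- \<delta> * \<bar>x\<bar>)" using True c by (intro mult_left_mono) (auto simp: \<delta>_def intro!: mult_right_mono)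
        also have "... \<le> (1 + 1 / c) * exp (- \<delta> * \<bar>x\<bar>)" by (intro mult_right_mono) auto
        finally show ?thesis .
      next
        case False
        have "exp (\<alpha> * x) * exp (- (exp x * c)) \<le> exp (\<alpha> * x) * 1" using c by (intro mult_left_mono) auto
        also have "... \<le> exp (- \<delta> * \<bar>x\<bar>)" using False by (auto simp: \<delta>_def intro!: mult_right_mono_neg)
        also have "... \<le> (1 + 1 / c) * exp (- \<delta> * \<bar>x\<bar>)" using c by simp
        finally show ?thesis .
      qed
      have "B / c * exp (\<alpha> * (- ln y + x)) * exp (- (exp (- ln y + x) * y * c)) =
        B / c / y powr \<alpha> * (exp (\<alpha> * x) * exp (- (exp x * c)))" unfolding 1 2 by simp
      also have "... \<le> B / c / y powr \<alpha> * ((1 + 1 / c) * exp (- \<delta> * \<bar>x\<bar>))" using B c by (intro mult_left_mono 3) auto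
      also have "... = E / y powr \<alpha> * exp (- \<delta> * \<bar>x\<bar>)" by (simp add: E_def)
      finally show "ennreal (B / c * exp (\<alpha> * (- ln y + x)) * exp (- (exp (- ln y + x) * y * c))) \<le>
        ennreal (E / y powr \<alpha>) * ennreal (exp (- \<delta> * \<bar>x\<bar>))" using E by (simp add: ennreal_leI flip: ennreal_mult)
    qed
    also have "... = ennreal (E / y powr \<alpha>) * ennreal D" unfolding D[symmetric] by (rule nn_integral_cmult) measurable
    also have "... = ennreal (E * D / y powr \<alpha>)" using E D0 by (simp flip: ennreal_mult)
    also have "... \<le> ennreal ((E * D + 1) / y powr \<alpha>)" by (intro ennreal_leI divide_right_mono) auto
    finally show ?thesis by (simp add: y_def)
  qed
  moreover have "E * D + 1 > 0" using E D0 by (simp add: add_nonneg_pos)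
  ultimately show ?thesis by blast
qed

end

section \<open>Spectral decomposition of the operator\<close>

lemma cinner_add_right: "cinner x (y + z) = cinner x y + cinner (x :: 'a::complex_hilbert) z" by (metis cinner_add_left cinner_commute complex_cnj_add)

lemma cinner_scaleC_right: "cinner x (c *\<^sub>C y) = cnj c * cinner (x :: 'a::complex_hilbert) y" by (metis cinner_commute cinner_scaleC_left complex_cnj_mult)

lemma cinner_scaleR_left: "cinner (r *\<^sub>R x) y = r *\<^sub>R cinner (x :: 'a::complex_hilbert) y" by (metis cinner_scaleC_left scaleC_of_real scaleR_conv_of_real)

lemma cinner_scaleR_right: "cinner x (r *\<^sub>R y) = r *\<^sub>R cinner (x :: 'a::complex_hilbert) y"
  by (metis cinner_scaleC_right scaleC_of_real scaleR_conv_of_real complex_cnj_complex_of_real)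

lemma norm_scaleC: "norm (c *\<^sub>C x) = cmod c * norm (x :: 'a::complex_hilbert)"
proof -
  have "complex_of_real ((norm (c *\<^sub>C x))\<^sup>2) = c * cnj c * of_real ((norm x)\<^sup>2)"
    by (simp only: cinner_self[symmetric] cinner_scaleC_left cinner_scaleC_right mult_ac)
  also have "... = complex_of_real ((cmod c * norm x)\<^sup>2)" by (simp add: complex_norm_square power_mult_distrib flip: of_real_power)
  finally have "(norm (c *\<^sub>C x))\<^sup>2 = (cmod c * norm x)\<^sup>2" by (simp only: of_real_eq_iff)
  then show ?thesis by (rule power2_eq_imp_eq) auto
qed

lemma cinner_zero_left [simp]: "cinner 0 (x :: 'a::complex_hilbert) = 0" using cinner_scaleR_left[of 0 0 x] by simp

lemma cinner_zero_right [simp]: "cinner (x :: 'a::complex_hilbert) 0 = 0" using cinner_scaleR_right[of x 0 0] by simp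

lemma cinner_minus_left: "cinner (- x) y = - cinner (x :: 'a::complex_hilbert) y" using cinner_scaleR_left[of "-1" x y] by simp

lemma cinner_diff_left: "cinner (x - y) z = cinner x z - cinner (y :: 'a::complex_hilbert) z" using cinner_add_left[of x "- y" z] by (simp add: cinner_minus_left)

lemma cinner_diff_right: "cinner z (x - y) = cinner z x - cinner z (y :: 'a::complex_hilbert)" by (metis cinner_commute cinner_diff_left complex_cnj_diff)

lemma cinner_Cauchy_Schwarz: "cmod (cinner x y) \<le> norm x * norm (y :: 'a::complex_hilbert)"
proof (cases "y = 0")
  case False
  define c where "c = cinner x y / of_real ((norm y)\<^sup>2)"
  have ny: "norm y > 0" using False by simp
  have "complex_of_real ((norm (x - c *\<^sub>C y))\<^sup>2) =
    of_real ((norm x)\<^sup>2) - cnj c * cinner x y - c * (cnj (cinner x y) - cnj c * of_real ((norm y)\<^sup>2))"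
    by (simp only: cinner_self[symmetric] cinner_diff_left cinner_diff_right cinner_scaleC_left cinner_scaleC_right
        cinner_commute[of y x]) (simp add: algebra_simps)
  also have "cnj c * of_real ((norm y)\<^sup>2) = cnj (cinner x y)" using ny by (simp add: c_def)
  also have "cnj c * cinner x y = of_real ((cmod (cinner x y))\<^sup>2 / (norm y)\<^sup>2)" by (simp add: c_def complex_norm_square mult.commute flip: of_real_power)
  finally have "complex_of_real ((norm (x - c *\<^sub>C y))\<^sup>2) = of_real ((norm x)\<^sup>2 - (cmod (cinner x y))\<^sup>2 / (norm y)\<^sup>2)" by simp
  then have "(norm (x - c *\<^sub>C y))\<^sup>2 = (norm x)\<^sup>2 - (cmod (cinner x y))\<^sup>2 / (norm y)\<^sup>2" by (simp only: of_real_eq_iff)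
  then have "(cmod (cinner x y))\<^sup>2 / (norm y)\<^sup>2 \<le> (norm x)\<^sup>2" by (metis diff_ge_0_iff_ge zero_le_power2)
  then have "(cmod (cinner x y))\<^sup>2 \<le> (norm x * norm y)\<^sup>2" using ny by (simp add: field_simps power_mult_distrib)
  then show ?thesis by (rule power2_le_imp_le) simp
qed simp

lemma bounded_bilinear_cinner: "bounded_bilinear (cinner :: 'a::complex_hilbert => 'a => complex)" by (rule bounded_bilinear.intro)
    (auto simp: cinner_add_left cinner_add_right cinner_scaleR_left cinner_scaleR_right
      intro!: exI[of _ 1] cinner_Cauchy_Schwarz)

lemma bounded_bilinear_scaleC: "bounded_bilinear (scaleC :: complex => 'a::complex_hilbert => 'a)"
proof (rule bounded_bilinear.intro)
  show "(r *\<^sub>R a) *\<^sub>C b = r *\<^sub>R a *\<^sub>C b" for r and a :: complex and b :: 'a by (simp add: scaleR_conv_of_real scaleC_of_real[symmetric] scaleC_scaleC)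
  show "a *\<^sub>C r *\<^sub>R b = r *\<^sub>R a *\<^sub>C b" for r and a :: complex and b :: 'a by (simp add: scaleC_of_real[symmetric] scaleC_scaleC mult.commute)
qed (auto simp: scaleC_add_left scaleC_add_right norm_scaleC intro!: exI[of _ 1])

lemmas tendsto_cinner [tendsto_intros] = bounded_bilinear.tendsto[OF bounded_bilinear_cinner]
lemmas bounded_linear_cinner_left = bounded_bilinear.bounded_linear_left[OF bounded_bilinear_cinner]
lemmas tendsto_scaleC [tendsto_intros] = bounded_bilinear.tendsto[OF bounded_bilinear_scaleC]
lemmas bounded_linear_scaleC_right = bounded_bilinear.bounded_linear_right[OF bounded_bilinear_scaleC]

lemma scaleC_one [simp]: "1 *\<^sub>C x = (x :: 'a::complex_hilbert)" using scaleC_of_real[of 1 x] by simp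

lemma scaleC_zero_left [simp]: "0 *\<^sub>C x = (0 :: 'a::complex_hilbert)" using scaleC_of_real[of 0 x] by simp

lemma scaleC_zero_right [simp]: "c *\<^sub>C (0 :: 'a::complex_hilbert) = 0" by (rule bounded_bilinear.zero_right[OF bounded_bilinear_scaleC])

lemma power2_norm_add:
  "(norm (x + y))\<^sup>2 = (norm x)\<^sup>2 + 2 * Re (cinner x y) + (norm (y :: 'a::complex_hilbert))\<^sup>2"
proof -
  have "complex_of_real ((norm (x + y))\<^sup>2) = cinner x x + (cinner x y + cnj (cinner x y)) + cinner y y"
    by (simp only: cinner_self[symmetric] cinner_add_left cinner_add_right cinner_commute[of y x] add_ac)
  also have "... = of_real ((norm x)\<^sup>2 + 2 * Re (cinner x y) + (norm y)\<^sup>2)" by (simp add: cinner_self complex_add_cnj)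
  finally show ?thesis by (simp only: of_real_eq_iff)
qed

lemma parallelogram_law:
  "(norm (x + y))\<^sup>2 + (norm (x - y))\<^sup>2 = 2 * (norm x)\<^sup>2 + 2 * (norm (y :: 'a::complex_hilbert))\<^sup>2"
proof -
  have "cinner x (- y) = - cinner x y" using cinner_diff_right[of x 0 y] by simp
  then show ?thesis using power2_norm_add[of x y] power2_norm_add[of x "- y"] by simp
qed

lemma csubspace_diff: "csubspace M ==> x \<in> M ==> y \<in> M ==> x - y \<in> M"
  using scaleC_of_real[of "-1" y] unfolding csubspace_def by (metis diff_conv_add_uminus scaleR_minus1_left)

lemma csubspace_scaleR: "csubspace M ==> x \<in> M ==> r *\<^sub>R x \<in> M" unfolding csubspace_def by (metis scaleC_of_real)

text \<open>Projection theorem: a minimizing sequence for the distance from \<open>x\<close> to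
  \<open>M\<close> is Cauchy by the parallelogram law, and \<open>x\<close> minus its limit is
  orthogonal to \<open>M\<close>.\<close>

lemma orthogonal_vector_exists:
  fixes M :: "'a::complex_hilbert set"
  assumes M: "csubspace M" "closed M" and x: "x \<notin> M"
  shows "\<exists>v. v \<noteq> 0 \<and> (\<forall>y\<in>M. cinner y v = 0)"
proof -
  have M0: "M \<noteq> {}" using M by (auto simp: csubspace_def)
  define d where "d = infdist x M"
  have d: "d \<le> norm (x - y)" if "y \<in> M" for y using infdist_le[OF that, of x] by (simp add: d_def dist_norm)
  have "\<exists>y\<in>M. norm (x - y) < d + 1 / real (Suc n)" for n
  proof (rule ccontr)
    assume "\<not> ?thesis"
    then have "d + 1 / real (Suc n) \<le> dist x y" if "y \<in> M" for y using that by (force simp: dist_norm not_less)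
    then have "d + 1 / real (Suc n) \<le> infdist x M" unfolding infdist_def using M0 by (auto intro: cINF_greatest)
    then show False by (simp add: d_def)
  qed
  then obtain y where y: "\<And>n. y n \<in> M" "\<And>n. norm (x - y n) < d + 1 / real (Suc n)" by metis
  have d0: "d \<ge> 0" by (simp add: d_def infdist_nonneg)
  have close: "(norm (y n - y m))\<^sup>2 \<le> 4 * (d + 1 / real (Suc N))\<^sup>2 - 4 * d\<^sup>2" if "n \<ge> N" "m \<ge> N" for n m N
  proof -
    have le: "norm (x - y k) \<le> d + 1 / real (Suc N)" if "k \<ge> N" for k
    proof -
      have "1 / real (Suc k) \<le> 1 / real (Suc N)" using that by (intro divide_left_mono) auto
      then show ?thesis using y(2)[of k] by linarith
    qed
    have "(1 / 2) *\<^sub>R (y n + y m) \<in> M" using M y by (auto simp: csubspace_def intro!: csubspace_scaleR)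
    then have "d \<le> norm (x - (1 / 2) *\<^sub>R (y n + y m))" by (rule d)
    then have "(2 * d)\<^sup>2 \<le> (2 * norm (x - (1 / 2) *\<^sub>R (y n + y m)))\<^sup>2" using d0 by (intro power_mono) auto
    also have "2 * norm (x - (1 / 2) *\<^sub>R (y n + y m)) = norm (2 *\<^sub>R (x - (1 / 2) *\<^sub>R (y n + y m)))" by simp
    also have "2 *\<^sub>R (x - (1 / 2) *\<^sub>R (y n + y m)) = (x - y n) + (x - y m)" by (simp add: scaleR_2 algebra_simps)
    finally have 1: "4 * d\<^sup>2 \<le> (norm ((x - y n) + (x - y m)))\<^sup>2" by (simp add: power_mult_distrib)
    have 2: "(norm ((x - y n) + (x - y m)))\<^sup>2 + (norm (y m - y n))\<^sup>2 = 2 * (norm (x - y n))\<^sup>2 + 2 * (norm (x - y m))\<^sup>2"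
      using parallelogram_law[of "x - y n" "x - y m"] by simp
    have 3: "(norm (x - y n))\<^sup>2 \<le> (d + 1 / real (Suc N))\<^sup>2" "(norm (x - y m))\<^sup>2 \<le> (d + 1 / real (Suc N))\<^sup>2"
      using le that by (auto intro: power_mono)
    show ?thesis using 1 2 3 by (simp add: norm_minus_commute)
  qed
  have "Cauchy y"
  proof (rule metric_CauchyI)
    fix e :: real assume e: "e > 0"
    have "(\<lambda>N. 4 * (d + 1 / real (Suc N))\<^sup>2 - 4 * d\<^sup>2) \<longlonglongrightarrow> 4 * (d + 0)\<^sup>2 - 4 * d\<^sup>2"
      by (intro tendsto_intros LIMSEQ_Suc[OF lim_1_over_n])
    then have "\<forall>\<^sub>F N in sequentially. 4 * (d + 1 / real (Suc N))\<^sup>2 - 4 * d\<^sup>2 < e\<^sup>2" using e by (intro order_tendstoD) auto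
    then obtain N where N: "4 * (d + 1 / real (Suc N))\<^sup>2 - 4 * d\<^sup>2 < e\<^sup>2" by (auto simp: eventually_sequentially)
    have "dist (y m) (y n) < e" if "m \<ge> N" "n \<ge> N" for m n
    proof -
      have "(norm (y m - y n))\<^sup>2 < e\<^sup>2" using close[OF that] N by linarith
      then show ?thesis using e by (simp add: dist_norm power_less_imp_less_base)
    qed
    then show "\<exists>M. \<forall>m\<ge>M. \<forall>n\<ge>M. dist (y m) (y n) < e" by blast
  qed
  then obtain m where m: "y \<longlonglongrightarrow> m" using Cauchy_convergent convergent_def by blast
  have mM: "m \<in> M" using closed_sequentially[OF M(2) _ m] y by blast
  have "(\<lambda>n. norm (x - y n)) \<longlonglongrightarrow> norm (x - m)" by (intro tendsto_intros m)
  moreover have "(\<lambda>n. d + 1 / real (Suc n)) \<longlonglongrightarrow> d + 0" by (intro tendsto_intros LIMSEQ_Suc[OF lim_1_over_n])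
  ultimately have "norm (x - m) \<le> d + 0" by (rule LIMSEQ_le) (use y(2) less_imp_le in blast)
  then have nd: "norm (x - m) \<le> norm (x - z)" if "z \<in> M" for z using d[OF that] by linarith
  define v where "v = x - m"
  have "v \<noteq> 0" using x mM by (auto simp: v_def)
  moreover have "cinner z v = 0" if z: "z \<in> M" for z
  proof (cases "z = 0")
    case False
    \<comment> \<open>The coefficient of the projection of \<open>v\<close> onto \<open>z\<close>:
      moving \<open>m\<close> by this multiple of \<open>z\<close> would shorten the distance unless
      it is zero.\<close>
    define c where "c = cinner v z / of_real ((norm z)\<^sup>2)"
    have nz: "norm z > 0" using False by simp
    have "m + c *\<^sub>C z \<in> M" using M(1) mM z by (simp add: csubspace_def)
    from nd[OF this] have "norm v \<le> norm (v - c *\<^sub>C z)" by (simp add: v_def algebra_simps)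
    then have le: "(norm v)\<^sup>2 \<le> (norm (v - c *\<^sub>C z))\<^sup>2" by (intro power_mono) auto
    have "(norm (v - c *\<^sub>C z))\<^sup>2 = (norm v)\<^sup>2 + 2 * Re (cinner v (- (c *\<^sub>C z))) + (norm (c *\<^sub>C z))\<^sup>2"
      using power2_norm_add[of v "- (c *\<^sub>C z)"] by simp
    also have "cinner v (- (c *\<^sub>C z)) = - (cnj c * cinner v z)" using cinner_diff_right[of v 0 "c *\<^sub>C z"] by (simp add: cinner_scaleC_right)
    also have "cnj c * cinner v z = of_real ((cmod (cinner v z))\<^sup>2 / (norm z)\<^sup>2)" by (simp add: c_def complex_norm_square mult.commute flip: of_real_power)
    also have "(norm (c *\<^sub>C z))\<^sup>2 = (cmod (cinner v z))\<^sup>2 / (norm z)\<^sup>2"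
    proof -
      have "cmod c = cmod (cinner v z) / (norm z)\<^sup>2" by (simp add: c_def norm_divide del: of_real_power)
      then show ?thesis using nz by (simp add: norm_scaleC power2_eq_square)
    qed
    finally have "(cmod (cinner v z))\<^sup>2 / (norm z)\<^sup>2 \<le> 0" using le by simp
    then have "cinner v z = 0" using nz by (simp add: divide_le_0_iff)
    then show ?thesis by (subst cinner_commute) simp
  qed simp
  ultimately show ?thesis by blast
qed

section \<open>The inverse of the negative operator and its eigenvectors\<close>

locale negative_operator =
  fixes A :: "'a::complex_hilbert => 'a" and D :: "'a set"
  assumes sa: "self_adjoint A D" and nd: "negative_definite A D" and cr: "compact_resolvent A D"
begin

lemma D_subspace: "csubspace D" and A_linear: "clinear_on D A"
  and graph: "adjoint_graph A D = {(u, A u) |u. u \<in> D}" using sa by (auto simp: self_adjoint_def)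

lemma A_symmetric: "u \<in> D ==> v \<in> D ==> cinner (A u) v = cinner u (A v)" using graph by (auto simp: adjoint_graph_def)

text \<open>Maximality of the domain, the half of self-adjointness that proves membership in
  \<open>D\<close>; closedness and surjectivity rest on it.\<close>

lemma A_graph: "(\<And>u. u \<in> D ==> cinner (A u) v = cinner u w) ==> v \<in> D \<and> A v = w"
proof -
  assume "\<And>u. u \<in> D ==> cinner (A u) v = cinner u w"
  then have "(v, w) \<in> adjoint_graph A D" by (simp add: adjoint_graph_def)
  then show "v \<in> D \<and> A v = w" unfolding graph by auto
qed

lemma A_add: "x \<in> D ==> y \<in> D ==> A (x + y) = A x + A y"
  and A_scaleC: "x \<in> D ==> A (c *\<^sub>C x) = c *\<^sub>C A x" using A_linear by (auto simp: clinear_on_def)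

lemma A_scaleR: "x \<in> D ==> A (r *\<^sub>R x) = r *\<^sub>R A x" using A_scaleC[of x "of_real r"] by (simp add: scaleC_of_real)

lemma A_diff: "x \<in> D ==> y \<in> D ==> A (x - y) = A x - A y" using A_add[of x "-1 *\<^sub>R y"] A_scaleR[of y "-1"] csubspace_scaleR[OF D_subspace, of y "-1"] by simp

lemma A_eq_0: "u \<in> D ==> A u = 0 ==> u = 0" using nd by (force simp: negative_definite_def)

lemma A_closed:
  assumes u: "\<And>n. u n \<in> D" "u \<longlonglongrightarrow> x" "(\<lambda>n. A (u n)) \<longlonglongrightarrow> w"
  shows "x \<in> D \<and> A x = w"
proof (rule A_graph)
  fix v assume v: "v \<in> D"
  have "(\<lambda>n. cinner (A v) (u n)) \<longlonglongrightarrow> cinner (A v) x" by (intro tendsto_intros u)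
  moreover have "(\<lambda>n. cinner v (A (u n))) \<longlonglongrightarrow> cinner v w" by (intro tendsto_intros u)
  ultimately show "cinner (A v) x = cinner v w" using A_symmetric[OF v u(1)] LIMSEQ_unique by auto
qed

text \<open>A sequence bounded in the graph norm is the image of the bounded sequence z u - A u
  under the compact resolvent.\<close>

lemma compact_sequence:
  assumes u: "\<And>n. u n \<in> D" and b: "\<And>n. norm (u n) \<le> B" "\<And>n. norm (A (u n)) \<le> B"
  shows "\<exists>r x. strict_mono (r :: nat => nat) \<and> (\<lambda>n. u (r n)) \<longlonglongrightarrow> x"
proof -
  obtain z where z: "z \<in> resolvent_set A D" and K: "compact_operator (resolvent A D z)" using cr by (auto simp: compact_resolvent_def)
  define S where "S = range (\<lambda>n. z *\<^sub>C u n - A (u n))"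
  have "inj_on (\<lambda>u. z *\<^sub>C u - A u) D" using z by (auto simp: resolvent_set_def bij_betw_def)
  then have R: "resolvent A D z (z *\<^sub>C u n - A (u n)) = u n" for n using inv_into_f_f[OF _ u[of n]] by (simp add: resolvent_def)
  have "norm (z *\<^sub>C u n - A (u n)) \<le> cmod z * B + B" for n using norm_triangle_ineq4[of "z *\<^sub>C u n" "A (u n)"] b(2)[of n] mult_left_mono[OF b(1)[of n], of "cmod z"]
    by (simp add: norm_scaleC)
  then have "bounded S" unfolding bounded_iff S_def by blast
  then have "compact (closure (resolvent A D z ` S))" using K by (simp add: compact_operator_def)
  moreover have "\<forall>n. u n \<in> closure (resolvent A D z ` S)"
  proof
    fix n
    have "resolvent A D z (z *\<^sub>C u n - A (u n)) \<in> resolvent A D z ` S" unfolding S_def by (intro imageI rangeI)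
    then show "u n \<in> closure (resolvent A D z ` S)" using R[of n] closure_subset by (metis subsetD)
  qed
  ultimately obtain x r where "strict_mono (r :: nat => nat)" "(u \<circ> r) \<longlonglongrightarrow> x" unfolding compact_def by blast
  then show ?thesis by (auto simp: o_def)
qed

text \<open>Otherwise there are unit vectors with A u tending to 0; by compactness a subsequence
  converges, and its limit is a unit vector in the kernel, contradicting negative
  definiteness.\<close>

lemma A_lower_bound: "\<exists>c>0. \<forall>u\<in>D. c * norm u \<le> norm (A u)"
proof (rule ccontr)
  assume "\<not> ?thesis"
  then have "\<exists>u\<in>D. norm (A u) < 1 / real (Suc n) * norm u" for n by (metis not_le of_nat_0_less_iff zero_less_Suc zero_less_divide_1_iff)
  then obtain w where w: "\<And>n. w n \<in> D" "\<And>n. norm (A (w n)) < 1 / real (Suc n) * norm (w n)" by metis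
  have wn: "norm (w n) > 0" for n using w(2)[of n] by (metis mult_zero_right norm_ge_zero norm_zero not_le order_less_le zero_less_norm_iff)
  define u where "u n = (1 / norm (w n)) *\<^sub>R w n" for n
  have u: "u n \<in> D" "norm (u n) = 1" "norm (A (u n)) \<le> 1 / real (Suc n)" for n
  proof -
    show "u n \<in> D" unfolding u_def by (intro csubspace_scaleR D_subspace w)
    show "norm (u n) = 1" using wn[of n] by (simp add: u_def)
    have "norm (A (u n)) = norm (A (w n)) / norm (w n)" unfolding u_def A_scaleR[OF w(1)] using wn[of n] by (simp add: divide_inverse mult.commute)
    also have "... \<le> 1 / real (Suc n)" using w(2)[of n] wn[of n] by (simp add: field_simps)
    finally show "norm (A (u n)) \<le> 1 / real (Suc n)" .
  qed
  have "norm (A (u n)) \<le> 1" for n using u(3)[of n] by (rule order_trans) simp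
  then obtain r x where r: "strict_mono r" "(\<lambda>n. u (r n)) \<longlonglongrightarrow> x" using compact_sequence[of u 1] u by auto
  have "(\<lambda>n. A (u n)) \<longlonglongrightarrow> 0" by (rule Lim_null_comparison[OF _ LIMSEQ_Suc[OF lim_1_over_n]]) (use u in auto)
  then have "(\<lambda>n. A (u (r n))) \<longlonglongrightarrow> 0" using r(1) LIMSEQ_subseq_LIMSEQ[of _ 0 r] by (auto simp: o_def)
  then have "x \<in> D \<and> A x = 0" using A_closed[of "\<lambda>n. u (r n)" x 0] u r by auto
  then have "x = 0" using A_eq_0 by blast
  moreover have "norm x = 1" using tendsto_norm[OF r(2)] u(2) by (simp add: LIMSEQ_const_iff)
  ultimately show False by simp
qed

text \<open>The lower bound makes the range closed. A vector orthogonal to the range lies in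
  \<open>D\<close> and is annihilated by \<open>A\<close>, so it is zero.\<close>

lemma A_surj: "\<exists>u\<in>D. A u = y"
proof (rule ccontr)
  assume y: "\<not> ?thesis"
  obtain c where c: "c > 0" "\<And>u. u \<in> D ==> c * norm u \<le> norm (A u)" using A_lower_bound by blast
  define M where "M = A ` D"
  have "csubspace M" unfolding csubspace_def M_def
  proof (intro conjI ballI allI)
    show "0 \<in> A ` D" using A_scaleR[of 0 0] D_subspace by (force simp: csubspace_def)
    show "x + y \<in> A ` D" if "x \<in> A ` D" "y \<in> A ` D" for x y using that D_subspace by (auto simp: csubspace_def A_add[symmetric])
    show "c *\<^sub>C x \<in> A ` D" if "x \<in> A ` D" for c x using that D_subspace by (auto simp: csubspace_def A_scaleC[symmetric])
  qed
  moreover have "closed M" unfolding closed_sequential_limits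
  proof (intro allI impI)
    fix f l assume f: "(\<forall>n. f n \<in> M) \<and> f \<longlonglongrightarrow> l"
    then have "\<exists>u. \<forall>n. u n \<in> D \<and> f n = A (u n)" by (intro choice) (auto simp: M_def)
    then obtain u where u: "\<And>n. u n \<in> D" "\<And>n. f n = A (u n)" by blast
    have "Cauchy u"
    proof (rule metric_CauchyI)
      fix e :: real assume e: "e > 0"
      have "Cauchy f" using f by (intro LIMSEQ_imp_Cauchy) auto
      then obtain N where N: "\<And>m n. m \<ge> N ==> n \<ge> N ==> dist (f m) (f n) < c * e" using c e by (meson metric_CauchyD mult_pos_pos)
      have "dist (u m) (u n) < e" if "m \<ge> N" "n \<ge> N" for m n
      proof -
        have "c * norm (u m - u n) \<le> norm (A (u m - u n))" by (intro c csubspace_diff D_subspace u)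
        also have "... = dist (f m) (f n)" by (simp add: A_diff u dist_norm)
        also have "... < c * e" by (rule N[OF that])
        finally show ?thesis using c by (simp add: dist_norm)
      qed
      then show "\<exists>M. \<forall>m\<ge>M. \<forall>n\<ge>M. dist (u m) (u n) < e" by blast
    qed
    then obtain x where x: "u \<longlonglongrightarrow> x" using Cauchy_convergent convergent_def by blast
    have "f = (\<lambda>n. A (u n))" using u by auto
    then have "x \<in> D \<and> A x = l" using f by (intro A_closed[OF u(1) x]) auto
    then show "l \<in> M" by (auto simp: M_def)
  qed
  moreover have "y \<notin> M" using y by (auto simp: M_def)
  ultimately obtain v where v: "v \<noteq> 0" "\<And>w. w \<in> M ==> cinner w v = 0" using orthogonal_vector_exists by blast
  have "v \<in> D \<and> A v = 0" by (rule A_graph) (use v in \<open>auto simp: M_def\<close>)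
  then show False using A_eq_0 v by blast
qed

text \<open>The inverse of \<open>- A\<close>, a compact, symmetric and positive operator; the
  spectral decomposition is carried out for it.\<close>

definition G :: "'a => 'a" where "G y = (SOME u. u \<in> D \<and> A u = - y)"

lemma G: "G y \<in> D" "A (G y) = - y" using A_surj[of "- y"] unfolding G_def by (metis (mono_tags, lifting) someI_ex)+

lemma G_A: "u \<in> D ==> G (A u) = - u"
proof -
  assume u: "u \<in> D"
  have "G (A u) + u \<in> D" using D_subspace G(1) u by (simp add: csubspace_def)
  moreover have "A (G (A u) + u) = 0" by (simp add: A_add G u)
  ultimately have "G (A u) + u = 0" by (rule A_eq_0)
  then show ?thesis by (simp add: eq_neg_iff_add_eq_0)
qed

lemma G_eqI: "u \<in> D ==> A u = - y ==> G y = u" using A_eq_0[of "G y - u"] A_diff[OF G(1), of u y] csubspace_diff[OF D_subspace G(1), of u y] by (auto simp: G)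

lemma G_add: "G (x + y) = G x + G y" using D_subspace by (intro G_eqI) (auto simp: A_add G csubspace_def)

lemma G_scaleC: "G (c *\<^sub>C x) = c *\<^sub>C G x" using D_subspace bounded_bilinear.minus_right[OF bounded_bilinear_scaleC, of c x]
  by (intro G_eqI) (auto simp: A_scaleC G csubspace_def)

lemma G_scaleR: "G (r *\<^sub>R x) = r *\<^sub>R G x" using G_scaleC[of "of_real r" x] by (simp add: scaleC_of_real)

lemma G_bounded: "\<exists>K>0. \<forall>x. norm (G x) \<le> K * norm x"
proof -
  obtain c where c: "c > 0" "\<And>u. u \<in> D ==> c * norm u \<le> norm (A u)" using A_lower_bound by blast
  have "norm (G x) \<le> 1 / c * norm x" for x using c(2)[OF G(1), of x] c(1) by (simp add: G field_simps)
  then show ?thesis using c(1) by (intro exI[of _ "1 / c"]) auto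
qed

lemma G_linear: "bounded_linear G"
proof -
  obtain K where "\<And>x. norm (G x) \<le> K * norm x" using G_bounded by blast
  then show ?thesis by (intro bounded_linear_intro[of _ K]) (auto simp: G_add G_scaleR mult.commute)
qed

lemma G_symmetric: "cinner (G x) y = cinner x (G y)" using A_symmetric[OF G(1)[of x] G(1)[of y]] by (metis G(2) cinner_minus_left cinner_commute complex_cnj_minus minus_minus)

lemma G_positive: "x \<noteq> 0 ==> \<exists>r>0. cinner (G x) x = of_real r"
proof -
  assume "x \<noteq> 0"
  then have "G x \<noteq> 0" using G(2)[of x] A_scaleR[of 0 0] D_subspace by (auto simp: csubspace_def)
  then have *: "cinner (A (G x)) (G x) \<in> \<real>" "Re (cinner (A (G x)) (G x)) < 0" using nd G(1)[of x] by (auto simp: negative_definite_def)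
  have "cinner (A (G x)) (G x) = - cinner x (G x)" by (simp add: G cinner_minus_left)
  then have "cinner (G x) x = - cinner (A (G x)) (G x)" by (simp add: G_symmetric)
  then show ?thesis using * by (intro exI[of _ "- Re (cinner (A (G x)) (G x))"]) (auto simp: complex_is_Real_iff complex_eq_iff)
qed

lemma G_compact:
  assumes "\<And>n. norm (y n) \<le> B"
  shows "\<exists>r x. strict_mono (r :: nat => nat) \<and> (\<lambda>n. G (y (r n))) \<longlonglongrightarrow> x"
proof -
  obtain K where K: "K > 0" "\<And>x. norm (G x) \<le> K * norm x" using G_bounded by blast
  have B: "B \<ge> 0" using assms[of 0] norm_ge_zero order_trans by blast
  have "norm (G (y n)) \<le> (K + 1) * B" "norm (A (G (y n))) \<le> (K + 1) * B" for n
  proof -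
    have "norm (G (y n)) \<le> K * B" using K(2)[of "y n"] mult_left_mono[OF assms[of n], of K] K(1) by linarith
    then show "norm (G (y n)) \<le> (K + 1) * B" using B by (simp add: algebra_simps)
    show "norm (A (G (y n))) \<le> (K + 1) * B" using add_increasing2[OF mult_nonneg_nonneg[OF B less_imp_le[OF K(1)]] assms[of n]] by (simp add: G algebra_simps)
  qed
  then show ?thesis using compact_sequence[of "\<lambda>n. G (y n)"] G(1) by blast
qed

text \<open>Unit vectors along which the norm of \<open>G x\<close> approaches its supremum
  \<open>\<nu>\<close> are approximate eigenvectors of G^2 for \<nu>^2. Compactness produces a
  genuine one, and positivity of \<open>G\<close> selects the root \<open>\<nu>\<close> of
  \<nu>^2.\<close>

lemma eigenvector_exists:
  assumes M: "csubspace M" "closed M" "\<And>x. x \<in> M ==> G x \<in> M" and x0: "x0 \<in> M" "x0 \<noteq> 0"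
  shows "\<exists>y\<in>M. \<exists>\<nu>>0. norm y = 1 \<and> G y = \<nu> *\<^sub>R y"
proof -
  obtain K where K: "K > 0" "\<And>x. norm (G x) \<le> K * norm x" using G_bounded by blast
  define U where "U = {x \<in> M. norm x = 1}"
  define \<nu> where "\<nu> = (SUP x\<in>U. norm (G x))"
  have U0: "(1 / norm x0) *\<^sub>R x0 \<in> U" using x0 M by (auto simp: U_def intro: csubspace_scaleR)
  have bdd: "bdd_above ((\<lambda>x. norm (G x)) ` U)"
  proof (rule bdd_aboveI2)
    fix x assume "x \<in> U"
    then show "norm (G x) \<le> K" using K(2)[of x] by (simp add: U_def)
  qed
  have le: "norm (G x) \<le> \<nu> * norm x" if "x \<in> M" for x
  proof (cases "x = 0")
    case False
    then have "(1 / norm x) *\<^sub>R x \<in> U" using that M by (auto simp: U_def intro: csubspace_scaleR)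
    then have "norm (G ((1 / norm x) *\<^sub>R x)) \<le> \<nu>" unfolding \<nu>_def by (intro cSUP_upper bdd)
    then show ?thesis using False by (simp add: G_scaleR field_simps)
  qed (use G_scaleR[of 0 0] in simp)
  have "norm (G x0) > 0" using G(2)[of x0] A_scaleR[of 0 0] D_subspace x0 by (auto simp: csubspace_def)
  then have \<nu>: "\<nu> > 0" using le[OF x0(1)] x0 by (metis linorder_not_le mult_le_0_iff norm_ge_zero order_less_le_trans)
  have "\<exists>x\<in>U. \<nu> - 1 / real (Suc n) < norm (G x)" for n
  proof -
    have "\<nu> - 1 / real (Suc n) < (SUP x\<in>U. norm (G x))" unfolding \<nu>_def by simp
    then show ?thesis using U0 bdd less_cSUP_iff[of U "\<lambda>x. norm (G x)"] by blast
  qed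
  then obtain x where x: "\<And>n. x n \<in> U" "\<And>n. \<nu> - 1 / real (Suc n) < norm (G (x n))" by metis
  have xM: "x n \<in> M" "norm (x n) = 1" for n using x(1)[of n] by (auto simp: U_def)
  have lim: "(\<lambda>n. norm (G (x n))) \<longlonglongrightarrow> \<nu>"
  proof (rule real_tendsto_sandwich)
    show "\<forall>\<^sub>F n in sequentially. \<nu> - 1 / real (Suc n) \<le> norm (G (x n))" using x(2) less_imp_le by (intro always_eventually) blast
    show "\<forall>\<^sub>F n in sequentially. norm (G (x n)) \<le> \<nu>" using le[OF xM(1)] xM(2) by (intro always_eventually) simp
    have "(\<lambda>n. \<nu> - 1 / real (Suc n)) \<longlonglongrightarrow> \<nu> - 0" by (intro tendsto_intros LIMSEQ_Suc[OF lim_1_over_n])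
    then show "(\<lambda>n. \<nu> - 1 / real (Suc n)) \<longlonglongrightarrow> \<nu>" by simp
  qed simp
  \<comment> \<open>Expanding the square, symmetry turns the mixed term into - 2 \<nu>^2 |G x|^2,
    and |G (G x)| is at most \<nu> |G x| because \<open>M\<close> is invariant.\<close>
  have est: "(norm (G (G (x n)) - \<nu>\<^sup>2 *\<^sub>R x n))\<^sup>2 \<le> \<nu>\<^sup>2 * (\<nu>\<^sup>2 - (norm (G (x n)))\<^sup>2)" for n
  proof -
    have "(norm (G (G (x n)) - \<nu>\<^sup>2 *\<^sub>R x n))\<^sup>2 = (norm (G (G (x n))))\<^sup>2 + 2 * Re (cinner (G (G (x n))) (- (\<nu>\<^sup>2 *\<^sub>R x n))) + (norm (\<nu>\<^sup>2 *\<^sub>R x n))\<^sup>2"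
      using power2_norm_add[of "G (G (x n))" "- (\<nu>\<^sup>2 *\<^sub>R x n)"] by simp
    also have "cinner (G (G (x n))) (- (\<nu>\<^sup>2 *\<^sub>R x n)) = - (of_real (\<nu>\<^sup>2 * (norm (G (x n)))\<^sup>2))"
      using cinner_diff_right[of "G (G (x n))" 0 "\<nu>\<^sup>2 *\<^sub>R x n"] by (simp add: cinner_scaleR_right G_symmetric[of "G (x n)"] cinner_self scaleR_conv_of_real)
    also have "(norm (\<nu>\<^sup>2 *\<^sub>R x n))\<^sup>2 = \<nu>\<^sup>2 * \<nu>\<^sup>2" by (simp add: xM power2_eq_square)
    also have "(norm (G (G (x n))))\<^sup>2 \<le> (\<nu> * norm (G (x n)))\<^sup>2" by (intro power_mono le M xM) auto
    finally show ?thesis by (simp add: algebra_simps power_mult_distrib)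
  qed
  have diff0: "(\<lambda>n. G (G (x n)) - \<nu>\<^sup>2 *\<^sub>R x n) \<longlonglongrightarrow> 0"
  proof -
    have "(\<lambda>n. \<nu>\<^sup>2 * (\<nu>\<^sup>2 - (norm (G (x n)))\<^sup>2)) \<longlonglongrightarrow> \<nu>\<^sup>2 * (\<nu>\<^sup>2 - \<nu>\<^sup>2)" by (intro tendsto_intros lim)
    then have "(\<lambda>n. \<nu>\<^sup>2 * (\<nu>\<^sup>2 - (norm (G (x n)))\<^sup>2)) \<longlonglongrightarrow> 0" by simp
    then have "(\<lambda>n. (norm (G (G (x n)) - \<nu>\<^sup>2 *\<^sub>R x n))\<^sup>2) \<longlonglongrightarrow> 0" by (rule Lim_null_comparison[rotated]) (use est in auto)
    then have "(\<lambda>n. sqrt ((norm (G (G (x n)) - \<nu>\<^sup>2 *\<^sub>R x n))\<^sup>2)) \<longlonglongrightarrow> sqrt 0" by (rule tendsto_real_sqrt)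
    then show ?thesis by (simp add: tendsto_norm_zero_iff)
  qed
  have "norm (G (x n)) \<le> K" for n using K(2)[of "x n"] xM by simp
  then obtain r w where r: "strict_mono (r :: nat => nat)" "(\<lambda>n. G (G (x (r n)))) \<longlonglongrightarrow> w" using G_compact[of "\<lambda>n. G (x n)"] by blast
  have "(\<lambda>n. G (G (x (r n))) - (G (G (x (r n))) - \<nu>\<^sup>2 *\<^sub>R x (r n))) \<longlonglongrightarrow> w - 0"
    using LIMSEQ_subseq_LIMSEQ[OF diff0 r(1)] by (intro tendsto_diff r) (simp add: o_def)
  then have "(\<lambda>n. \<nu>\<^sup>2 *\<^sub>R x (r n)) \<longlonglongrightarrow> w" by simp
  then have "(\<lambda>n. (1 / \<nu>\<^sup>2) *\<^sub>R (\<nu>\<^sup>2 *\<^sub>R x (r n))) \<longlonglongrightarrow> (1 / \<nu>\<^sup>2) *\<^sub>R w" by (intro tendsto_intros)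
  then have xlim: "(\<lambda>n. x (r n)) \<longlonglongrightarrow> (1 / \<nu>\<^sup>2) *\<^sub>R w" using \<nu> by simp
  define z where "z = (1 / \<nu>\<^sup>2) *\<^sub>R w"
  have zM: "z \<in> M" using closed_sequentially[OF M(2) _ xlim] xM by (simp add: z_def)
  have "(\<lambda>n. norm (x (r n))) \<longlonglongrightarrow> norm z" using tendsto_norm[OF xlim] by (simp only: z_def)
  then have "norm z = 1" using xM by (simp add: LIMSEQ_const_iff)
  then have z0: "z \<noteq> 0" by auto
  have "(\<lambda>n. G (G (x (r n)))) \<longlonglongrightarrow> G (G z)" using xlim unfolding z_def by (intro bounded_linear.tendsto[OF G_linear])
  then have "G (G z) = w" using r(2) LIMSEQ_unique by blast
  then have GGz: "G (G z) = \<nu>\<^sup>2 *\<^sub>R z" using \<nu> by (simp add: z_def)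
  \<comment> \<open>From G^2 z = \<nu>^2 z it follows that G y = \<nu> y; the inner product of
    \<open>y\<close> with \<open>z\<close> is positive, so \<open>y\<close> is not zero.\<close>
  define y where "y = G z + \<nu> *\<^sub>R z"
  obtain q where q: "q > 0" "cinner (G z) z = of_real q" using G_positive[OF z0] by blast
  have "cinner y z = of_real (q + \<nu>)" using q \<open>norm z = 1\<close> by (simp add: y_def cinner_add_left cinner_scaleR_left cinner_self scaleR_conv_of_real)
  then have y0: "y \<noteq> 0" using q \<nu> by (auto simp flip: of_real_add)
  have Gy: "G y = \<nu> *\<^sub>R y" by (simp add: y_def G_add G_scaleR GGz power2_eq_square algebra_simps)
  have yM: "y \<in> M" using M zM csubspace_scaleR[OF M(1) zM, of \<nu>] by (auto simp: y_def csubspace_def)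
  show ?thesis using y0 yM Gy \<nu> M(1) by (intro bexI[of _ "(1 / norm y) *\<^sub>R y"] exI[of _ \<nu>]) (auto simp: G_scaleR intro: csubspace_scaleR)
qed

definition eigen_onb :: "'a set => bool"
  where "eigen_onb B \<longleftrightarrow> (\<forall>b\<in>B. norm b = 1 \<and> (\<exists>\<nu>>0. G b = \<nu> *\<^sub>R b)) \<and> (\<forall>b\<in>B. \<forall>c\<in>B. b \<noteq> c --> cinner b c = 0)"

text \<open>Zorn's lemma: the orthogonal complement of a maximal orthonormal set of eigenvectors is
  closed and invariant under \<open>G\<close>, so if nonzero it would contain one more
  eigenvector.\<close>

lemma total_eigen_onb: "\<exists>B. eigen_onb B \<and> (\<forall>x. (\<forall>b\<in>B. cinner x b = 0) --> x = 0)"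
proof -
  have "\<exists>M\<in>Collect eigen_onb. \<forall>X\<in>Collect eigen_onb. M \<subseteq> X --> X = M"
  proof (rule subset_Zorn_nonempty)
    have "eigen_onb {}" by (simp add: eigen_onb_def)
    then show "Collect eigen_onb \<noteq> {}" by blast
    fix C assume C: "C \<noteq> {}" "subset.chain (Collect eigen_onb) C"
    show "\<Union>C \<in> Collect eigen_onb" unfolding mem_Collect_eq eigen_onb_def
    proof (intro conjI ballI impI)
      fix b assume "b \<in> \<Union>C"
      then obtain X where "X \<in> C" "b \<in> X" by blast
      moreover have "eigen_onb X" using C \<open>X \<in> C\<close> by (auto simp: subset.chain_def)
      ultimately show "norm b = 1" "\<exists>\<nu>>0. G b = \<nu> *\<^sub>R b" by (simp_all add: eigen_onb_def)
    next
      fix b c assume bc: "b \<in> \<Union>C" "c \<in> \<Union>C" "b \<noteq> c"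
      then obtain X Y where XY: "X \<in> C" "Y \<in> C" "b \<in> X" "c \<in> Y" by blast
      then have "X \<subseteq> Y \<or> Y \<subseteq> X" using C by (auto simp: subset.chain_def)
      then obtain Z where "Z \<in> C" "b \<in> Z" "c \<in> Z" using XY by blast
      then show "cinner b c = 0" using C bc by (auto simp: subset.chain_def eigen_onb_def)
    qed
  qed
  then obtain B where B: "eigen_onb B" "\<And>X. eigen_onb X ==> B \<subseteq> X ==> X = B" by auto
  define M where "M = {x. \<forall>b\<in>B. cinner x b = 0}"
  have "x = 0" if x: "x \<in> M" for x
  proof (rule ccontr)
    assume "x \<noteq> 0"
    have "csubspace M" by (auto simp: M_def csubspace_def cinner_add_left cinner_scaleC_left)
    moreover have "closed M" unfolding closed_sequential_limits
    proof (intro allI impI)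
      fix f l assume f: "(\<forall>n. f n \<in> M) \<and> f \<longlonglongrightarrow> l"
      have "cinner l b = 0" if "b \<in> B" for b
      proof -
        have "(\<lambda>n. cinner (f n) b) \<longlonglongrightarrow> cinner l b" using f by (intro tendsto_intros) auto
        then show ?thesis using f that by (simp add: M_def LIMSEQ_const_iff)
      qed
      then show "l \<in> M" by (simp add: M_def)
    qed
    moreover have "G y \<in> M" if "y \<in> M" for y unfolding M_def
    proof (intro CollectI ballI)
      fix b assume b: "b \<in> B"
      then obtain \<nu> where "G b = \<nu> *\<^sub>R b" using B(1) unfolding eigen_onb_def by blast
      then show "cinner (G y) b = 0" using that b by (simp add: G_symmetric cinner_scaleR_right M_def)
    qed
    ultimately obtain y \<nu> where y: "y \<in> M" "\<nu> > 0" "norm y = 1" "G y = \<nu> *\<^sub>R y" using eigenvector_exists[of M x] x \<open>x \<noteq> 0\<close> by blast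
    have yb: "cinner y b = 0" "cinner b y = 0" if "b \<in> B" for b using y(1) that cinner_commute[of b y] by (auto simp: M_def)
    have "eigen_onb (insert y B)" using B(1) y yb unfolding eigen_onb_def by auto
    then have "insert y B = B" using B(2) by blast
    then have "cinner y y = 0" using yb by blast
    then show False using y(3) by (simp add: cinner_self)
  qed
  then show ?thesis using B(1) by (auto simp: M_def)
qed

end

text \<open>Distinct orthonormal vectors have distance at least 1, so points of a countable dense
  set within 1/2 of them are distinct.\<close>

lemma countable_orthonormal:
  fixes B :: "'a::{complex_hilbert, second_countable_topology} set"
  assumes B: "\<And>b. b \<in> B ==> norm b = 1" "\<And>b c. b \<in> B ==> c \<in> B ==> b \<noteq> c ==> cinner b c = 0"
  shows "countable B"
proof -
  obtain C :: "'a set" where C: "countable C" "\<And>X. open X ==> X \<noteq> {} ==> \<exists>d\<in>C. d \<in> X" using countable_dense_exists by blast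
  have "\<exists>d\<in>C. d \<in> ball b (1 / 2)" for b by (rule C(2)) auto
  then obtain f where f: "\<And>b. f b \<in> C" "\<And>b. dist b (f b) < 1 / 2" by (metis mem_ball)
  have "inj_on f B"
  proof (rule inj_onI, rule ccontr)
    fix b c assume bc: "b \<in> B" "c \<in> B" "f b = f c" "b \<noteq> c"
    have "dist b c < 1" using f(2)[of b] f(2)[of c] bc(3) dist_triangle[of b c "f b"] by (simp add: dist_commute)
    then have "(norm (b + (- c)))\<^sup>2 < 1" by (simp add: dist_norm power_less_one_iff abs_square_less_1)
    moreover have "cinner b (- c) = 0" using cinner_diff_right[of b 0 c] B(2)[OF bc(1,2,4)] by simp
    ultimately show False using power2_norm_add[of b "- c"] B(1) bc by simp
  qed
  moreover have "countable (f ` B)" using C(1) f(1) by (meson countable_subset image_subsetI)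
  ultimately show ?thesis using countable_image_inj_on by blast
qed

text \<open>A total orthonormal sequence of eigenvectors, padded with zeros when the space is
  finite-dimensional.\<close>

locale eigenbasis =
  fixes A :: "'a::complex_hilbert => 'a" and D :: "'a set" and e :: "nat => 'a" and lam :: "nat => real" and lam0 :: real
  assumes lam0_pos: "lam0 > 0" and lam_ge: "\<And>n. lam0 \<le> lam n"
    and e_norm: "\<And>n. e n = 0 \<or> norm (e n) = 1"
    and e_orth: "\<And>m n. m \<noteq> n ==> cinner (e m) (e n) = 0"
    and e_total: "\<And>x. (\<And>n. cinner x (e n) = 0) ==> x = 0"
    and D_cspace: "csubspace D" and A_clinear: "clinear_on D A"
    and A_coeff: "\<And>u n. u \<in> D ==> cinner (A u) (e n) = - of_real (lam n) * cinner u (e n)"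
    and D_I: "\<And>u v. (\<And>n. cinner v (e n) = of_real (lam n) * cinner u (e n)) ==> u \<in> D"

lemma eigenbasis_exists:
  fixes A :: "'a::{complex_hilbert, second_countable_topology} => 'a"
  assumes "self_adjoint A D" "negative_definite A D" "compact_resolvent A D"
  shows "\<exists>e lam lam0. eigenbasis A D e lam lam0"
proof -
  interpret negative_operator A D using assms by (simp add: negative_operator_def)
  obtain B where B: "eigen_onb B" "\<And>x. (\<And>b. b \<in> B ==> cinner x b = 0) ==> x = 0" using total_eigen_onb by blast
  have "countable B" using B(1) by (intro countable_orthonormal) (auto simp: eigen_onb_def)
  define N where "N = to_nat_on B ` B"
  have N: "from_nat_into B n \<in> B" if "n \<in> N" for n using that \<open>countable B\<close> by (auto simp: N_def)
  have inj: "n = m" if "n \<in> N" "m \<in> N" "from_nat_into B n = from_nat_into B m" for n m using that \<open>countable B\<close> by (auto simp: N_def)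
  define e where "e n = (if n \<in> N then from_nat_into B n else 0)" for n
  obtain K where K: "K > 0" "\<And>x. norm (G x) \<le> K * norm x" using G_bounded by blast
  have "\<exists>\<nu>>0. G (e n) = \<nu> *\<^sub>R e n \<and> \<nu> \<le> K" for n
  proof (cases "n \<in> N")
    case True
    then obtain \<nu> where \<nu>: "\<nu> > 0" "G (e n) = \<nu> *\<^sub>R e n" "norm (e n) = 1" using B(1) N[OF True] by (auto simp: e_def eigen_onb_def)
    then have "\<nu> \<le> K" using K(2)[of "e n"] by simp
    then show ?thesis using \<nu> by blast
  next
    case False
    \<comment> \<open>At a padding index the vector is 0, so any \<open>\<nu>\<close> fits the
      eigenvalue equation; \<open>K\<close> also keeps \<open>lam\<close> above 1 / K.\<close>
    then show ?thesis using K(1) G_scaleR[of 0 0] by (intro exI[of _ K]) (auto simp: e_def)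
  qed
  then obtain \<nu> where \<nu>: "\<And>n. \<nu> n > 0" "\<And>n. G (e n) = \<nu> n *\<^sub>R e n" "\<And>n. \<nu> n \<le> K" by metis
  define lam where "lam n = 1 / \<nu> n" for n
  have G_coeff: "cinner (G v) (e n) = of_real (\<nu> n) * cinner v (e n)" for v n by (simp add: G_symmetric \<nu> cinner_scaleR_right scaleR_conv_of_real)
  have total: "x = 0" if "\<And>n. cinner x (e n) = 0" for x
  proof (rule B(2))
    fix b assume b: "b \<in> B"
    then have "to_nat_on B b \<in> N" "from_nat_into B (to_nat_on B b) = b" using \<open>countable B\<close> by (auto simp: N_def)
    then show "cinner x b = 0" using that[of "to_nat_on B b"] by (simp add: e_def)
  qed
  have "eigenbasis A D e lam (1 / K)"
  proof
    show "1 / K > 0" using K by simp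
    show "1 / K \<le> lam n" for n unfolding lam_def using \<nu>(1,3)[of n] by (intro divide_left_mono) auto
    show "e n = 0 \<or> norm (e n) = 1" for n using B(1) N by (auto simp: e_def eigen_onb_def)
    show "cinner (e m) (e n) = 0" if "m \<noteq> n" for m n
    proof (cases "m \<in> N \<and> n \<in> N")
      case True
      then have "from_nat_into B m \<noteq> from_nat_into B n" using inj that by blast
      then show ?thesis using B(1) N True by (simp add: e_def eigen_onb_def)
    qed (auto simp: e_def)
    show "x = 0" if "\<And>n. cinner x (e n) = 0" for x using total that by blast
    show "cinner (A u) (e n) = - of_real (lam n) * cinner u (e n)" if "u \<in> D" for u n
    proof -
      have "- cinner u (e n) = of_real (\<nu> n) * cinner (A u) (e n)" using G_coeff[of "A u" n] G_A[OF that] by (simp add: cinner_minus_left)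
      then show ?thesis using \<nu>(1)[of n] by (simp add: lam_def field_simps)
    qed
    show "u \<in> D" if uv: "\<And>n. cinner v (e n) = of_real (lam n) * cinner u (e n)" for u v
    proof -
      have "G v - u = 0"
      proof (rule total)
        fix n
        show "cinner (G v - u) (e n) = 0" using uv[of n] \<nu>(1)[of n] by (simp add: cinner_diff_left G_coeff lam_def)
      qed
      then show ?thesis using G(1)[of v] by simp
    qed
  qed (fact D_subspace A_linear)+
  then show ?thesis by blast
qed

section \<open>Coordinates in the eigenbasis\<close>

context eigenbasis
begin

lemma lam_pos: "lam n > 0" using lam0_pos lam_ge[of n] by linarith

abbreviation coeff :: "'a => nat => complex" where "coeff x n \<equiv> cinner x (e n)"

lemma coeff_zero_e: "e n = 0 ==> coeff x n = 0" by simp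

lemma cinner_e_self: "e n \<noteq> 0 ==> cinner (e n) (e n) = 1" using e_norm[of n] by (auto simp: cinner_self)

text \<open>At a padding index a coefficient cannot be recovered from the vector, whence the
  condition on \<open>a\<close>.\<close>

lemma coeff_sum:
  assumes "\<And>n. e n = 0 ==> a n = 0"
  shows "coeff (\<Sum>n<N. a n *\<^sub>C e n) m = (if m < N then a m else 0)"
proof -
  have "coeff (\<Sum>n<N. a n *\<^sub>C e n) m = (\<Sum>n<N. a n * cinner (e n) (e m))" by (simp add: bounded_bilinear.sum_left[OF bounded_bilinear_cinner] cinner_scaleC_left)
  also have "... = (\<Sum>n<N. if n = m then a m else 0)" using e_orth cinner_e_self assms by (intro sum.cong refl) auto
  finally show ?thesis by simp
qed

lemma norm_sum_sq:
  assumes "\<And>n. e n = 0 ==> a n = 0"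
  shows "(norm (\<Sum>n\<in>{M..<N}. a n *\<^sub>C e n))\<^sup>2 = (\<Sum>n\<in>{M..<N}. (cmod (a n))\<^sup>2)"
proof (induction N)
  case (Suc N)
  show ?case
  proof (cases "M \<le> N")
    case True
    have "cinner (\<Sum>n\<in>{M..<N}. a n *\<^sub>C e n) (a N *\<^sub>C e N) = 0"
      using e_orth by (simp add: bounded_bilinear.sum_left[OF bounded_bilinear_cinner] cinner_scaleC_left
          cinner_scaleC_right) 
    moreover have "(norm (a N *\<^sub>C e N))\<^sup>2 = (cmod (a N))\<^sup>2" using assms[of N] e_norm[of N] by (auto simp: norm_scaleC)
    ultimately show ?thesis using True Suc.IH by (simp add: power2_norm_add)
  qed simp
qed simp

lemma bessel: "(\<Sum>n<N. (cmod (coeff x n))\<^sup>2) \<le> (norm x)\<^sup>2"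
proof -
  define y where "y = (\<Sum>n<N. coeff x n *\<^sub>C e n)"
  have y2: "(norm y)\<^sup>2 = (\<Sum>n<N. (cmod (coeff x n))\<^sup>2)" using norm_sum_sq[of "coeff x" 0 N] by (simp add: y_def atLeast0LessThan)
  have "cinner x y = (\<Sum>n<N. cnj (coeff x n) * coeff x n)" by (simp add: y_def bounded_bilinear.sum_right[OF bounded_bilinear_cinner] cinner_scaleC_right)
  also have "... = of_real ((norm y)\<^sup>2)" unfolding y2 of_real_sum complex_norm_square by (simp add: mult.commute)
  finally have xy: "Re (cinner x y) = (norm y)\<^sup>2" by simp
  have "cinner x (- y) = - cinner x y" using cinner_diff_right[of x 0 y] by simp
  then have "(norm (x - y))\<^sup>2 = (norm x)\<^sup>2 - (norm y)\<^sup>2" using power2_norm_add[of x "- y"] xy by simp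
  then show ?thesis using y2 by (metis diff_ge_0_iff_ge zero_le_power2)
qed

lemma series_converges:
  assumes a: "\<And>n. e n = 0 ==> a n = 0" and s: "summable (\<lambda>n. (cmod (a n))\<^sup>2)"
  shows "summable (\<lambda>n. a n *\<^sub>C e n)" unfolding summable_Cauchy
proof (intro allI impI)
  fix \<epsilon> :: real assume \<epsilon>: "\<epsilon> > 0"
  then obtain N where N: "\<And>m n. m \<ge> N ==> norm (\<Sum>n\<in>{m..<n}. (cmod (a n))\<^sup>2) < \<epsilon>\<^sup>2"
    using s unfolding summable_Cauchy by (metis zero_less_power)
  have "norm (\<Sum>n\<in>{m..<n}. a n *\<^sub>C e n) < \<epsilon>" if "m \<ge> N" for m n
  proof -
    have "(norm (\<Sum>n\<in>{m..<n}. a n *\<^sub>C e n))\<^sup>2 < \<epsilon>\<^sup>2" using N[OF that, of n] norm_sum_sq[of a m n] a by simp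
    then show ?thesis using \<epsilon> by (simp add: power_less_imp_less_base)
  qed
  then show "\<exists>N. \<forall>m\<ge>N. \<forall>n. norm (\<Sum>n\<in>{m..<n}. a n *\<^sub>C e n) < \<epsilon>" by blast
qed

lemma coeff_suminf:
  assumes a: "\<And>n. e n = 0 ==> a n = 0" and s: "summable (\<lambda>n. a n *\<^sub>C e n)"
  shows "coeff (\<Sum>n. a n *\<^sub>C e n) m = a m"
proof -
  have "(\<lambda>N. coeff (\<Sum>n<N. a n *\<^sub>C e n) m) \<longlonglongrightarrow> coeff (\<Sum>n. a n *\<^sub>C e n) m" by (intro tendsto_intros summable_LIMSEQ s)
  moreover have "(\<lambda>N. coeff (\<Sum>n<N. a n *\<^sub>C e n) m) \<longlonglongrightarrow> a m" using coeff_sum[of a _ m] a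
    by (intro tendsto_eventually eventually_sequentiallyI[of "Suc m"]) auto
  ultimately show ?thesis by (rule LIMSEQ_unique)
qed

lemma eq_coeffI: "(\<And>n. coeff x n = coeff y n) ==> x = y" using e_total[of "x - y"] by (simp add: cinner_diff_left)

lemma summable_coeff: "summable (\<lambda>n. (cmod (coeff x n))\<^sup>2)"
  by (rule bounded_imp_summable[of _ "(norm x)\<^sup>2"]) (use bessel[of x "Suc n" for n] in \<open>auto simp: lessThan_Suc_atMost\<close>)

lemma expansion: "(\<lambda>n. coeff x n *\<^sub>C e n) sums x"
proof -
  have s: "summable (\<lambda>n. coeff x n *\<^sub>C e n)" by (rule series_converges) (use summable_coeff in auto)
  moreover have "(\<Sum>n. coeff x n *\<^sub>C e n) = x" by (rule eq_coeffI, rule coeff_suminf) (use s in auto)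
  ultimately show ?thesis using summable_sums by fastforce
qed

lemma parseval: "(\<lambda>n. (cmod (coeff x n))\<^sup>2) sums (norm x)\<^sup>2"
proof -
  have "(\<lambda>N. (norm (\<Sum>n<N. coeff x n *\<^sub>C e n))\<^sup>2) \<longlonglongrightarrow> (norm x)\<^sup>2"
    using expansion[of x] unfolding sums_def by (intro tendsto_intros)
  moreover have "(norm (\<Sum>n<N. coeff x n *\<^sub>C e n))\<^sup>2 = (\<Sum>n<N. (cmod (coeff x n))\<^sup>2)" for N
    using norm_sum_sq[of "coeff x" 0 N] by (simp add: atLeast0LessThan)
  ultimately show ?thesis by (simp add: sums_def)
qed

end

section \<open>Fractional integrals of p-integrable functions\<close>

text \<open>The p-th power of the norm, without a root and with infinity allowed.\<close>

definition LpE :: "real => (real => 'b::real_normed_vector) => ennreal"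
  where "LpE p f = (\<integral>t. ennreal (norm (f t) powr p))"

text \<open>Borel representatives of \<open>L\<^sup>p(0,T)\<close>, extended by zero.\<close>

definition Lpb :: "real => real => (real => 'b::{banach, second_countable_topology}) set"
  where "Lpb p T = {f. f \<in> borel_measurable borel \<and> (\<forall>t. t \<notin> {0<..<T} --> f t = 0) \<and> LpE p f < top}"

definition fint :: "real => (real => 'b::{banach, second_countable_topology}) => real => 'b"
  where "fint \<beta> g t = (LINT s|lborel. frac_kernel \<beta> (t - s) *\<^sub>R g s)"

lemma Lpb_measurable: "f \<in> Lpb p T ==> f \<in> borel_measurable borel"
  and Lpb_zero: "f \<in> Lpb p T ==> t \<notin> {0<..<T} ==> f t = 0"
  and Lpb_finite: "f \<in> Lpb p T ==> LpE p f < top" by (auto simp: Lpb_def)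

text \<open>Pointwise Young inequality for the normalized factors. Positive upper bounds
  \<open>A\<close> and \<open>B\<close> replace the integrals themselves, which removes degenerate
  cases.\<close>

lemma nn_Hoelder:
  fixes a b :: "'c => real"
  assumes pq: "p > 1" "q > 1" "1 / q + 1 / p = 1"
    and [measurable]: "a \<in> borel_measurable M" "b \<in> borel_measurable M"
    and nn: "\<And>x. 0 \<le> a x" "\<And>x. 0 \<le> b x"
    and A: "A > 0" "(\<integral>\<^sup>+x. ennreal (a x powr q) \<partial>M) \<le> ennreal A"
    and B: "B > 0" "(\<integral>\<^sup>+x. ennreal (b x powr p) \<partial>M) \<le> ennreal B"
  shows "(\<integral>\<^sup>+x. ennreal (a x * b x) \<partial>M) \<le> ennreal (A powr (1 / q) * B powr (1 / p))"
proof -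
  define c where "c = A powr (1 / q) * B powr (1 / p)"
  have c: "c > 0" using A B by (simp add: c_def)
  have "a x * b x \<le> c / (q * A) * a x powr q + c / (p * B) * b x powr p" for x
  proof -
    have "a x * b x = c * ((a x / A powr (1 / q)) * (b x / B powr (1 / p)))" using A B by (simp add: c_def)
    also have "... \<le> c * ((a x / A powr (1 / q)) powr q / q + (b x / B powr (1 / p)) powr p / p)" using c pq nn by (intro mult_left_mono Youngs_inequality) auto
    also have "(a x / A powr (1 / q)) powr q = a x powr q / A" using nn A pq by (simp add: powr_divide powr_powr)
    also have "(b x / B powr (1 / p)) powr p = b x powr p / B" using nn B pq by (simp add: powr_divide powr_powr)
    finally show ?thesis by (simp add: algebra_simps)
  qed
  then have "(\<integral>\<^sup>+x. ennreal (a x * b x) \<partial>M) \<le>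
    (\<integral>\<^sup>+x. ennreal (c / (q * A)) * ennreal (a x powr q) + ennreal (c / (p * B)) * ennreal (b x powr p) \<partial>M)"
    using A B c pq by (intro nn_integral_mono) (simp flip: ennreal_mult ennreal_plus add: ennreal_leI)
  also have "... = ennreal (c / (q * A)) * (\<integral>\<^sup>+x. ennreal (a x powr q) \<partial>M) +
    ennreal (c / (p * B)) * (\<integral>\<^sup>+x. ennreal (b x powr p) \<partial>M)" by (subst nn_integral_add) (auto simp: nn_integral_cmult)
  also have "... \<le> ennreal (c / (q * A)) * ennreal A + ennreal (c / (p * B)) * ennreal B" by (intro add_mono mult_left_mono A B) auto
  also have "... = ennreal (c / (q * A) * A + c / (p * B) * B)"
  proof -
    have e1: "ennreal (c / (q * A) * A) = ennreal (c / (q * A)) * ennreal A" by (rule ennreal_mult) (use A c pq in auto)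
    have e2: "ennreal (c / (p * B) * B) = ennreal (c / (p * B)) * ennreal B" by (rule ennreal_mult) (use B c pq in auto)
    show ?thesis unfolding e1[symmetric] e2[symmetric] by (rule ennreal_plus[symmetric]) (use A B c pq in auto)
  qed
  also have "c / (q * A) * A + c / (p * B) * B = c * (1 / q + 1 / p)" using A B pq by (simp add: field_simps)
  also have "... = c" using pq by simp
  finally show ?thesis by (simp add: c_def)
qed

text \<open>After division by b + c both bases lie between 0 and 1, where raising to a power p \<ge>
  1 only decreases them.\<close>

lemma powr_superadd:
  fixes b c p :: real
  assumes "b \<ge> 0" "c \<ge> 0" "p \<ge> 1"
  shows "b powr p + c powr p \<le> (b + c) powr p"
proof (cases "b + c = 0")
  case True
  then have "b = 0" "c = 0" using assms by auto
  then show ?thesis by simp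
next
  case False
  then have s: "b + c > 0" using assms by auto
  have *: "x powr p \<le> x" if "0 \<le> x" "x \<le> 1" for x :: real using powr_mono'[of 1 p x] that assms by (cases "x = 0") auto
  have "(b / (b + c)) powr p + (c / (b + c)) powr p \<le> b / (b + c) + c / (b + c)" using assms s by (intro add_mono *) auto
  also have "... = 1" using s by (simp flip: add_divide_distrib)
  finally show ?thesis using assms s by (simp add: powr_divide field_simps)
qed

text \<open>The second integral is the first one shifted by \<open>h\<close>; what does not cancel
  is at most the integral over {0<..<h}, uniformly in \<open>X\<close>.\<close>

lemma power_difference_integral:
  fixes g h X :: real
  assumes g: "- 1 < g" "g \<le> 0" and h: "h > 0" and X: "X \<ge> 0"
  shows "(\<integral>x. ennreal (x powr g - (x + h) powr g) * indicator {0<..<X} x) \<le> ennreal (h powr (g + 1) / (g + 1))"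
proof -
  define P where "P c = (\<integral>x. ennreal (x powr g) * indicator {0<..<c} x)" for c :: real
  have P: "P c = ennreal (c powr (g + 1) / (g + 1))" if "c \<ge> 0" for c unfolding P_def using that g by (intro nn_integral_powr_from_0) auto
  define I where "I = (\<integral>x. ennreal (x powr g - (x + h) powr g) * indicator {0<..<X} x)"
  define S where "S = (\<integral>x. ennreal ((x + h) powr g) * indicator {0<..<X} x)"
  have "P X = I + S" unfolding P_def I_def S_def
  proof (subst nn_integral_add[symmetric])
    show "(\<integral>x. ennreal (x powr g) * indicator {0<..<X} x) =
      (\<integral>x. ennreal (x powr g - (x + h) powr g) * indicator {0<..<X} x + ennreal ((x + h) powr g) * indicator {0<..<X} x)"
    proof (intro nn_integral_cong)
      fix x :: real
      have "(x + h) powr g \<le> x powr g" if "x > 0" using that h g by (intro powr_mono2') auto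
      then show "ennreal (x powr g) * indicator {0<..<X} x =
        ennreal (x powr g - (x + h) powr g) * indicator {0<..<X} x + ennreal ((x + h) powr g) * indicator {0<..<X} x" by (auto simp: indicator_def simp flip: ennreal_plus)
    qed
  qed auto
  moreover have "P (X + h) \<le> P h + S"
  proof -
    have "S = (\<integral>x. ennreal (x powr g) * indicator {0<..<X} (x - h))" unfolding S_def
      using nn_integral_real_affine[of "\<lambda>x. ennreal (x powr g) * indicator {0<..<X} (x - h)" 1 h] by (simp add: add.commute)
    moreover have "P (X + h) \<le> (\<integral>x. ennreal (x powr g) * indicator {0<..<h} x + ennreal (x powr g) * indicator {0<..<X} (x - h))" unfolding P_def
    proof (rule nn_integral_mono_AE)
      have "AE x in lborel. x \<noteq> h" by (rule AE_lborel_singleton)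
      then show "AE x in lborel. ennreal (x powr g) * indicator {0<..<X + h} x \<le>
        ennreal (x powr g) * indicator {0<..<h} x + ennreal (x powr g) * indicator {0<..<X} (x - h)" by eventually_elim (auto simp: indicator_def)
    qed
    ultimately show ?thesis unfolding P_def by (subst (asm) nn_integral_add) auto
  qed
  moreover have "P X \<le> P (X + h)" unfolding P_def using h by (intro nn_integral_mono) (auto simp: indicator_def)
  moreover have "S < top"
  proof -
    have "S \<le> P X" using \<open>P X = I + S\<close> by simp
    then show ?thesis using P[OF X] by (auto simp: less_top[symmetric] top_unique)
  qed
  ultimately have "I + S \<le> P h + S" by (metis order_trans)
  then have "I \<le> P h" using \<open>S < top\<close> by (auto simp: ennreal_add_left_cancel_le add.commute)
  then show ?thesis using P[of h] h by (simp add: I_def)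
qed

locale fractional_Lp = fractional_order +
  fixes p :: real
  assumes p: "p > 1 / \<alpha>"
begin

abbreviation J :: "(real => 'b::{banach, second_countable_topology}) => real => 'b"
  where "J \<equiv> fint \<alpha>"

lemma p_gt_1: "p > 1"
proof -
  have "1 \<le> 1 / \<alpha>" using \<alpha> by simp
  then show ?thesis using p by linarith
qed

definition q :: real where "q = p / (p - 1)"

lemma q_gt_1: "q > 1" and conj_pq: "1 / q + 1 / p = 1" using p_gt_1 by (auto simp: q_def field_simps)

text \<open>The exponent of the q-th power of the kernel; that it exceeds - 1 amounts to p > 1 /
  \<alpha>.\<close>

definition \<gamma> :: real where "\<gamma> = (\<alpha> - 1) * q"

lemma \<gamma>_bounds: "- 1 < \<gamma>" "\<gamma> < 0"
proof -
  have "\<alpha> * p > 1" using p \<alpha> by (simp add: field_simps)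
  then show "- 1 < \<gamma>" using p_gt_1 by (simp add: \<gamma>_def q_def field_simps)
  show "\<gamma> < 0" using \<alpha> q_gt_1 by (simp add: \<gamma>_def mult_neg_pos)
qed

lemma \<gamma>_q: "(\<gamma> + 1) / q = \<alpha> - 1 / p"
proof -
  have "(\<gamma> + 1) / q = \<alpha> - 1 + 1 / q" using q_gt_1 by (simp add: \<gamma>_def add_divide_distrib)
  then show ?thesis using conj_pq by simp
qed

lemma order_pos: "\<alpha> - 1 / p > 0"
proof -
  have "(\<gamma> + 1) / q > 0" using \<gamma>_bounds q_gt_1 by (intro divide_pos_pos) auto
  then show ?thesis by (simp add: \<gamma>_q)
qed

lemma frac_kernel_q:
  assumes "c \<ge> 0"
  shows "(\<integral>r. ennreal ((frac_kernel \<alpha> (t - r) * indicator {t - c<..} r) powr q)) \<le>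
    ennreal (c powr (\<gamma> + 1) / (\<gamma> + 1) / Gamma \<alpha> powr q)"
proof -
  have G: "Gamma \<alpha> > 0" using \<alpha> by (simp add: Gamma_real_pos)
  have "(\<integral>r. ennreal ((frac_kernel \<alpha> (t - r) * indicator {t - c<..} r) powr q)) =
    (\<integral>x. ennreal ((frac_kernel \<alpha> x * indicator {t - c<..} (t - x)) powr q))"
    using nn_integral_real_affine[of "\<lambda>r. ennreal ((frac_kernel \<alpha> (t - r) * indicator {t - c<..} r) powr q)" "-1" t] by simp
  also have "... = (\<integral>x. ennreal (1 / Gamma \<alpha> powr q) * (ennreal (x powr \<gamma>) * indicator {0<..<c} x))" using G q_gt_1 by (intro nn_integral_cong)
      (auto simp: frac_kernel_def indicator_def powr_divide powr_powr \<gamma>_def simp flip: ennreal_mult)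
  also have "... = ennreal (1 / Gamma \<alpha> powr q) * ennreal (c powr (\<gamma> + 1) / (\<gamma> + 1))"
    using assms \<gamma>_bounds by (subst nn_integral_cmult) (auto simp: nn_integral_powr_from_0)
  also have "... = ennreal (c powr (\<gamma> + 1) / (\<gamma> + 1) / Gamma \<alpha> powr q)" using \<gamma>_bounds by (subst ennreal_mult[symmetric]) auto
  finally show ?thesis by simp
qed

text \<open>Two equal contributions: times between \<open>s\<close> and \<open>t\<close>, where only
  the first kernel is nonzero, and times before \<open>s\<close>, where the difference of q-th
  powers telescopes.\<close>

lemma frac_kernel_increment:
  assumes st: "s < t"
  shows "(\<integral>r. ennreal ((\<bar>frac_kernel \<alpha> (t - r) - frac_kernel \<alpha> (s - r)\<bar> * indicator {0<..} r) powr q)) \<le>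
    ennreal (2 * ((t - s) powr (\<gamma> + 1) / (\<gamma> + 1) / Gamma \<alpha> powr q))"
proof -
  define h where "h = t - s"
  define X where "X = max s 0"
  have h: "h > 0" using st by (simp add: h_def)
  have G: "Gamma \<alpha> > 0" using \<alpha> by (simp add: Gamma_real_pos)
  have "(\<integral>r. ennreal ((\<bar>frac_kernel \<alpha> (t - r) - frac_kernel \<alpha> (s - r)\<bar> * indicator {0<..} r) powr q)) \<le>
    (\<integral>r. ennreal (1 / Gamma \<alpha> powr q) * (ennreal ((s - r) powr \<gamma> - ((s - r) + h) powr \<gamma>) * indicator {0<..<X} (s - r)) +
      ennreal ((frac_kernel \<alpha> (t - r) * indicator {t - h<..} r) powr q))"
  proof (rule nn_integral_mono_AE)
    have "AE r in lborel. r \<noteq> s" by (rule AE_lborel_singleton)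
    then show "AE r in lborel. ennreal ((\<bar>frac_kernel \<alpha> (t - r) - frac_kernel \<alpha> (s - r)\<bar> * indicator {0<..} r) powr q) \<le>
      ennreal (1 / Gamma \<alpha> powr q) * (ennreal ((s - r) powr \<gamma> - ((s - r) + h) powr \<gamma>) * indicator {0<..<X} (s - r)) +
      ennreal ((frac_kernel \<alpha> (t - r) * indicator {t - h<..} r) powr q)"
    proof eventually_elim
      case (elim r)
      consider "r \<le> 0" | "r > 0" "r < s" | "r > s" using elim by linarith
      then show ?case
      proof cases
        case 2
        define x where "x = s - r"
        have x: "x > 0" using 2 by (simp add: x_def)
        have t: "t - r = x + h" by (simp add: x_def h_def)
        define u where "u = x powr (\<alpha> - 1)"
        define v where "v = (x + h) powr (\<alpha> - 1)"
        have v: "v \<ge> 0" "v \<le> u" unfolding u_def v_def using x h \<alpha> by (auto intro!: powr_mono2')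
        have "\<bar>frac_kernel \<alpha> (t - r) - frac_kernel \<alpha> (s - r)\<bar> = (u - v) / Gamma \<alpha>"
          using x h v G unfolding t x_def[symmetric] u_def v_def frac_kernel_def by (simp add: diff_divide_distrib[symmetric] abs_minus_commute)
        then have "(\<bar>frac_kernel \<alpha> (t - r) - frac_kernel \<alpha> (s - r)\<bar> * indicator {0<..} r) powr q = (u - v) powr q / Gamma \<alpha> powr q"
          using 2 G v by (simp add: powr_divide)
        \<comment> \<open>Superadditivity replaces the power of a difference by a difference of
          powers, to which \<open>power_difference_integral\<close> applies.\<close>
        also have "(u - v) powr q \<le> u powr q - v powr q" using powr_superadd[of "u - v" v q] v q_gt_1 by simp
        then have "(u - v) powr q / Gamma \<alpha> powr q \<le> (u powr q - v powr q) / Gamma \<alpha> powr q" by (rule divide_right_mono) simp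
        also have "u powr q - v powr q = x powr \<gamma> - (x + h) powr \<gamma>" by (simp add: u_def v_def powr_powr \<gamma>_def)
        finally have "ennreal ((\<bar>frac_kernel \<alpha> (t - r) - frac_kernel \<alpha> (s - r)\<bar> * indicator {0<..} r) powr q) \<le>
          ennreal (1 / Gamma \<alpha> powr q * (x powr \<gamma> - (x + h) powr \<gamma>))" by (intro ennreal_leI) simp
        also have "... = ennreal (1 / Gamma \<alpha> powr q) * (ennreal (x powr \<gamma> - (x + h) powr \<gamma>) * indicator {0<..<X} x)"
          using 2 by (subst ennreal_mult') (auto simp: X_def x_def)
        finally show ?thesis unfolding x_def by (simp add: add_increasing2)
      next
        case 3
        then show ?thesis by (cases "r > 0") (auto simp: h_def frac_kernel_def abs_of_pos[OF G])
      qed (use q_gt_1 in simp)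
    qed
  qed
  also have "... = ennreal (1 / Gamma \<alpha> powr q) * (\<integral>r. ennreal ((s - r) powr \<gamma> - ((s - r) + h) powr \<gamma>) * indicator {0<..<X} (s - r)) +
      (\<integral>r. ennreal ((frac_kernel \<alpha> (t - r) * indicator {t - h<..} r) powr q))" by (subst nn_integral_add) (auto simp: nn_integral_cmult)
  also have "(\<integral>r. ennreal ((s - r) powr \<gamma> - ((s - r) + h) powr \<gamma>) * indicator {0<..<X} (s - r)) =
    (\<integral>x. ennreal (x powr \<gamma> - (x + h) powr \<gamma>) * indicator {0<..<X} x)"
    using nn_integral_real_affine[of "\<lambda>x. ennreal (x powr \<gamma> - (x + h) powr \<gamma>) * indicator {0<..<X} x" "-1" s] by simp
  also have "ennreal (1 / Gamma \<alpha> powr q) * (\<integral>x. ennreal (x powr \<gamma> - (x + h) powr \<gamma>) * indicator {0<..<X} x) +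
      (\<integral>r. ennreal ((frac_kernel \<alpha> (t - r) * indicator {t - h<..} r) powr q)) \<le>
    ennreal (1 / Gamma \<alpha> powr q) * ennreal (h powr (\<gamma> + 1) / (\<gamma> + 1)) + ennreal (h powr (\<gamma> + 1) / (\<gamma> + 1) / Gamma \<alpha> powr q)"
    using \<gamma>_bounds h by (intro add_mono mult_left_mono power_difference_integral frac_kernel_q) (auto simp: X_def)
  also have "... = ennreal (1 / Gamma \<alpha> powr q * (h powr (\<gamma> + 1) / (\<gamma> + 1)) + h powr (\<gamma> + 1) / (\<gamma> + 1) / Gamma \<alpha> powr q)"
    using \<gamma>_bounds by (simp flip: ennreal_mult ennreal_plus)
  finally show ?thesis by (simp add: h_def)
qed

lemma frac_kernel_integrable:
  assumes g: "g \<in> Lpb p T"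
  shows "integrable lborel (\<lambda>s. frac_kernel \<alpha> (t - s) *\<^sub>R g s)"
proof (rule integrableI_bounded)
  have [measurable]: "g \<in> borel_measurable borel" using g by (rule Lpb_measurable)
  show "(\<lambda>s. frac_kernel \<alpha> (t - s) *\<^sub>R g s) \<in> borel_measurable lborel" by measurable
  have G: "Gamma \<alpha> > 0" using \<alpha> by (simp add: Gamma_real_pos)
  define c where "c = max t 0"
  define A where "A = c powr (\<gamma> + 1) / (\<gamma> + 1) / Gamma \<alpha> powr q + 1"
  have A: "A > 0" "(\<integral>r. ennreal ((frac_kernel \<alpha> (t - r) * indicator {t - c<..} r) powr q)) \<le> ennreal A"
  proof -
    show "A > 0" using \<gamma>_bounds G by (auto simp: A_def intro!: add_nonneg_pos)
    show "(\<integral>r. ennreal ((frac_kernel \<alpha> (t - r) * indicator {t - c<..} r) powr q)) \<le> ennreal A"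
      by (rule order_trans[OF frac_kernel_q]) (auto simp: c_def A_def intro!: ennreal_leI)
  qed
  obtain b where b: "LpE p g = ennreal b" "b \<ge> 0" using Lpb_finite[OF g] by (cases "LpE p g") auto
  have "(\<integral>s. ennreal (norm (frac_kernel \<alpha> (t - s) *\<^sub>R g s))) \<le>
    (\<integral>s. ennreal ((frac_kernel \<alpha> (t - s) * indicator {t - c<..} s) * norm (g s)))"
  proof (rule nn_integral_mono)
    fix s
    show "ennreal (norm (frac_kernel \<alpha> (t - s) *\<^sub>R g s)) \<le> ennreal ((frac_kernel \<alpha> (t - s) * indicator {t - c<..} s) * norm (g s))"
      using Lpb_zero[OF g, of s] frac_kernel_nonneg[OF \<alpha>(1), of "t - s"] by (cases "s > 0 \<and> s < t") (auto simp: c_def frac_kernel_def indicator_def abs_of_pos[OF G])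
  qed
  also have "... \<le> ennreal (A powr (1 / q) * (b + 1) powr (1 / p))" using p_gt_1 q_gt_1 conj_pq A b frac_kernel_nonneg[OF \<alpha>(1)]
    by (intro nn_Hoelder) (auto simp: LpE_def[symmetric] intro: ennreal_leI)
  also have "... < \<infinity>" by simp
  finally show "(\<integral>s. ennreal (norm (frac_kernel \<alpha> (t - s) *\<^sub>R g s))) < \<infinity>" .
qed

definition hoelder_const :: real
  where "hoelder_const = (2 / (\<gamma> + 1) / Gamma \<alpha> powr q) powr (1 / q)"

lemma hoelder_const_pos: "hoelder_const > 0" using \<gamma>_bounds Gamma_real_pos[OF \<alpha>(1)] by (simp add: hoelder_const_def)

text \<open>Hoelder's inequality against the q-norm of the kernel increment. The exponent (\<gamma>
  + 1) / q equals \<alpha> - 1 / p and is the source of the interpolation exponent later on.\<close>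

lemma fint_hoelder:
  assumes g: "g \<in> Lpb p T" and B: "B > 0" "LpE p g \<le> ennreal B"
  shows "norm (J g t - J g s) \<le> hoelder_const * \<bar>t - s\<bar> powr (\<alpha> - 1 / p) * B powr (1 / p)"
proof -
  have main: "norm (J g t - J g s) \<le> hoelder_const * (t - s) powr (\<alpha> - 1 / p) * B powr (1 / p)"
    if st: "s < t" for s t
  proof -
    have [measurable]: "g \<in> borel_measurable borel" using g by (rule Lpb_measurable)
    define A where "A = 2 * ((t - s) powr (\<gamma> + 1) / (\<gamma> + 1) / Gamma \<alpha> powr q)"
    have A0: "A > 0" using st \<gamma>_bounds Gamma_real_pos[OF \<alpha>(1)] by (simp add: A_def)
    have "J g t - J g s = (LINT r|lborel. frac_kernel \<alpha> (t - r) *\<^sub>R g r - frac_kernel \<alpha> (s - r) *\<^sub>R g r)"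
      unfolding fint_def using frac_kernel_integrable[OF g] by simp
    then have "ennreal (norm (J g t - J g s)) \<le>
      (\<integral>r. ennreal (norm (frac_kernel \<alpha> (t - r) *\<^sub>R g r - frac_kernel \<alpha> (s - r) *\<^sub>R g r)))"
      by (simp only:) (intro integral_norm_bound_ennreal Bochner_Integration.integrable_diff frac_kernel_integrable[OF g])
    also have "... = (\<integral>r. ennreal ((\<bar>frac_kernel \<alpha> (t - r) - frac_kernel \<alpha> (s - r)\<bar> * indicator {0<..} r) * norm (g r)))"
      using Lpb_zero[OF g] by (intro nn_integral_cong) (auto simp: indicator_def simp flip: scaleR_diff_left)
    also have "... \<le> ennreal (A powr (1 / q) * B powr (1 / p))" using p_gt_1 q_gt_1 conj_pq A0 B frac_kernel_increment[OF st]
      by (intro nn_Hoelder) (auto simp: LpE_def[symmetric] A_def)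
    finally have "norm (J g t - J g s) \<le> A powr (1 / q) * B powr (1 / p)" by (subst (asm) ennreal_le_iff) auto
    also have "A powr (1 / q) = hoelder_const * (t - s) powr (\<alpha> - 1 / p)"
    proof -
      have "A = (2 / (\<gamma> + 1) / Gamma \<alpha> powr q) * (t - s) powr (\<gamma> + 1)" by (simp add: A_def)
      then have "A powr (1 / q) = hoelder_const * ((t - s) powr (\<gamma> + 1)) powr (1 / q)" unfolding hoelder_const_def by (simp only: powr_mult)
      then show ?thesis using \<gamma>_q by (simp add: powr_powr)
    qed
    finally show ?thesis by simp
  qed
  consider "s < t" | "t < s" | "s = t" by linarith
  then show ?thesis
  proof cases
    case 2
    then show ?thesis using main[OF 2] by (simp add: norm_minus_commute abs_minus_commute)
  qed (use main hoelder_const_pos in auto)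
qed

lemma fint_zero:
  assumes g: "g \<in> Lpb p T" and "t \<le> 0"
  shows "J g t = 0"
proof -
  have "frac_kernel \<alpha> (t - s) *\<^sub>R g s = 0" for s using Lpb_zero[OF g, of s] assms(2) by (cases "s > 0") (auto simp: frac_kernel_def)
  then have "(\<lambda>s. frac_kernel \<alpha> (t - s) *\<^sub>R g s) = (\<lambda>s. 0)" by (rule ext)
  then show ?thesis unfolding fint_def by simp
qed

lemma fint_continuous:
  assumes g: "g \<in> Lpb p T"
  shows "continuous_on UNIV (J g)"
proof -
  obtain b where b: "LpE p g = ennreal b" "b \<ge> 0" using Lpb_finite[OF g] by (cases "LpE p g") auto
  define B where "B = b + 1"
  have B: "B > 0" "LpE p g \<le> ennreal B" using b by (auto simp: B_def intro: ennreal_leI)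
  show ?thesis unfolding continuous_on
  proof
    fix t
    have "((\<lambda>s. \<bar>s - t\<bar> powr (\<alpha> - 1 / p)) \<longlongrightarrow> \<bar>t - t\<bar> powr (\<alpha> - 1 / p)) (at t within UNIV)"
      using order_pos by (intro tendsto_powr2 tendsto_intros) auto
    then have "((\<lambda>s. \<bar>s - t\<bar> powr (\<alpha> - 1 / p)) \<longlongrightarrow> 0) (at t within UNIV)" using order_pos by simp
    then have "((\<lambda>s. hoelder_const * \<bar>s - t\<bar> powr (\<alpha> - 1 / p) * B powr (1 / p)) \<longlongrightarrow> 0) (at t within UNIV)"
      by (intro tendsto_mult_left_zero tendsto_mult_right_zero)
    then have "((\<lambda>s. J g s - J g t) \<longlongrightarrow> 0) (at t within UNIV)" by (rule Lim_null_comparison[rotated]) (use fint_hoelder[OF g B] in auto)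
    then show "(J g \<longlongrightarrow> J g t) (at t within UNIV)" by (simp add: LIM_zero_iff)
  qed
qed

end

section \<open>The scalar Volterra equation\<close>

lemma Lpb_integrable:
  assumes f: "f \<in> Lpb p T" and p: "p \<ge> 1"
  shows "integrable lborel f"
proof (rule integrableI_bounded)
  have [measurable]: "f \<in> borel_measurable borel" using f by (rule Lpb_measurable)
  show "f \<in> borel_measurable lborel" by measurable
  have le: "x \<le> 1 + x powr p" if "x \<ge> 0" for x :: real
  proof (cases "x \<le> 1")
    case True
    then show ?thesis using powr_ge_zero[of x p] by linarith
  next
    case False
    then show ?thesis using powr_mono[of 1 p x] p by simp
  qed
  have "(\<integral>t. ennreal (norm (f t))) \<le> (\<integral>t. indicator {0<..<T} t + ennreal (norm (f t) powr p))"
  proof (rule nn_integral_mono)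
    fix t
    have "ennreal (norm (f t)) \<le> ennreal (1 + norm (f t) powr p)" by (intro ennreal_leI le) simp
    then show "ennreal (norm (f t)) \<le> indicator {0<..<T} t + ennreal (norm (f t) powr p)" using Lpb_zero[OF f, of t] by (cases "t \<in> {0<..<T}") auto
  qed
  also have "... = emeasure lborel {0<..<T} + LpE p f" unfolding LpE_def by (subst nn_integral_add) auto
  also have "... < \<infinity>" using Lpb_finite[OF f] by (cases "0 \<le> T") (auto simp: less_top)
  finally show "(\<integral>t. ennreal (norm (f t))) < \<infinity>" .
qed

lemma Lpb_laplace_class: "f \<in> Lpb p T ==> p \<ge> 1 ==> f \<in> laplace_class" by (intro laplace_classI Lpb_integrable Lpb_measurable Lpb_zero) auto

lemma conv_cong_left:
  assumes f: "\<And>t. t \<le> 0 ==> f t = 0" and t: "t \<le> T"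
    and [measurable]: "f \<in> borel_measurable borel" "g \<in> borel_measurable borel" "h \<in> borel_measurable borel"
    and gh: "AE s in lborel. s < T --> g s = h s"
  shows "conv f g t = conv f h t" unfolding conv_def
proof (rule integral_cong_AE)
  show "AE s in lborel. f (t - s) * g s = f (t - s) * h s" using gh by eventually_elim (use f t in \<open>force simp: not_less\<close>)
qed measurable

definition cfrac :: "real => real => complex" where "cfrac \<beta> t = of_real (frac_kernel \<beta> t)"

lemma cfrac_class: "\<beta> > 0 ==> cfrac \<beta> \<in> laplace_class" unfolding cfrac_def[abs_def] by (rule frac_kernel_laplace_class)

lemma laplace_cfrac: "\<beta> > 0 ==> s > 0 ==> laplace (cfrac \<beta>) s = of_real (s powr (- \<beta>))" unfolding cfrac_def[abs_def] by (rule laplace_frac_kernel)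

lemma cfrac_zero: "t \<le> 0 ==> cfrac \<beta> t = 0" by (simp add: cfrac_def frac_kernel_def)

lemma cfrac_measurable [measurable]: "cfrac \<beta> \<in> borel_measurable borel" unfolding cfrac_def[abs_def] by measurable

context fractional_order
begin

definition mu :: "real => real" where "mu l = l powr (1 / \<alpha>)"

lemma mu_pos: "l > 0 ==> mu l > 0" by (simp add: mu_def)

lemma mu_powr: "l > 0 ==> s \<ge> 0 ==> (s / mu l) powr \<alpha> = s powr \<alpha> / l"
  "l > 0 ==> s \<ge> 0 ==> (mu l * s) powr \<alpha> = l * s powr \<alpha>" using \<alpha> by (simp_all add: mu_def powr_divide powr_mult powr_powr)

abbreviation mlk :: "real => real => complex" where "mlk l \<equiv> ml_kernel \<alpha> (mu l)"

lemma mlk_class: "l > 0 ==> mlk l \<in> laplace_class" by (intro ml_kernel_laplace_class mu_pos)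

lemma mlk_zero: "t \<le> 0 ==> mlk l t = 0" by (simp add: ml_kernel_def)

lemma complex_denominator: "x > 0 ==> complex_of_real x + \<i> * of_real l \<noteq> 0" by (auto simp: complex_eq_iff)

lemma laplace_mlk:
  assumes "l > 0" "s > 0"
  shows "laplace (mlk l) s = of_real l / (of_real (s powr \<alpha>) + \<i> * of_real l)"
  using assms laplace_ml_kernel[OF mu_pos, of l s] complex_denominator[of "s powr \<alpha>" l] by (simp add: mu_powr field_simps)

text \<open>Both sides have Laplace transform l / (s powr \<alpha> + \<i> l) times that of
  \<open>\<phi>\<close>.\<close>

lemma volterra:
  assumes l: "l > 0" and \<phi>: "\<phi> \<in> laplace_class"
  shows "AE t in lborel. conv (mlk l) \<phi> t = of_real l * conv (cfrac \<alpha>) (\<lambda>s. \<phi> s - \<i> * conv (mlk l) \<phi> s) t"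
proof (rule laplace_injective)
  have v: "conv (mlk l) \<phi> \<in> laplace_class" by (intro laplace_class_conv mlk_class l \<phi>)
  then show "conv (mlk l) \<phi> \<in> laplace_class" .
  have w: "(\<lambda>s. \<phi> s - \<i> * conv (mlk l) \<phi> s) \<in> laplace_class" by (intro laplace_class_diff laplace_class_cmult \<phi> v)
  then show "(\<lambda>t. of_real l * conv (cfrac \<alpha>) (\<lambda>s. \<phi> s - \<i> * conv (mlk l) \<phi> s) t) \<in> laplace_class"
    using \<alpha> by (intro laplace_class_cmult laplace_class_conv cfrac_class) auto
  fix s :: real assume s: "s \<ge> 1"
  define d where "d = complex_of_real (s powr \<alpha>) + \<i> * of_real l"
  have d: "d \<noteq> 0" using s by (auto simp: d_def intro!: complex_denominator)
  have K: "laplace (mlk l) s = of_real l / d" using laplace_mlk[OF l, of s] s by (simp add: d_def)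
  have L: "laplace (\<lambda>t. of_real l * conv (cfrac \<alpha>) (\<lambda>s. \<phi> s - \<i> * conv (mlk l) \<phi> s) t) s =
    of_real l * (of_real (s powr (- \<alpha>)) * (laplace \<phi> s - \<i> * (of_real l / d * laplace \<phi> s)))" using s \<alpha> w v \<phi> l
    by (simp add: laplace_cmult laplace_conv cfrac_class laplace_cfrac laplace_diff laplace_class_cmult mlk_class K)
  have "1 - \<i> * (of_real l / d) = of_real (s powr \<alpha>) / d" using d by (simp add: field_simps) (simp add: d_def)
  then have "laplace \<phi> s - \<i> * (of_real l / d * laplace \<phi> s) = of_real (s powr \<alpha>) / d * laplace \<phi> s"
    by (metis (no_types, lifting) left_diff_distrib mult.assoc mult_1)
  moreover have "complex_of_real (s powr (- \<alpha>)) * of_real (s powr \<alpha>) = 1" using s by (simp flip: of_real_mult powr_add)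
  ultimately have "of_real (s powr (- \<alpha>)) * (laplace \<phi> s - \<i> * (of_real l / d * laplace \<phi> s)) = laplace \<phi> s / d"
    by (simp only: times_divide_eq_left times_divide_eq_right mult.assoc[symmetric] mult_1)
  then show "laplace (conv (mlk l) \<phi>) s = laplace (\<lambda>t. of_real l * conv (cfrac \<alpha>) (\<lambda>s. \<phi> s - \<i> * conv (mlk l) \<phi> s) t) s"
    unfolding L using s \<phi> l by (simp add: laplace_conv mlk_class K)
qed

text \<open>The equation holds before \<open>T\<close> only, so it cannot be transformed directly.
  Its residual \<open>r\<close> on the line vanishes before \<open>T\<close>, and \<open>y\<close>
  is recovered as r - \<i> (k convolved with r), which by causality vanishes there as well.\<close>

lemma volterra_unique:
  assumes l: "l > 0" and y: "y \<in> laplace_class" and yT: "\<And>t. t \<ge> T ==> y t = 0"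
    and eq: "AE t in lborel. t < T --> y t = - \<i> * of_real l * conv (cfrac \<alpha>) y t"
  shows "AE t in lborel. y t = 0"
proof -
  define r where "r t = y t + \<i> * of_real l * conv (cfrac \<alpha>) y t" for t
  have c: "conv (cfrac \<alpha>) y \<in> laplace_class" using \<alpha> by (intro laplace_class_conv cfrac_class y) auto
  have r: "r \<in> laplace_class" unfolding r_def[abs_def] by (intro laplace_class_add laplace_class_cmult y c)
  have r0: "AE t in lborel. t < T --> r t = 0" using eq by eventually_elim (simp add: r_def)
  have kr: "conv (mlk l) r \<in> laplace_class" by (intro laplace_class_conv mlk_class l r)
  have "AE t in lborel. y t = r t - \<i> * conv (mlk l) r t"
  proof (rule laplace_injective[OF y])
    show "(\<lambda>t. r t - \<i> * conv (mlk l) r t) \<in> laplace_class" by (intro laplace_class_diff laplace_class_cmult r kr)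
    fix s :: real assume s: "s \<ge> 1"
    define a where "a = complex_of_real (s powr \<alpha>)"
    define d where "d = a + \<i> * of_real l"
    have d: "d \<noteq> 0" using s by (auto simp: d_def a_def intro!: complex_denominator)
    have a: "a \<noteq> 0" "complex_of_real (s powr (- \<alpha>)) = 1 / a" using s by (auto simp: a_def powr_minus divide_inverse)
    have K: "laplace (mlk l) s = of_real l / d" using laplace_mlk[OF l, of s] s by (simp add: d_def a_def)
    have R: "laplace r s = laplace y s + \<i> * of_real l * (1 / a * laplace y s)" unfolding r_def[abs_def] using s \<alpha> y c
      by (simp add: laplace_add laplace_cmult laplace_class_cmult laplace_conv cfrac_class laplace_cfrac a)
    have "laplace (\<lambda>t. r t - \<i> * conv (mlk l) r t) s = laplace r s - \<i> * (of_real l / d * laplace r s)"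
      using s r kr l by (simp add: laplace_diff laplace_cmult laplace_class_cmult laplace_conv mlk_class K)
    also have "... = (1 - \<i> * (of_real l / d)) * laplace r s" by (simp add: algebra_simps)
    also have "1 - \<i> * (of_real l / d) = a / d" using d by (simp add: field_simps) (simp add: d_def)
    also have "laplace r s = d / a * laplace y s" using a unfolding R by (simp add: d_def field_simps)
    also have "a / d * (d / a * laplace y s) = laplace y s" using a d by simp
    finally show "laplace y s = laplace (\<lambda>t. r t - \<i> * conv (mlk l) r t) s" by simp
  qed
  then show ?thesis using r0
  proof eventually_elim
    case (elim t)
    show ?case
    proof (cases "t < T")
      case True
      then have "conv (mlk l) r t = 0" by (intro conv_zero[OF mlk_zero r0]) auto
      then show ?thesis using elim True by simp
    qed (use yT in auto)
  qed
qed

end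

text \<open>Integrating once more with order 1 - \<alpha> turns the hypothesis into the vanishing of
  the primitive of \<open>y\<close> before \<open>T\<close>, by causality and the semigroup law of
  the kernels.\<close>

lemma conv_cfrac_injective:
  assumes \<alpha>: "0 < \<alpha>" "\<alpha> < 1" and y: "y \<in> laplace_class" "integrable lborel y" and yT: "\<And>t. t \<ge> T ==> y t = 0"
    and eq: "AE t in lborel. t < T --> conv (cfrac \<alpha>) y t = 0"
  shows "AE t in lborel. y t = 0"
proof -
  define r where "r = conv (cfrac \<alpha>) y"
  have r: "r \<in> laplace_class" using \<alpha> unfolding r_def by (intro laplace_class_conv cfrac_class y) auto
  have one: "cfrac 1 t = (if t > 0 then 1 else 0)" for t by (simp add: cfrac_def frac_kernel_def)
  have eq1: "AE t in lborel. conv (cfrac (1 - \<alpha>)) r t = conv (cfrac 1) y t"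
  proof (rule laplace_injective)
    show "conv (cfrac (1 - \<alpha>)) r \<in> laplace_class" "conv (cfrac 1) y \<in> laplace_class" using \<alpha> by (auto intro!: laplace_class_conv cfrac_class r y)
    fix s :: real assume s: "s \<ge> 1"
    have "s powr (- (1 - \<alpha>)) * s powr (- \<alpha>) = s powr (- 1)" using s by (simp flip: powr_add)
    then have "complex_of_real (s powr (- (1 - \<alpha>))) * of_real (s powr (- \<alpha>)) = of_real (s powr (- 1))" by (simp only: of_real_mult[symmetric])
    then show "laplace (conv (cfrac (1 - \<alpha>)) r) s = laplace (conv (cfrac 1) y) s"
      using s \<alpha> y(1) r by (simp add: r_def laplace_conv laplace_class_conv cfrac_class laplace_cfrac flip: mult.assoc)
  qed
  have z0: "conv (cfrac (1 - \<alpha>)) r t = 0" if "t < T" for t using that eq by (intro conv_zero[of "cfrac (1 - \<alpha>)" T]) (auto simp: cfrac_zero r_def)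
  have ae: "AE t in lborel. t < T --> (LINT s|lborel. indicator {..<t} s *\<^sub>R y s) = 0" using eq1
  proof eventually_elim
    case (elim t)
    have "conv (cfrac 1) y t = (LINT s|lborel. indicator {..<t} s *\<^sub>R y s)" unfolding conv_def one by (intro Bochner_Integration.integral_cong) (auto simp: indicator_def)
    then show ?case using elim z0 by auto
  qed
  show ?thesis
  proof (rule AE_zero_if_initial_integrals_zero[OF y(2)])
    fix a :: real
    have ind: "(LINT t|lborel. indicator {..a} t *\<^sub>R y t) = (LINT t|lborel. indicator {..<a} t *\<^sub>R y t)" for a
    proof (rule integral_cong_AE)
      have "AE t in lborel. t \<noteq> a" by (rule AE_lborel_singleton)
      then show "AE t in lborel. indicator {..a} t *\<^sub>R y t = indicator {..<a} t *\<^sub>R y t" by eventually_elim (auto simp: indicator_def)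
    qed (use y(2) in auto)
    have zero: "(LINT t|lborel. indicator {..<b} t *\<^sub>R y t) = 0" if b: "b \<le> T" for b
    proof -
      \<comment> \<open>The primitive is known to vanish at almost every time, hence at times
        increasing to \<open>b\<close>.\<close>
      have "\<exists>t. b - 1 / real (Suc n) < t \<and> t < b \<and> (LINT s|lborel. indicator {..<t} s *\<^sub>R y s) = 0" for n
      proof (rule ccontr)
        assume no: "\<not> ?thesis"
        define I where "I = {b - 1 / real (Suc n)<..<b}"
        have "AE t in lborel. t \<notin> I" using ae by eventually_elim (use no b in \<open>auto simp: I_def\<close>)
        then have "emeasure lborel I = 0" by (subst (asm) AE_iff_measurable[where N=I]) (auto simp: I_def)
        then show False by (simp add: I_def)
      qed
      then obtain t where t: "\<And>n. b - 1 / real (Suc n) < t n" "\<And>n. t n < b"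
        "\<And>n. (LINT s|lborel. indicator {..<t n} s *\<^sub>R y s) = 0" by metis
      have tlim: "t \<longlonglongrightarrow> b"
      proof (rule real_tendsto_sandwich)
        show "\<forall>\<^sub>F n in sequentially. b - 1 / real (Suc n) \<le> t n" using t(1) by (intro always_eventually allI less_imp_le)
        show "\<forall>\<^sub>F n in sequentially. t n \<le> b" using t(2) by (intro always_eventually allI less_imp_le)
        have "(\<lambda>n. b - 1 / real (Suc n)) \<longlonglongrightarrow> b - 0" by (intro tendsto_intros LIMSEQ_Suc[OF lim_1_over_n])
        then show "(\<lambda>n. b - 1 / real (Suc n)) \<longlonglongrightarrow> b" by simp
      qed simp
      have "(\<lambda>n. LINT s|lborel. indicator {..<t n} s *\<^sub>R y s) \<longlonglongrightarrow> (LINT s|lborel. indicator {..<b} s *\<^sub>R y s)"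
      proof (rule integral_dominated_convergence[where w="\<lambda>s. norm (y s)"])
        show "AE s in lborel. (\<lambda>n. indicator {..<t n} s *\<^sub>R y s) \<longlonglongrightarrow> indicator {..<b} s *\<^sub>R y s"
        proof (rule AE_I2, rule tendsto_eventually)
          fix s
          show "\<forall>\<^sub>F n in sequentially. indicator {..<t n} s *\<^sub>R y s = indicator {..<b} s *\<^sub>R y s"
          proof (cases "s < b")
            case True
            then have "\<forall>\<^sub>F n in sequentially. s < t n" using tlim by (intro order_tendstoD)
            then show ?thesis by eventually_elim (use True in auto)
          next
            case False
            then have "\<not> s < t n" for n using t(2)[of n] by linarith
            then show ?thesis using False by auto
          qed
        qed
      qed (use y(2) in \<open>auto simp: indicator_def\<close>)
      then show ?thesis using t(3) by (simp add: LIMSEQ_const_iff)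
    qed
    have "(LINT t|lborel. indicator {..<a} t *\<^sub>R y t) = (LINT t|lborel. indicator {..<min a T} t *\<^sub>R y t)"
      using yT by (intro Bochner_Integration.integral_cong) (auto simp: indicator_def)
    then show "(LINT t|lborel. indicator {..a} t *\<^sub>R y t) = 0" unfolding ind using zero[of "min a T"] by simp
  qed
qed

section \<open>The linear problem\<close>

lemma LpE_measurable_integrand [measurable]:
  fixes f :: "real => 'b::{real_normed_vector, second_countable_topology}"
  assumes [measurable]: "f \<in> borel_measurable borel"
  shows "(\<lambda>t. ennreal (norm (f t) powr p)) \<in> borel_measurable borel" by measurable

lemma powr_add_le:
  fixes a b :: real
  assumes "a \<ge> 0" "b \<ge> 0" "p > 0"
  shows "(a + b) powr p \<le> 2 powr p * (a powr p + b powr p)"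
proof -
  have "(a + b) powr p \<le> (2 * max a b) powr p" using assms by (intro powr_mono2) auto
  also have "... = 2 powr p * max a b powr p" by (simp add: powr_mult)
  also have "... \<le> 2 powr p * (a powr p + b powr p)" by (intro mult_left_mono) (auto simp: max_def)
  finally show ?thesis .
qed

lemma LpE_mono:
  assumes "p \<ge> 0" "AE t in lborel. norm (f t) \<le> norm (g t)"
  shows "LpE p f \<le> LpE p g" unfolding LpE_def
proof (rule nn_integral_mono_AE, use assms(2) in eventually_elim)
  case (elim t)
  then show ?case using assms(1) by (intro ennreal_leI powr_mono2) auto
qed

lemma LpE_add_le:
  fixes f g :: "real => 'b::{real_normed_vector, second_countable_topology}"
  assumes [measurable]: "f \<in> borel_measurable borel" "g \<in> borel_measurable borel" and p: "p > 0"
    and h: "AE t in lborel. norm (h t) \<le> norm (f t) + norm (g t)"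
  shows "LpE p h \<le> ennreal (2 powr p) * (LpE p f + LpE p g)"
proof -
  have "LpE p h \<le> (\<integral>t. ennreal (2 powr p) * (ennreal (norm (f t) powr p) + ennreal (norm (g t) powr p)))" unfolding LpE_def
  proof (rule nn_integral_mono_AE, use h in eventually_elim)
    case (elim t)
    have "norm (h t) powr p \<le> (norm (f t) + norm (g t)) powr p" using elim p by (intro powr_mono2) auto
    also have "... \<le> 2 powr p * (norm (f t) powr p + norm (g t) powr p)" using p by (intro powr_add_le) auto
    finally show ?case by (simp add: ennreal_leI flip: ennreal_plus ennreal_mult)
  qed
  also have "... = ennreal (2 powr p) * (LpE p f + LpE p g)" unfolding LpE_def by (subst nn_integral_cmult, measurable, subst nn_integral_add) auto
  finally show ?thesis .
qed

lemma Lpb_dominated: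
  fixes f g h :: "real => 'b::{banach, second_countable_topology}"
  assumes f: "f \<in> Lpb p T" and g: "g \<in> Lpb p T" and p: "p > 0"
    and h: "h \<in> borel_measurable borel" "\<And>t. norm (h t) \<le> norm (f t) + norm (g t)"
  shows "h \<in> Lpb p T"
proof -
  have "LpE p h \<le> ennreal (2 powr p) * (LpE p f + LpE p g)" by (rule LpE_add_le[OF Lpb_measurable[OF f] Lpb_measurable[OF g] p]) (intro AE_I2 h(2))
  also have "... < top" using Lpb_finite[OF f] Lpb_finite[OF g] by (simp add: ennreal_mult_less_top)
  finally have "LpE p h < top" .
  moreover have "h t = 0" if "t \<notin> {0<..<T}" for t using h(2)[of t] Lpb_zero[OF f that] Lpb_zero[OF g that] by simp
  ultimately show ?thesis using h(1) by (auto simp: Lpb_def)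
qed

lemma borel_measurable_scaleC [measurable]:
  fixes f :: "real => 'a::{complex_hilbert, second_countable_topology}"
  assumes [measurable]: "f \<in> borel_measurable borel"
  shows "(\<lambda>t. c *\<^sub>C f t) \<in> borel_measurable borel"
proof -
  have "continuous_on UNIV (\<lambda>x::'a. c *\<^sub>C x)" by (rule linear_continuous_on[OF bounded_linear_scaleC_right])
  then have "(\<lambda>x::'a. c *\<^sub>C x) \<in> borel_measurable borel" by (rule borel_measurable_continuous_onI)
  then show ?thesis by measurable
qed

lemma borel_measurable_scaleC_const [measurable]:
  fixes x :: "'a::{complex_hilbert, second_countable_topology}"
  assumes [measurable]: "f \<in> borel_measurable borel"
  shows "(\<lambda>t. f t *\<^sub>C x) \<in> borel_measurable borel"
proof -
  have "continuous_on UNIV (\<lambda>c. c *\<^sub>C x)" by (rule linear_continuous_on[OF bounded_bilinear.bounded_linear_left[OF bounded_bilinear_scaleC]])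
  then have [measurable]: "(\<lambda>c. c *\<^sub>C x) \<in> borel_measurable borel" by (rule borel_measurable_continuous_onI)
  show ?thesis by measurable
qed

lemma borel_measurable_cinner_const [measurable]:
  fixes f :: "real => 'a::{complex_hilbert, second_countable_topology}"
  assumes [measurable]: "f \<in> borel_measurable borel"
  shows "(\<lambda>t. cinner (f t) x) \<in> borel_measurable borel"
proof -
  have "continuous_on UNIV (\<lambda>y::'a. cinner y x)" by (rule linear_continuous_on[OF bounded_linear_cinner_left])
  then have [measurable]: "(\<lambda>y::'a. cinner y x) \<in> borel_measurable borel" by (rule borel_measurable_continuous_onI)
  show ?thesis by measurable
qed

locale mr_setting = fractional_Lp \<alpha> p + eigenbasis A D e lam lam0
  for \<alpha> p :: real and A :: "'a::{complex_hilbert, second_countable_topology} => 'a" and D e lam lam0 +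
  fixes T :: real
  assumes T: "T > 0"
begin

abbreviation L :: "(real => 'a) set" where "L \<equiv> Lpb p T"

lemma p_pos: "p > 0" using p_gt_1 by simp

lemma norm_e: "norm (e n) \<le> 1" using e_norm[of n] by auto

lemma coeff_le: "cmod (coeff x n) \<le> norm x" using cinner_Cauchy_Schwarz[of x "e n"] norm_e[of n] mult_left_mono[OF norm_e, of "norm x" n] by simp

lemma Lpb_coeff: "f \<in> L ==> (\<lambda>t. coeff (f t) n) \<in> Lpb p T"
proof -
  assume f: "f \<in> L"
  have "LpE p (\<lambda>t. coeff (f t) n) \<le> LpE p f" using p_pos coeff_le by (intro LpE_mono) auto
  then show ?thesis using Lpb_finite[OF f] Lpb_zero[OF f] borel_measurable_cinner_const[OF Lpb_measurable[OF f]] by (auto simp: Lpb_def intro: le_less_trans)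
qed

lemma coeff_class: "f \<in> L ==> (\<lambda>t. coeff (f t) n) \<in> laplace_class" using p_gt_1 by (intro Lpb_laplace_class[OF Lpb_coeff]) auto

lemma coeff_fint:
  assumes "g \<in> L"
  shows "coeff (J g t) n = conv (cfrac \<alpha>) (\<lambda>s. coeff (g s) n) t"
proof -
  have "coeff (J g t) n = (LINT s|lborel. coeff (frac_kernel \<alpha> (t - s) *\<^sub>R g s) n)" unfolding fint_def
    by (rule integral_bounded_linear[OF bounded_linear_cinner_left frac_kernel_integrable[OF assms], symmetric])
  then show ?thesis by (simp add: conv_def cinner_scaleR_left cfrac_def scaleR_conv_of_real)
qed

definition vcoef :: "(real => 'a) => nat => real => complex"
  where "vcoef f n = conv (mlk (lam n)) (\<lambda>s. coeff (f s) n)"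

text \<open>\<open>Top f\<close> is \<open>- A u\<close> for the solution \<open>u\<close> of the linear problem with right-hand side \<open>f\<close>
  and zero initial value.\<close>

definition Top :: "(real => 'a) => real => 'a"
  where "Top f t = indicator {0<..<T} t *\<^sub>R (\<Sum>n. vcoef f n t *\<^sub>C e n)"

abbreviation resid :: "(real => 'a) => real => 'a" where "resid f \<equiv> \<lambda>t. f t - \<i> *\<^sub>C Top f t"

lemma vcoef_measurable [measurable]: "f \<in> L ==> vcoef f n \<in> borel_measurable borel" unfolding vcoef_def
  by (intro conv_measurable borel_measurable_cinner_const[OF Lpb_measurable] laplace_class_measurable[OF mlk_class] lam_pos)

lemma Top_measurable: "f \<in> L ==> Top f \<in> borel_measurable borel" unfolding Top_def[abs_def]
  by (intro borel_measurable_scaleR borel_measurable_suminf borel_measurable_scaleC_const vcoef_measurable) auto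

lemma vcoef_zero: "e n = 0 ==> vcoef f n t = 0" by (simp add: vcoef_def conv_def)

definition vmaj :: "(real => 'a) => nat => real => ennreal"
  where "vmaj f n t = nnconv (ml_majorant \<alpha> (mu (lam n))) (\<lambda>s. ennreal (cmod (coeff (f s) n))) t"

lemma vcoef_le: "ennreal (cmod (vcoef f n t)) \<le> vmaj f n t"
proof -
  define F where "F s = mlk (lam n) (t - s) * coeff (f s) n" for s
  have "ennreal (cmod (vcoef f n t)) \<le> (\<integral>s. ennreal (cmod (F s)))"
  proof (cases "integrable lborel F")
    case True
    then show ?thesis unfolding vcoef_def conv_def F_def by (rule integral_norm_bound_ennreal)
  next
    case False
    then show ?thesis unfolding vcoef_def conv_def F_def by (simp add: not_integrable_integral_eq)
  qed
  also have "... \<le> vmaj f n t" unfolding vmaj_def nnconv_def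
  proof (rule nn_integral_mono)
    fix s
    show "ennreal (cmod (F s)) \<le> ml_majorant \<alpha> (mu (lam n)) (t - s) * ennreal (cmod (coeff (f s) n))"
      unfolding F_def using norm_ml_kernel_le[OF mu_pos[OF lam_pos], of n "t - s"] by (simp add: norm_mult ennreal_mult mult_right_mono)
  qed
  finally show ?thesis .
qed

lemma vmaj_measurable [measurable]:
  assumes f: "f \<in> L" shows "vmaj f n \<in> borel_measurable borel"
proof -
  note [measurable] = borel_measurable_cinner_const[OF Lpb_measurable[OF f]]
  show ?thesis unfolding vmaj_def[abs_def] by (intro nnconv_measurable) measurable
qed

text \<open>The square function bound for the first N coordinates is uniform in \<open>N\<close>,
  and monotone convergence gives an almost everywhere finite supremum. Where it is finite the series
  defining \<open>Top\<close> converges, which is why the coordinates are identified in the same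
  lemma.\<close>

lemma Top_bound_ex:
  "\<exists>C>0. \<forall>f\<in>L. LpE p (Top f) \<le> ennreal C * LpE p f \<and>
    (AE t\<in>{0<..<T} in lborel. (\<forall>n. coeff (Top f t) n = vcoef f n t))"
proof -
  interpret M: maximal_kernels "\<lambda>n. ml_majorant \<alpha> (mu (lam n))" kernel_const by (rule maximal_kernels_ml_majorant) (intro mu_pos lam_pos)
  obtain K where K: "K \<ge> 0" "\<And>N f. (\<And>n. f n \<in> borel_measurable borel) ==> (\<And>n s. 0 \<le> f n s) ==>
    (\<integral>t. epow (\<Sum>n<N. (nnconv (ml_majorant \<alpha> (mu (lam n))) (\<lambda>s. ennreal (f n s)) t)\<^sup>2) (p / 2)) \<le>
    ennreal K * (\<integral>t. ennreal ((\<Sum>n<N. (f n t)\<^sup>2) powr (p / 2)))" using M.square_function_bound[OF p_gt_1] by auto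
  show ?thesis
  proof (intro exI[of _ "K + 1"] conjI ballI)
    show "K + 1 > 0" using K by simp
    fix f assume f: "f \<in> L"
    have [measurable]: "f \<in> borel_measurable borel" using f by (rule Lpb_measurable)
    note [measurable] = vmaj_measurable[OF f] vcoef_measurable[OF f]
    define W where "W N t = epow (\<Sum>n<N. (vmaj f n t)\<^sup>2) (p / 2)" for N t
    have WN: "(\<integral>t. W N t) \<le> ennreal K * LpE p f" for N
    proof -
      have "(\<integral>t. W N t) \<le> ennreal K * (\<integral>t. ennreal ((\<Sum>n<N. (cmod (coeff (f t) n))\<^sup>2) powr (p / 2)))" unfolding W_def vmaj_def by (rule K(2)) auto
      also have "... \<le> ennreal K * LpE p f" unfolding LpE_def
      proof (intro mult_left_mono nn_integral_mono ennreal_leI)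
        fix t
        have "(\<Sum>n<N. (cmod (coeff (f t) n))\<^sup>2) powr (p / 2) \<le> ((norm (f t))\<^sup>2) powr (p / 2)" using p_pos by (intro powr_mono2 bessel) (auto simp: sum_nonneg)
        then show "(\<Sum>n<N. (cmod (coeff (f t) n))\<^sup>2) powr (p / 2) \<le> norm (f t) powr p" by (simp add: power2_powr_half)
      qed simp
      finally show ?thesis .
    qed
    have inc: "incseq W" unfolding W_def incseq_def le_fun_def using p_pos by (intro allI impI epow_mono sum_mono2) auto
    have [measurable]: "W N \<in> borel_measurable borel" for N unfolding W_def by measurable
    have SUP_le: "(\<integral>t. (SUP N. W N t)) \<le> ennreal K * LpE p f" using inc by (subst nn_integral_monotone_convergence_SUP) (auto intro!: SUP_least WN)
    then have "(\<integral>t. (SUP N. W N t)) < top" using Lpb_finite[OF f] by (auto simp: ennreal_mult_less_top intro: le_less_trans)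
    then have fin: "AE t in lborel. (SUP N. W N t) \<noteq> \<infinity>" by (intro nn_integral_noteq_infinite) auto
    have partial: "ennreal ((\<Sum>n<N. (cmod (vcoef f n t))\<^sup>2) powr (p / 2)) \<le> W N t" for N t
    proof -
      have "ennreal ((\<Sum>n<N. (cmod (vcoef f n t))\<^sup>2) powr (p / 2)) = epow (ennreal (\<Sum>n<N. (cmod (vcoef f n t))\<^sup>2)) (p / 2)" by (simp add: sum_nonneg)
      also have "... \<le> W N t" unfolding W_def
      proof (rule epow_mono)
        have "ennreal (\<Sum>n<N. (cmod (vcoef f n t))\<^sup>2) = (\<Sum>n<N. (ennreal (cmod (vcoef f n t)))\<^sup>2)" by (subst sum_ennreal[symmetric]) (auto simp: ennreal_power)
        also have "... \<le> (\<Sum>n<N. (vmaj f n t)\<^sup>2)" by (intro sum_mono power_mono vcoef_le) auto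
        finally show "ennreal (\<Sum>n<N. (cmod (vcoef f n t))\<^sup>2) \<le> (\<Sum>n<N. (vmaj f n t)\<^sup>2)" .
      qed (use p_pos in simp)
      finally show ?thesis .
    qed
    have good: "summable (\<lambda>n. vcoef f n t *\<^sub>C e n) \<and> (t \<in> {0<..<T} --> ennreal (norm (Top f t) powr p) \<le> (SUP N. W N t))"
      if "(SUP N. W N t) \<noteq> \<infinity>" for t
    proof -
      define B where "B = enn2real (SUP N. W N t)"
      have B: "B \<ge> 0" "(SUP N. W N t) = ennreal B" using that unfolding B_def by (intro enn2real_nonneg, subst ennreal_enn2real) (simp_all only: less_top infinity_ennreal_def)
      have le: "(\<Sum>n<N. (cmod (vcoef f n t))\<^sup>2) powr (p / 2) \<le> B" for N
      proof -
        have "ennreal ((\<Sum>n<N. (cmod (vcoef f n t))\<^sup>2) powr (p / 2)) \<le> ennreal B" unfolding B(2)[symmetric] using partial SUP_upper[OF UNIV_I] by (rule order_trans)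
        then show ?thesis using B(1) by simp
      qed
      have le2: "(\<Sum>n<N. (cmod (vcoef f n t))\<^sup>2) \<le> B powr (2 / p)" for N
      proof -
        have "(\<Sum>n<N. (cmod (vcoef f n t))\<^sup>2) = ((\<Sum>n<N. (cmod (vcoef f n t))\<^sup>2) powr (p / 2)) powr (2 / p)" using p_pos by (simp add: powr_powr sum_nonneg)
        also have "... \<le> B powr (2 / p)" using p_pos by (intro powr_mono2 le) auto
        finally show ?thesis .
      qed
      have "summable (\<lambda>n. (cmod (vcoef f n t))\<^sup>2)" by (rule bounded_imp_summable[of _ "B powr (2 / p)"])
          (use le2[of "Suc n" for n] in \<open>auto simp: lessThan_Suc_atMost\<close>)
      then have s: "summable (\<lambda>n. vcoef f n t *\<^sub>C e n)" by (intro series_converges vcoef_zero)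
      have "norm (Top f t) powr p \<le> B" if t: "t \<in> {0<..<T}"
      proof -
        have c: "coeff (Top f t) n = vcoef f n t" for n using t coeff_suminf[of "\<lambda>n. vcoef f n t", OF vcoef_zero s] by (simp add: Top_def)
        have "(\<lambda>N. (\<Sum>n<N. (cmod (vcoef f n t))\<^sup>2)) \<longlonglongrightarrow> (norm (Top f t))\<^sup>2" using parseval[of "Top f t"] unfolding sums_def c .
        then have "(\<lambda>N. (\<Sum>n<N. (cmod (vcoef f n t))\<^sup>2) powr (p / 2)) \<longlonglongrightarrow> ((norm (Top f t))\<^sup>2) powr (p / 2)"
          using p_pos by (intro tendsto_powr2 tendsto_const) (auto simp: sum_nonneg)
        then have "((norm (Top f t))\<^sup>2) powr (p / 2) \<le> B" by (rule LIMSEQ_le_const2) (use le in auto)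
        then show ?thesis by (simp add: power2_powr_half)
      qed
      then show ?thesis using s B by (auto intro: ennreal_leI)
    qed
    have "LpE p (Top f) \<le> (\<integral>t. (SUP N. W N t))" unfolding LpE_def
    proof (rule nn_integral_mono_AE, use fin in eventually_elim)
      case (elim t)
      then show ?case using good[of t] p_pos by (cases "t \<in> {0<..<T}") (auto simp: Top_def)
    qed
    also have "... \<le> ennreal K * LpE p f" by (rule SUP_le)
    also have "... \<le> ennreal (K + 1) * LpE p f" by (intro mult_right_mono ennreal_leI) auto
    finally show "LpE p (Top f) \<le> ennreal (K + 1) * LpE p f" .
    show "AE t\<in>{0<..<T} in lborel. (\<forall>n. coeff (Top f t) n = vcoef f n t)" using fin
    proof eventually_elim
      case (elim t)
      then show ?case using good[of t] coeff_suminf[of "\<lambda>n. vcoef f n t", OF vcoef_zero] by (auto simp: Top_def)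
    qed
  qed
qed

lemma Top_coeff: "f \<in> L ==> AE t\<in>{0<..<T} in lborel. (\<forall>n. coeff (Top f t) n = vcoef f n t)" using Top_bound_ex by blast

lemma Top_L: "f \<in> L ==> Top f \<in> L"
proof -
  assume f: "f \<in> L"
  obtain C where "LpE p (Top f) \<le> ennreal C * LpE p f" using Top_bound_ex f by blast
  then have "LpE p (Top f) < top" using Lpb_finite[OF f] by (auto simp: ennreal_mult_less_top intro: le_less_trans)
  then show ?thesis using Top_measurable[OF f] by (auto simp: Lpb_def Top_def)
qed

lemma L_diff: "f \<in> L ==> g \<in> L ==> (\<lambda>t. f t - g t) \<in> L"
  by (rule Lpb_dominated[where f=f and g=g, OF _ _ p_pos]) (auto intro: norm_triangle_ineq4 borel_measurable_diff Lpb_measurable)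

lemma L_add: "f \<in> L ==> g \<in> L ==> (\<lambda>t. f t + g t) \<in> L"
  by (rule Lpb_dominated[where f=f and g=g, OF _ _ p_pos]) (auto intro: norm_triangle_ineq borel_measurable_add Lpb_measurable)

end

context mr_setting
begin

lemma LpE_scaleC: "cmod c = 1 ==> LpE p (\<lambda>t. c *\<^sub>C f t) = LpE p f" by (simp add: LpE_def norm_scaleC)

lemma L_scaleC:
  assumes f: "f \<in> L" and c: "cmod c = 1"
  shows "(\<lambda>t. c *\<^sub>C f t) \<in> L"
proof -
  have "(\<lambda>t. c *\<^sub>C f t) \<in> borel_measurable borel" by (intro borel_measurable_scaleC Lpb_measurable[OF f])
  moreover have "c *\<^sub>C f t = 0" if "t \<notin> {0<..<T}" for t using Lpb_zero[OF f that] norm_scaleC[of c "0::'a"] by simp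
  moreover have "LpE p (\<lambda>t. c *\<^sub>C f t) < top" using Lpb_finite[OF f] by (simp add: LpE_scaleC[OF c])
  ultimately show ?thesis unfolding Lpb_def by blast
qed

lemma L_cut:
  assumes f: "f \<in> L"
  shows "(\<lambda>t. indicator {..<\<tau>} t *\<^sub>R f t) \<in> L"
proof -
  have "LpE p (\<lambda>t. indicator {..<\<tau>} t *\<^sub>R f t) \<le> LpE p f" using p_pos by (intro LpE_mono AE_I2) (auto simp: indicator_def)
  then have "LpE p (\<lambda>t. indicator {..<\<tau>} t *\<^sub>R f t) < top" using Lpb_finite[OF f] by (rule le_less_trans)
  moreover have "(\<lambda>t. indicator {..<\<tau>} t *\<^sub>R f t) \<in> borel_measurable borel"
    by (intro borel_measurable_scaleR borel_measurable_indicator Lpb_measurable[OF f]) auto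
  ultimately show ?thesis using Lpb_zero[OF f] unfolding Lpb_def by simp
qed

lemma domain_from_coeff:
  assumes "\<And>n. coeff v n = of_real (lam n) * coeff u n"
  shows "u \<in> D" "A u = - v"
proof -
  show "u \<in> D" by (rule D_I[OF assms])
  then show "A u = - v" by (intro eq_coeffI) (simp add: A_coeff assms cinner_minus_left)
qed

text \<open>The scalar Volterra equation in each coordinate. Under the convolution the kernel
  coefficients may be replaced by those of \<open>Top f\<close>, since they agree almost everywhere
  before \<open>T\<close> and later times do not matter.\<close>

lemma coeff_conv_equation:
  assumes f: "f \<in> L"
  shows "AE t\<in>{0<..<T} in lborel. (\<forall>n. coeff (Top f t) n =
    of_real (lam n) * coeff (J (resid f) t) n)"
proof -
  define g where "g s = f s - \<i> *\<^sub>C Top f s" for s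
  have g: "g \<in> L" unfolding g_def by (intro L_diff L_scaleC Top_L f) auto
  have [measurable]: "f \<in> borel_measurable borel" "g \<in> borel_measurable borel" "Top f \<in> borel_measurable borel" using f g Top_L[OF f] by (auto intro: Lpb_measurable)
  have V: "AE t in lborel. \<forall>n. vcoef f n t = of_real (lam n) * conv (cfrac \<alpha>) (\<lambda>s. coeff (f s) n - \<i> * vcoef f n s) t"
    unfolding AE_all_countable vcoef_def by (intro allI volterra lam_pos coeff_class f)
  have gc: "AE s in lborel. s < T --> coeff (g s) n = coeff (f s) n - \<i> * vcoef f n s" for n using Top_coeff[OF f]
  proof eventually_elim
    case (elim s)
    show ?case
    proof (cases "s > 0")
      case True
      then show ?thesis using elim by (auto simp: g_def cinner_diff_left cinner_scaleC_left)
    next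
      case False
      have "vcoef f n s = 0" unfolding vcoef_def using False Lpb_zero[OF f] by (intro conv_zero[OF mlk_zero, where T=0]) auto
      then show ?thesis using False Lpb_zero[OF f, of s] by (simp add: g_def Top_def)
    qed
  qed
  show ?thesis using V Top_coeff[OF f]
  proof eventually_elim
    case (elim t)
    show ?case
    proof (intro impI allI)
      fix n assume t: "t \<in> {0<..<T}"
      have "conv (cfrac \<alpha>) (\<lambda>s. coeff (g s) n) t = conv (cfrac \<alpha>) (\<lambda>s. coeff (f s) n - \<i> * vcoef f n s) t"
        using t gc[of n] vcoef_measurable[OF f] by (intro conv_cong_left[where T=T] cfrac_zero) auto
      then have "of_real (lam n) * coeff (J g t) n = vcoef f n t" using elim(1) by (simp add: coeff_fint[OF g])
      then show "coeff (Top f t) n = of_real (lam n) * coeff (J (resid f) t) n" using elim(2) t by (simp add: g_def[abs_def])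
    qed
  qed
qed

lemma Top_solution:
  assumes f: "f \<in> L"
  shows "AE t\<in>{0<..<T} in lborel.
    J (resid f) t \<in> D \<and> A (J (resid f) t) = - Top f t" using coeff_conv_equation[OF f] by eventually_elim (use domain_from_coeff in blast)

lemma fint_cong_AE:
  assumes f: "f \<in> L" and g: "g \<in> L" and "AE s in lborel. f s = g s"
  shows "J f t = J g t" unfolding fint_def
proof (rule integral_cong_AE)
  note [measurable] = Lpb_measurable[OF f] Lpb_measurable[OF g]
  show "(\<lambda>s. frac_kernel \<alpha> (t - s) *\<^sub>R f s) \<in> borel_measurable lborel"
    "(\<lambda>s. frac_kernel \<alpha> (t - s) *\<^sub>R g s) \<in> borel_measurable lborel" by measurable
  show "AE s in lborel. frac_kernel \<alpha> (t - s) *\<^sub>R f s = frac_kernel \<alpha> (t - s) *\<^sub>R g s" using assms(3) by eventually_elim simp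
qed

lemma fint_diff:
  assumes f: "f \<in> L" and g: "g \<in> L"
  shows "J (\<lambda>s. f s - g s) t = J f t - J g t" unfolding fint_def using frac_kernel_integrable[OF f] frac_kernel_integrable[OF g] by (simp add: scaleR_diff_right)

lemma fint_add:
  assumes f: "f \<in> L" and g: "g \<in> L"
  shows "J (\<lambda>s. f s + g s) t = J f t + J g t" unfolding fint_def using frac_kernel_integrable[OF f] frac_kernel_integrable[OF g] by (simp add: scaleR_add_right)

text \<open>Here \<open>v\<close> is a representative of \<open>- A z\<close>.\<close>

lemma linear_unique:
  assumes f: "f \<in> L" and v: "v \<in> L"
    and z: "AE t\<in>{0<..<T} in lborel.
      J (\<lambda>s. f s - \<i> *\<^sub>C v s) t \<in> D \<and> A (J (\<lambda>s. f s - \<i> *\<^sub>C v s) t) = - v t"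
  shows "AE t in lborel. v t = Top f t"
proof -
  \<comment> \<open>Each coordinate of the difference solves the homogeneous Volterra equation and
    vanishes by \<open>volterra_unique\<close>.\<close>
  define w where "w s = v s - Top f s" for s
  have w: "w \<in> L" unfolding w_def by (intro L_diff Top_L f v)
  have g1: "(\<lambda>s. f s - \<i> *\<^sub>C v s) \<in> L" and g2: "(resid f) \<in> L" by (simp_all add: L_diff[OF f L_scaleC[OF v]] L_diff[OF f L_scaleC[OF Top_L[OF f]]])
  have iw: "(\<lambda>s. (- \<i>) *\<^sub>C w s) \<in> L" by (intro L_scaleC w) simp
  have eq: "J (\<lambda>s. f s - \<i> *\<^sub>C v s) t - J (resid f) t = J (\<lambda>s. (- \<i>) *\<^sub>C w s) t" for t unfolding fint_diff[OF g1 g2, symmetric] w_def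
    by (intro arg_cong[of _ _ "\<lambda>h. J h t"] ext eq_coeffI)
      (simp add: cinner_diff_left cinner_scaleC_left algebra_simps)
  have "AE t\<in>{0<..<T} in lborel. (\<forall>n. coeff (w t) n = of_real (lam n) * coeff (J (\<lambda>s. (- \<i>) *\<^sub>C w s) t) n)" using z Top_solution[OF f]
  proof eventually_elim
    case (elim t)
    show ?case
    proof (intro impI allI)
      fix n assume t: "t \<in> {0<..<T}"
      let ?a = "J (\<lambda>s. f s - \<i> *\<^sub>C v s) t" and ?b = "J (resid f) t"
      have "?a \<in> D" "A ?a = - v t" "?b \<in> D" "A ?b = - Top f t" using elim t by auto
      then have "coeff (v t) n = of_real (lam n) * coeff ?a n" "coeff (Top f t) n = of_real (lam n) * coeff ?b n"
        using A_coeff[of ?a n] A_coeff[of ?b n] by (simp_all add: cinner_minus_left)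
      then show "coeff (w t) n = of_real (lam n) * coeff (J (\<lambda>s. (- \<i>) *\<^sub>C w s) t) n" by (simp add: eq[symmetric]) (simp add: w_def cinner_diff_left algebra_simps)
    qed
  qed
  then have "AE t in lborel. coeff (w t) n = 0" for n
  proof (intro volterra_unique[where T=T, OF lam_pos[of n] coeff_class[OF w]])
    fix t assume "t \<ge> T"
    then show "coeff (w t) n = 0" using Lpb_zero[OF w, of t] by simp
  next
    assume ae: "AE t\<in>{0<..<T} in lborel. (\<forall>n. coeff (w t) n = of_real (lam n) * coeff (J (\<lambda>s. (- \<i>) *\<^sub>C w s) t) n)"
    have c: "conv (cfrac \<alpha>) (\<lambda>s. coeff ((- \<i>) *\<^sub>C w s) n) t = - \<i> * conv (cfrac \<alpha>) (\<lambda>s. coeff (w s) n) t" for t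
    proof -
      have "conv (cfrac \<alpha>) (\<lambda>s. coeff ((- \<i>) *\<^sub>C w s) n) t = (LINT s|lborel. (- \<i>) * (cfrac \<alpha> (t - s) * coeff (w s) n))"
        unfolding conv_def by (intro Bochner_Integration.integral_cong) (auto simp: cinner_scaleC_left)
      then show ?thesis unfolding conv_def by simp
    qed
    show "AE t in lborel. t < T --> coeff (w t) n = - \<i> * of_real (lam n) * conv (cfrac \<alpha>) (\<lambda>t. coeff (w t) n) t" using ae
    proof eventually_elim
      case (elim t)
      show ?case
      proof (cases "t > 0")
        case True
        then show ?thesis using elim by (simp add: coeff_fint[OF iw] c)
      next
        case False
        have "conv (cfrac \<alpha>) (\<lambda>t. coeff (w t) n) t = 0" using False Lpb_zero[OF w] by (intro conv_zero[OF cfrac_zero, where T=0]) auto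
        then show ?thesis using False Lpb_zero[OF w, of t] by simp
      qed
    qed
  qed
  then have "AE t in lborel. \<forall>n. coeff (w t) n = 0" by (simp add: AE_all_countable)
  then show ?thesis by eventually_elim (use e_total in \<open>force simp: w_def\<close>)
qed

text \<open>The kernels vanish at nonpositive times. The identity holds at every \<open>t\<close>,
  since \<open>Top\<close> is defined by integrals; it permits estimates on a short time
  interval.\<close>

lemma Top_causal:
  assumes "t \<le> \<tau>"
  shows "Top (\<lambda>s. indicator {..<\<tau>} s *\<^sub>R f s) t = Top f t"
proof -
  have "vcoef (\<lambda>s. indicator {..<\<tau>} s *\<^sub>R f s) n t = vcoef f n t" for n unfolding vcoef_def conv_def
  proof (intro Bochner_Integration.integral_cong refl)
    fix s
    show "mlk (lam n) (t - s) * coeff (indicator {..<\<tau>} s *\<^sub>R f s) n = mlk (lam n) (t - s) * coeff (f s) n" using assms mlk_zero[of "t - s"] by (cases "s < \<tau>") auto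
  qed
  then show ?thesis by (simp add: Top_def)
qed

lemma fint_causal:
  assumes "t \<le> \<tau>"
  shows "J (\<lambda>s. indicator {..<\<tau>} s *\<^sub>R f s) t = J f t" unfolding fint_def
proof (intro Bochner_Integration.integral_cong refl)
  fix s
  show "frac_kernel \<alpha> (t - s) *\<^sub>R indicator {..<\<tau>} s *\<^sub>R f s = frac_kernel \<alpha> (t - s) *\<^sub>R f s"
    using assms by (cases "s < \<tau>") (auto simp: frac_kernel_def)
qed

text \<open>Linearity is read off from \<open>linear_unique\<close>: the difference of two solutions
  solves the problem for the difference of the data.\<close>

lemma Top_diff:
  assumes f: "f \<in> L" and g: "g \<in> L"
  shows "AE t in lborel. Top f t - Top g t = Top (\<lambda>s. f s - g s) t"
proof (rule linear_unique)
  show "(\<lambda>s. f s - g s) \<in> L" "(\<lambda>t. Top f t - Top g t) \<in> L" by (intro L_diff Top_L f g)+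
  have fg: "(resid f) \<in> L" "(resid g) \<in> L" by (simp_all add: L_diff[OF f L_scaleC[OF Top_L[OF f]]] L_diff[OF g L_scaleC[OF Top_L[OF g]]])
  have "(\<lambda>s. f s - g s - \<i> *\<^sub>C (Top f s - Top g s)) = (\<lambda>s. (f s - \<i> *\<^sub>C Top f s) - (g s - \<i> *\<^sub>C Top g s))"
    by (intro ext eq_coeffI) (simp only: cinner_diff_left cinner_scaleC_left, simp add: algebra_simps)
  then have eq: "J (\<lambda>s. f s - g s - \<i> *\<^sub>C (Top f s - Top g s)) t =
    J (resid f) t - J (resid g) t" for t using fint_diff[OF fg] by simp
  show "AE t\<in>{0<..<T} in lborel. J (\<lambda>s. f s - g s - \<i> *\<^sub>C (Top f s - Top g s)) t \<in> D \<and>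
    A (J (\<lambda>s. f s - g s - \<i> *\<^sub>C (Top f s - Top g s)) t) = - (Top f t - Top g t)" using Top_solution[OF f] Top_solution[OF g]
  proof eventually_elim
    case (elim t)
    show ?case unfolding eq
    proof (rule impI)
      assume t: "t \<in> {0<..<T}"
      have c: "coeff (Top f t - Top g t) n = of_real (lam n) *
        coeff (J (resid f) t - J (resid g) t) n" for n using elim t A_coeff[of "J (resid f) t" n] A_coeff[of "J (resid g) t" n]
        by (simp add: cinner_diff_left cinner_minus_left algebra_simps)
      show "J (resid f) t - J (resid g) t \<in> D \<and>
        A (J (resid f) t - J (resid g) t) = - (Top f t - Top g t)" using domain_from_coeff[OF c] by blast
    qed
  qed
qed

end

section \<open>The K-functional\<close>

lemma nn_integral_powr_to_infinity:
  fixes e :: real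
  assumes "e < -1"
  shows "(\<integral>t. ennreal (t powr e) * indicator {1..} t) = ennreal (1 / (- e - 1))"
proof -
  have "((\<lambda>x. x powr e) has_integral (- (1 powr (e + 1)) / (e + 1))) {1..}" using assms by (intro has_integral_powr_to_inf) auto
  moreover have "- (1 powr (e + 1)) / (e + 1) = 1 / (- e - 1)" using assms by (simp add: field_simps)
  ultimately have "((\<lambda>x. x powr e) has_integral (1 / (- e - 1))) {1..}" by simp
  from nn_integral_has_integral_lebesgue[OF _ this]
  show ?thesis by (simp add: mult.commute nn_integral_completion ennreal_mult' flip: ennreal_indicator)
qed

context eigenbasis
begin

lemma zero_in_D: "0 \<in> D" "A 0 = 0"
proof -
  show z: "0 \<in> D" using D_cspace by (simp add: csubspace_def)
  have "A (0 + 0) = A 0 + A 0" using A_clinear z unfolding clinear_on_def by blast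
  then show "A 0 = 0" by simp
qed

lemma D_add: "x \<in> D ==> y \<in> D ==> x + y \<in> D \<and> A (x + y) = A x + A y" using D_cspace A_clinear unfolding csubspace_def clinear_on_def by blast

lemma norm_le_coeffI:
  assumes "C \<ge> 0" and "\<And>n. cmod (coeff x n) \<le> C * cmod (coeff y n)"
  shows "norm x \<le> C * norm y"
proof -
  have "(norm x)\<^sup>2 \<le> C\<^sup>2 * (norm y)\<^sup>2"
  proof (rule sums_le[OF _ parseval sums_mult[OF parseval]])
    fix n
    show "(cmod (coeff x n))\<^sup>2 \<le> C\<^sup>2 * (cmod (coeff y n))\<^sup>2" using power_mono[OF assms(2)[of n], of 2] by (simp add: power_mult_distrib)
  qed
  then show ?thesis using assms(1) by (metis mult_nonneg_nonneg norm_ge_zero power2_le_imp_le power_mult_distrib)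
qed

lemma norm_le_A: "u \<in> D ==> norm u \<le> 1 / lam0 * norm (A u)"
proof (rule norm_le_coeffI)
  fix n assume "u \<in> D"
  then have "cmod (coeff (A u) n) = lam n * cmod (coeff u n)" using lam_pos[of n] by (simp add: A_coeff norm_mult)
  moreover have "lam0 * cmod (coeff u n) \<le> lam n * cmod (coeff u n)" using lam_ge[of n] by (intro mult_right_mono) auto
  ultimately show "cmod (coeff u n) \<le> 1 / lam0 * cmod (coeff (A u) n)" using lam0_pos by (simp add: field_simps)
qed (use lam0_pos in simp)

text \<open>The functional calculus in the eigenbasis; meaningful for bounded \<open>m\<close>, for
  which the series converges.\<close>

definition mult :: "(nat => complex) => 'a => 'a"
  where "mult m x = (\<Sum>n. (m n * coeff x n) *\<^sub>C e n)"

context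
  fixes m :: "nat => complex" and C :: real
  assumes m: "\<And>n. cmod (m n) \<le> C"
begin

lemma coeff_mult: "coeff (mult m x) n = m n * coeff x n" unfolding mult_def
proof (rule coeff_suminf)
  show "summable (\<lambda>n. (m n * coeff x n) *\<^sub>C e n)"
  proof (rule series_converges)
    show "summable (\<lambda>n. (cmod (m n * coeff x n))\<^sup>2)"
    proof (rule summable_comparison_test'[where N=0, OF summable_mult[OF summable_coeff]])
      fix n
      have "(cmod (m n))\<^sup>2 * (cmod (coeff x n))\<^sup>2 \<le> C\<^sup>2 * (cmod (coeff x n))\<^sup>2" using m by (intro mult_right_mono power_mono) auto
      then show "norm ((cmod (m n * coeff x n))\<^sup>2) \<le> C\<^sup>2 * (cmod (coeff x n))\<^sup>2" by (simp add: norm_mult power_mult_distrib)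
    qed
  qed (simp add: coeff_zero_e)
qed (simp add: coeff_zero_e)

lemma norm_mult_le: "norm (mult m x) \<le> C * norm x"
proof (rule norm_le_coeffI)
  show "C \<ge> 0" using order_trans[OF norm_ge_zero m] .
  show "cmod (coeff (mult m x) n) \<le> C * cmod (coeff x n)" for n using m by (simp add: coeff_mult norm_mult mult_right_mono)
qed

lemma mult_D:
  assumes "b \<in> D"
  shows "mult m b \<in> D" "A (mult m b) = mult m (A b)"
proof -
  have "coeff (- mult m (A b)) n = of_real (lam n) * coeff (mult m b) n" for n by (simp add: cinner_minus_left coeff_mult A_coeff[OF assms])
  then show *: "mult m b \<in> D" by (rule D_I)
  show "A (mult m b) = mult m (A b)" by (rule eq_coeffI) (simp add: A_coeff[OF *] A_coeff[OF assms] coeff_mult)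
qed

lemma mult_add: "mult m (x + y) = mult m x + mult m y" by (rule eq_coeffI) (simp add: coeff_mult cinner_add_left distrib_left)

end

text \<open>The inverse of \<open>- A\<close>, not of \<open>A\<close>.\<close>

definition inv_A :: "'a => 'a" where "inv_A = mult (\<lambda>n. of_real (1 / lam n))"

lemma inv_lam_le: "cmod (of_real (1 / lam n)) \<le> 1 / lam0" using lam_pos[of n] lam_ge[of n] lam0_pos by (simp add: norm_divide frac_le)

lemma inv_A: "inv_A v \<in> D" "A (inv_A v) = - v"
proof -
  have c: "coeff v n = of_real (lam n) * coeff (inv_A v) n" for n using lam_pos[of n] unfolding inv_A_def by (subst coeff_mult[OF inv_lam_le]) simp
  show *: "inv_A v \<in> D" by (rule D_I[OF c])
  show "A (inv_A v) = - v" by (rule eq_coeffI) (simp add: A_coeff[OF *] cinner_minus_left c[symmetric])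
qed

lemma A_inj: "u \<in> D ==> w \<in> D ==> A u = A w ==> u = w"
proof (rule eq_coeffI)
  fix n assume *: "u \<in> D" "w \<in> D" "A u = A w"
  have "- of_real (lam n) * coeff u n = - of_real (lam n) * coeff w n" using A_coeff[OF *(1), of n] A_coeff[OF *(2), of n] *(3) by metis
  moreover have "- complex_of_real (lam n) \<noteq> 0" using less_imp_neq[OF lam_pos[of n]] by simp
  ultimately show "coeff u n = coeff w n" by (metis mult_cancel_left)
qed

lemma inv_A_eqI: "u \<in> D ==> A u = - v ==> inv_A v = u" using A_inj inv_A by metis

lemma inv_A_add: "inv_A (v + w) = inv_A v + inv_A w" unfolding inv_A_def by (rule mult_add[OF inv_lam_le])

lemma D_diff: "x \<in> D ==> y \<in> D ==> x - y \<in> D \<and> A (x - y) = A x - A y"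
proof -
  assume xy: "x \<in> D" "y \<in> D"
  then have "x - y \<in> D" using D_cspace by (intro csubspace_diff)
  then show ?thesis using D_add[of "x - y" y] xy by simp
qed

lemma inv_A_diff: "inv_A (v - w) = inv_A v - inv_A w" using inv_A_add[of "v - w" w] by simp

abbreviation KF :: "real => 'a => real" where "KF \<equiv> K_functional A D"

lemma KF_le:
  assumes "\<tau> \<ge> 0" "b \<in> D" "x = a + b"
  shows "KF \<tau> x \<le> norm a + \<tau> * norm (A b)" unfolding K_functional_def by (rule cInf_lower) (use assms in \<open>auto intro!: bdd_belowI[of _ 0]\<close>)

lemma KF_ge:
  assumes "\<And>a b. b \<in> D ==> x = a + b ==> c \<le> norm a + \<tau> * norm (A b)"
  shows "c \<le> KF \<tau> x" unfolding K_functional_def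
proof (rule cInf_greatest)
  have "x = x + 0 \<and> 0 \<in> D" using zero_in_D by simp
  then show "{norm a + \<tau> * norm (A b) |a b. b \<in> D \<and> x = a + b} \<noteq> {}" by blast
qed (use assms in auto)

lemma KF_nonneg: "\<tau> \<ge> 0 ==> KF \<tau> x \<ge> 0" by (rule KF_ge) simp

lemma KF_le_norm: "\<tau> \<ge> 0 ==> KF \<tau> x \<le> norm x" using KF_le[of \<tau> 0 x x] zero_in_D by simp

lemma KF_mono: "0 \<le> \<sigma> ==> \<sigma> \<le> \<tau> ==> KF \<sigma> x \<le> KF \<tau> x"
proof (rule KF_ge)
  fix a b assume *: "0 \<le> \<sigma>" "\<sigma> \<le> \<tau>" "b \<in> D" "x = a + b"
  have "KF \<sigma> x \<le> norm a + \<sigma> * norm (A b)" using * by (intro KF_le)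
  also have "... \<le> norm a + \<tau> * norm (A b)" using * by (simp add: mult_right_mono)
  finally show "KF \<sigma> x \<le> norm a + \<tau> * norm (A b)" .
qed

lemma KF_diff_le:
  assumes "\<tau> \<ge> 0"
  shows "KF \<tau> (x - y) \<le> KF \<tau> x + KF \<tau> y"
proof -
  have "KF \<tau> (x - y) - KF \<tau> x \<le> KF \<tau> y"
  proof (rule KF_ge)
    fix c d assume cd: "d \<in> D" "y = c + d"
    have "KF \<tau> (x - y) - (norm c + \<tau> * norm (A d)) \<le> KF \<tau> x"
    proof (rule KF_ge)
      fix a b assume ab: "b \<in> D" "x = a + b"
      have "KF \<tau> (x - y) \<le> norm (a - c) + \<tau> * norm (A (b - d))" using assms cd ab D_diff by (intro KF_le) auto
      also have "A (b - d) = A b - A d" using D_diff[OF ab(1) cd(1)] by simp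
      also have "norm (a - c) + \<tau> * norm (A b - A d) \<le> (norm a + norm c) + \<tau> * (norm (A b) + norm (A d))"
        using assms by (intro add_mono mult_left_mono norm_triangle_ineq4)
      finally show "KF \<tau> (x - y) - (norm c + \<tau> * norm (A d)) \<le> norm a + \<tau> * norm (A b)" by (simp add: algebra_simps)
    qed
    then show "KF \<tau> (x - y) - KF \<tau> x \<le> norm c + \<tau> * norm (A d)" by simp
  qed
  then show ?thesis by simp
qed

lemma KF_triangle: "\<tau> \<ge> 0 ==> KF \<tau> x \<le> KF \<tau> y + norm (x - y)"
proof -
  assume \<tau>: "\<tau> \<ge> 0"
  have "KF \<tau> (y - (y - x)) \<le> KF \<tau> y + KF \<tau> (y - x)" by (rule KF_diff_le[OF \<tau>])
  then show ?thesis using KF_le_norm[OF \<tau>, of "y - x"] by (simp add: norm_minus_commute)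
qed

lemma KF_add_le: "\<tau> \<ge> 0 ==> KF \<tau> (x + y) \<le> KF \<tau> x + KF \<tau> y"
proof -
  assume \<tau>: "\<tau> \<ge> 0"
  have "KF \<tau> (0 - y) \<le> KF \<tau> y" using KF_diff_le[OF \<tau>, of 0 y] KF_le_norm[OF \<tau>, of 0] by simp
  then show ?thesis using KF_diff_le[OF \<tau>, of x "0 - y"] by simp
qed

lemma norm_le_KF: "norm x \<le> max 1 (1 / lam0) * KF 1 x"
proof -
  define M where "M = max 1 (1 / lam0)"
  have M: "M > 0" "1 \<le> M" "1 / lam0 \<le> M" by (auto simp: M_def)
  have "norm x / M \<le> KF 1 x"
  proof (rule KF_ge)
    fix a b assume ab: "b \<in> D" "x = a + b"
    have "norm x \<le> norm a + norm b" using ab norm_triangle_ineq by blast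
    also have "... \<le> M * norm a + M * norm (A b)" using M mult_right_mono[OF M(2), of "norm a"] mult_right_mono[OF M(3), of "norm (A b)"] norm_le_A[OF ab(1)] by simp
    finally show "norm x / M \<le> norm a + 1 * norm (A b)" using M by (simp add: field_simps)
  qed
  then show ?thesis using M by (simp add: M_def[symmetric] field_simps)
qed

text \<open>Multipliers commute with \<open>A\<close>, so they map any splitting of \<open>x\<close>
  to a splitting of the image with both parts bounded by the factor \<open>C\<close>.\<close>

lemma KF_mult_le:
  assumes m: "\<And>n. cmod (m n) \<le> C" and C: "C > 0" and \<tau>: "\<tau> \<ge> 0"
  shows "KF \<tau> (mult m x) \<le> C * KF \<tau> x"
proof -
  have "KF \<tau> (mult m x) / C \<le> KF \<tau> x"
  proof (rule KF_ge)
    fix a b assume ab: "b \<in> D" "x = a + b"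
    have "KF \<tau> (mult m x) \<le> norm (mult m a) + \<tau> * norm (A (mult m b))" using ab \<tau> by (intro KF_le mult_D[OF m]) (auto simp: mult_add[OF m])
    also have "... \<le> C * norm a + \<tau> * (C * norm (A b))" unfolding mult_D(2)[OF m ab(1)] using \<tau> by (intro add_mono mult_left_mono norm_mult_le[OF m])
    finally show "KF \<tau> (mult m x) / C \<le> norm a + \<tau> * norm (A b)" using C by (simp add: field_simps)
  qed
  then show ?thesis using C by (simp add: field_simps)
qed

text \<open>Measurability through monotonicity, which is available for \<tau> \<ge> 0; hence the
  truncation.\<close>

lemma KF_measurable [measurable]: "(\<lambda>\<tau>. KF (max 0 \<tau>) x) \<in> borel_measurable borel" by (rule borel_measurable_mono) (auto simp: mono_def intro!: KF_mono)

text \<open>The K-functional increases, so on the interval from \<tau> to 2 \<tau> the integrand is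
  bounded below by its value with \<open>KF \<tau> x\<close> and the weights at 2 \<tau>.\<close>

lemma KF_le_interp_norm:
  assumes x: "x \<in> interp_space A D \<theta> p" and \<tau>: "\<tau> > 0" and p: "p > 0" and \<theta>: "\<theta> > 0"
  shows "KF \<tau> x \<le> 2 powr (1 / p + \<theta>) * \<tau> powr \<theta> * interp_norm A D \<theta> p x"
proof -
  define I where "I = enn2real (interp_integral A D \<theta> p x)"
  have fin: "interp_integral A D \<theta> p x < top" using x by (simp add: interp_space_def)
  have I: "interp_integral A D \<theta> p x = ennreal I" "I \<ge> 0" unfolding I_def using fin by auto
  define c where "c = ((2 * \<tau>) powr (-\<theta>) * KF \<tau> x) powr p / (2 * \<tau>)"
  have K0: "KF \<tau> x \<ge> 0" using \<tau> by (intro KF_nonneg) auto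
  have c0: "c \<ge> 0" using \<tau> by (simp add: c_def)
  have "ennreal (c * \<tau>) = (\<integral>\<^sup>+t\<in>{\<tau>..2 * \<tau>}. ennreal c \<partial>lborel)"
    using \<tau> c0 by (subst nn_integral_cmult_indicator) (auto simp: ennreal_mult)
  also have "... \<le> interp_integral A D \<theta> p x" unfolding interp_integral_def
  proof (rule nn_integral_mono)
    fix t
    show "ennreal c * indicator {\<tau>..2 * \<tau>} t \<le> ennreal ((t powr - \<theta> * KF t x) powr p / t) * indicator {0<..} t"
    proof (cases "t \<in> {\<tau>..2 * \<tau>}")
      case True
      have "(2 * \<tau>) powr (-\<theta>) \<le> t powr (-\<theta>)" using True \<tau> \<theta> by (intro powr_mono2') auto
      then have "(2 * \<tau>) powr (-\<theta>) * KF \<tau> x \<le> t powr (-\<theta>) * KF t x" using True \<tau> K0 by (intro mult_mono KF_mono) auto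
      then have "((2 * \<tau>) powr (-\<theta>) * KF \<tau> x) powr p \<le> (t powr (-\<theta>) * KF t x) powr p" using p K0 by (intro powr_mono2) auto
      then have "c \<le> (t powr - \<theta> * KF t x) powr p / t" unfolding c_def using True \<tau> by (intro frac_le) auto
      then show ?thesis using True \<tau> by (auto intro: ennreal_leI)
    qed simp
  qed
  finally have "c * \<tau> \<le> I" unfolding I using I(2) by simp
  then have "((2 * \<tau>) powr (-\<theta>) * KF \<tau> x) powr p \<le> 2 * I" using \<tau> by (simp add: c_def)
  then have "(((2 * \<tau>) powr (-\<theta>) * KF \<tau> x) powr p) powr (1 / p) \<le> (2 * I) powr (1 / p)" using p by (intro powr_mono2) auto
  then have "(2 * \<tau>) powr (-\<theta>) * KF \<tau> x \<le> 2 powr (1 / p) * I powr (1 / p)" using p K0 by (simp add: powr_powr powr_mult)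
  then have "(2 * \<tau>) powr \<theta> * ((2 * \<tau>) powr (-\<theta>) * KF \<tau> x) \<le> (2 * \<tau>) powr \<theta> * (2 powr (1 / p) * I powr (1 / p))"
    by (rule mult_left_mono) simp
  moreover have "(2 * \<tau>) powr \<theta> * (2 * \<tau>) powr (-\<theta>) = 1" using \<tau> by (simp flip: powr_add)
  ultimately have "KF \<tau> x \<le> (2 * \<tau>) powr \<theta> * (2 powr (1 / p) * I powr (1 / p))" by (simp flip: mult.assoc)
  then show ?thesis by (simp add: I_def interp_norm_def powr_mult powr_add mult_ac)
qed

text \<open>The norm of t powr (- \<theta>) * min 1 (t powr \<theta>') in L^p with respect to dt /
  t; the two summands are the integrals below and above 1.\<close>

definition interp_const :: "real => real => real => real"
  where "interp_const \<theta>' \<theta> p = (1 / ((\<theta>' - \<theta>) * p) + 1 / (\<theta> * p)) powr (1 / p)"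

text \<open>The embedding of the interpolation space with exponent \<theta>' and index infinity into
  that with a smaller exponent \<theta> and index \<open>p\<close>.\<close>

lemma interp_from_KF:
  assumes \<theta>: "0 < \<theta>" "\<theta> < \<theta>'" and p: "p > 0" and \<kappa>: "\<kappa> \<ge> 0"
    and K: "\<And>\<tau>. \<tau> > 0 ==> KF \<tau> x \<le> \<kappa> * min 1 (\<tau> powr \<theta>')"
  shows "x \<in> interp_space A D \<theta> p" "interp_norm A D \<theta> p x \<le> interp_const \<theta>' \<theta> p * \<kappa>"
proof -
  define J where "J = 1 / ((\<theta>' - \<theta>) * p) + 1 / (\<theta> * p)"
  have J: "J \<ge> 0" using \<theta> p by (simp add: J_def)
  have "interp_integral A D \<theta> p x \<le> (\<integral>t. ennreal (\<kappa> powr p) *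
    (ennreal (t powr ((\<theta>' - \<theta>) * p - 1)) * indicator {0<..<1} t + ennreal (t powr (- \<theta> * p - 1)) * indicator {1..} t))" unfolding interp_integral_def
  proof (rule nn_integral_mono)
    fix t :: real
    show "ennreal ((t powr - \<theta> * KF t x) powr p / t) * indicator {0<..} t \<le> ennreal (\<kappa> powr p) *
      (ennreal (t powr ((\<theta>' - \<theta>) * p - 1)) * indicator {0<..<1} t + ennreal (t powr (- \<theta> * p - 1)) * indicator {1..} t)"
    proof (cases "t > 0")
      case True
      note K0 = KF_nonneg[OF less_imp_le[OF True], of x]
      show ?thesis
      proof (cases "t < 1")
        case t1: True
        have "KF t x \<le> \<kappa> * t powr \<theta>'" using K[OF True] mult_left_mono[OF min.cobounded2[of 1 "t powr \<theta>'"] \<kappa>] by linarith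
        then have "t powr - \<theta> * KF t x \<le> \<kappa> * t powr (\<theta>' - \<theta>)"
          using mult_left_mono[of "KF t x" "\<kappa> * t powr \<theta>'" "t powr - \<theta>"] True by (simp add: powr_diff powr_minus field_simps)
        then have "(t powr - \<theta> * KF t x) powr p \<le> (\<kappa> * t powr (\<theta>' - \<theta>)) powr p" using p K0 by (intro powr_mono2) auto
        then have "(t powr - \<theta> * KF t x) powr p / t \<le> (\<kappa> * t powr (\<theta>' - \<theta>)) powr p / t" using True by (intro divide_right_mono) auto
          also have "(\<kappa> * t powr (\<theta>' - \<theta>)) powr p / t = \<kappa> powr p * t powr ((\<theta>' - \<theta>) * p - 1)"
          using True \<kappa> powr_diff[of t "(\<theta>' - \<theta>) * p" 1] by (simp add: powr_mult powr_powr)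
          finally have "(t powr - \<theta> * KF t x) powr p / t \<le> \<kappa> powr p * t powr ((\<theta>' - \<theta>) * p - 1)" .
        then show ?thesis using True t1 by (simp add: ennreal_leI flip: ennreal_mult')
      next
        case t1: False
        have "KF t x \<le> \<kappa>" using K[OF True] mult_left_mono[OF min.cobounded1[of 1 "t powr \<theta>'"] \<kappa>] by linarith
        then have "t powr - \<theta> * KF t x \<le> \<kappa> * t powr (- \<theta>)" using mult_left_mono[of "KF t x" "\<kappa>" "t powr - \<theta>"] by (simp add: mult.commute)
        then have "(t powr - \<theta> * KF t x) powr p \<le> (\<kappa> * t powr (- \<theta>)) powr p" using p K0 by (intro powr_mono2) auto
        then have "(t powr - \<theta> * KF t x) powr p / t \<le> (\<kappa> * t powr (- \<theta>)) powr p / t" using True by (intro divide_right_mono) auto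
          also have "(\<kappa> * t powr (- \<theta>)) powr p / t = \<kappa> powr p * t powr (- \<theta> * p - 1)"
          using True \<kappa> powr_diff[of t "- \<theta> * p" 1] by (simp add: powr_mult powr_powr)
          finally have "(t powr - \<theta> * KF t x) powr p / t \<le> \<kappa> powr p * t powr (- \<theta> * p - 1)" .
        then show ?thesis using True t1 by (simp add: ennreal_leI flip: ennreal_mult')
      qed
    qed simp
  qed
  also have "... = ennreal (\<kappa> powr p) * ((\<integral>t. ennreal (t powr ((\<theta>' - \<theta>) * p - 1)) * indicator {0<..<1} t)
    + (\<integral>t. ennreal (t powr (- \<theta> * p - 1)) * indicator {1..} t))" by (subst nn_integral_cmult, measurable, subst nn_integral_add) auto
  also have "(\<integral>t. ennreal (t powr ((\<theta>' - \<theta>) * p - 1)) * indicator {0<..<1} t) = ennreal (1 / ((\<theta>' - \<theta>) * p))"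
    using \<theta> p nn_integral_powr_from_0[of 1 "(\<theta>' - \<theta>) * p - 1"] by (simp add: mult.commute)
  also have "(\<integral>t. ennreal (t powr (- \<theta> * p - 1)) * indicator {1..} t) = ennreal (1 / (\<theta> * p))" using \<theta> p by (subst nn_integral_powr_to_infinity) auto
  also have "ennreal (\<kappa> powr p) * (ennreal (1 / ((\<theta>' - \<theta>) * p)) + ennreal (1 / (\<theta> * p))) = ennreal (\<kappa> powr p * J)"
    using \<theta> p by (simp add: J_def ennreal_mult' flip: ennreal_plus)
  finally have le: "interp_integral A D \<theta> p x \<le> ennreal (\<kappa> powr p * J)" .
  then show "x \<in> interp_space A D \<theta> p" by (auto simp: interp_space_def intro: le_less_trans)
  have "enn2real (interp_integral A D \<theta> p x) \<le> \<kappa> powr p * J" using enn2real_mono[OF le] J by (simp add: enn2real_ennreal)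
  then have "interp_norm A D \<theta> p x \<le> (\<kappa> powr p * J) powr (1 / p)" unfolding interp_norm_def using p by (intro powr_mono2) auto
  also have "... = interp_const \<theta>' \<theta> p * \<kappa>" using p \<kappa> J by (simp add: interp_const_def J_def[symmetric] powr_mult powr_powr)
  finally show "interp_norm A D \<theta> p x \<le> interp_const \<theta>' \<theta> p * \<kappa>" .
qed

end

section \<open>The homogeneous problem\<close>

context mr_setting
begin

text \<open>The exponent of the initial values; \<alpha> * \<theta> = \<alpha> - 1 / p matches the
  Hoelder exponent in time under \<tau> = t powr \<alpha>.\<close>

definition \<theta> :: real where "\<theta> = 1 - 1 / (\<alpha> * p)"

lemma \<theta>_bounds: "0 < \<theta>" "\<theta> < 1" using \<alpha> p p_pos by (auto simp: \<theta>_def field_simps)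

lemma \<alpha>\<theta>: "\<alpha> * \<theta> = \<alpha> - 1 / p" using \<alpha> by (simp add: \<theta>_def field_simps)

lemma X_space_\<alpha>: "X_space A D \<alpha> p = interp_space A D \<theta> p" "X_norm A D \<alpha> p = interp_norm A D \<theta> p"
  by (simp_all add: X_space_def X_norm_def \<theta>_def fun_eq_iff)

text \<open>The substitution \<tau> = t powr \<alpha>; the exponents match because \<alpha> \<theta>
  p + 1 = \<alpha> p. It is carried out on compact intervals, followed by monotone
  convergence.\<close>

lemma interp_substitution:
  "(\<integral>t. ennreal ((t powr (-\<alpha>) * KF (t powr \<alpha>) x) powr p) * indicator {0<..} t) \<le>
    ennreal (1 / \<alpha>) * interp_integral A D \<theta> p x"
proof -
  define G where "G t = ennreal ((t powr (-\<alpha>) * KF (max 0 (t powr \<alpha>)) x) powr p)" for t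
  define H where "H \<tau> = (\<tau> powr (-\<theta>) * KF (max 0 \<tau>) x) powr p / \<tau>" for \<tau>
  have [measurable]: "H \<in> borel_measurable borel" unfolding H_def by measurable
  have [measurable]: "G \<in> borel_measurable borel" unfolding G_def using measurable_compose[OF _ KF_measurable, of "\<lambda>t. t powr \<alpha>" borel x] by measurable
  have part: "(\<integral>t. G t * indicator {1 / real (Suc n)..real (Suc n)} t) \<le>
    ennreal (1 / \<alpha>) * interp_integral A D \<theta> p x" for n
  proof -
    define a b where "a = 1 / real (Suc n)" "b = real (Suc n)"
    have ab: "0 < a" "a \<le> b" by (auto simp: a_b_def field_simps)
    have "(\<integral>\<^sup>+\<tau>. ennreal (H \<tau> * indicator {a powr \<alpha>..b powr \<alpha>} \<tau>) \<partial>lborel) =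
      (\<integral>t. ennreal (H (t powr \<alpha>) * (\<alpha> * t powr (\<alpha> - 1)) * indicator {a..b} t))"
    proof (rule nn_integral_substitution)
      show "((\<lambda>t. t powr \<alpha>) has_real_derivative \<alpha> * t powr (\<alpha> - 1)) (at t)" if "t \<in> {a..b}" for t
        using that ab by (auto intro!: derivative_eq_intros)
      show "continuous_on {a..b} (\<lambda>t. \<alpha> * t powr (\<alpha> - 1))" using ab by (intro continuous_intros) auto
    qed (use \<alpha> ab in \<open>auto simp: set_borel_measurable_def\<close>)
    also have "... = (\<integral>t. ennreal \<alpha> * (G t * indicator {a..b} t))"
    proof (rule nn_integral_cong)
      fix t
      show "ennreal (H (t powr \<alpha>) * (\<alpha> * t powr (\<alpha> - 1)) * indicator {a..b} t) = ennreal \<alpha> * (G t * indicator {a..b} t)"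
      proof (cases "t \<in> {a..b}")
        case True
        then have t: "t > 0" using ab by auto
        define k where "k = KF (t powr \<alpha>) x"
        have k: "k \<ge> 0" unfolding k_def by (intro KF_nonneg) simp
        have "H (t powr \<alpha>) * (\<alpha> * t powr (\<alpha> - 1)) = \<alpha> * (k powr p * (t powr (- (\<alpha> * \<theta>) * p) * t powr (- \<alpha>) * t powr (\<alpha> - 1)))"
          using k powr_minus_divide[of t \<alpha>] by (simp add: H_def k_def[symmetric] powr_mult powr_powr)
        also have "t powr (- (\<alpha> * \<theta>) * p) * t powr (- \<alpha>) * t powr (\<alpha> - 1) = t powr (- (\<alpha> * \<theta>) * p - 1)" using t by (simp flip: powr_add)
        also have "- (\<alpha> * \<theta>) * p - 1 = - \<alpha> * p" using p_pos by (simp add: \<alpha>\<theta> field_simps)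
        also have "k powr p * t powr (- \<alpha> * p) = (t powr (- \<alpha>) * k) powr p" using k by (simp add: powr_mult powr_powr)
        finally have "H (t powr \<alpha>) * (\<alpha> * t powr (\<alpha> - 1)) = \<alpha> * (t powr (- \<alpha>) * k) powr p" .
        then have "ennreal (H (t powr \<alpha>) * (\<alpha> * t powr (\<alpha> - 1))) = ennreal \<alpha> * G t" using \<alpha> by (simp only:) (simp add: G_def k_def ennreal_mult)
        then show ?thesis using True by simp
      qed simp
    qed
    also have "... = ennreal \<alpha> * (\<integral>t. G t * indicator {a..b} t)" by (subst nn_integral_cmult) auto
    finally have "ennreal \<alpha> * (\<integral>t. G t * indicator {a..b} t) \<le> interp_integral A D \<theta> p x"
    proof (rule ord_eq_le_trans[OF sym])
      show "(\<integral>\<^sup>+\<tau>. ennreal (H \<tau> * indicator {a powr \<alpha>..b powr \<alpha>} \<tau>) \<partial>lborel) \<le> interp_integral A D \<theta> p x"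
        unfolding interp_integral_def
      proof (rule nn_integral_mono)
        fix \<tau>
        have "\<tau> > 0" if "\<tau> \<in> {a powr \<alpha>..b powr \<alpha>}" using ab that less_le_trans[of 0 "a powr \<alpha>" \<tau>] by simp
        then show "ennreal (H \<tau> * indicator {a powr \<alpha>..b powr \<alpha>} \<tau>) \<le> ennreal ((\<tau> powr - \<theta> * KF \<tau> x) powr p / \<tau>) * indicator {0<..} \<tau>"
          by (auto simp: H_def indicator_def)
      qed
    qed
    then have "ennreal (1 / \<alpha>) * (ennreal \<alpha> * (\<integral>t. G t * indicator {a..b} t)) \<le> ennreal (1 / \<alpha>) * interp_integral A D \<theta> p x"
      by (rule mult_left_mono) simp
    moreover have "ennreal (1 / \<alpha>) * ennreal \<alpha> = 1" using \<alpha> by (simp flip: ennreal_mult)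
    ultimately show ?thesis by (simp add: a_b_def flip: mult.assoc)
  qed
  have inc: "incseq (\<lambda>n t. G t * indicator {1 / real (Suc n)..real (Suc n)} t)"
  proof (rule incseq_SucI, rule le_funI, rule mult_left_mono)
    fix n and t :: real
    have "1 / real (Suc (Suc n)) \<le> 1 / real (Suc n)" by (intro divide_left_mono) auto
    then have "t \<in> {1 / real (Suc n)..real (Suc n)} ==> t \<in> {1 / real (Suc (Suc n))..real (Suc (Suc n))}" by simp
    then show "indicator {1 / real (Suc n)..real (Suc n)} t \<le> (indicator {1 / real (Suc (Suc n))..real (Suc (Suc n))} t :: ennreal)"
      unfolding indicator_def of_bool_def by (simp only: split: if_split) simp
  qed simp
  have SUP: "(SUP n. G t * indicator {1 / real (Suc n)..real (Suc n)} t) = G t * indicator {0<..} t" for t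
  proof (cases "t > 0")
    case True
    obtain n where n: "1 / real (Suc n) < t" using True nat_approx_posE by blast
    obtain m where m: "t \<le> real m" using real_arch_simple by blast
    define N where "N = max n m"
    have "1 / real (Suc N) \<le> 1 / real (Suc n)" by (intro divide_left_mono) (auto simp: N_def)
    then have "t \<in> {1 / real (Suc N)..real (Suc N)}" using n m by (auto simp: N_def)
    then have "G t \<le> (SUP n. G t * indicator {1 / real (Suc n)..real (Suc n)} t)" by (intro SUP_upper2[of N]) auto
    moreover have "(SUP n. G t * indicator {1 / real (Suc n)..real (Suc n)} t) \<le> G t" by (intro SUP_least) (auto simp: indicator_def)
    ultimately show ?thesis using True by simp
  next
    case False
    have "t \<notin> {1 / real (Suc n)..real (Suc n)}" for n using False divide_pos_pos[of 1 "real (Suc n)"] unfolding atLeastAtMost_iff by linarith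
    then show ?thesis using False by simp
  qed
  have "(\<integral>t. G t * indicator {0<..} t) = (SUP n. (\<integral>t. G t * indicator {1 / real (Suc n)..real (Suc n)} t))"
    unfolding SUP[symmetric] by (rule nn_integral_monotone_convergence_SUP[OF inc]) measurable
  also have "... \<le> ennreal (1 / \<alpha>) * interp_integral A D \<theta> p x" by (intro SUP_least part)
  finally show ?thesis by (simp add: G_def)
qed

definition one_T :: "real => complex" where "one_T t = indicator {0<..<T} t"

lemma one_T_class: "one_T \<in> laplace_class"
proof (rule laplace_classI)
  show "integrable lborel one_T"
  proof -
    have "integrable lborel (\<lambda>t. complex_of_real (indicator {0<..<T} t))" using T by (intro integrable_of_real integrable_real_indicator) auto
    then show ?thesis by (simp add: one_T_def[abs_def] of_real_indicator)
  qed
qed (auto simp: one_T_def[abs_def])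

text \<open>On {0<..<T} this is the Mittag-Leffler function of order \<alpha> at - \<i> * lam n * t
  powr \<alpha>, the scalar homogeneous solution with initial value 1.\<close>

definition sc :: "nat => real => complex"
  where "sc n t = one_T t - \<i> * conv (mlk (lam n)) one_T t"

lemma sc_class: "sc n \<in> laplace_class" unfolding sc_def[abs_def] by (intro laplace_class_diff laplace_class_cmult laplace_class_conv one_T_class mlk_class lam_pos)

lemma sc_measurable [measurable]: "sc n \<in> borel_measurable borel" by (rule laplace_class_measurable[OF sc_class])

text \<open>Since the kernel has integral \<open>- \<i>\<close>, the scalar solution is the tail of the kernel, which
  gains the factor \<open>t powr (- \<alpha>) / lam n\<close>.\<close>

lemma sc_tail:
  assumes "t \<in> {0<..<T}"
  shows "sc n t = \<i> * (LINT r|lborel. indicator {t..} r *\<^sub>R mlk (lam n) r)"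
proof -
  have i: "integrable lborel (mlk (lam n))" by (intro integrable_ml_kernel mu_pos lam_pos)
  have "conv (mlk (lam n)) one_T t = (LINT r|lborel. mlk (lam n) (t - (t + (-1) * r)) * one_T (t + (-1) * r))"
    unfolding conv_def by (subst lborel_integral_real_affine[where c="-1" and t=t]) auto
  also have "... = (LINT r|lborel. mlk (lam n) r - indicator {t..} r *\<^sub>R mlk (lam n) r)"
  proof (intro Bochner_Integration.integral_cong refl)
    fix r
    show "mlk (lam n) (t - (t + - 1 * r)) * one_T (t + - 1 * r) = mlk (lam n) r - indicator {t..} r *\<^sub>R mlk (lam n) r"
      using assms mlk_zero[of r] by (cases "r \<le> 0"; cases "r < t") (auto simp: one_T_def)
  qed
  also have "... = - \<i> - (LINT r|lborel. indicator {t..} r *\<^sub>R mlk (lam n) r)" using i integrable_mult_indicator[OF _ i, of "{t..}"]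
    by (subst Bochner_Integration.integral_diff) (auto simp: integral_ml_kernel mu_pos lam_pos)
  finally show ?thesis using assms by (simp add: sc_def one_T_def right_diff_distrib)
qed

text \<open>The uniform bound comes from the total mass of the majorant, the decay in
  \<open>lam n\<close> from the tail bound with (mu (lam n) * t) powr \<alpha> = lam n * t powr
  \<alpha>.\<close>

lemma sc_bound_ex: "\<exists>C>0. \<forall>n. \<forall>t\<in>{0<..<T}. cmod (sc n t) \<le> C \<and> lam n * cmod (sc n t) \<le> C * t powr (-\<alpha>)"
proof -
  obtain C where C: "C > 0" "\<And>\<mu> T. \<mu> > 0 ==> T > 0 ==>
    (\<integral>t. indicator {T<..} t * ml_majorant \<alpha> \<mu> t) \<le> ennreal (C / (\<mu> * T) powr \<alpha>)" using ml_majorant_tail_bound by metis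
  define M where "M = density_mass / cos \<eta>"
  have M: "M \<ge> 0" using density_mass_nonneg cos_\<eta>_pos by (simp add: M_def)
  show ?thesis
  proof (intro exI[of _ "C + M"] conjI allI ballI)
    show "C + M > 0" using C M by simp
    fix n t assume t: "t \<in> {0<..<T}"
    have \<mu>: "mu (lam n) > 0" by (intro mu_pos lam_pos)
    have i: "integrable lborel (\<lambda>r. indicator {t..} r *\<^sub>R mlk (lam n) r)" by (intro integrable_mult_indicator integrable_ml_kernel \<mu>) auto
    have "ennreal (cmod (sc n t)) \<le> (\<integral>r. ennreal (cmod (indicator {t..} r *\<^sub>R mlk (lam n) r)))"
      unfolding sc_tail[OF t] using integral_norm_bound_ennreal[OF i] by (simp add: norm_mult)
    also have "... \<le> (\<integral>r. indicator {t<..} r * ml_majorant \<alpha> (mu (lam n)) r)"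
    proof (rule nn_integral_mono_AE, use AE_lborel_singleton[of t] in eventually_elim)
      case (elim r)
      then show ?case using norm_ml_kernel_le[OF \<mu>, of r] by (auto simp: indicator_def)
    qed
    finally have le: "ennreal (cmod (sc n t)) \<le> (\<integral>r. indicator {t<..} r * ml_majorant \<alpha> (mu (lam n)) r)" .
    have "(\<integral>r. indicator {t<..} r * ml_majorant \<alpha> (mu (lam n)) r) \<le> ennreal M" unfolding M_def nn_integral_ml_majorant[OF \<mu>, symmetric]
      by (intro nn_integral_mono) (auto simp: indicator_def)
    then have "cmod (sc n t) \<le> M" using le M by (simp flip: ennreal_le_iff)
    then show "cmod (sc n t) \<le> C + M" using C by simp
    have "ennreal (cmod (sc n t)) \<le> ennreal (C / (mu (lam n) * t) powr \<alpha>)" using le C(2)[OF \<mu>, of t] t by (auto intro: order_trans)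
    then have "cmod (sc n t) \<le> C / (lam n * t powr \<alpha>)" using t C lam_pos[of n] by (simp add: mu_powr[OF lam_pos])
    then have "lam n * cmod (sc n t) \<le> C * t powr (-\<alpha>)" using t lam_pos[of n] by (simp add: powr_minus_divide field_simps)
    also have "... \<le> (C + M) * t powr (-\<alpha>)" using M by (intro mult_right_mono) auto
    finally show "lam n * cmod (sc n t) \<le> (C + M) * t powr (-\<alpha>)" .
  qed
qed

definition sc_const :: real
  where "sc_const = (SOME C. C > 0 \<and> (\<forall>n. \<forall>t\<in>{0<..<T}. cmod (sc n t) \<le> C \<and> lam n * cmod (sc n t) \<le> C * t powr (-\<alpha>)))"

lemma sc_const: "sc_const > 0" "t \<in> {0<..<T} ==> cmod (sc n t) \<le> sc_const"
  "t \<in> {0<..<T} ==> cmod (of_real (lam n) * sc n t) \<le> sc_const * t powr (-\<alpha>)"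
  using someI_ex[OF sc_bound_ex] lam_pos[of n] unfolding sc_const_def[symmetric] by (auto simp: norm_mult)

text \<open>\<open>hom x\<close> is \<open>- A u\<close> for the solution \<open>u\<close> of the homogeneous problem with initial value \<open>x\<close>.\<close>

definition hom :: "'a => real => 'a"
  where "hom x t = indicator {0<..<T} t *\<^sub>R mult (\<lambda>n. of_real (lam n) * sc n t) x"

lemma hom_measurable [measurable]: "hom x \<in> borel_measurable borel" unfolding hom_def[abs_def] mult_def
  by (intro borel_measurable_scaleR borel_measurable_suminf borel_measurable_scaleC_const) measurable

text \<open>For x = a + b the decay of \<open>sc\<close> is spent on \<open>a\<close>, while for
  \<open>b\<close> the factor \<open>lam n\<close> is moved into \<open>A b\<close>; the infimum
  over the splittings is the K-functional.\<close>

lemma norm_hom_le: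
  assumes t: "t \<in> {0<..<T}"
  shows "norm (hom x t) \<le> sc_const * (t powr (-\<alpha>) * KF (t powr \<alpha>) x)"
proof -
  have "norm (hom x t) / (sc_const * t powr (-\<alpha>)) \<le> KF (t powr \<alpha>) x"
  proof (rule KF_ge)
    fix a b assume ab: "b \<in> D" "x = a + b"
    let ?m = "\<lambda>n. of_real (lam n) * sc n t"
    note m = sc_const(3)[OF t]
    have "norm (mult ?m b) \<le> sc_const * norm (A b)"
    proof (rule norm_le_coeffI)
      fix n
      have "coeff (mult ?m b) n = - sc n t * coeff (A b) n" by (simp add: coeff_mult[OF m] A_coeff[OF ab(1)])
      then show "cmod (coeff (mult ?m b) n) \<le> sc_const * cmod (coeff (A b) n)" using sc_const(2)[OF t, of n] by (simp add: norm_mult mult_right_mono)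
    qed (use sc_const(1) in simp)
    moreover have "norm (hom x t) \<le> norm (mult ?m a) + norm (mult ?m b)" using t norm_triangle_ineq unfolding ab(2) hom_def mult_add[OF m] by simp
    ultimately have "norm (hom x t) \<le> sc_const * t powr (-\<alpha>) * norm a + sc_const * norm (A b)" using norm_mult_le[where m="?m" and x=a, OF m] by linarith
    also have "... = sc_const * t powr (-\<alpha>) * (norm a + t powr \<alpha> * norm (A b))" using t by (simp add: powr_minus field_simps)
    finally show "norm (hom x t) / (sc_const * t powr (-\<alpha>)) \<le> norm a + t powr \<alpha> * norm (A b)" using sc_const(1) t by (simp add: pos_divide_le_eq mult.commute)
  qed
  then show ?thesis using sc_const(1) t by (simp add: pos_divide_le_eq mult_ac)
qed

definition hom_const :: real where "hom_const = sc_const / \<alpha> powr (1 / p)"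

lemma hom_const_pos: "hom_const > 0" using sc_const(1) \<alpha> by (simp add: hom_const_def)

text \<open>The point where the initial value has to lie in the interpolation space: the p-th power
  of the pointwise bound, integrated in time, is its norm up to the factor 1 / \<alpha> of the
  substitution.\<close>

lemma LpE_hom:
  assumes x: "x \<in> X_space A D \<alpha> p"
  shows "LpE p (hom x) \<le> ennreal ((hom_const * X_norm A D \<alpha> p x) powr p)"
proof -
  have fin: "interp_integral A D \<theta> p x < top" using x by (simp add: X_space_\<alpha> interp_space_def)
  define I where "I = enn2real (interp_integral A D \<theta> p x)"
  have I: "interp_integral A D \<theta> p x = ennreal I" "I \<ge> 0" unfolding I_def using fin by auto
  have "LpE p (hom x) \<le> (\<integral>t. ennreal (sc_const powr p) * (ennreal ((t powr (-\<alpha>) * KF (t powr \<alpha>) x) powr p) * indicator {0<..} t))" unfolding LpE_def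
  proof (rule nn_integral_mono)
    fix t
    show "ennreal (norm (hom x t) powr p) \<le> ennreal (sc_const powr p) * (ennreal ((t powr (-\<alpha>) * KF (t powr \<alpha>) x) powr p) * indicator {0<..} t)"
    proof (cases "t \<in> {0<..<T}")
      case True
      have "norm (hom x t) powr p \<le> (sc_const * (t powr (-\<alpha>) * KF (t powr \<alpha>) x)) powr p" using p_pos by (intro powr_mono2 norm_hom_le True) auto
      also have "... = sc_const powr p * (t powr (-\<alpha>) * KF (t powr \<alpha>) x) powr p" by (rule powr_mult)
      finally show ?thesis using True by (simp add: ennreal_leI flip: ennreal_mult')
    next
      case False
      then show ?thesis using p_pos by (simp add: hom_def)
    qed
  qed
  also have "... = ennreal (sc_const powr p) * (\<integral>t. ennreal ((t powr (-\<alpha>) * KF (t powr \<alpha>) x) powr p) * indicator {0<..} t)"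
  proof (rule nn_integral_cmult)
    have "(\<lambda>t. KF (max 0 (t powr \<alpha>)) x) \<in> borel_measurable borel" by (rule measurable_compose[OF _ KF_measurable]) measurable
    then have [measurable]: "(\<lambda>t. KF (t powr \<alpha>) x) \<in> borel_measurable borel" by simp
    show "(\<lambda>t. ennreal ((t powr (-\<alpha>) * KF (t powr \<alpha>) x) powr p) * indicator {0<..} t) \<in> borel_measurable lborel" by measurable
  qed
  also have "... \<le> ennreal (sc_const powr p) * (ennreal (1 / \<alpha>) * interp_integral A D \<theta> p x)" by (intro mult_left_mono interp_substitution) simp
  also have "... = ennreal (sc_const powr p * (1 / \<alpha>) * I)"
    using I \<alpha> by (simp only: mult.assoc) (simp add: ennreal_mult del: times_divide_eq_right times_divide_eq_left)
  also have "sc_const powr p * (1 / \<alpha>) * I = (hom_const * X_norm A D \<alpha> p x) powr p" using sc_const(1) \<alpha> p_pos I(2)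
    by (simp add: hom_const_def X_space_\<alpha> interp_norm_def I_def[symmetric] powr_mult powr_divide powr_powr)
  finally show ?thesis .
qed

lemma hom_L:
  assumes x: "x \<in> X_space A D \<alpha> p"
  shows "hom x \<in> L"
proof -
  have "LpE p (hom x) < top" using LpE_hom[OF x] by (rule le_less_trans) simp
  then show ?thesis by (simp add: Lpb_def hom_def[of x])
qed

text \<open>Coordinatewise this is the scalar equation for \<open>sc\<close>. The description as a
  multiplier is needed for the K-functional estimate, the second part for the equation
  itself.\<close>

lemma hom_solution:
  assumes x: "x \<in> X_space A D \<alpha> p"
  shows "AE t\<in>{0<..<T} in lborel. x + J (\<lambda>s. (- \<i>) *\<^sub>C hom x s) t = mult (\<lambda>n. sc n t) x"
    "AE t\<in>{0<..<T} in lborel. x + J (\<lambda>s. (- \<i>) *\<^sub>C hom x s) t \<in> D \<and>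
      A (x + J (\<lambda>s. (- \<i>) *\<^sub>C hom x s) t) = - hom x t"
proof -
  have g: "(\<lambda>s. (- \<i>) *\<^sub>C hom x s) \<in> L" by (intro L_scaleC hom_L x) simp
  have hc: "coeff (hom x t) n = of_real (lam n) * sc n t * coeff x n" if "t \<in> {0<..<T}" for n t using that by (simp add: hom_def coeff_mult[OF sc_const(3)[OF that]])
  have V: "AE t in lborel. \<forall>n. conv (mlk (lam n)) one_T t = of_real (lam n) * conv (cfrac \<alpha>) (sc n) t"
    unfolding AE_all_countable sc_def[abs_def] by (intro allI volterra lam_pos one_T_class)
  have c: "conv (cfrac \<alpha>) (\<lambda>s. coeff ((- \<i>) *\<^sub>C hom x s) n) t = - \<i> * of_real (lam n) * coeff x n * conv (cfrac \<alpha>) (sc n) t"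
    if t: "t \<in> {0<..<T}" for n t
  proof -
    have "conv (cfrac \<alpha>) (\<lambda>s. coeff ((- \<i>) *\<^sub>C hom x s) n) t = (LINT s|lborel. (- \<i> * of_real (lam n) * coeff x n) * (cfrac \<alpha> (t - s) * sc n s))"
      unfolding conv_def
    proof (intro Bochner_Integration.integral_cong refl)
      fix s
      show "cfrac \<alpha> (t - s) * coeff ((- \<i>) *\<^sub>C hom x s) n = (- \<i> * of_real (lam n) * coeff x n) * (cfrac \<alpha> (t - s) * sc n s)"
      proof (cases "s \<in> {0<..<t}")
        case True
        then show ?thesis using t by (simp add: cinner_scaleC_left hc)
      next
        case False
        then consider "s \<le> 0" | "s \<ge> t" by fastforce
        then show ?thesis
        proof cases
          case 1
          have "sc n s = 0" using sc_class 1 by (simp add: laplace_class_def)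
          then show ?thesis using 1 by (simp add: hom_def cinner_scaleC_left)
        qed (simp add: cfrac_zero)
      qed
    qed
    then show ?thesis unfolding conv_def by simp
  qed
  have *: "AE t\<in>{0<..<T} in lborel. (\<forall>n. coeff (x + J (\<lambda>s. (- \<i>) *\<^sub>C hom x s) t) n = sc n t * coeff x n)" using V
  proof eventually_elim
    case (elim t)
    show ?case
    proof (intro impI allI)
      fix n assume t: "t \<in> {0<..<T}"
      have "sc n t = 1 - \<i> * (of_real (lam n) * conv (cfrac \<alpha>) (sc n) t)" unfolding sc_def[of n t] elim[rule_format, of n] using t by (simp add: one_T_def)
      then have s: "\<i> * (of_real (lam n) * conv (cfrac \<alpha>) (sc n) t) = 1 - sc n t" by simp
      have "coeff (x + J (\<lambda>s. (- \<i>) *\<^sub>C hom x s) t) n = coeff x n - (\<i> * (of_real (lam n) * conv (cfrac \<alpha>) (sc n) t)) * coeff x n"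
        by (simp add: cinner_add_left coeff_fint[OF g] c[OF t] mult_ac)
      then show "coeff (x + J (\<lambda>s. (- \<i>) *\<^sub>C hom x s) t) n = sc n t * coeff x n" unfolding s by (simp add: algebra_simps)
    qed
  qed
  then show "AE t\<in>{0<..<T} in lborel. x + J (\<lambda>s. (- \<i>) *\<^sub>C hom x s) t = mult (\<lambda>n. sc n t) x"
    by eventually_elim (auto intro!: eq_coeffI simp: coeff_mult[OF sc_const(2)])
  show "AE t\<in>{0<..<T} in lborel. x + J (\<lambda>s. (- \<i>) *\<^sub>C hom x s) t \<in> D \<and>
      A (x + J (\<lambda>s. (- \<i>) *\<^sub>C hom x s) t) = - hom x t" using *
  proof eventually_elim
    case (elim t)
    show ?case
    proof (rule impI)
      assume t: "t \<in> {0<..<T}"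
      have "coeff (hom x t) n = of_real (lam n) * coeff (x + J (\<lambda>s. (- \<i>) *\<^sub>C hom x s) t) n" for n using elim t by (simp add: hc)
      from domain_from_coeff[OF this]
      show "x + J (\<lambda>s. (- \<i>) *\<^sub>C hom x s) t \<in> D \<and>
        A (x + J (\<lambda>s. (- \<i>) *\<^sub>C hom x s) t) = - hom x t" by blast
    qed
  qed
qed

end

section \<open>Bounds in the interpolation spaces\<close>

lemma AE_interval_dense:
  fixes t \<delta> T :: real
  assumes "AE s\<in>{0<..<T} in lborel. P s" "t \<in> {0..T}" "T > 0" "\<delta> > 0"
  obtains s where "s \<in> {0<..<T}" "\<bar>s - t\<bar> < \<delta>" "P s"
proof -
  define I where "I = {max 0 (t - \<delta>)<..<min T (t + \<delta>)}"
  have "\<exists>s\<in>I. P s"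
  proof (rule ccontr)
    assume "\<not> ?thesis"
    then have "AE s in lborel. s \<notin> I" using assms(1) by (auto simp: I_def elim!: eventually_mono)
    then have "emeasure lborel I = 0" by (subst (asm) AE_iff_measurable[where N=I]) (auto simp: I_def)
    then show False using assms by (auto simp: I_def)
  qed
  then show thesis using that by (auto simp: I_def)
qed

text \<open>Chebyshev's argument: otherwise the integral over the interval would be at least twice
  the allowed amount. Times before 0 are permitted, so the interval need not fit into
  {0..T}.\<close>

lemma AE_average_le:
  fixes v :: "real => 'b::{real_normed_vector, second_countable_topology}"
  assumes [measurable]: "v \<in> borel_measurable borel" and v: "LpE p v \<le> ennreal (b powr p)" and "b > 0" "p > 0" "h > 0"
    and P: "AE s in lborel. s < T --> P s" and "t \<le> T"
  obtains s where "t - h < s" "s < t" "P s" "norm (v s) \<le> (2 / h) powr (1 / p) * b"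
proof -
  have "\<exists>s. t - h < s \<and> s < t \<and> P s \<and> norm (v s) \<le> (2 / h) powr (1 / p) * b"
  proof (rule ccontr)
    assume no: "\<not> ?thesis"
    have "ennreal (2 * b powr p) = (\<integral>s. ennreal (2 / h * b powr p) * indicator {t - h<..<t} s)"
      using \<open>h > 0\<close> by (subst nn_integral_cmult_indicator) (auto simp: ennreal_mult[symmetric])
    also have "... \<le> LpE p v" unfolding LpE_def
    proof (rule nn_integral_mono_AE, use P in eventually_elim)
      case (elim s)
      show ?case
      proof (cases "s \<in> {t - h<..<t}")
        case True
        then have "norm (v s) \<ge> (2 / h) powr (1 / p) * b" using no elim \<open>t \<le> T\<close> by force
        then have "((2 / h) powr (1 / p) * b) powr p \<le> norm (v s) powr p" using \<open>b > 0\<close> \<open>p > 0\<close> by (intro powr_mono2) auto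
        moreover have "((2 / h) powr (1 / p) * b) powr p = 2 / h * b powr p" using \<open>b > 0\<close> \<open>p > 0\<close> \<open>h > 0\<close> by (simp add: powr_mult powr_powr)
        ultimately show ?thesis using True by (simp add: ennreal_leI)
      qed simp
    qed
    also have "... \<le> ennreal (b powr p)" by (rule v)
    finally show False using \<open>b > 0\<close> by simp
  qed
  then show thesis using that by blast
qed

context mr_setting
begin

text \<open>For b \<ge> 0 this bounds the norm itself by \<open>b\<close>, not its p-th
  power.\<close>

definition Lp_le :: "(real => 'a) => real => bool"
  where "Lp_le f b \<longleftrightarrow> LpE p f \<le> ennreal (b powr p)"

lemma Lp_le_mono: "Lp_le f b ==> 0 \<le> b ==> b \<le> c ==> Lp_le f c" unfolding Lp_le_def by (erule order_trans, intro ennreal_leI powr_mono2) (use p_pos in auto)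

lemma Lp_le_scale:
  assumes [measurable]: "f \<in> borel_measurable borel" and f: "Lp_le f b" and "b \<ge> 0" "c \<ge> 0"
    and h: "AE t in lborel. norm (h t) \<le> c * norm (f t)"
  shows "Lp_le h (c * b)"
proof -
  have "LpE p h \<le> (\<integral>t. ennreal (c powr p) * ennreal (norm (f t) powr p))" unfolding LpE_def
  proof (rule nn_integral_mono_AE, use h in eventually_elim)
    case (elim t)
    have "norm (h t) powr p \<le> (c * norm (f t)) powr p" using elim p_pos by (intro powr_mono2) auto
    then show ?case by (simp add: powr_mult ennreal_leI flip: ennreal_mult)
  qed
  also have "... = ennreal (c powr p) * LpE p f" unfolding LpE_def by (rule nn_integral_cmult) measurable
  also have "... \<le> ennreal (c powr p) * ennreal (b powr p)" using f unfolding Lp_le_def by (rule mult_left_mono) simp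
  also have "... = ennreal ((c * b) powr p)" by (simp add: powr_mult flip: ennreal_mult)
  finally show ?thesis by (simp add: Lp_le_def)
qed

text \<open>The factor 2 is the price of the elementary inequality \<open>powr_add_le\<close> in
  place of Minkowski's.\<close>

lemma Lp_le_add:
  assumes [measurable]: "f \<in> borel_measurable borel" "g \<in> borel_measurable borel"
    and f: "Lp_le f b" and g: "Lp_le g c" and "b \<ge> 0" "c \<ge> 0"
    and h: "AE t in lborel. norm (h t) \<le> norm (f t) + norm (g t)"
  shows "Lp_le h (2 * (b + c))"
proof -
  have "LpE p h \<le> ennreal (2 powr p) * (LpE p f + LpE p g)" by (rule LpE_add_le[OF assms(1,2) p_pos h])
  also have "... \<le> ennreal (2 powr p) * (ennreal (b powr p) + ennreal (c powr p))" using f g unfolding Lp_le_def by (intro mult_left_mono add_mono) auto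
  also have "... = ennreal (2 powr p * (b powr p + c powr p))" by (simp add: ennreal_mult' flip: ennreal_plus)
  also have "... \<le> ennreal (2 powr p * (b + c) powr p)" using assms by (intro ennreal_leI mult_left_mono powr_superadd) (use p_gt_1 in auto)
  finally show ?thesis unfolding Lp_le_def powr_mult .
qed

definition top_const :: real
  where "top_const = (SOME C. C > 0 \<and> (\<forall>f\<in>L. \<forall>b\<ge>0. Lp_le f b --> Lp_le (Top f) (C * b)))"

lemma top_const: "top_const > 0" "f \<in> L ==> b \<ge> 0 ==> Lp_le f b ==> Lp_le (Top f) (top_const * b)"
proof -
  obtain C where C: "C > 0" "\<And>f. f \<in> L ==> LpE p (Top f) \<le> ennreal C * LpE p f" using Top_bound_ex by metis
  have "C powr (1 / p) > 0 \<and> (\<forall>f\<in>L. \<forall>b\<ge>0. Lp_le f b --> Lp_le (Top f) (C powr (1 / p) * b))"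
  proof (intro conjI ballI allI impI)
    fix f b assume f: "f \<in> L" "b \<ge> 0" "Lp_le f b"
    have "LpE p (Top f) \<le> ennreal C * ennreal (b powr p)" by (rule order_trans[OF C(2)[OF f(1)] mult_left_mono]) (use f in \<open>simp_all add: Lp_le_def\<close>)
    also have "... = ennreal ((C powr (1 / p) * b) powr p)" using C p_pos by (simp add: powr_mult powr_powr ennreal_mult)
    finally show "Lp_le (Top f) (C powr (1 / p) * b)" by (simp add: Lp_le_def)
  qed (use C in simp)
  then have "\<exists>C>0. \<forall>f\<in>L. \<forall>b\<ge>0. Lp_le f b --> Lp_le (Top f) (C * b)" by blast
  from someI_ex[OF this] show "top_const > 0" "f \<in> L ==> b \<ge> 0 ==> Lp_le f b ==> Lp_le (Top f) (top_const * b)" unfolding top_const_def[symmetric] by blast+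
qed

text \<open>The summands stem from the bound on all of {0..T} for \<tau> \<ge> 1, the Hoelder
  increment, and the average of \<open>v\<close>.\<close>

definition kf_const :: real
  where "kf_const = hoelder_const * T powr (\<alpha> - 1 / p) + hoelder_const + 2 powr (1 / p)"

text \<open>The splitting \<open>z t = (z t - z s) + z s\<close>, with \<open>s\<close> at distance at most \<open>\<tau> powr (1 / \<alpha>)\<close> of \<open>t\<close>
  and \<open>v s\<close> not larger than its average, estimates the K-functional.\<close>

lemma KF_fint_le:
  assumes g: "g \<in> L" "Lp_le g b" and v: "v \<in> L" "Lp_le v b" and b: "b > 0"
    and dom: "AE t\<in>{0<..<T} in lborel. J g t \<in> D \<and> A (J g t) = - v t"
    and t: "t \<in> {0..T}" and \<tau>: "\<tau> > 0"
  shows "KF \<tau> (J g t) \<le> kf_const * b * min 1 (\<tau> powr \<theta>)"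
proof (cases "\<tau> \<ge> 1")
  case True
  have "KF \<tau> (J g t) \<le> norm (J g t - J g 0)" using KF_le_norm[of \<tau> "J g t"] \<tau> fint_zero[OF g(1), of 0] by simp
  also have "... \<le> hoelder_const * \<bar>t - 0\<bar> powr (\<alpha> - 1 / p) * (b powr p) powr (1 / p)" using g b by (intro fint_hoelder[OF g(1)]) (auto simp: Lp_le_def)
  also have "... \<le> hoelder_const * T powr (\<alpha> - 1 / p) * b" using t b p_pos hoelder_const_pos order_pos
    by (auto simp: powr_powr intro!: mult_right_mono mult_left_mono powr_mono2)
  also have "... \<le> kf_const * b" using b hoelder_const_pos by (intro mult_right_mono) (auto simp: kf_const_def)
  also have "min 1 (\<tau> powr \<theta>) = 1" using True \<theta>_bounds ge_one_powr_ge_zero[of \<tau> \<theta>] by simp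
  then have "kf_const * b = kf_const * b * min 1 (\<tau> powr \<theta>)" by simp
  finally show ?thesis .
next
  case False
  define h where "h = \<tau> powr (1 / \<alpha>)"
  have h: "h > 0" using \<tau> by (simp add: h_def)
  \<comment> \<open>Before time 0 both functions vanish, so the comparison time \<open>s\<close> may
    leave {0..T} to the left.\<close>
  have dom': "AE s in lborel. s < T --> J g s \<in> D \<and> A (J g s) = - v s" using dom
  proof eventually_elim
    case (elim s)
    then show ?case using fint_zero[OF g(1), of s] Lpb_zero[OF v(1), of s] zero_in_D by (cases "s > 0") auto
  qed
  obtain s where s: "t - h < s" "s < t" "J g s \<in> D \<and> A (J g s) = - v s"
    "norm (v s) \<le> (2 / h) powr (1 / p) * b" using AE_average_le[OF Lpb_measurable[OF v(1)] v(2)[unfolded Lp_le_def] b p_pos h dom', of t] t by auto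
  have "KF \<tau> (J g t) \<le> norm (J g t - J g s) + \<tau> * norm (A (J g s))" using \<tau> s by (intro KF_le) auto
  also have "norm (A (J g s)) = norm (v s)" using s by simp
  also have "norm (J g t - J g s) \<le> hoelder_const * \<bar>t - s\<bar> powr (\<alpha> - 1 / p) * (b powr p) powr (1 / p)"
    using g b by (intro fint_hoelder[OF g(1)]) (auto simp: Lp_le_def)
  also have "... \<le> hoelder_const * h powr (\<alpha> - 1 / p) * b" using s b p_pos hoelder_const_pos order_pos
    by (auto simp: powr_powr intro!: mult_right_mono mult_left_mono powr_mono2)
  also have "h powr (\<alpha> - 1 / p) = \<tau> powr \<theta>" using \<alpha> by (simp add: h_def powr_powr \<alpha>\<theta>[symmetric])
  also have "\<tau> * norm (v s) \<le> \<tau> * ((2 / h) powr (1 / p) * b)" using s \<tau> by (intro mult_left_mono) auto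
  also have "... = 2 powr (1 / p) * \<tau> powr \<theta> * b"
  proof -
    \<comment> \<open>With h = \<tau> powr (1 / \<alpha>) the exponents combine to 1 - 1 / (\<alpha>
      * p), which is \<open>\<theta>\<close>.\<close>
    have "\<tau> * (1 / h) powr (1 / p) = \<tau> powr 1 * \<tau> powr (- (1 / (\<alpha> * p)))" using \<tau> by (simp add: h_def powr_powr powr_divide powr_minus_divide)
    also have "... = \<tau> powr \<theta>" using \<tau> by (simp add: \<theta>_def powr_diff powr_minus_divide)
    finally show ?thesis using h powr_mult[of 2 "1 / h" "1 / p"] by (simp add: mult_ac)
  qed
  also have "hoelder_const * \<tau> powr \<theta> * b + 2 powr (1 / p) * \<tau> powr \<theta> * b \<le> kf_const * b * \<tau> powr \<theta>"
    using b hoelder_const_pos by (simp add: kf_const_def algebra_simps)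
  also have "\<tau> powr \<theta> = min 1 (\<tau> powr \<theta>)" using False \<tau> \<theta>_bounds powr_le1[of \<theta> \<tau>] by simp
  finally show ?thesis by (simp add: add_mono)
qed

definition zero_const :: real where "zero_const = kf_const * (2 * (1 + top_const))"

lemma kf_const_pos: "kf_const > 0" using hoelder_const_pos T by (auto simp: kf_const_def intro!: add_nonneg_pos add_pos_pos)

lemma zero_const_pos: "zero_const > 0" using kf_const_pos top_const(1) by (simp add: zero_const_def)

lemma L_Top: "f \<in> L ==> (resid f) \<in> L" by (intro L_diff L_scaleC Top_L) auto

lemma KF_Top_le:
  assumes f: "f \<in> L" "Lp_le f b" and b: "b > 0" and t: "t \<in> {0..T}" and \<tau>: "\<tau> > 0"
  shows "KF \<tau> (J (resid f) t) \<le> zero_const * b * min 1 (\<tau> powr \<theta>)"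
proof -
  define c where "c = 2 * (b + top_const * b)"
  have "top_const * b > 0" using b top_const(1) by simp
  moreover have "c = 2 * (top_const * b) + 2 * b" by (simp add: c_def)
  ultimately have c: "c > 0" "top_const * b \<le> c" using b by linarith+
  note Tf = top_const(2)[OF f(1) less_imp_le[OF b] f(2)]
  have "Lp_le (resid f) c" unfolding c_def
  proof (rule Lp_le_add[OF Lpb_measurable[OF f(1)] Top_measurable[OF f(1)] f(2) Tf])
    show "AE t in lborel. norm (f t - \<i> *\<^sub>C Top f t) \<le> norm (f t) + norm (Top f t)"
      using norm_triangle_ineq4[of "f t" "\<i> *\<^sub>C Top f t" for t] by (intro AE_I2) (simp add: norm_scaleC)
  qed (use b top_const(1) in auto)
  moreover have "Lp_le (Top f) c" using b top_const(1) c by (intro Lp_le_mono[OF Tf]) auto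
  ultimately have "KF \<tau> (J (resid f) t) \<le> kf_const * c * min 1 (\<tau> powr \<theta>)" using f c t \<tau> by (intro KF_fint_le[OF L_Top _ Top_L _ _ Top_solution]) auto
  then show ?thesis by (simp add: c_def zero_const_def algebra_simps)
qed

definition hom_kf_const :: real
  where "hom_kf_const = sc_const * (2 powr (1 / p + \<theta>) * (1 + max 1 (1 / lam0)))"

lemma hom_kf_const_pos: "hom_kf_const > 0" using sc_const(1) by (auto simp: hom_kf_const_def intro!: mult_pos_pos add_pos_pos)

lemma KF_X_norm_le:
  assumes x: "x \<in> X_space A D \<alpha> p" and \<tau>: "\<tau> > 0"
  shows "KF \<tau> x \<le> 2 powr (1 / p + \<theta>) * (1 + max 1 (1 / lam0)) * X_norm A D \<alpha> p x * min 1 (\<tau> powr \<theta>)"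
proof -
  define N where "N = interp_norm A D \<theta> p x"
  define c where "c = 2 powr (1 / p + \<theta>)"
  define m where "m = max 1 (1 / lam0)"
  have pos: "c > 0" "m > 0" "N \<ge> 0" by (auto simp: c_def m_def N_def interp_norm_def)
  have K: "KF \<sigma> x \<le> c * \<sigma> powr \<theta> * N" if "\<sigma> > 0" for \<sigma>
    using KF_le_interp_norm[of x \<theta> p \<sigma>] x that p_pos \<theta>_bounds by (simp add: X_space_\<alpha> N_def c_def)
  have "KF \<tau> x \<le> norm x" using \<tau> by (intro KF_le_norm) auto
  also have "... \<le> m * KF 1 x" unfolding m_def by (rule norm_le_KF)
  also have "... \<le> m * (c * N)" using K[of 1] pos by (intro mult_left_mono) auto
  finally have 1: "KF \<tau> x \<le> c * m * N" by (simp add: mult_ac)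
  have "KF \<tau> x \<le> c * (1 + m) * N * min 1 (\<tau> powr \<theta>)"
  proof (cases "1 \<le> \<tau> powr \<theta>")
    case True
    have "c * m * N \<le> c * (1 + m) * N" using pos by (intro mult_right_mono mult_left_mono) auto
    then show ?thesis using 1 True by simp
  next
    case False
    have "c * \<tau> powr \<theta> * N \<le> c * (1 + m) * N * \<tau> powr \<theta>" using pos by (simp add: algebra_simps)
    then show ?thesis using K[OF \<tau>] False by simp
  qed
  then show ?thesis by (simp add: X_space_\<alpha> c_def m_def N_def)
qed

text \<open>\<open>sol x f\<close> solves the linear problem with initial value \<open>x\<close> and right-hand side \<open>f\<close>, and
  \<open>vsol x f\<close> represents \<open>- A (sol x f)\<close>.\<close>

definition vsol :: "'a => (real => 'a) => real => 'a"
  where "vsol x f t = hom x t + Top f t"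

definition sol :: "'a => (real => 'a) => real => 'a"
  where "sol x f t = x + J (\<lambda>s. f s - \<i> *\<^sub>C vsol x f s) t"

context
  fixes x :: 'a
  assumes x: "x \<in> X_space A D \<alpha> p"
begin

lemma L_hom: "(\<lambda>s. (- \<i>) *\<^sub>C hom x s) \<in> L" by (intro L_scaleC hom_L x) simp

lemma vsol_L: "f \<in> L ==> vsol x f \<in> L" unfolding vsol_def[abs_def] by (intro L_add hom_L x Top_L)

lemma L_vsol: "f \<in> L ==> (\<lambda>s. f s - \<i> *\<^sub>C vsol x f s) \<in> L" by (intro L_diff L_scaleC vsol_L) auto

lemma sol_split:
  assumes f: "f \<in> L"
  shows "sol x f t = (x + J (\<lambda>s. (- \<i>) *\<^sub>C hom x s) t) + J (resid f) t"
proof -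
  have "(\<lambda>s. f s - \<i> *\<^sub>C vsol x f s) = (\<lambda>s. (- \<i>) *\<^sub>C hom x s + (f s - \<i> *\<^sub>C Top f s))" by (intro ext eq_coeffI)
      (simp only: vsol_def cinner_diff_left cinner_add_left cinner_scaleC_left, simp add: algebra_simps)
  then show ?thesis unfolding sol_def by (simp add: fint_add[OF L_hom L_Top[OF f]])
qed

lemma sol_continuous: "f \<in> L ==> continuous_on UNIV (sol x f)" unfolding sol_def[abs_def] by (intro continuous_intros fint_continuous[OF L_vsol])

lemma sol_0: "f \<in> L ==> sol x f 0 = x" unfolding sol_def by (simp add: fint_zero[OF L_vsol])

lemma sol_domain:
  assumes f: "f \<in> L"
  shows "AE t\<in>{0<..<T} in lborel. sol x f t \<in> D \<and> A (sol x f t) = - vsol x f t" using hom_solution(2)[OF x] Top_solution[OF f]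
proof eventually_elim
  case (elim t)
  then show ?case using D_add[of "x + J (\<lambda>s. (- \<i>) *\<^sub>C hom x s) t" "J (resid f) t"] by (simp only: sol_split[OF f] vsol_def) simp
qed

text \<open>Subtracting the homogeneous solution reduces the claim to
  \<open>linear_unique\<close>.\<close>

lemma sol_unique:
  assumes f: "f \<in> L" and v: "v \<in> L"
    and dom: "AE t\<in>{0<..<T} in lborel. x + J (\<lambda>s. f s - \<i> *\<^sub>C v s) t \<in> D \<and>
      A (x + J (\<lambda>s. f s - \<i> *\<^sub>C v s) t) = - v t"
  shows "AE t in lborel. v t = vsol x f t"
proof -
  define w where "w s = v s - hom x s" for s
  have w: "w \<in> L" unfolding w_def[abs_def] by (intro L_diff v hom_L x)
  have fw: "(\<lambda>s. f s - \<i> *\<^sub>C w s) \<in> L" by (intro L_diff f L_scaleC w) simp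
  have "(\<lambda>s. f s - \<i> *\<^sub>C v s) = (\<lambda>s. (- \<i>) *\<^sub>C hom x s + (f s - \<i> *\<^sub>C w s))" unfolding w_def by (intro ext eq_coeffI)
      (simp only: cinner_diff_left cinner_add_left cinner_scaleC_left, simp add: algebra_simps)
  then have eq: "J (\<lambda>s. f s - \<i> *\<^sub>C w s) t =
    (x + J (\<lambda>s. f s - \<i> *\<^sub>C v s) t) - (x + J (\<lambda>s. (- \<i>) *\<^sub>C hom x s) t)" for t by (simp add: fint_add[OF L_hom fw])
  have "AE t in lborel. w t = Top f t"
  proof (rule linear_unique[OF f w])
    show "AE t\<in>{0<..<T} in lborel. J (\<lambda>s. f s - \<i> *\<^sub>C w s) t \<in> D \<and>
      A (J (\<lambda>s. f s - \<i> *\<^sub>C w s) t) = - w t" using hom_solution(2)[OF x] dom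
    proof eventually_elim
      case (elim t)
      then show ?case using D_diff[of "x + J (\<lambda>s. f s - \<i> *\<^sub>C v s) t" "x + J (\<lambda>s. (- \<i>) *\<^sub>C hom x s) t"] by (simp only: eq) (auto simp: w_def)
    qed
  qed
  then show ?thesis by eventually_elim (simp add: w_def vsol_def algebra_simps)
qed

text \<open>The homogeneous part is a multiplier of \<open>x\<close> only at almost every time;
  continuity in norm and the Lipschitz dependence of the K-functional on the norm extend its bound
  to all of {0..T}.\<close>

lemma KF_sol_le:
  assumes f: "f \<in> L" "Lp_le f b" and b: "b > 0" and t: "t \<in> {0..T}" and \<tau>: "\<tau> > 0"
  shows "KF \<tau> (sol x f t) \<le> (hom_kf_const * X_norm A D \<alpha> p x + zero_const * b) * min 1 (\<tau> powr \<theta>)"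
proof -
  define u where "u t = x + J (\<lambda>s. (- \<i>) *\<^sub>C hom x s) t" for t
  have cu: "continuous_on UNIV u" unfolding u_def[abs_def] by (intro continuous_intros fint_continuous[OF L_hom])
  have "KF \<tau> (u t) \<le> sc_const * KF \<tau> x"
  proof (rule field_le_epsilon)
    fix \<epsilon> :: real assume \<epsilon>: "\<epsilon> > 0"
    then obtain \<delta> where \<delta>: "\<delta> > 0" "\<And>s. \<bar>s - t\<bar> < \<delta> ==> norm (u s - u t) < \<epsilon>"
      using cu unfolding continuous_on_iff dist_norm real_norm_def by blast
    obtain s where s: "s \<in> {0<..<T}" "\<bar>s - t\<bar> < \<delta>" "u s = mult (\<lambda>n. sc n s) x"
      using AE_interval_dense[OF hom_solution(1)[OF x] t T \<delta>(1)] by (auto simp: u_def)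
    have "KF \<tau> (u t) \<le> KF \<tau> (u s) + norm (u t - u s)" using \<tau> by (intro KF_triangle) auto
    also have "KF \<tau> (u s) \<le> sc_const * KF \<tau> x" unfolding s(3) using s(1) sc_const \<tau> by (intro KF_mult_le) auto
    also have "norm (u t - u s) \<le> \<epsilon>" using \<delta>(2)[OF s(2)] by (simp add: norm_minus_commute)
    finally show "KF \<tau> (u t) \<le> sc_const * KF \<tau> x + \<epsilon>" by simp
  qed
  also have "... \<le> hom_kf_const * X_norm A D \<alpha> p x * min 1 (\<tau> powr \<theta>)"
    using mult_left_mono[OF KF_X_norm_le[OF x \<tau>] less_imp_le[OF sc_const(1)]] by (simp add: hom_kf_const_def mult_ac)
  finally have "KF \<tau> (u t) \<le> hom_kf_const * X_norm A D \<alpha> p x * min 1 (\<tau> powr \<theta>)" .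
  moreover have "KF \<tau> (sol x f t) \<le> KF \<tau> (u t) + KF \<tau> (J (resid f) t)" unfolding sol_split[OF f(1)] u_def using \<tau> by (intro KF_add_le) auto
  ultimately show ?thesis using KF_Top_le[OF f b t \<tau>] by (simp add: distrib_right)
qed

text \<open>The initial value cancels, and by causality only f - g before \<open>\<sigma>\<close>
  enters.\<close>

lemma sol_diff:
  assumes f: "f \<in> L" and g: "g \<in> L" and "t \<le> \<sigma>"
  defines "h \<equiv> \<lambda>s. indicator {..<\<sigma>} s *\<^sub>R (f s - g s)"
  shows "sol x f t - sol x g t = J (resid h) t"
proof -
  have d: "(\<lambda>s. f s - g s) \<in> L" by (intro L_diff f g)
  have h: "h \<in> L" unfolding h_def by (intro L_cut d)
  note cut = fint_causal[OF \<open>t \<le> \<sigma>\<close>, symmetric]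
  have "sol x f t - sol x g t = J (resid f) t - J (resid g) t" by (simp add: sol_split[OF f] sol_split[OF g])
  also have "... = J (\<lambda>s. (f s - \<i> *\<^sub>C Top f s) - (g s - \<i> *\<^sub>C Top g s)) t" by (rule fint_diff[OF L_Top[OF f] L_Top[OF g], symmetric])
  also have "... = J (\<lambda>s. (f s - g s) - \<i> *\<^sub>C Top (\<lambda>s. f s - g s) s) t"
  proof (rule fint_cong_AE)
    show "AE s in lborel. (f s - \<i> *\<^sub>C Top f s) - (g s - \<i> *\<^sub>C Top g s) = (f s - g s) - \<i> *\<^sub>C Top (\<lambda>s. f s - g s) s" using Top_diff[OF f g]
    proof eventually_elim
      case (elim s)
      show ?case unfolding elim[symmetric] by (rule eq_coeffI) (simp only: cinner_diff_left cinner_scaleC_left, simp add: algebra_simps)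
    qed
  qed (intro L_diff L_Top f g d)+
  also have "... = J (resid h) t" unfolding cut[of "\<lambda>s. (f s - g s) - \<i> *\<^sub>C Top (\<lambda>s. f s - g s) s"] cut[of "\<lambda>s. h s - \<i> *\<^sub>C Top h s"]
  proof (intro arg_cong[of _ _ "\<lambda>g. J g t"] ext)
    fix s
    show "indicator {..<\<sigma>} s *\<^sub>R (f s - g s - \<i> *\<^sub>C Top (\<lambda>s. f s - g s) s) = indicator {..<\<sigma>} s *\<^sub>R (h s - \<i> *\<^sub>C Top h s)"
      using Top_causal[of s \<sigma> "\<lambda>s. f s - g s"] by (cases "s < \<sigma>") (auto simp: h_def)
  qed
  finally show ?thesis .
qed

end

end

section \<open>A contraction principle\<close>

context mr_setting
begin

lemma zero_L: "(\<lambda>t. 0) \<in> L" using p_pos by (simp add: Lpb_def LpE_def)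

lemma Lp_le_zero: "Lp_le (\<lambda>t. 0) b" using p_pos by (simp add: Lp_le_def LpE_def)

lemma Lp_le_ex:
  assumes "f \<in> L"
  obtains b where "b > 0" "Lp_le f b"
proof -
  obtain r where r: "LpE p f = ennreal r" "r \<ge> 0" using Lpb_finite[OF assms] by (cases "LpE p f") auto
  have "ennreal r \<le> ennreal (((r + 1) powr (1 / p)) powr p)" using r p_pos by (intro ennreal_leI) (simp add: powr_powr)
  then show thesis using r by (intro that[of "(r + 1) powr (1 / p)"]) (auto simp: Lp_le_def)
qed

lemma Lp_le_all_zero:
  assumes [measurable]: "f \<in> borel_measurable borel" and "C \<ge> 0" and f: "\<And>k::nat. Lp_le f (C / 2 ^ k)"
  shows "AE t in lborel. f t = 0"
proof -
  have "(\<lambda>k. (C * (1 / 2) ^ k) powr p) \<longlonglongrightarrow> (C * 0) powr p"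
    using p_pos \<open>C \<ge> 0\<close> by (intro tendsto_powr2 tendsto_intros LIMSEQ_realpow_zero) auto
  then have "(\<lambda>k. ennreal ((C * (1 / 2) ^ k) powr p)) \<longlonglongrightarrow> ennreal ((C * 0) powr p)" by (intro tendsto_ennrealI)
  then have "LpE p f \<le> ennreal ((C * 0) powr p)" by (rule LIMSEQ_le_const) (use f in \<open>auto simp: Lp_le_def power_divide\<close>)
  then have "(\<integral>t. ennreal (norm (f t) powr p)) = 0" by (simp add: LpE_def)
  then have "AE t in lborel. ennreal (norm (f t) powr p) = 0" by (subst (asm) nn_integral_0_iff_AE) auto
  then show ?thesis by eventually_elim (simp add: ennreal_eq_0_iff)
qed

text \<open>Fatou's lemma; it keeps the limit of the iteration in the ball.\<close>

lemma Lp_le_limit: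
  assumes [measurable]: "\<And>k. f k \<in> borel_measurable borel" and f: "\<And>k. Lp_le (f k) b"
    and lim: "AE t in lborel. (\<lambda>k. f k t) \<longlonglongrightarrow> g t"
  shows "Lp_le g b"
proof -
  have "LpE p g \<le> (\<integral>t. liminf (\<lambda>k. ennreal (norm (f k t) powr p)))" unfolding LpE_def
  proof (rule nn_integral_mono_AE, use lim in eventually_elim)
    case (elim t)
    then have "(\<lambda>k. ennreal (norm (f k t) powr p)) \<longlonglongrightarrow> ennreal (norm (g t) powr p)"
      using p_pos by (intro tendsto_ennrealI tendsto_powr2 tendsto_norm) auto
    then show ?case by (simp only: lim_imp_Liminf[OF sequentially_bot])
  qed
  also have "... \<le> liminf (\<lambda>k. LpE p (f k))" unfolding LpE_def by (rule nn_integral_liminf) measurable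
  also have "... \<le> ennreal (b powr p)" using f unfolding Lp_le_def by (intro order_trans[OF Liminf_le_Limsup Limsup_bounded]) auto
  finally show ?thesis by (simp add: Lp_le_def)
qed

text \<open>Banach's fixed point theorem on a ball, with completeness of L^p proved for the
  iterates: increments of size 4^(- k), weighted by 2^k, are still summable, which gives convergence
  almost everywhere and a rate in norm.\<close>

lemma picard:
  assumes \<rho>: "\<rho> > 0"
    and N: "\<And>f. f \<in> L ==> Lp_le f \<rho> ==> N f \<in> L \<and> Lp_le (N f) \<rho>"
    and contr: "\<And>f g b. f \<in> L ==> g \<in> L ==> Lp_le f \<rho> ==> Lp_le g \<rho> ==> b > 0 ==>
      Lp_le (\<lambda>t. f t - g t) b ==> Lp_le (\<lambda>t. N f t - N g t) (b / 4)"
  shows "\<exists>f\<in>L. Lp_le f \<rho> \<and> (AE t in lborel. N f t = f t)"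
proof -
  define f where "f = rec_nat (\<lambda>t. 0) (\<lambda>_. N)"
  have f_simps: "f 0 = (\<lambda>t. 0)" "f (Suc k) = N (f k)" for k by (simp_all add: f_def)
  have f: "f k \<in> L \<and> Lp_le (f k) \<rho>" for k by (induction k) (simp_all add: f_simps zero_L Lp_le_zero N)
  have fL: "f k \<in> L" and fb: "Lp_le (f k) \<rho>" for k using f by auto
  have [measurable]: "f k \<in> borel_measurable borel" for k by (rule Lpb_measurable[OF fL])
  define h where "h k t = f (Suc k) t - f k t" for k t
  have [measurable]: "h k \<in> borel_measurable borel" for k unfolding h_def by measurable
  have h: "Lp_le (h k) (\<rho> / 4 ^ k)" for k
  proof (induction k)
    case 0
    then show ?case using fb[of 1] by (simp add: h_def f_simps)
  next
    case (Suc k)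
    have "Lp_le (\<lambda>t. N (f (Suc k)) t - N (f k) t) (\<rho> / 4 ^ k / 4)" using Suc \<rho> by (intro contr fL fb) (auto simp: h_def[abs_def])
    then show ?case by (simp add: h_def[abs_def] f_simps(2) mult.commute)
  qed
  \<comment> \<open>Where this sum is finite the increments are dominated by a geometric series with
    ratio 1/2 and a constant controlled by \<open>S t\<close>.\<close>
  define S where "S t = (\<Sum>k. ennreal ((2 ^ k * norm (h k t)) powr p))" for t
  have [measurable]: "S \<in> borel_measurable borel" unfolding S_def by measurable
  have "(\<integral>t. S t) = (\<Sum>k. (\<integral>t. ennreal ((2 ^ k * norm (h k t)) powr p)))" unfolding S_def by (rule nn_integral_suminf) measurable
  also have "... \<le> (\<Sum>k. ennreal (\<rho> powr p * ((1 / 2) powr p) ^ k))"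
  proof (rule suminf_le)
    fix k
    have "(\<integral>t. ennreal ((2 ^ k * norm (h k t)) powr p)) = LpE p (\<lambda>t. 2 ^ k *\<^sub>R h k t)" by (simp add: LpE_def)
    also have "... \<le> ennreal ((2 ^ k * (\<rho> / 4 ^ k)) powr p)" unfolding Lp_le_def[symmetric] using \<rho> by (intro Lp_le_scale[OF _ h]) auto
    also have "2 ^ k * (\<rho> / 4 ^ k) = \<rho> * (1 / 2) ^ k" by (simp add: power_divide field_simps flip: power_mult_distrib)
    also have "(\<rho> * (1 / 2) ^ k) powr p = \<rho> powr p * ((1 / 2) powr p) ^ k" by (simp add: powr_mult powr_power powr_realpow[symmetric] powr_powr mult.commute)
    finally show "(\<integral>t. ennreal ((2 ^ k * norm (h k t)) powr p)) \<le> ennreal (\<rho> powr p * ((1 / 2) powr p) ^ k)" .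
  qed auto
  also have "... < top"
  proof -
    have "(1 / 2 :: real) powr p < 1 powr p" using p_pos by (intro powr_less_mono2) auto
    then have "summable (\<lambda>k. \<rho> powr p * ((1 / 2) powr p) ^ k)" by (intro summable_mult summable_geometric) auto
    then have "(\<Sum>k. ennreal (\<rho> powr p * ((1 / 2) powr p) ^ k)) \<noteq> top" by (rule ennreal_suminf_neq_top) simp
    then show ?thesis by (simp only: less_top)
  qed
  finally have Sfin: "(\<integral>t. S t) < top" .
  define s where "s = (enn2real (\<integral>t. S t) + 1) powr (1 / p)"
  have s: "s > 0" "(\<integral>t. S t) \<le> ennreal (s powr p)"
  proof -
    have "(0::real) < enn2real (\<integral>t. S t) + 1" using enn2real_nonneg[of "\<integral>t. S t"] by linarith
    then show "s > 0" by (simp add: s_def)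
    have "(\<integral>t. S t) = ennreal (enn2real (\<integral>t. S t))" using Sfin by simp
    also have "... \<le> ennreal (s powr p)" using p_pos enn2real_nonneg[of "\<integral>t. S t"] by (intro ennreal_leI) (simp add: s_def powr_powr)
    finally show "(\<integral>t. S t) \<le> ennreal (s powr p)" .
  qed
  define g where "g t = lim (\<lambda>k. f k t)" for t
  have g_meas [measurable]: "g \<in> borel_measurable borel" unfolding g_def by (rule borel_measurable_lim_metric) measurable
  have Sae: "AE t in lborel. S t \<noteq> \<infinity>" using Sfin by (intro nn_integral_noteq_infinite) auto
  have key: "(\<lambda>k. f k t) \<longlonglongrightarrow> g t \<and> (\<forall>k. ennreal (norm (f k t - g t) powr p) \<le> ennreal ((2 / 2 ^ k) powr p) * S t)"
    if "S t \<noteq> \<infinity>" for t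
  proof -
    define B where "B = enn2real (S t)"
    have B: "S t = ennreal B" "B \<ge> 0" using that by (auto simp: B_def less_top)
    define c where "c = B powr (1 / p)"
    have hle: "norm (h k t) \<le> c * (1 / 2) ^ k" for k
    proof -
      define a where "a k = ennreal ((2 ^ k * norm (h k t)) powr p)" for k
      have "(\<Sum>i\<in>{k}. a i) \<le> (\<Sum>k. a k)" by (rule sum_le_suminf[OF summableI]) auto
      then have "ennreal ((2 ^ k * norm (h k t)) powr p) \<le> S t" unfolding S_def by (simp add: a_def[symmetric])
      then have "(2 ^ k * norm (h k t)) powr p \<le> B" using B by simp
      then have "((2 ^ k * norm (h k t)) powr p) powr (1 / p) \<le> c" unfolding c_def using p_pos by (intro powr_mono2) auto
      then have "2 ^ k * norm (h k t) \<le> c" using p_pos by (simp add: powr_powr)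
      then show ?thesis by (simp add: power_divide field_simps)
    qed
    have geo: "summable (\<lambda>k. c * (1 / 2) ^ k)" by (intro summable_mult summable_geometric) auto
    have sn: "summable (\<lambda>k. norm (h k t))" by (rule summable_comparison_test'[OF geo, of 0]) (use hle in auto)
    have tel: "(\<Sum>i<k. h i t) = f k t" for k unfolding h_def by (subst sum_lessThan_telescope) (simp add: f_simps)
    have conv: "(\<lambda>k. f k t) \<longlonglongrightarrow> (\<Sum>i. h i t)" using summable_LIMSEQ[OF summable_norm_cancel[OF sn]] by (simp add: tel)
    then have gt: "g t = (\<Sum>i. h i t)" by (simp add: g_def limI)
    have "norm (f k t - g t) \<le> 2 / 2 ^ k * c" for k
    proof -
      have "g t - f k t = (\<Sum>i. h (i + k) t)" unfolding gt tel[symmetric] by (rule suminf_minus_initial_segment[OF summable_norm_cancel[OF sn], symmetric])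
      moreover have "norm (\<Sum>i. h (i + k) t) \<le> (\<Sum>i. c * (1 / 2) ^ k * (1 / 2) ^ i)"
      proof (rule order_trans[OF summable_norm suminf_le])
        show sk: "summable (\<lambda>i. norm (h (i + k) t))" using sn by (rule summable_ignore_initial_segment)
        show "summable (\<lambda>i. norm (h (i + k) t))" by (rule sk)
        show "summable (\<lambda>i. c * (1 / 2) ^ k * (1 / 2) ^ i)" by (intro summable_mult summable_geometric) auto
        show "norm (h (i + k) t) \<le> c * (1 / 2) ^ k * (1 / 2) ^ i" for i using hle[of "i + k"] by (simp add: power_add mult_ac)
      qed
      moreover have "(\<Sum>i. c * (1 / 2) ^ k * (1 / 2) ^ i) = 2 / 2 ^ k * c" by (subst suminf_mult) (auto simp: summable_geometric suminf_geometric power_divide)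
      ultimately show ?thesis by (simp add: norm_minus_commute)
    qed
    then have "norm (f k t - g t) powr p \<le> (2 / 2 ^ k * c) powr p" for k using p_pos by (intro powr_mono2) auto
    moreover have "(2 / 2 ^ k * c) powr p = (2 / 2 ^ k) powr p * B" for k :: nat unfolding powr_mult c_def using p_pos B(2) by (simp add: powr_powr)
    ultimately have "ennreal (norm (f k t - g t) powr p) \<le> ennreal ((2 / 2 ^ k) powr p) * S t" for k unfolding B(1) by (simp add: ennreal_leI flip: ennreal_mult')
    then show ?thesis using conv gt by simp
  qed
  have lim: "AE t in lborel. (\<lambda>k. f k t) \<longlonglongrightarrow> g t" using Sae by eventually_elim (use key in blast)
  have gb: "Lp_le g \<rho>" by (rule Lp_le_limit[OF _ fb lim]) measurable
  have g0: "g t = 0" if "t \<notin> {0<..<T}" for t unfolding g_def using Lpb_zero[OF fL that] by (simp add: limI)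
  have "LpE p g < top" using gb unfolding Lp_le_def by (rule le_less_trans) simp
  then have gL: "g \<in> L" using g0 by (simp add: Lpb_def)
  have fg: "Lp_le (\<lambda>t. f k t - g t) (2 * s / 2 ^ k)" for k
  proof -
    have "LpE p (\<lambda>t. f k t - g t) \<le> (\<integral>t. ennreal ((2 / 2 ^ k) powr p) * S t)" unfolding LpE_def
      by (rule nn_integral_mono_AE, use Sae in eventually_elim) (use key in blast)
    also have "... = ennreal ((2 / 2 ^ k) powr p) * (\<integral>t. S t)" by (rule nn_integral_cmult) measurable
    also have "... \<le> ennreal ((2 / 2 ^ k) powr p) * ennreal (s powr p)" by (intro mult_left_mono s) simp
    also have "... = ennreal ((2 / 2 ^ k * s) powr p)" unfolding powr_mult by (rule ennreal_mult[symmetric]) auto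
    finally show ?thesis by (simp add: Lp_le_def)
  qed
  have "AE t in lborel. N g t - g t = 0"
  proof (rule Lp_le_all_zero)
    show "8 * s \<ge> 0" using s by simp
    have [measurable]: "N g \<in> borel_measurable borel" "N (f k) \<in> borel_measurable borel" for k using N gL gb fL fb Lpb_measurable by blast+
    show "(\<lambda>t. N g t - g t) \<in> borel_measurable borel" by measurable
    fix k
    have 1: "Lp_le (\<lambda>t. N (f k) t - N g t) (2 * s / 2 ^ k / 4)" using s by (intro contr fL gL fb gb fg) auto
    have 2: "Lp_le (\<lambda>t. N (f k) t - g t) (2 * s / 2 ^ Suc k)" using fg[of "Suc k"] by (simp add: f_simps)
    have "Lp_le (\<lambda>t. N g t - g t) (2 * (2 * s / 2 ^ k / 4 + 2 * s / 2 ^ Suc k))"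
    proof (rule Lp_le_add[OF _ _ 1 2])
      show "AE t in lborel. norm (N g t - g t) \<le> norm (N (f k) t - N g t) + norm (N (f k) t - g t)"
        using norm_triangle_ineq4[of "N (f k) t - g t" "N (f k) t - N g t" for t] by (intro AE_I2) (simp add: add.commute)
    qed (use s in auto)
    then show "Lp_le (\<lambda>t. N g t - g t) (8 * s / 2 ^ k)" by (rule Lp_le_mono) (use s in \<open>auto simp: field_simps\<close>)
  qed
  then have "AE t in lborel. N g t = g t" by simp
  then show ?thesis using gL gb by blast
qed

lemma Top_cong_AE:
  assumes f: "f \<in> L" and g: "g \<in> L" and "AE s in lborel. f s = g s"
  shows "Top f t = Top g t"
proof -
  note [measurable] = borel_measurable_cinner_const[OF Lpb_measurable[OF f]]
    borel_measurable_cinner_const[OF Lpb_measurable[OF g]]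
  have "vcoef f n t = vcoef g n t" for n unfolding vcoef_def conv_def
  proof (rule integral_cong_AE)
    show "AE s in lborel. mlk (lam n) (t - s) * coeff (f s) n = mlk (lam n) (t - s) * coeff (g s) n" using assms(3) by eventually_elim simp
  qed measurable
  then show ?thesis by (simp add: Top_def)
qed

end

section \<open>The quasilinear equation\<close>

locale quasilinear_setting = mr_setting \<alpha> p A D e lam lam0 T
  for \<alpha> p :: real and A :: "'a::{complex_hilbert, second_countable_topology} => 'a" and D e lam lam0 T +
  fixes \<epsilon> :: real and F :: "'a => 'a => 'a"
  assumes \<epsilon>: "0 < \<epsilon>" "\<epsilon> < \<alpha> - 1 / p"
    and F_bounded: "\<And>v. v \<in> X_space A D (\<alpha> - \<epsilon>) p ==> F v \<in> bounded_operators A D"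
    and F_lipschitz: "lipschitz_on_bounded_subsets A D (\<alpha> - \<epsilon>) p F"
    and F_0: "\<And>u. u \<in> D ==> F 0 u = A u"
begin

abbreviation X :: "'a set" where "X \<equiv> X_space A D (\<alpha> - \<epsilon>) p"
abbreviation Xn :: "'a => real" where "Xn \<equiv> X_norm A D (\<alpha> - \<epsilon>) p"

definition \<theta>' :: real where "\<theta>' = 1 - 1 / ((\<alpha> - \<epsilon>) * p)"

lemma \<theta>'_bounds: "0 < \<theta>'" "\<theta>' < \<theta>"
proof -
  have "1 / p < \<alpha> - \<epsilon>" using \<epsilon> by simp
  then have *: "1 < (\<alpha> - \<epsilon>) * p" "(\<alpha> - \<epsilon>) * p < \<alpha> * p" using p_pos \<epsilon> by (auto simp: field_simps)
  then show "0 < \<theta>'" by (simp add: \<theta>'_def)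
  have "1 / (\<alpha> * p) < 1 / ((\<alpha> - \<epsilon>) * p)" using * by (intro divide_strict_left_mono) auto
  then show "\<theta>' < \<theta>" by (simp add: \<theta>'_def \<theta>_def)
qed

lemma X_KF:
  assumes "\<theta>' < \<mu>" "\<kappa> \<ge> 0" "\<And>\<tau>. \<tau> > 0 ==> KF \<tau> x \<le> \<kappa> * min 1 (\<tau> powr \<mu>)"
  shows "x \<in> X" "Xn x \<le> interp_const \<mu> \<theta>' p * \<kappa>" using interp_from_KF[OF \<theta>'_bounds(1) assms(1) p_pos assms(2,3)]
  by (simp_all add: X_space_def X_norm_def \<theta>'_def)

lemma Xn_nonneg: "Xn x \<ge> 0" by (simp add: X_norm_def interp_norm_def)

lemma zero_X: "0 \<in> X" "Xn 0 = 0"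
proof -
  have "KF \<tau> 0 \<le> 0 * min 1 (\<tau> powr \<theta>)" if "\<tau> > 0" for \<tau> using KF_le_norm[of \<tau> 0] that by simp
  from X_KF[OF \<theta>'_bounds(2) _ this] Xn_nonneg[of 0] show "0 \<in> X" "Xn 0 = 0" by auto
qed

text \<open>The supremum in \<open>operator_norm\<close> is attained or not, but finite since both
  operators are bounded; normalizing \<open>u\<close> places it in the set of that supremum.\<close>

lemma bounded_diff:
  assumes "x \<in> X" "y \<in> X" "u \<in> D"
  shows "norm (F x u - F y u) \<le> operator_norm A D (\<lambda>u. F x u - F y u) * norm (A u)"
proof -
  let ?B = "\<lambda>u. F x u - F y u"
  obtain C C' where C: "\<And>u. u \<in> D ==> norm (F x u) \<le> C * norm (A u)" "\<And>u. u \<in> D ==> norm (F y u) \<le> C' * norm (A u)"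
    and lin: "clinear_on D (F x)" "clinear_on D (F y)" using F_bounded[OF assms(1)] F_bounded[OF assms(2)] unfolding bounded_operators_def by blast
  have B: "norm (?B u) \<le> (C + C') * norm (A u)" if "u \<in> D" for u using norm_triangle_ineq4[of "F x u" "F y u"] C[OF that] by (simp add: distrib_right)
  define r where "r = norm (A u)"
  show ?thesis
  proof (cases "r = 0")
    case True
    then show ?thesis using B[OF assms(3)] by (simp add: r_def)
  next
    case False
    then have r: "r > 0" by (simp add: r_def)
    define w where "w = complex_of_real (1 / r) *\<^sub>C u"
    have w: "w \<in> D" using D_cspace assms(3) by (simp add: w_def csubspace_def)
    have sc: "G w = (1 / r) *\<^sub>R G u" if "clinear_on D G" for G using that assms(3) by (simp only: w_def clinear_on_def flip: scaleC_of_real)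
    have "norm (?B w) \<le> operator_norm A D ?B" unfolding operator_norm_def
    proof (rule cSUP_upper)
      show "w \<in> {u \<in> D. norm (A u) \<le> 1}" using w sc[OF A_clinear] r by (simp add: r_def)
      show "bdd_above ((\<lambda>u. norm (?B u)) ` {u \<in> D. norm (A u) \<le> 1})"
      proof (rule bdd_aboveI2)
        fix u assume u: "u \<in> {u \<in> D. norm (A u) \<le> 1}"
        have "(C + C') * norm (A u) \<le> \<bar>C + C'\<bar> * 1" using u by (intro mult_mono) auto
        then show "norm (?B u) \<le> \<bar>C + C'\<bar>" using B[of u] u by simp
      qed
    qed
    moreover have "norm (?B w) = norm (?B u) / r" using r by (simp only: sc[OF lin(1)] sc[OF lin(2)] scaleR_diff_right[symmetric]) simp
    ultimately show ?thesis using r by (simp add: r_def[symmetric] field_simps)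
  qed
qed

text \<open>The Lipschitz condition on a ball, applied to vectors of \<open>D\<close>, so that later
  estimates are free of \<open>operator_norm\<close>.\<close>

definition lip :: "real => real => bool"
  where "lip R \<Lambda> \<longleftrightarrow> \<Lambda> \<ge> 0 \<and> (\<forall>x\<in>X. \<forall>y\<in>X. Xn x \<le> R --> Xn y \<le> R -->
    (\<forall>u\<in>D. norm (F x u - F y u) \<le> \<Lambda> * Xn (x - y) * norm (A u)))"

lemma lip_nonneg: "lip R \<Lambda> ==> \<Lambda> \<ge> 0" by (simp add: lip_def)

lemma lipD: "lip R \<Lambda> ==> x \<in> X ==> y \<in> X ==> Xn x \<le> R ==> Xn y \<le> R ==> u \<in> D ==>
    norm (F x u - F y u) \<le> \<Lambda> * Xn (x - y) * norm (A u)" by (simp add: lip_def)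

lemma lip_ex: "\<exists>\<Lambda>. lip R \<Lambda>"
proof -
  define S where "S = {x \<in> X. Xn x \<le> R}"
  have S: "S \<subseteq> X" "\<exists>R. \<forall>v\<in>S. Xn v \<le> R" unfolding S_def by blast+
  obtain l where "\<forall>v\<in>S. \<forall>w\<in>S. operator_norm A D (\<lambda>x. F v x - F w x) \<le> l * Xn (v - w)"
    using F_lipschitz[unfolded lipschitz_on_bounded_subsets_def, THEN spec, THEN mp, OF S(1), THEN mp, OF S(2)] ..
  then have l: "operator_norm A D (\<lambda>x. F v x - F w x) \<le> l * Xn (v - w)" if "v \<in> S" "w \<in> S" for v w using that by blast
  have "norm (F x u - F y u) \<le> \<bar>l\<bar> * Xn (x - y) * norm (A u)"
    if *: "x \<in> X" "y \<in> X" "Xn x \<le> R" "Xn y \<le> R" "u \<in> D" for x y u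
  proof -
    have "operator_norm A D (\<lambda>u. F x u - F y u) \<le> l * Xn (x - y)" using l * by (simp add: S_def)
    also have "... \<le> \<bar>l\<bar> * Xn (x - y)" using Xn_nonneg by (intro mult_right_mono) auto
    finally show ?thesis using bounded_diff[OF *(1,2,5)] by (meson mult_right_mono norm_ge_zero order_trans)
  qed
  then show ?thesis unfolding lip_def by (intro exI[of _ "\<bar>l\<bar>"]) auto
qed

text \<open>A common constant for the bounds, uniform in time, of a solution and of a difference of
  solutions in \<open>X\<close>.\<close>

definition xk :: real where "xk = interp_const \<theta> \<theta>' p * (hom_kf_const + zero_const)"

lemma interp_const_nonneg: "interp_const a b c \<ge> 0" by (simp add: interp_const_def)

lemma xk_nonneg: "xk \<ge> 0" using hom_kf_const_pos zero_const_pos by (simp add: xk_def interp_const_nonneg)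

text \<open>The solutions are \<open>sol x f\<close> for the fixed points \<open>f\<close> of \<open>nl x\<close>; the function \<open>u = sol x f\<close> is replaced by
  \<open>inv_A (vsol x f)\<close>, which agrees with it almost everywhere and is in the domain everywhere.\<close>

definition nl :: "'a => (real => 'a) => real => 'a"
  where "nl x f t = indicator {0<..<T} t *\<^sub>R (\<i> *\<^sub>C (F (sol x f t) (inv_A (vsol x f t)) + vsol x f t))"

lemma sol_diff_X:
  assumes x: "x \<in> X_space A D \<alpha> p" and fg: "f \<in> L" "g \<in> L" and b: "b > 0"
    and h: "Lp_le (\<lambda>s. indicator {..<\<sigma>} s *\<^sub>R (f s - g s)) b" and t: "t \<in> {0..T}" "t \<le> \<sigma>"
  shows "Xn (sol x f t - sol x g t) \<le> xk * b"
proof -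
  have K: "KF \<tau> (sol x f t - sol x g t) \<le> zero_const * b * min 1 (\<tau> powr \<theta>)" if "\<tau> > 0" for \<tau>
    unfolding sol_diff[OF x fg t(2)] using fg h b t that by (intro KF_Top_le L_cut L_diff)
  have "Xn (sol x f t - sol x g t) \<le> interp_const \<theta> \<theta>' p * (zero_const * b)" by (rule X_KF(2)[OF \<theta>'_bounds(2) _ K]) (use b zero_const_pos in auto)
  also have "... \<le> interp_const \<theta> \<theta>' p * ((hom_kf_const + zero_const) * b)"
    using b hom_kf_const_pos by (intro mult_left_mono mult_right_mono interp_const_nonneg) auto
  finally show ?thesis by (simp add: xk_def mult.assoc)
qed

context
  fixes x :: 'a
  assumes x: "x \<in> X_space A D \<alpha> p"
begin

lemma sol_X:
  assumes f: "f \<in> L" "Lp_le f b" and b: "b > 0" and t: "t \<in> {0..T}"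
  shows "sol x f t \<in> X" "Xn (sol x f t) \<le> xk * (X_norm A D \<alpha> p x + b)"
proof -
  define n where "n = X_norm A D \<alpha> p x"
  have n: "n \<ge> 0" by (simp add: n_def X_norm_def interp_norm_def)
  note K = KF_sol_le[OF x f b t, folded n_def]
  have \<kappa>: "hom_kf_const * n + zero_const * b \<ge> 0" using n b hom_kf_const_pos zero_const_pos by simp
  show "sol x f t \<in> X" by (rule X_KF(1)[OF \<theta>'_bounds(2) \<kappa> K])
  have "Xn (sol x f t) \<le> interp_const \<theta> \<theta>' p * (hom_kf_const * n + zero_const * b)" by (rule X_KF(2)[OF \<theta>'_bounds(2) \<kappa> K])
  also have "... \<le> interp_const \<theta> \<theta>' p * ((hom_kf_const + zero_const) * (n + b))" using n b hom_kf_const_pos zero_const_pos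
    by (intro mult_left_mono interp_const_nonneg) (auto simp: algebra_simps)
  finally show "Xn (sol x f t) \<le> xk * (X_norm A D \<alpha> p x + b)" by (simp add: xk_def n_def mult.assoc)
qed

lemma sol_bounded:
  assumes f: "f \<in> L"
  shows "\<exists>R\<ge>0. \<forall>t\<in>{0..T}. sol x f t \<in> X \<and> Xn (sol x f t) \<le> R"
proof -
  obtain b where b: "b > 0" "Lp_le f b" using Lp_le_ex[OF f] .
  have "X_norm A D \<alpha> p x \<ge> 0" by (simp add: X_norm_def interp_norm_def)
  then show ?thesis using b sol_X[OF f b(2,1)] xk_nonneg by (intro exI[of _ "xk * (X_norm A D \<alpha> p x + b)"]) auto
qed

text \<open>Continuity into the space with the smaller exponent follows by interpolating between the
  continuity in the norm and the boundedness in the space with the exponent \<open>\<theta>\<close>.\<close>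

lemma sol_X_continuous:
  assumes f: "f \<in> L" and t: "t \<in> {0..T}"
  shows "((\<lambda>s. Xn (sol x f s - sol x f t)) \<longlongrightarrow> 0) (at t within {0..T})"
proof -
  obtain b where b: "b > 0" "Lp_le f b" using Lp_le_ex[OF f] .
  define k where "k = hom_kf_const * X_norm A D \<alpha> p x + zero_const * b"
  have k: "k > 0" using b hom_kf_const_pos zero_const_pos by (auto simp: k_def X_norm_def interp_norm_def intro!: add_nonneg_pos)
  \<comment> \<open>Makes \<mu> * \<theta> the midpoint of \<open>\<theta>'\<close> and
    \<open>\<theta>\<close>, leaving a positive power 1 - \<mu> for the norm difference.\<close>
  define \<mu> where "\<mu> = (\<theta>' + \<theta>) / (2 * \<theta>)"
  have \<mu>: "0 < \<mu>" "\<mu> < 1" "\<theta>' < \<mu> * \<theta>" using \<theta>'_bounds by (auto simp: \<mu>_def field_simps)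
  define d where "d s = norm (sol x f s - sol x f t)" for s
  have d_ge: "d s \<ge> 0" for s by (simp add: d_def)
  have bound: "Xn (sol x f s - sol x f t) \<le> interp_const (\<mu> * \<theta>) \<theta>' p * (d s powr (1 - \<mu>) * (2 * k + d s) powr \<mu>)"
    if s: "s \<in> {0..T}" for s
  proof (rule X_KF(2)[OF \<mu>(3)])
    fix \<tau> :: real assume \<tau>: "\<tau> > 0"
    let ?K = "KF \<tau> (sol x f s - sol x f t)"
    have K0: "?K \<ge> 0" and Kd: "?K \<le> d s" using \<tau> KF_nonneg KF_le_norm by (auto simp: d_def)
    have "?K \<le> KF \<tau> (sol x f s) + KF \<tau> (sol x f t)" using \<tau> by (intro KF_diff_le) auto
    also have "... \<le> 2 * k * min 1 (\<tau> powr \<theta>)" using KF_sol_le[OF x f b(2,1) s \<tau>, folded k_def] KF_sol_le[OF x f b(2,1) t \<tau>, folded k_def] by linarith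
    also have "... \<le> (2 * k + d s) * min 1 (\<tau> powr \<theta>)" by (intro mult_right_mono) (auto simp: d_def)
    finally have Kk: "?K \<le> (2 * k + d s) * min 1 (\<tau> powr \<theta>)" .
    have "?K = ?K powr (1 - \<mu>) * ?K powr \<mu>" using K0 by (simp flip: powr_add)
    also have "... \<le> d s powr (1 - \<mu>) * ((2 * k + d s) * min 1 (\<tau> powr \<theta>)) powr \<mu>" using K0 Kd Kk \<mu> by (intro mult_mono powr_mono2) auto
    also have "... = d s powr (1 - \<mu>) * (2 * k + d s) powr \<mu> * min 1 (\<tau> powr \<theta>) powr \<mu>" by (simp add: powr_mult)
    also have "min 1 (\<tau> powr \<theta>) powr \<mu> = min 1 (\<tau> powr (\<mu> * \<theta>))"
      using \<mu> powr_mono2[of \<mu> "\<tau> powr \<theta>" 1] powr_mono2[of \<mu> 1 "\<tau> powr \<theta>"] by (auto simp: min_def powr_powr mult.commute)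
    finally show "?K \<le> d s powr (1 - \<mu>) * (2 * k + d s) powr \<mu> * min 1 (\<tau> powr (\<mu> * \<theta>))" .
  qed auto
  have "(sol x f \<longlongrightarrow> sol x f t) (at t within {0..T})" using continuous_on_subset[OF sol_continuous[OF x f] subset_UNIV] t unfolding continuous_on by blast
  then have "(d \<longlongrightarrow> 0) (at t within {0..T})" unfolding d_def[abs_def] by (intro tendsto_norm_zero) (simp add: LIM_zero)
  then have "((\<lambda>s. interp_const (\<mu> * \<theta>) \<theta>' p * (d s powr (1 - \<mu>) * (2 * k + d s) powr \<mu>)) \<longlongrightarrow>
    interp_const (\<mu> * \<theta>) \<theta>' p * (0 powr (1 - \<mu>) * (2 * k + 0) powr \<mu>)) (at t within {0..T})"
    using \<mu> k by (intro tendsto_intros tendsto_powr2) (auto simp: d_ge)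
  then have lim: "((\<lambda>s. interp_const (\<mu> * \<theta>) \<theta>' p * (d s powr (1 - \<mu>) * (2 * k + d s) powr \<mu>)) \<longlongrightarrow> 0) (at t within {0..T})"
    by simp
  show ?thesis by (rule tendsto_sandwich[OF _ _ tendsto_const lim])
      (use bound Xn_nonneg in \<open>auto simp: eventually_at_filter\<close>)
qed

text \<open>Since F 0 = A and \<open>inv_A\<close> inverts - A, the bracket in \<open>nl\<close> is
  F at the solution minus F at 0, applied to \<open>inv_A (vsol x f t)\<close>.\<close>

lemma nl_le:
  assumes \<Lambda>: "lip R \<Lambda>" and "sol x f t \<in> X" "Xn (sol x f t) \<le> R"
  shows "norm (nl x f t) \<le> \<Lambda> * Xn (sol x f t) * norm (vsol x f t)"
proof -
  let ?u = "sol x f t" and ?v = "vsol x f t"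
  have "R \<ge> 0" using assms(3) Xn_nonneg order_trans by blast
  then have le: "norm (F ?u (inv_A ?v) - F 0 (inv_A ?v)) \<le> \<Lambda> * Xn (?u - 0) * norm (A (inv_A ?v))" using assms zero_X inv_A by (intro lipD[OF \<Lambda>]) auto
  moreover have "F ?u (inv_A ?v) - F 0 (inv_A ?v) = F ?u (inv_A ?v) + ?v" using F_0 inv_A by simp
  ultimately have "norm (F ?u (inv_A ?v) + ?v) \<le> \<Lambda> * Xn ?u * norm ?v" by (simp add: inv_A)
  then show ?thesis using order_trans[OF norm_ge_zero] by (auto simp: nl_def norm_scaleC indicator_def)
qed

lemma F_inv_A_diff: "y \<in> X ==> F y (inv_A (v - w)) = F y (inv_A v) - F y (inv_A w)"
proof -
  assume "y \<in> X"
  then have lin: "clinear_on D (F y)" using F_bounded unfolding bounded_operators_def by blast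
  have "F y (inv_A (v - w) + inv_A w) = F y (inv_A (v - w)) + F y (inv_A w)" using lin inv_A unfolding clinear_on_def by blast
  then show ?thesis by (simp add: inv_A_diff)
qed

text \<open>The map sending (t, v) to the bracket in \<open>nl\<close> is continuous on {0<..<T}
  times the space, by the Lipschitz condition and continuity of the solution into \<open>X\<close>.
  Composing it with the measurable \<open>vsol\<close> requires \<open>inv_A\<close> in place of the
  solution.\<close>

lemma nl_measurable:
  assumes f: "f \<in> L"
  shows "nl x f \<in> borel_measurable borel"
proof -
  obtain R where R: "R \<ge> 0" "\<And>t. t \<in> {0..T} ==> sol x f t \<in> X \<and> Xn (sol x f t) \<le> R" using sol_bounded[OF f] by blast
  obtain \<Lambda> where \<Lambda>: "lip R \<Lambda>" using lip_ex by blast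
  define P where "P z = F (sol x f (fst z)) (inv_A (snd z)) + snd z" for z :: "real \<times> 'a"
  define S where "S = {0<..<T} \<times> (UNIV :: 'a set)"
  have P_diff: "norm (P z - P y) \<le> \<Lambda> * Xn (sol x f (fst z) - sol x f (fst y)) * norm (snd z) + \<Lambda> * R * norm (snd z - snd y)"
    if "z \<in> S" "y \<in> S" for z y
  proof -
    obtain s v t w where zy: "z = (s, v)" "y = (t, w)" by (cases z; cases y)
    have st: "s \<in> {0..T}" "t \<in> {0..T}" using that by (auto simp: S_def zy)
    note Rs = R(2)[OF st(1)] and Rt = R(2)[OF st(2)]
    let ?a = "F (sol x f s) (inv_A v) - F (sol x f t) (inv_A v)"
    let ?b = "F (sol x f t) (inv_A (v - w)) - F 0 (inv_A (v - w))"
    have "P z - P y = ?a + ?b" using Rt F_0[of "inv_A (v - w)"] by (simp add: P_def zy F_inv_A_diff inv_A)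
    moreover have "norm ?a \<le> \<Lambda> * Xn (sol x f s - sol x f t) * norm (A (inv_A v))" using Rs Rt inv_A by (intro lipD[OF \<Lambda>]) auto
    moreover have "norm ?b \<le> \<Lambda> * Xn (sol x f t - 0) * norm (A (inv_A (v - w)))" using Rt R(1) inv_A zero_X by (intro lipD[OF \<Lambda>]) auto
    moreover have "\<Lambda> * Xn (sol x f t) * norm (v - w) \<le> \<Lambda> * R * norm (v - w)" using Rt lip_nonneg[OF \<Lambda>] by (intro mult_right_mono mult_left_mono) auto
    ultimately show ?thesis using norm_triangle_ineq[of ?a ?b] by (simp add: zy inv_A norm_minus_commute[of w v])
  qed
  have "continuous_on S P" unfolding continuous_on_def
  proof
    fix y assume y: "y \<in> S"
    have t: "fst y \<in> {0..T}" using y by (auto simp: S_def)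
    have X0: "((\<lambda>z. Xn (sol x f (fst z) - sol x f (fst y))) \<longlongrightarrow> 0) (at y within S)"
    proof -
      have "((\<lambda>s. Xn (sol x f s - sol x f (fst y))) \<longlongrightarrow> Xn (sol x f (fst y) - sol x f (fst y))) (at (fst y) within {0..T})"
        using sol_X_continuous[OF f t] zero_X by simp
      then have "continuous (at (fst y) within {0..T}) (\<lambda>s. Xn (sol x f s - sol x f (fst y)))" by (simp add: continuous_within)
      then have "continuous (at (fst y) within fst ` S) (\<lambda>s. Xn (sol x f s - sol x f (fst y)))" by (rule continuous_within_subset) (auto simp: S_def)
      then have "continuous (at y within S) ((\<lambda>s. Xn (sol x f s - sol x f (fst y))) \<circ> fst)" by (intro continuous_within_compose continuous_fst continuous_ident)
      then show ?thesis using zero_X by (simp add: continuous_within o_def)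
    qed
    have "((\<lambda>z. \<Lambda> * Xn (sol x f (fst z) - sol x f (fst y)) * norm (snd z) + \<Lambda> * R * norm (snd z - snd y))
      \<longlongrightarrow> \<Lambda> * 0 * norm (snd y) + \<Lambda> * R * norm (snd y - snd y)) (at y within S)" by (intro tendsto_intros X0 tendsto_ident_at)
    then have "((\<lambda>z. \<Lambda> * Xn (sol x f (fst z) - sol x f (fst y)) * norm (snd z) + \<Lambda> * R * norm (snd z - snd y)) \<longlongrightarrow> 0) (at y within S)"
      by simp
    then have "((\<lambda>z. P z - P y) \<longlongrightarrow> 0) (at y within S)"
      by (rule Lim_null_comparison[rotated]) (use P_diff y in \<open>auto simp: eventually_at_filter\<close>)
    then show "(P \<longlongrightarrow> P y) (at y within S)" by (simp add: LIM_zero_iff)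
  qed
  moreover have "S \<in> sets borel" unfolding S_def by (intro borel_open open_Times) auto
  ultimately have [measurable]: "(\<lambda>z. indicator S z *\<^sub>R P z) \<in> borel_measurable borel" by (intro borel_measurable_continuous_on_indicator)
  have [measurable]: "vsol x f \<in> borel_measurable borel" by (rule Lpb_measurable[OF vsol_L[OF x f]])
  have "(\<lambda>t. (t, vsol x f t)) \<in> borel_measurable borel" by measurable
  then have "(\<lambda>t. indicator S (t, vsol x f t) *\<^sub>R P (t, vsol x f t)) \<in> borel_measurable borel" by (rule measurable_compose) measurable
  then have "(\<lambda>t. \<i> *\<^sub>C (indicator S (t, vsol x f t) *\<^sub>R P (t, vsol x f t))) \<in> borel_measurable borel" by (rule borel_measurable_scaleC)
  moreover have "nl x f = (\<lambda>t. \<i> *\<^sub>C (indicator S (t, vsol x f t) *\<^sub>R P (t, vsol x f t)))"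
    using norm_scaleC[of \<i> "0::'a"] by (intro ext) (auto simp: nl_def P_def S_def indicator_def)
  ultimately show ?thesis by (simp only:)
qed

end

end

section \<open>Existence and uniqueness of fixed points for small initial values\<close>

context quasilinear_setting
begin

definition lip1 :: real where "lip1 = (SOME \<Lambda>. lip 1 \<Lambda>)"

lemma lip1: "lip 1 lip1" unfolding lip1_def by (rule someI_ex[OF lip_ex])

text \<open>The term 2 * xk keeps solutions in the unit ball of \<open>X\<close>, where
  \<open>lip1\<close> is valid. The factor 32 is 4 times 8: the difference estimate below has the
  factor 8, and a contraction by 1/4 is wanted.\<close>

definition radius :: real
  where "radius = 1 / (1 + 2 * xk + 32 * (lip1 * xk * (hom_const + top_const)))"

lemma radius: "radius > 0" "2 * xk * radius \<le> 1" "32 * (lip1 * xk * (hom_const + top_const)) * radius \<le> 1"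
proof -
  have a: "lip1 * xk * (hom_const + top_const) \<ge> 0" using lip_nonneg[OF lip1] xk_nonneg hom_const_pos top_const(1) by simp
  then have d: "1 + 2 * xk + 32 * (lip1 * xk * (hom_const + top_const)) > 0" using xk_nonneg by linarith
  show "radius > 0" "2 * xk * radius \<le> 1" "32 * (lip1 * xk * (hom_const + top_const)) * radius \<le> 1" using a d xk_nonneg unfolding radius_def by (simp_all add: divide_le_eq)
qed

context
  fixes x :: 'a
  assumes x: "x \<in> X_space A D \<alpha> p"
begin

text \<open>The difference splits into F at the two solutions applied to the second, and F at the
  first minus F 0 applied to the difference. The second term involves only the size of the first
  solution, so it may use a constant for a smaller ball; uniqueness depends on this.\<close>

lemma nl_diff:
  assumes "lip R \<Lambda>" "lip R' \<Lambda>'" "sol x f t \<in> X" "sol x g t \<in> X"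
    and "Xn (sol x f t) \<le> R" "Xn (sol x g t) \<le> R" "Xn (sol x f t) \<le> R'"
  shows "norm (nl x f t - nl x g t) \<le> \<Lambda> * Xn (sol x f t - sol x g t) * norm (vsol x g t) +
    \<Lambda>' * Xn (sol x f t) * norm (vsol x f t - vsol x g t)"
proof -
  let ?u = "sol x f t" and ?v = "vsol x f t" and ?w = "sol x g t" and ?z = "vsol x g t"
  let ?a = "F ?u (inv_A ?z) - F ?w (inv_A ?z)" and ?b = "F ?u (inv_A (?v - ?z)) - F 0 (inv_A (?v - ?z))"
  have "R' \<ge> 0" using assms(7) Xn_nonneg order_trans by blast
  then have b: "norm ?b \<le> \<Lambda>' * Xn (?u - 0) * norm (A (inv_A (?v - ?z)))" using assms zero_X inv_A by (intro lipD[OF assms(2)]) auto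
  have a: "norm ?a \<le> \<Lambda> * Xn (?u - ?w) * norm (A (inv_A ?z))" using assms inv_A by (intro lipD[OF assms(1)]) auto
  have "norm (nl x f t - nl x g t) \<le> norm (?a + ?b)"
  proof (cases "t \<in> {0<..<T}")
    case True
    have "nl x f t - nl x g t = \<i> *\<^sub>C ((F ?u (inv_A ?v) + ?v) - (F ?w (inv_A ?z) + ?z))"
      using True by (simp add: nl_def) (rule linear_diff[OF bounded_linear.linear[OF bounded_linear_scaleC_right], symmetric])
    also have "(F ?u (inv_A ?v) + ?v) - (F ?w (inv_A ?z) + ?z) = ?a + ?b" using F_0[of "inv_A (?v - ?z)"] by (simp add: F_inv_A_diff[OF x assms(3)] inv_A)
    finally show ?thesis by (simp add: norm_scaleC)
  qed (simp add: nl_def)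
  also have "... \<le> norm ?a + norm ?b" by (rule norm_triangle_ineq)
  finally show ?thesis using a b by (simp add: inv_A norm_minus_commute)
qed

lemma vsol_diff:
  assumes "f \<in> L" "g \<in> L"
  shows "AE t in lborel. vsol x f t - vsol x g t = Top (\<lambda>s. f s - g s) t" using Top_diff[OF assms] by eventually_elim (simp add: vsol_def)

lemma vsol_measurable: "f \<in> L ==> vsol x f \<in> borel_measurable borel" by (rule Lpb_measurable[OF vsol_L[OF x]])

context
  assumes small: "X_norm A D \<alpha> p x \<le> radius"
begin

lemma small_sol:
  assumes "f \<in> L" "Lp_le f radius" "t \<in> {0..T}"
  shows "sol x f t \<in> X" "Xn (sol x f t) \<le> 2 * xk * radius" "Xn (sol x f t) \<le> 1"
proof -
  have "Xn (sol x f t) \<le> xk * (X_norm A D \<alpha> p x + radius)" "sol x f t \<in> X" using sol_X[OF x assms(1,2) radius(1) assms(3)] by auto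
  moreover have "xk * (X_norm A D \<alpha> p x + radius) \<le> xk * (2 * radius)" using small xk_nonneg by (intro mult_left_mono) auto
  ultimately show "sol x f t \<in> X" "Xn (sol x f t) \<le> 2 * xk * radius" "Xn (sol x f t) \<le> 1" using radius(2) by auto
qed

lemma small_vsol:
  assumes "f \<in> L" "Lp_le f radius"
  shows "Lp_le (vsol x f) (2 * (hom_const + top_const) * radius)"
proof -
  have n: "X_norm A D \<alpha> p x \<ge> 0" by (simp add: X_norm_def interp_norm_def)
  have "Lp_le (hom x) (hom_const * X_norm A D \<alpha> p x)" unfolding Lp_le_def by (rule LpE_hom[OF x])
  then have "Lp_le (hom x) (hom_const * radius)" by (rule Lp_le_mono) (use n small hom_const_pos in \<open>auto intro: mult_left_mono\<close>)
  moreover have "Lp_le (Top f) (top_const * radius)" using assms radius(1) by (intro top_const) auto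
  ultimately have "Lp_le (vsol x f) (2 * (hom_const * radius + top_const * radius))"
    using hom_const_pos top_const(1) radius(1) Lpb_measurable[OF hom_L[OF x]] Top_measurable[OF assms(1)] by (intro Lp_le_add) (auto simp: vsol_def norm_triangle_ineq)
  then show ?thesis by (simp add: algebra_simps)
qed

lemma cut_T: "f \<in> L ==> g \<in> L ==> (\<lambda>s. indicator {..<T} s *\<^sub>R (f s - g s)) = (\<lambda>s. f s - g s)"
proof
  fix s assume "f \<in> L" "g \<in> L"
  then show "indicator {..<T} s *\<^sub>R (f s - g s) = f s - g s" using Lpb_zero[of f p T s] Lpb_zero[of g p T s] by (cases "s < T") auto
qed

text \<open>\<open>nl\<close> is quadratic near 0: the solution is bounded in \<open>X\<close> by a
  multiple of \<open>radius\<close>, and so is \<open>vsol\<close> in L^p, so a small radius makes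
  it a contraction of the ball.\<close>

lemma fixed_point_exists: "\<exists>f\<in>L. Lp_le f radius \<and> (AE t in lborel. nl x f t = f t)"
proof (rule picard[OF radius(1)])
  have l: "lip1 \<ge> 0" "lip1 * xk \<ge> 0" using lip_nonneg[OF lip1] xk_nonneg by auto
  have r: "radius \<ge> 0" and V: "2 * (hom_const + top_const) * radius \<ge> 0" using radius(1) hom_const_pos top_const(1) by auto
  fix f assume f: "f \<in> L" "Lp_le f radius"
  have [measurable]: "vsol x f \<in> borel_measurable borel" by (rule vsol_measurable[OF f(1)])
  have "Lp_le (nl x f) (2 * (lip1 * xk) * radius * (2 * (hom_const + top_const) * radius))"
  proof (rule Lp_le_scale[OF _ small_vsol[OF f] V])
    show "AE t in lborel. norm (nl x f t) \<le> 2 * (lip1 * xk) * radius * norm (vsol x f t)"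
    proof (rule AE_I2)
      fix t
      show "norm (nl x f t) \<le> 2 * (lip1 * xk) * radius * norm (vsol x f t)"
      proof (cases "t \<in> {0<..<T}")
        case True
        then have t: "t \<in> {0..T}" by auto
        have "norm (nl x f t) \<le> lip1 * Xn (sol x f t) * norm (vsol x f t)" by (rule nl_le[OF x lip1]) (use small_sol[OF f t] in auto)
        also have "... \<le> lip1 * (2 * xk * radius) * norm (vsol x f t)" using small_sol[OF f t] l by (intro mult_right_mono mult_left_mono) auto
        finally show ?thesis by (simp add: mult_ac)
      qed (use l r in \<open>simp add: nl_def\<close>)
    qed
  qed (use l r in auto)
  then have le: "Lp_le (nl x f) radius"
  proof (rule Lp_le_mono)
    show "0 \<le> 2 * (lip1 * xk) * radius * (2 * (hom_const + top_const) * radius)" using l r V by simp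
    have "(32 * (lip1 * xk * (hom_const + top_const)) * radius) * radius \<le> 1 * radius" using radius by (intro mult_right_mono) auto
    moreover have "0 \<le> (lip1 * xk * (hom_const + top_const)) * radius * radius" using l r hom_const_pos top_const(1) by simp
    moreover have "2 * (lip1 * xk) * radius * (2 * (hom_const + top_const) * radius) =
      4 * ((lip1 * xk * (hom_const + top_const)) * radius * radius)" by (simp add: algebra_simps)
    ultimately show "2 * (lip1 * xk) * radius * (2 * (hom_const + top_const) * radius) \<le> radius" by linarith
  qed
  then have "LpE p (nl x f) < top" unfolding Lp_le_def by (rule le_less_trans) simp
  then show "nl x f \<in> L \<and> Lp_le (nl x f) radius" using le nl_measurable[OF x f(1)] by (simp add: Lpb_def nl_def[of x f])
  fix g b assume g: "g \<in> L" "Lp_le g radius" and b: "b > 0" "Lp_le (\<lambda>t. f t - g t) b"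
  have d: "(\<lambda>t. f t - g t) \<in> L" by (intro L_diff f g)
  have "Lp_le (\<lambda>t. nl x f t - nl x g t) (2 * (lip1 * xk * b * (2 * (hom_const + top_const) * radius) +
    2 * (lip1 * xk) * radius * (top_const * b)))"
  proof (rule Lp_le_add)
    show "Lp_le (\<lambda>t. (lip1 * xk * b) *\<^sub>R vsol x g t) (lip1 * xk * b * (2 * (hom_const + top_const) * radius))"
      using l b V by (intro Lp_le_scale[OF vsol_measurable[OF g(1)] small_vsol[OF g]]) auto
    show "Lp_le (\<lambda>t. (2 * (lip1 * xk) * radius) *\<^sub>R Top (\<lambda>t. f t - g t) t) (2 * (lip1 * xk) * radius * (top_const * b))" using l b r top_const(1)
      by (intro Lp_le_scale[OF Top_measurable[OF d] top_const(2)[OF d _ b(2)]]) auto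
    show "AE t in lborel. norm (nl x f t - nl x g t) \<le> norm ((lip1 * xk * b) *\<^sub>R vsol x g t) +
      norm ((2 * (lip1 * xk) * radius) *\<^sub>R Top (\<lambda>t. f t - g t) t)" using vsol_diff[OF f(1) g(1)]
    proof eventually_elim
      case (elim t)
      show ?case
      proof (cases "t \<in> {0<..<T}")
        case True
        then have t: "t \<in> {0..T}" "t \<le> T" by auto
        note sf = small_sol[OF f t(1)] and sg = small_sol[OF g t(1)]
        have "Xn (sol x f t - sol x g t) \<le> xk * b" using b(2) t by (intro sol_diff_X[OF x f(1) g(1) b(1)]) (simp_all only: cut_T[OF f(1) g(1)])
        then have "lip1 * Xn (sol x f t - sol x g t) * norm (vsol x g t) \<le> lip1 * (xk * b) * norm (vsol x g t)" using l by (intro mult_right_mono mult_left_mono) auto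
        moreover have "lip1 * Xn (sol x f t) * norm (vsol x f t - vsol x g t) \<le> lip1 * (2 * xk * radius) * norm (vsol x f t - vsol x g t)"
          using l sf by (intro mult_right_mono mult_left_mono) auto
        ultimately show ?thesis using nl_diff[OF lip1 lip1 sf(1) sg(1) sf(3) sg(3) sf(3)] l b r xk_nonneg by (simp add: elim abs_mult mult_ac)
      qed (simp add: nl_def)
    qed
    show "(\<lambda>t. (lip1 * xk * b) *\<^sub>R vsol x g t) \<in> borel_measurable borel"
      "(\<lambda>t. (2 * (lip1 * xk) * radius) *\<^sub>R Top (\<lambda>t. f t - g t) t) \<in> borel_measurable borel"
      using vsol_measurable[OF g(1)] Top_measurable[OF d] by (simp_all add: borel_measurable_scaleR)
  qed (use l b r V top_const(1) in auto)
  then show "Lp_le (\<lambda>t. nl x f t - nl x g t) (b / 4)"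
  proof (rule Lp_le_mono)
    have "lip1 * xk * top_const \<le> lip1 * xk * (hom_const + top_const)" using l hom_const_pos by (intro mult_left_mono) auto
    then have "b * radius * (lip1 * xk * top_const) \<le> b * radius * (lip1 * xk * (hom_const + top_const))" by (rule mult_left_mono) (use b r in auto)
    moreover have "b * (32 * (lip1 * xk * (hom_const + top_const)) * radius) \<le> b * 1" using radius(3) b by (intro mult_left_mono) auto
    ultimately show "2 * (lip1 * xk * b * (2 * (hom_const + top_const) * radius) +
      2 * (lip1 * xk) * radius * (top_const * b)) \<le> b / 4" by (simp add: algebra_simps)
  qed (use l b r xk_nonneg hom_const_pos top_const(1) in \<open>auto intro!: add_nonneg_nonneg mult_nonneg_nonneg\<close>)
qed

text \<open>By causality; the end point t = \<sigma> is included since the values are given by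
  integrals over earlier times.\<close>

lemma sol_eq_before:
  assumes fg: "f \<in> L" "g \<in> L" and h: "AE s in lborel. s < \<sigma> --> f s = g s" and t: "t \<le> \<sigma>"
  shows "sol x f t = sol x g t"
proof -
  define h where "h s = indicator {..<\<sigma>} s *\<^sub>R (f s - g s)" for s
  have hL: "h \<in> L" unfolding h_def[abs_def] by (intro L_cut L_diff fg)
  have h0: "AE s in lborel. h s = 0" using assms(3) by eventually_elim (auto simp: h_def)
  have T0: "Top h s = 0" for s using Top_cong_AE[OF hL zero_L h0, of s] by (simp add: Top_def vcoef_def conv_def)
  have "J (resid h) t = J (\<lambda>s. 0) t"
  proof (rule fint_cong_AE[OF L_Top[OF hL] zero_L])
    show "AE s in lborel. h s - \<i> *\<^sub>C Top h s = 0" using h0 by eventually_elim (use norm_scaleC[of \<i> "0::'a"] in \<open>simp add: T0\<close>)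
  qed
  then show ?thesis using sol_diff[OF x fg t] by (simp add: h_def[abs_def] fint_def)
qed

text \<open>The coincidence set is extended beyond \<open>\<sigma>\<close> by an interval on which the \<open>L^p\<close>-norm of
  \<open>vsol x g\<close> is small; the smallness of \<open>sol x f\<close> takes care of the other term.\<close>

lemma fixed_point_extend:
  assumes f: "f \<in> L" "Lp_le f radius" "AE t in lborel. nl x f t = f t"
    and g: "g \<in> L" "AE t in lborel. nl x g t = g t"
    and \<sigma>: "AE s in lborel. s < \<sigma> --> f s = g s" and \<tau>: "\<tau> \<le> T"
    and R: "lip R \<Lambda>" "R \<ge> 1" "\<And>t. t \<in> {0..T} ==> sol x g t \<in> X \<and> Xn (sol x g t) \<le> R"
    and \<eta>: "Lp_le (\<lambda>t. indicator {\<sigma>..<\<tau>} t *\<^sub>R vsol x g t) (1 / (8 * (1 + \<Lambda> * xk)))"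
  shows "AE s in lborel. s < \<tau> --> f s = g s"
proof -
  define h where "h s = indicator {..<\<tau>} s *\<^sub>R (f s - g s)" for s
  define w where "w t = indicator {\<sigma>..<\<tau>} t *\<^sub>R vsol x g t" for t
  define \<eta>' where "\<eta>' = 1 / (8 * (1 + \<Lambda> * xk))"
  have l: "lip1 \<ge> 0" "lip1 * xk \<ge> 0" "\<Lambda> \<ge> 0" "\<Lambda> * xk \<ge> 0" "radius \<ge> 0" using lip_nonneg[OF lip1] lip_nonneg[OF R(1)] xk_nonneg radius(1) by auto
  have \<eta>'0: "\<eta>' \<ge> 0" using l by (simp add: \<eta>'_def)
  have hL: "h \<in> L" unfolding h_def[abs_def] by (intro L_cut L_diff f g)
  have [measurable]: "vsol x g \<in> borel_measurable borel" "Top h \<in> borel_measurable borel" using vsol_measurable[OF g(1)] Top_measurable[OF hL] by auto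
  have w: "w \<in> borel_measurable borel" unfolding w_def[abs_def] by measurable
  have w\<eta>: "Lp_le w \<eta>'" using \<eta> unfolding w_def[abs_def] \<eta>'_def .
  \<comment> \<open>Any bound of \<open>h\<close> can be halved, so \<open>h\<close> vanishes: the
    small interval contributes b/4 and the small solution at most b/8.\<close>
  have step: "Lp_le h (b / 2)" if b: "b > 0" "Lp_le h b" for b
  proof -
    have "Lp_le h (2 * (\<Lambda> * xk * b * \<eta>' + 2 * (lip1 * xk) * radius * (top_const * b)))"
    proof (rule Lp_le_add)
      show "Lp_le (\<lambda>t. (\<Lambda> * xk * b) *\<^sub>R w t) (\<Lambda> * xk * b * \<eta>')" using l b \<eta>'0 by (intro Lp_le_scale[OF w w\<eta>]) auto
      show "Lp_le (\<lambda>t. (2 * (lip1 * xk) * radius) *\<^sub>R Top h t) (2 * (lip1 * xk) * radius * (top_const * b))"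
        using l b top_const(1) by (intro Lp_le_scale[OF Top_measurable[OF hL] top_const(2)[OF hL _ b(2)]]) auto
      show "AE t in lborel. norm (h t) \<le> norm ((\<Lambda> * xk * b) *\<^sub>R w t) + norm ((2 * (lip1 * xk) * radius) *\<^sub>R Top h t)"
        using vsol_diff[OF f(1) g(1)] f(3) g(2)
      proof eventually_elim
        case (elim t)
        show ?case
        proof (cases "t \<in> {0<..<\<tau>}")
          case True
          then have t: "t \<in> {0..T}" "t \<le> \<tau>" using \<tau> by auto
          note sf = small_sol[OF f(1,2) t(1)] and sg = R(3)[OF t(1)]
          \<comment> \<open>Before \<open>\<sigma>\<close> the two solutions coincide and the left
            side is 0; afterwards \<open>vsol x g\<close> is \<open>w\<close>, which is small in
            L^p.\<close>
          have "Xn (sol x f t - sol x g t) * norm (vsol x g t) \<le> xk * b * norm (w t)"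
          proof (cases "t < \<sigma>")
            case True
            then show ?thesis using sol_eq_before[OF f(1) g(1) \<sigma>, of t] zero_X xk_nonneg b by simp
          next
            case False
            then have "w t = vsol x g t" using \<open>t \<in> {0<..<\<tau>}\<close> by (simp add: w_def)
            then show ?thesis using sol_diff_X[OF x f(1) g(1) b(1) b(2)[unfolded h_def[abs_def]] t] by (simp add: mult_right_mono)
          qed
          then have "\<Lambda> * (Xn (sol x f t - sol x g t) * norm (vsol x g t)) \<le> \<Lambda> * (xk * b * norm (w t))" using l by (intro mult_left_mono) auto
          moreover have "lip1 * Xn (sol x f t) * norm (vsol x f t - vsol x g t) \<le> lip1 * (2 * xk * radius) * norm (vsol x f t - vsol x g t)"
            using l sf by (intro mult_right_mono mult_left_mono) auto
          moreover have "vsol x f t - vsol x g t = Top h t" using elim(1) Top_causal[OF t(2), of "\<lambda>s. f s - g s"] by (simp add: h_def[abs_def])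
          moreover have "norm (h t) = norm (nl x f t - nl x g t)" using True elim(2,3) by (simp add: h_def)
          moreover have "norm (nl x f t - nl x g t) \<le> \<Lambda> * Xn (sol x f t - sol x g t) * norm (vsol x g t) +
              lip1 * Xn (sol x f t) * norm (vsol x f t - vsol x g t)" using sf sg R(2) by (intro nl_diff[OF R(1) lip1]) auto
          ultimately show ?thesis using l b xk_nonneg by (simp add: abs_mult mult_ac)
        next
          case False
          then have "h t = 0" using Lpb_zero[OF f(1), of t] Lpb_zero[OF g(1), of t] by (auto simp: h_def)
          then show ?thesis by simp
        qed
      qed
      show "(\<lambda>t. (\<Lambda> * xk * b) *\<^sub>R w t) \<in> borel_measurable borel"
        "(\<lambda>t. (2 * (lip1 * xk) * radius) *\<^sub>R Top h t) \<in> borel_measurable borel" using w by (simp_all add: borel_measurable_scaleR)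
    qed (use l b top_const(1) \<eta>'0 in auto)
    then show ?thesis
    proof (rule Lp_le_mono)
      have "\<Lambda> * xk * \<eta>' \<le> 1 / 8" using l by (simp add: \<eta>'_def divide_le_eq)
      then have "b * (\<Lambda> * xk * \<eta>') \<le> b * (1 / 8)" using b by (intro mult_left_mono) auto
      moreover have "lip1 * xk * top_const \<le> lip1 * xk * (hom_const + top_const)" using l hom_const_pos by (intro mult_left_mono) auto
      then have "b * radius * (lip1 * xk * top_const) \<le> b * radius * (lip1 * xk * (hom_const + top_const))" by (rule mult_left_mono) (use b l in auto)
      moreover have "b * (32 * (lip1 * xk * (hom_const + top_const)) * radius) \<le> b * 1" using radius(3) b by (intro mult_left_mono) auto
      moreover have "b * (32 * (lip1 * xk * (hom_const + top_const)) * radius) =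
        32 * (b * radius * (lip1 * xk * (hom_const + top_const)))" by (simp only: mult_ac)
      moreover have "2 * (\<Lambda> * xk * b * \<eta>' + 2 * (lip1 * xk) * radius * (top_const * b)) =
        2 * (b * (\<Lambda> * xk * \<eta>')) + 4 * (b * radius * (lip1 * xk * top_const))" by (simp add: algebra_simps)
      ultimately show "2 * (\<Lambda> * xk * b * \<eta>' + 2 * (lip1 * xk) * radius * (top_const * b)) \<le> b / 2" using b(1) by linarith
    qed (use l b xk_nonneg top_const(1) \<eta>'0 in \<open>auto intro!: add_nonneg_nonneg mult_nonneg_nonneg\<close>)
  qed
  obtain b where b: "b > 0" "Lp_le h b" using Lp_le_ex[OF hL] .
  have "Lp_le h (b / 2 ^ k)" for k
  proof (induction k)
    case (Suc k)
    then show ?case using step[of "b / 2 ^ k"] b by (simp add: mult.commute)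
  qed (use b in simp)
  then have "AE t in lborel. h t = 0" using b by (intro Lp_le_all_zero[OF Lpb_measurable[OF hL], of b]) auto
  then show ?thesis by eventually_elim (auto simp: h_def)
qed

text \<open>Only \<open>f\<close> is assumed to be small. The supremum of the times up to which f =
  g holds can be exceeded as long as it is below \<open>T\<close>, because the L^p norm of
  \<open>vsol x g\<close> over short intervals tends to 0.\<close>

lemma fixed_point_unique:
  assumes f: "f \<in> L" "Lp_le f radius" "AE t in lborel. nl x f t = f t"
    and g: "g \<in> L" "AE t in lborel. nl x g t = g t"
  shows "AE s in lborel. s < T --> f s = g s"
proof -
  obtain R0 where R0: "R0 \<ge> 0" "\<And>t. t \<in> {0..T} ==> sol x g t \<in> X \<and> Xn (sol x g t) \<le> R0" using sol_bounded[OF x g(1)] by blast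
  define R where "R = R0 + 1"
  have "R \<ge> 1" using R0(1) by (simp add: R_def)
  have R: "sol x g t \<in> X \<and> Xn (sol x g t) \<le> R" if "t \<in> {0..T}" for t using R0(2)[OF that] by (auto simp: R_def)
  obtain \<Lambda> where \<Lambda>: "lip R \<Lambda>" using lip_ex by blast
  define \<eta> where "\<eta> = 1 / (8 * (1 + \<Lambda> * xk))"
  have \<eta>: "\<eta> > 0" using lip_nonneg[OF \<Lambda>] xk_nonneg by (auto simp: \<eta>_def intro!: mult_pos_pos add_pos_nonneg)
  define G where "G = {\<sigma>\<in>{0..T}. AE s in lborel. s < \<sigma> --> f s = g s}"
  have "0 \<in> G" using Lpb_zero[OF f(1)] Lpb_zero[OF g(1)] T by (auto simp: G_def intro!: AE_I2)
  then have G: "G \<noteq> {}" "bdd_above G" by (auto simp: G_def intro: bdd_aboveI[of _ T])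
  define \<sigma> where "\<sigma> = Sup G"
  have \<sigma>T: "0 \<le> \<sigma>" "\<sigma> \<le> T" using cSup_upper[OF \<open>0 \<in> G\<close> G(2)] G(1) by (auto simp: \<sigma>_def G_def intro!: cSup_least)
  \<comment> \<open>Countably many null sets suffice to pass to the supremum, which therefore
    belongs to \<open>G\<close> itself.\<close>
  have \<sigma>: "AE s in lborel. s < \<sigma> --> f s = g s"
  proof -
    have "\<exists>\<rho>\<in>G. \<sigma> - 1 / real (Suc n) < \<rho>" for n unfolding \<sigma>_def using less_cSup_iff[OF G, of "Sup G - 1 / real (Suc n)"] by simp
    then obtain \<rho> where \<rho>: "\<And>n. \<rho> n \<in> G" "\<And>n. \<sigma> - 1 / real (Suc n) < \<rho> n" by metis
    have "AE s in lborel. \<forall>n. s < \<rho> n --> f s = g s" unfolding AE_all_countable using \<rho>(1) by (simp add: G_def)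
    then show ?thesis
    proof eventually_elim
      case (elim s)
      show ?case
      proof
        assume "s < \<sigma>"
        then obtain n where "1 / real (Suc n) < \<sigma> - s" using nat_approx_posE[of "\<sigma> - s"] by auto
        then have "s < \<rho> n" using \<rho>(2)[of n] by linarith
        then show "f s = g s" using elim by blast
      qed
    qed
  qed
  have "\<sigma> = T"
  proof (rule ccontr)
    assume "\<sigma> \<noteq> T"
    then have \<sigma>_less: "\<sigma> < T" using \<sigma>T by simp
    have [measurable]: "vsol x g \<in> borel_measurable borel" by (rule vsol_measurable[OF g(1)])
    have "LpE p (vsol x g) < top" by (rule Lpb_finite[OF vsol_L[OF x g(1)]])
    then have lim: "(\<lambda>n. (\<integral>t. indicator {\<sigma>..<\<sigma> + 1 / real (Suc n)} t * ennreal (norm (vsol x g t) powr p)))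
      \<longlonglongrightarrow> (\<integral>\<^sup>+t. 0 \<partial>(lborel :: real measure))"
    proof (intro nn_integral_dominated_convergence[where w="\<lambda>t. ennreal (norm (vsol x g t) powr p)"])
      show "AE t in lborel. (\<lambda>n. indicator {\<sigma>..<\<sigma> + 1 / real (Suc n)} t * ennreal (norm (vsol x g t) powr p)) \<longlonglongrightarrow> 0"
        using AE_lborel_singleton[of \<sigma>]
      proof eventually_elim
        case (elim t)
        have "\<forall>\<^sub>F n in sequentially. t \<notin> {\<sigma>..<\<sigma> + 1 / real (Suc n)}"
        proof (cases "t > \<sigma>")
          case True
          then have "\<forall>\<^sub>F n in sequentially. 1 / real (Suc n) < t - \<sigma>" using order_tendstoD(2)[OF LIMSEQ_Suc[OF lim_1_over_n], of "t - \<sigma>"] by simp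
          then show ?thesis by eventually_elim auto
        qed (use elim in auto)
        then show ?case by (intro tendsto_eventually) (auto elim: eventually_mono)
      qed
    qed (auto simp: LpE_def indicator_def)
    moreover have "ennreal (\<eta> powr p) > 0" using \<eta> by simp
    ultimately have "\<forall>\<^sub>F n in sequentially. (\<integral>t. indicator {\<sigma>..<\<sigma> + 1 / real (Suc n)} t * ennreal (norm (vsol x g t) powr p)) < ennreal (\<eta> powr p)"
      by (intro order_tendstoD(2)[OF lim]) simp
    then obtain n where n: "(\<integral>t. indicator {\<sigma>..<\<sigma> + 1 / real (Suc n)} t * ennreal (norm (vsol x g t) powr p)) < ennreal (\<eta> powr p)"
      unfolding eventually_sequentially by blast
    define \<tau> where "\<tau> = min T (\<sigma> + 1 / real (Suc n))"
    have \<tau>: "\<sigma> < \<tau>" "\<tau> \<le> T" using \<sigma>_less by (auto simp: \<tau>_def)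
    have "LpE p (\<lambda>t. indicator {\<sigma>..<\<tau>} t *\<^sub>R vsol x g t) \<le>
      (\<integral>t. indicator {\<sigma>..<\<sigma> + 1 / real (Suc n)} t * ennreal (norm (vsol x g t) powr p))"
      unfolding LpE_def using p_pos by (intro nn_integral_mono) (auto simp: indicator_def \<tau>_def)
    then have "Lp_le (\<lambda>t. indicator {\<sigma>..<\<tau>} t *\<^sub>R vsol x g t) \<eta>" using n unfolding Lp_le_def by order
    then have "\<tau> \<in> G" using fixed_point_extend[OF f g \<sigma> \<tau>(2) \<Lambda> \<open>R \<ge> 1\<close> R] \<tau> \<sigma>T by (simp add: G_def \<eta>_def)
    then show False using cSup_upper[OF _ G(2), of \<tau>] \<tau>(1) by (simp add: \<sigma>_def)
  qed
  then show ?thesis using \<sigma> by simp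
qed

end

end

end

section \<open>Lebesgue representatives and the theorem\<close>

lemma AE_lebesgue_on_interval:
  "(AE t in lebesgue_on {0<..<T::real}. P t) \<longleftrightarrow> (AE t\<in>{0<..<T} in lborel. P t)" by (subst AE_restrict_space_iff) (simp_all add: AE_completion_iff)

text \<open>Approximating simple functions are changed on null sets to Borel ones; the limit of the
  latter is Borel and agrees almost everywhere.\<close>

lemma lebesgue_borel_representative:
  fixes g :: "real => 'b::{banach, second_countable_topology}"
  assumes "g \<in> borel_measurable lebesgue"
  shows "\<exists>h\<in>borel_measurable borel. AE t in lborel. g t = h t"
proof -
  obtain s where s: "\<And>i. simple_function lebesgue (s i)" "\<And>x. (\<lambda>i. s i x) \<longlonglongrightarrow> g x"
    using borel_measurable_implies_sequence_metric[OF assms, of 0] by auto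
  have "\<exists>s'. simple_function lborel s' \<and> (AE x in lborel. s i x = s' x)" for i by (rule completion_ex_simple_function[OF s(1)])
  then obtain s' where s': "\<And>i. simple_function lborel (s' i)" "\<And>i. AE x in lborel. s i x = s' i x" by metis
  have [measurable]: "s' i \<in> borel_measurable borel" for i using borel_measurable_simple_function[OF s'(1)] by simp
  have "AE x in lborel. \<forall>i. s i x = s' i x" using s'(2) by (simp add: AE_all_countable)
  then have "AE x in lborel. g x = lim (\<lambda>i. s' i x)"
  proof eventually_elim
    case (elim x)
    then have "(\<lambda>i. s i x) = (\<lambda>i. s' i x)" by auto
    then show ?case using limI[OF s(2)[of x]] by simp
  qed
  moreover have "(\<lambda>x. lim (\<lambda>i. s' i x)) \<in> borel_measurable borel" by measurable
  ultimately show ?thesis by (rule bexI)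
qed

text \<open>Passage between the Lebesgue measurable functions of the statement and the Borel
  representatives, extended by zero, of the proof.\<close>

lemma Lp_space_iff:
  fixes v :: "real => 'a::{complex_hilbert, second_countable_topology}"
  assumes p: "p > 0"
  shows "v \<in> Lp_space p T \<longleftrightarrow> (\<exists>f\<in>Lpb p T. AE t\<in>{0<..<T} in lborel. v t = f t)"
proof -
  define w where "w t = indicator {0<..<T} t *\<^sub>R v t" for t
  have S: "{0<..<T} \<inter> space lebesgue \<in> sets lebesgue" by simp
  have eq: "indicator {0<..<T} t *\<^sub>R norm (v t) powr p = norm (w t) powr p" for t using p by (auto simp: w_def indicator_def)
  have iff: "v \<in> Lp_space p T \<longleftrightarrow> w \<in> borel_measurable lebesgue \<and> integrable lebesgue (\<lambda>t. norm (w t) powr p)"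
    unfolding Lp_space_def mem_Collect_eq borel_measurable_restrict_space_iff[OF S] integrable_restrict_space[OF S] eq w_def ..
  have E: "LpE p f = (\<integral>\<^sup>+t. ennreal (norm (norm (w t) powr p)) \<partial>lebesgue)" if "AE t in lborel. w t = f t" for f unfolding LpE_def nn_integral_completion
    by (rule nn_integral_cong_AE, use that in eventually_elim) simp
  show ?thesis
  proof
    assume "v \<in> Lp_space p T"
    then have w: "w \<in> borel_measurable lebesgue" "integrable lebesgue (\<lambda>t. norm (w t) powr p)" by (auto simp: iff)
    obtain h where h: "h \<in> borel_measurable borel" "AE t in lborel. w t = h t" using lebesgue_borel_representative[OF w(1)] by blast
    define f where "f t = indicator {0<..<T} t *\<^sub>R h t" for t
    have ae: "AE t in lborel. w t = f t" using h(2) by eventually_elim (auto simp: f_def w_def indicator_def)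
    have "LpE p f < top" using w(2) unfolding E[OF ae] integrable_iff_bounded by simp
    moreover have "f \<in> borel_measurable borel" unfolding f_def using h(1) by measurable
    ultimately have "f \<in> Lpb p T" by (auto simp: Lpb_def f_def)
    moreover have "AE t\<in>{0<..<T} in lborel. v t = f t" using ae by eventually_elim (auto simp: w_def)
    ultimately show "\<exists>f\<in>Lpb p T. AE t\<in>{0<..<T} in lborel. v t = f t" by (intro bexI[of _ f])
  next
    assume "\<exists>f\<in>Lpb p T. AE t\<in>{0<..<T} in lborel. v t = f t"
    then obtain f where f: "f \<in> Lpb p T" "AE t\<in>{0<..<T} in lborel. v t = f t" by blast
    have ae: "AE t in lborel. w t = f t" using f(2) by eventually_elim (use Lpb_zero[OF f(1)] in \<open>auto simp: w_def indicator_def\<close>)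
    have fm: "f \<in> borel_measurable lebesgue" using Lpb_measurable[OF f(1)] by (intro measurable_completion) simp
    have w: "w \<in> borel_measurable lebesgue"
    proof (rule measurableI)
      fix U :: "'a set" assume U: "U \<in> sets borel"
      show "w -` U \<inter> space lebesgue \<in> sets lebesgue"
      proof (rule completion.in_sets_AE)
        show "f -` U \<inter> space lebesgue \<in> sets lebesgue" by (rule measurable_sets[OF fm U])
        show "AE t in lebesgue. t \<in> f -` U \<inter> space lebesgue \<longleftrightarrow> t \<in> w -` U \<inter> space lebesgue"
          unfolding AE_completion_iff using ae by eventually_elim simp
      qed simp
    qed simp
    moreover have "integrable lebesgue (\<lambda>t. norm (w t) powr p)"
    proof (rule integrableI_bounded)
      show "(\<integral>\<^sup>+t. ennreal (norm (norm (w t) powr p)) \<partial>lebesgue) < \<infinity>" using Lpb_finite[OF f(1)] unfolding E[OF ae, symmetric] by simp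
    qed (use w in measurable)
    ultimately show "v \<in> Lp_space p T" by (simp add: iff)
  qed
qed

context mr_setting
begin

lemma frac_integral_eq:
  assumes v: "v \<in> Lp_space p T" and f: "f \<in> L" and ae: "AE t\<in>{0<..<T} in lborel. v t = f t" and t: "t \<le> T"
  shows "frac_integral \<alpha> v t = J f t"
proof -
  have [measurable]: "f \<in> borel_measurable borel" by (rule Lpb_measurable[OF f])
  have v_meas: "(\<lambda>s. indicator {0<..<T} s *\<^sub>R v s) \<in> borel_measurable lebesgue" using v by (simp add: Lp_space_def borel_measurable_restrict_space_iff)
  have "(LINT s:{0<..<t}|lebesgue. (t - s) powr (\<alpha> - 1) *\<^sub>R v s) =
    (LINT s|lebesgue. (indicator {0<..<t} s * (t - s) powr (\<alpha> - 1)) *\<^sub>R f s)" unfolding set_lebesgue_integral_def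
  proof (rule integral_cong_AE)
    have "(\<lambda>s. indicator {0<..<t} s * (t - s) powr (\<alpha> - 1)) \<in> borel_measurable lebesgue" by (rule measurable_completion) measurable
    from borel_measurable_scaleR[OF this v_meas]
    show "(\<lambda>s. indicator {0<..<t} s *\<^sub>R (t - s) powr (\<alpha> - 1) *\<^sub>R v s) \<in> borel_measurable lebesgue"
      by (rule measurable_cong[THEN iffD1, rotated]) (use t in \<open>auto simp: indicator_def\<close>)
    show "(\<lambda>s. (indicator {0<..<t} s * (t - s) powr (\<alpha> - 1)) *\<^sub>R f s) \<in> borel_measurable lebesgue" by (rule measurable_completion) measurable
    show "AE s in lebesgue. indicator {0<..<t} s *\<^sub>R (t - s) powr (\<alpha> - 1) *\<^sub>R v s =
      (indicator {0<..<t} s * (t - s) powr (\<alpha> - 1)) *\<^sub>R f s" unfolding AE_completion_iff using ae by eventually_elim (use t in \<open>auto simp: indicator_def\<close>)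
  qed
  also have "... = (LINT s|lborel. (indicator {0<..<t} s * (t - s) powr (\<alpha> - 1)) *\<^sub>R f s)" by (rule integral_completion) measurable
  finally have "frac_integral \<alpha> v t = (LINT s|lborel. (1 / Gamma \<alpha>) *\<^sub>R (indicator {0<..<t} s * (t - s) powr (\<alpha> - 1)) *\<^sub>R f s)"
    by (simp only: frac_integral_def integral_scaleR_right)
  also have "... = J f t" unfolding fint_def
  proof (intro Bochner_Integration.integral_cong refl)
    fix s
    show "(1 / Gamma \<alpha>) *\<^sub>R (indicator {0<..<t} s * (t - s) powr (\<alpha> - 1)) *\<^sub>R f s = frac_kernel \<alpha> (t - s) *\<^sub>R f s"
      using Lpb_zero[OF f, of s] by (cases "s \<le> 0") (auto simp: frac_kernel_def indicator_def)
  qed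
  finally show ?thesis .
qed

text \<open>Coordinatewise from \<open>conv_cfrac_injective\<close>; countably many coordinates
  leave a null set.\<close>

lemma fint_injective:
  assumes f: "f \<in> L" and g: "g \<in> L" and eq: "AE t\<in>{0<..<T} in lborel. J f t = J g t"
  shows "AE t in lborel. f t = g t"
proof -
  define h where "h t = f t - g t" for t
  have h: "h \<in> L" unfolding h_def[abs_def] by (intro L_diff f g)
  have "AE t in lborel. coeff (h t) n = 0" for n
  proof (rule conv_cfrac_injective[OF \<alpha> coeff_class[OF h] Lpb_integrable[OF Lpb_coeff[OF h]], where T=T])
    show "AE t in lborel. t < T --> conv (cfrac \<alpha>) (\<lambda>s. coeff (h s) n) t = 0" using eq
    proof eventually_elim
      case (elim t)
      have "J h t = J f t - J g t" unfolding h_def[abs_def] by (rule fint_diff[OF f g])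
      then have "t < T ==> J h t = 0" using elim fint_zero[OF h, of t] by (cases "t > 0") auto
      then show ?case by (simp add: coeff_fint[OF h, symmetric])
    qed
  qed (use p_gt_1 Lpb_zero[OF h] in auto)
  then have "AE t in lborel. \<forall>n. coeff (h t) n = 0" by (simp add: AE_all_countable)
  then show ?thesis by eventually_elim (use e_total[of "h t" for t] in \<open>simp add: h_def\<close>)
qed

text \<open>Injectivity of the fractional integral makes the choice in \<open>frac_deriv\<close>
  immaterial up to null sets.\<close>

lemma frac_deriv_eq:
  assumes g: "g \<in> L" and w: "AE t\<in>{0<..<T} in lborel. w t = J g t"
  shows "AE t\<in>{0<..<T} in lborel. frac_deriv \<alpha> p T w t = g t"
proof -
  have gL: "g \<in> Lp_space p T" unfolding Lp_space_iff[OF p_pos] using g by auto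
  have "AE t in lebesgue_on {0<..<T}. w t = frac_integral \<alpha> g t" unfolding AE_lebesgue_on_interval using w by eventually_elim (use frac_integral_eq[OF gL g] in auto)
  then have ex: "\<exists>v. v \<in> Lp_space p T \<and> (AE t in lebesgue_on {0<..<T}. w t = frac_integral \<alpha> v t)" using gL by blast
  define d where "d = frac_deriv \<alpha> p T w"
  have d: "d \<in> Lp_space p T" "AE t\<in>{0<..<T} in lborel. w t = frac_integral \<alpha> d t"
    using someI_ex[OF ex] unfolding d_def frac_deriv_def AE_lebesgue_on_interval by auto
  obtain k where k: "k \<in> L" "AE t\<in>{0<..<T} in lborel. d t = k t" using d(1) unfolding Lp_space_iff[OF p_pos] by blast
  have "AE t in lborel. k t = g t"
  proof (rule fint_injective[OF k(1) g])
    show "AE t\<in>{0<..<T} in lborel. J k t = J g t" using w d(2) by eventually_elim (use frac_integral_eq[OF d(1) k] in auto)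
  qed
  then show ?thesis using k(2) by eventually_elim (simp add: d_def)
qed

end

section \<open>Solutions of the quasilinear equation and fixed points\<close>

context quasilinear_setting
begin

context
  fixes x :: 'a
  assumes x: "x \<in> X_space A D \<alpha> p"
begin

text \<open>Almost everywhere \<open>inv_A (vsol x f t)\<close> is the solution itself, so the fixed
  point equation turns f - \<i> vsol, the fractional derivative of \<open>sol x f\<close>, into \<i>
  F u u.\<close>

lemma solution_of_fixed_point:
  assumes f: "f \<in> L" and fix_f: "AE t in lborel. nl x f t = f t"
  shows "quasilinear_solution A D \<alpha> p T F x (sol x f)"
proof -
  define g where "g s = f s - \<i> *\<^sub>C vsol x f s" for s
  have g: "g \<in> L" unfolding g_def[abs_def] by (rule L_vsol[OF x f])
  have u: "sol x f t - x = J g t" for t by (simp add: sol_def g_def[abs_def])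
  have gL: "g \<in> Lp_space p T" unfolding Lp_space_iff[OF p_pos] using g by auto
  have dom: "AE t\<in>{0<..<T} in lborel. sol x f t \<in> D \<and> A (sol x f t) = - vsol x f t" by (rule sol_domain[OF x f])
  have "sol x f \<in> Lp_domain A D p T" unfolding Lp_domain_def mem_Collect_eq AE_lebesgue_on_interval
  proof (intro conjI)
    show "AE t\<in>{0<..<T} in lborel. sol x f t \<in> D" using dom by eventually_elim auto
    have "(\<lambda>t. 0 - vsol x f t) \<in> L" by (rule L_diff[OF zero_L vsol_L[OF x f]])
    then show "(\<lambda>t. A (sol x f t)) \<in> Lp_space p T" unfolding Lp_space_iff[OF p_pos] using dom by (intro bexI) (auto elim: eventually_mono)
  qed
  moreover have "(\<lambda>t. sol x f t - sol x f 0) \<in> W_space \<alpha> p T" unfolding W_space_def mem_Collect_eq AE_lebesgue_on_interval sol_0[OF x f] u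
    using gL frac_integral_eq[OF gL g] by (intro bexI[OF _ gL] AE_I2) auto
  moreover have "AE t\<in>{0<..<T} in lborel. frac_deriv \<alpha> p T (\<lambda>s. sol x f s - x) t = g t" by (rule frac_deriv_eq[OF g]) (simp add: u)
  then have "AE t\<in>{0<..<T} in lborel.
      frac_deriv \<alpha> p T (\<lambda>s. sol x f s - x) t - \<i> *\<^sub>C F (sol x f t) (sol x f t) = 0" using dom fix_f
  proof eventually_elim
    case (elim t)
    show ?case
    proof
      assume t: "t \<in> {0<..<T}"
      then have "inv_A (vsol x f t) = sol x f t" using elim by (intro inv_A_eqI) auto
      then have "f t = \<i> *\<^sub>C (F (sol x f t) (sol x f t) + vsol x f t)" using elim t by (simp add: nl_def)
      then have "g t = \<i> *\<^sub>C F (sol x f t) (sol x f t)" by (simp add: g_def scaleC_add_right)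
      then show "frac_deriv \<alpha> p T (\<lambda>s. sol x f s - x) t - \<i> *\<^sub>C F (sol x f t) (sol x f t) = 0" using elim t by simp
    qed
  qed
  ultimately show ?thesis unfolding quasilinear_solution_def MR_space_def AE_lebesgue_on_interval
    using sol_0[OF x f] continuous_on_subset[OF sol_continuous[OF x f] subset_UNIV] by simp
qed

text \<open>Every solution \<open>w\<close> of the quasilinear equation solves a linear problem,
  with f its fractional derivative minus \<i> A w; linear uniqueness identifies it with
  \<open>sol x f\<close>, without any smallness.\<close>

lemma fixed_point_of_solution:
  assumes w: "quasilinear_solution A D \<alpha> p T F x w"
  shows "\<exists>f\<in>L. (AE t in lborel. nl x f t = f t) \<and> (\<forall>t\<in>{0..T}. w t = sol x f t)"
proof -
  have cw: "continuous_on {0..T} w" and w0: "w 0 = x"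
    and dom: "AE t\<in>{0<..<T} in lborel. w t \<in> D" and Aw: "(\<lambda>t. A (w t)) \<in> Lp_space p T"
    and W: "(\<lambda>t. w t - x) \<in> W_space \<alpha> p T"
    and eq: "AE t\<in>{0<..<T} in lborel. frac_deriv \<alpha> p T (\<lambda>s. w s - x) t - \<i> *\<^sub>C F (w t) (w t) = 0"
    using w unfolding quasilinear_solution_def MR_space_def Lp_domain_def AE_lebesgue_on_interval by auto
  obtain d where d: "d \<in> Lp_space p T" "AE t\<in>{0<..<T} in lborel. w t - x = frac_integral \<alpha> d t" using W unfolding W_space_def AE_lebesgue_on_interval by blast
  obtain g where g: "g \<in> L" "AE t\<in>{0<..<T} in lborel. d t = g t" using d(1) unfolding Lp_space_iff[OF p_pos] by blast
  have wg: "AE t\<in>{0<..<T} in lborel. w t - x = J g t" using d(2) by eventually_elim (use frac_integral_eq[OF d(1) g] in auto)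
  \<comment> \<open>The representation holds almost everywhere by definition; both sides are
    continuous on {0..T}.\<close>
  have w_eq: "w t = x + J g t" if t: "t \<in> {0..T}" for t
  proof -
    define r where "r s = w s - (x + J g s)" for s
    have "continuous_on {0..T} r" unfolding r_def[abs_def] by (intro continuous_intros cw continuous_on_subset[OF fint_continuous[OF g(1)] subset_UNIV])
    have "norm (r t) \<le> 0"
    proof (rule field_le_epsilon)
      fix \<epsilon> :: real assume "\<epsilon> > 0"
      then obtain \<delta> where \<delta>: "\<delta> > 0" "\<forall>s\<in>{0..T}. dist s t < \<delta> --> dist (r s) (r t) < \<epsilon>"
        using \<open>continuous_on {0..T} r\<close> t unfolding continuous_on_iff by blast
      obtain s where s: "s \<in> {0<..<T}" "\<bar>s - t\<bar> < \<delta>" "w s - x = J g s" using AE_interval_dense[OF wg t T \<delta>(1)] .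
      have "dist (r s) (r t) < \<epsilon>" using \<delta>(2) s by (simp add: dist_norm)
      moreover have "r s = 0" using s(3) by (simp add: r_def algebra_simps)
      ultimately show "norm (r t) \<le> 0 + \<epsilon>" by simp
    qed
    then show ?thesis by (simp add: r_def)
  qed
  obtain k where k: "k \<in> L" "AE t\<in>{0<..<T} in lborel. A (w t) = k t" using Aw unfolding Lp_space_iff[OF p_pos] by blast
  define v where "v t = 0 - k t" for t
  have v: "v \<in> L" unfolding v_def[abs_def] by (rule L_diff[OF zero_L k(1)])
  have iv: "(\<lambda>t. \<i> *\<^sub>C v t) \<in> L" by (intro L_scaleC v) simp
  \<comment> \<open>With \<open>v\<close> representing - A w this is the right-hand side that makes
    \<open>w\<close> a solution of the linear problem.\<close>
  define f where "f t = g t + \<i> *\<^sub>C v t" for t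
  have f: "f \<in> L" unfolding f_def[abs_def] by (rule L_add[OF g(1) iv])
  have gf: "(\<lambda>s. f s - \<i> *\<^sub>C v s) = g" by (simp add: f_def)
  have "AE t\<in>{0<..<T} in lborel. x + J (\<lambda>s. f s - \<i> *\<^sub>C v s) t \<in> D \<and>
      A (x + J (\<lambda>s. f s - \<i> *\<^sub>C v s) t) = - v t" unfolding gf using dom k(2)
  proof eventually_elim
    case (elim t)
    then show ?case using w_eq[of t] by (auto simp: v_def)
  qed
  then have vs: "AE t in lborel. v t = vsol x f t" by (rule sol_unique[OF x f v])
  have "J (\<lambda>s. f s - \<i> *\<^sub>C vsol x f s) t = J g t" for t
  proof (rule fint_cong_AE[OF L_vsol[OF x f] g(1)])
    show "AE s in lborel. f s - \<i> *\<^sub>C vsol x f s = g s" using vs by eventually_elim (simp add: f_def)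
  qed
  then have ws: "w t = sol x f t" if "t \<in> {0..T}" for t using w_eq[OF that] by (simp add: sol_def)
  have "AE t\<in>{0<..<T} in lborel. frac_deriv \<alpha> p T (\<lambda>s. w s - x) t = g t" by (rule frac_deriv_eq[OF g(1) wg])
  then have "AE t in lborel. nl x f t = f t" using eq dom k(2) vs
  proof eventually_elim
    case (elim t)
    show ?case
    proof (cases "t \<in> {0<..<T}")
      case True
      then have wt: "w t = sol x f t" "A (w t) = - v t" "w t \<in> D" using elim(3,4) ws[of t] by (auto simp: v_def)
      then have "inv_A (v t) = w t" by (intro inv_A_eqI) auto
      then have "nl x f t = \<i> *\<^sub>C (F (w t) (w t) + v t)" using True wt elim by (simp add: nl_def)
      then show ?thesis using True elim by (simp add: f_def scaleC_add_right)
    next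
      case False
      then show ?thesis using Lpb_zero[OF f False] by (simp add: nl_def)
    qed
  qed
  then show ?thesis using f ws by blast
qed

end

end

theorem theorem5p2:
  fixes A :: "'a::{complex_hilbert, second_countable_topology} \<Rightarrow> 'a"
    and D :: "'a set"
    and F :: "'a \<Rightarrow> 'a \<Rightarrow> 'a"
    and \<alpha> p \<epsilon> T :: real
  assumes "self_adjoint A D"
    and "negative_definite A D"
    and "compact_resolvent A D"
    and "0 < \<alpha>" "\<alpha> < 1"
    and "p > 1 / \<alpha>"
    and "0 < \<epsilon>" "\<epsilon> < \<alpha> - 1 / p"
    and "T > 0"
    and "\<And>v. v \<in> X_space A D (\<alpha> - \<epsilon>) p \<Longrightarrow> F v \<in> bounded_operators A D"
    and "lipschitz_on_bounded_subsets A D (\<alpha> - \<epsilon>) p F"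
    and "\<And>u. u \<in> D \<Longrightarrow> F 0 u = A u"
  shows "\<exists>\<epsilon>'>0. \<forall>u0\<in>X_space A D \<alpha> p. X_norm A D \<alpha> p u0 \<le> \<epsilon>' \<longrightarrow>
    (\<exists>u. quasilinear_solution A D \<alpha> p T F u0 u \<and>
      (\<forall>w. quasilinear_solution A D \<alpha> p T F u0 w \<longrightarrow> (\<forall>t\<in>{0..T}. w t = u t)))"
proof -
  obtain e lam lam0 where "eigenbasis A D e lam lam0" using eigenbasis_exists[OF assms(1-3)] by blast
  then interpret eigenbasis A D e lam lam0 .
  interpret quasilinear_setting \<alpha> p A D e lam lam0 T \<epsilon> F using assms by unfold_locales auto
  show ?thesis
  proof (intro exI[of _ radius] conjI ballI impI)
    show "radius > 0" by (rule radius)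
    fix u0 assume u0: "u0 \<in> X_space A D \<alpha> p" "X_norm A D \<alpha> p u0 \<le> radius"
    obtain f where f: "f \<in> L" "Lp_le f radius" "AE t in lborel. nl u0 f t = f t" using fixed_point_exists[OF u0] by blast
    show "\<exists>u. quasilinear_solution A D \<alpha> p T F u0 u \<and>
      (\<forall>w. quasilinear_solution A D \<alpha> p T F u0 w --> (\<forall>t\<in>{0..T}. w t = u t))"
    proof (intro exI[of _ "sol u0 f"] conjI allI impI ballI)
      show "quasilinear_solution A D \<alpha> p T F u0 (sol u0 f)" by (rule solution_of_fixed_point[OF u0(1) f(1,3)])
      fix w t assume "quasilinear_solution A D \<alpha> p T F u0 w" and t: "t \<in> {0..T}"
      then obtain g where g: "g \<in> L" "AE t in lborel. nl u0 g t = g t" "w t = sol u0 g t" using fixed_point_of_solution[OF u0(1)] by blast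
      have "sol u0 f t = sol u0 g t" using t by (intro sol_eq_before[OF u0 f(1) g(1) fixed_point_unique[OF u0 f g(1,2)]]) auto
      then show "w t = sol u0 f t" using g(3) by simp
    qed
  qed
qed

end
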